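(* Let $\mathcal{P}$ be a Poisson point process of unit intensity in $\mathbb{R}^2$ with law $\mathbb{P}$ on $\mathbb{M}$. There exists a deterministic isometry-equivariant $6$-coloring scheme of the Poisson–Voronoi map: a measurable map $F:\mathbb{M}\to\mathbb{M}^6$ such that $F(\mathcal{P})$ is $\mathbb{P}$-a.s. a proper $6$-coloring of $\mathcal{P}$, and $\gamma F(\mathcal{P})=F(\gamma\mathcal{P})$ for every isometry $\gamma$ of $\mathbb{R}^2$.
   Context: $\mathbb{M}$ is the space of locally finite subsets of $\mathbb{R}^d$ with the local topology and Borel $\sigma$-algebra. For a nonempty locally finite $S\subset\mathbb{R}^d$, the Voronoi cell of $x\in S$ is $C(x)=\{z\in\mathbb{R}^d: d(z,x)=d(z,S)\}$. The Delaunay graph of $S$ has vertex set $S$ and an edge $(x,y)$ iff $|C(x)\cap C(y)|>1$. A (proper) $k$-coloring of $S$ is a partition $S=\bigcup_{i=1}^k S_i$ (an element of $\mathbb{M}^k$) such that no two Delaunay-adjacent points lie in the same $S_i$. Isometries act on $\mathbb{M}$ and $\mathbb{M}^k$ in the natural way. *)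

theory Defs
  imports "HOL-Probability.Probability"
begin

type_synonym pt = "real ^ 2"

definition locfin :: "pt set \<Rightarrow> bool" where
  "locfin S \<longleftrightarrow> (\<forall>B. bounded B \<longrightarrow> finite (S \<inter> B))"

definition Mspace :: "pt set set" where
  "Mspace = {S. locfin S}"

definition Msp :: "pt set measure" where
  "Msp = sigma Mspace
     {{S \<in> Mspace. card (S \<inter> B) = n} | B n. B \<in> sets borel \<and> bounded B}"

definition Msp_pow :: "nat \<Rightarrow> (nat \<Rightarrow> pt set) measure" where
  "Msp_pow k = PiM {..<k} (\<lambda>_. Msp)"

definition poisson_law :: "pt set measure \<Rightarrow> bool" where
  "poisson_law P \<longleftrightarrow>
     prob_space P \<and> sets P = sets Msp \<and> space P = Mspace \<and>
     (\<forall>B k. B \<in> sets borel \<and> bounded B \<longrightarrow>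
        measure P {S \<in> space P. card (S \<inter> B) = k}
          = exp (- measure lborel B) * (measure lborel B) ^ k / fact k) \<and>
     (\<forall>(Bs :: nat \<Rightarrow> pt set) n.
        (\<forall>i<n. Bs i \<in> sets borel \<and> bounded (Bs i)) \<and> disjoint_family_on Bs {..<n} \<longrightarrow>
        prob_space.indep_vars P (\<lambda>_. count_space UNIV) (\<lambda>i S. card (S \<inter> Bs i)) {..<n})"

definition voronoi_cell :: "pt set \<Rightarrow> pt \<Rightarrow> pt set" where
  "voronoi_cell S x = {z. dist z x = infdist z S}"

definition delaunay_edge :: "pt set \<Rightarrow> pt \<Rightarrow> pt \<Rightarrow> bool" where
  "delaunay_edge S x y \<longleftrightarrow> x \<in> S \<and> y \<in> S \<and> x \<noteq> y \<and>
     (\<exists>a b. a \<noteq> b \<and> a \<in> voronoi_cell S x \<inter> voronoi_cell S y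
                   \<and> b \<in> voronoi_cell S x \<inter> voronoi_cell S y)"

definition proper_coloring :: "nat \<Rightarrow> pt set \<Rightarrow> (nat \<Rightarrow> pt set) \<Rightarrow> bool" where
  "proper_coloring k S C \<longleftrightarrow>
     S = (\<Union>i<k. C i) \<and>
     (\<forall>i<k. \<forall>j<k. i \<noteq> j \<longrightarrow> C i \<inter> C j = {}) \<and>
     (\<forall>i<k. \<forall>x\<in>C i. \<forall>y\<in>C i. \<not> delaunay_edge S x y)"

definition isometry :: "(pt \<Rightarrow> pt) \<Rightarrow> bool" where
  "isometry g \<longleftrightarrow> (\<forall>x y. dist (g x) (g y) = dist x y)"

end

theory Submission
  imports Defs "HOL-Real_Asymp.Real_Asymp"
begin

text \<open>A finite planar Delaunay graph has a vertex of degree at most five. Hence, if the vertices can be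
  removed successively, each having fewer than six remaining neighbours at its removal, then choosing
  colours greedily in the reverse order needs only six of them. On an infinite graph this works when
  the removal splits into two rounds of peeling with finite components only.

  In the first round only the vertices of a region are removed. It is the union, over a rapidly growing
  sequence of scales, of wide zones along the boundaries of the Voronoi cells of rare sites, namely of
  points that have another point at tiny distance; all of this is defined equivariantly. The zones are
  so sparse that their components are finite. The second round removes what is left. For its
  components to be finite no path of remaining vertices may cross a zone: a set \<open>K\<close> of vertices all
  of which have six neighbours in \<open>K\<close> within a zone cannot reach far into it. Indeed, configurations
  that force a hole in \<open>K\<close> occur with positive density; by the exact edge count, each hole forces six
  neighbours only at the cost of edges leaving a disc, so that \<open>K\<close> grows exponentially in the radius
  of the disc, whereas the number of points grows quadratically.

  Both estimates hold at all large scales almost surely by the Borel--Cantelli lemma. Ties are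
  broken by the numbers of points in discs, which almost surely differ at different points.\<close>

section \<open>Empty circles\<close>

text \<open>The exponents of the scales balance several effects. Empty discs may have radius of
  order \<open>n\<close>, so a spot must exclude enclosing triangles of that size. This costs a
  probability of order \<open>1 / x\<close> for \<open>x = 2 ^ n\<^sup>2\<close>, so spots occur
  within distance about \<open>n * x\<close>. Discs of that radius hold at most \<open>x ^ 4\<close>
  points; a set of minimal degree six thus loses a fraction \<open>1 / x ^ 8\<close> per inward step
  of order \<open>n\<close>, and \<open>x ^ 9\<close> steps fit into a zone of width
  \<open>x ^ 10\<close>. A disc of radius \<open>D\<close> holds about
  \<open>D\<^sup>2 * h\<^sup>2\<close> close pairs, while pairs of clusters whose distances from the
  centre differ by at most about \<open>w\<close> number \<open>D ^ 3 * w * h ^ 4\<close> on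
  average. For \<open>D = x ^ 15\<close>, \<open>h = 1 / x ^ 14\<close>, \<open>w = x ^ 10\<close>
  these are \<open>x\<^sup>2\<close> and \<open>1 / x\<close>, so a given point is very likely well
  inside a cell.

  The obstacle is that equivariance forbids an origin, a grid or an enumeration of the points.
  Simultaneous peeling, counts in discs and cells of rare sites avoid such choices; grids and
  integer points occur only in proofs of measurability and of probability estimates.\<close>

definition cross :: "pt \<Rightarrow> pt \<Rightarrow> real" where
  "cross a b = a$1 * b$2 - a$2 * b$1"

definition rot :: "pt \<Rightarrow> pt" where
  "rot a = vector [- a$2, a$1]"

text \<open>The power of \<open>z\<close> with respect to the circle around \<open>c\<close> through \<open>x\<close>. For fixed \<open>x\<close>, the
  difference of two such powers is linear in \<open>z - x\<close>, so that no angle is ever needed.\<close>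

definition pw :: "pt \<Rightarrow> pt \<Rightarrow> pt \<Rightarrow> real" where
  "pw c x z = (z - x) \<bullet> (z - x) - 2 * ((c - x) \<bullet> (z - x))"

lemma inner_2: "(a::pt) \<bullet> b = a$1 * b$1 + a$2 * b$2"
  by (simp add: inner_vec_def sum_2)

lemma rot_nth [simp]: "rot a $ 1 = - a$2" "rot a $ 2 = a$1"
  by (simp_all add: rot_def)

lemma vec2_eq_iff: "(a::pt) = b \<longleftrightarrow> a$1 = b$1 \<and> a$2 = b$2"
  by (simp add: vec_eq_iff forall_2)

lemma cross_self [simp]: "cross a a = 0" and cross_0 [simp]: "cross a 0 = 0" "cross 0 a = 0"
  by (simp_all add: cross_def)

lemma cross_skew: "cross a b = - cross b a"
  by (simp add: cross_def)

lemma cross_cyclic: "cross (p - u) (x - u) = cross (u - x) (p - x)"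
  by (simp add: cross_def algebra_simps)

lemma rot_eq_0_iff: "rot a = 0 \<longleftrightarrow> a = 0"
  by (auto simp: vec2_eq_iff)

lemma pw_eq_norm: "pw c x z = (norm (z - c))\<^sup>2 - (norm (x - c))\<^sup>2"
  by (simp add: pw_def power2_norm_eq_inner inner_2 algebra_simps)

lemma pw_self [simp]: "pw c x x = 0"
  by (simp add: pw_def)

lemma pw_ge_0_iff: "0 \<le> pw c x z \<longleftrightarrow> dist c x \<le> dist c z"
  by (simp add: pw_eq_norm dist_norm norm_minus_commute)

lemma pw_eq_0_iff: "pw c x z = 0 \<longleftrightarrow> dist c z = dist c x"
  by (simp add: pw_eq_norm dist_norm norm_minus_commute)

lemma pw_base: "pw c x u = 0 \<Longrightarrow> pw c u z = pw c x z"
  by (simp add: pw_eq_norm)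

lemma pw_shift: "pw (c + t *\<^sub>R rot (u - x)) x z = pw c x z - 2 * t * cross (u - x) (z - x)"
  by (simp add: pw_def inner_2 cross_def algebra_simps)

text \<open>Both centres lie on the perpendicular bisector of \<open>x\<close> and \<open>u\<close>,
  so they differ by a multiple of \<open>rot (u - x)\<close>. The sign of \<open>k\<close> tells
  which of two circles through the same chord reaches further to the left; later comparisons of
  circles rest on this.\<close>

lemma pw_diff:
  assumes "pw a x u = 0" "pw b x u = 0" "x \<noteq> u"
  obtains k where "\<And>z. pw a x z - pw b x z = k * cross (u - x) (z - x)"
    "a = b + (- k / 2) *\<^sub>R rot (u - x)"
proof -
  define v where "v = u - x"
  define d where "d = a - b"
  have v: "v \<noteq> 0" using assms by (simp add: v_def)
  have perp: "d \<bullet> v = 0"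
    using assms(1,2) unfolding pw_def v_def d_def by (simp add: algebra_simps)
  define m where "m = cross v d / (v \<bullet> v)"
  have vv: "v \<bullet> v \<noteq> 0" using v by simp
  have "m *\<^sub>R rot v = d"
  proof -
    have "d$1 * v$1 + d$2 * v$2 = 0" using perp by (simp add: inner_2)
    then have "cross v d * - v$2 = (v\<bullet>v) * d$1" "cross v d * v$1 = (v\<bullet>v) * d$2"
      unfolding cross_def inner_2 by algebra+
    then show ?thesis using vv by (simp add: vec2_eq_iff m_def field_simps)
  qed
  then have a: "a = b + m *\<^sub>R rot (u - x)" by (simp add: d_def v_def algebra_simps)
  show thesis
  proof (rule that[of "- 2 * m"])
    show "pw a x z - pw b x z = - 2 * m * cross (u - x) (z - x)" for z
      using pw_shift[of b m u x z] a by simp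
    show "a = b + (- (- 2 * m) / 2) *\<^sub>R rot (u - x)" using a by simp
  qed
qed

lemma voronoi_cell_iff:
  assumes "x \<in> S"
  shows "a \<in> voronoi_cell S x \<longleftrightarrow> (\<forall>z\<in>S. 0 \<le> pw a x z)"
proof -
  have ne: "S \<noteq> {}" using assms by auto
  have "dist a x = infdist a S \<longleftrightarrow> (\<forall>z\<in>S. dist a x \<le> dist a z)"
  proof
    assume "dist a x = infdist a S"
    then show "\<forall>z\<in>S. dist a x \<le> dist a z" by (simp add: infdist_le)
  next
    assume *: "\<forall>z\<in>S. dist a x \<le> dist a z"
    have "dist a x \<le> infdist a S"
      unfolding infdist_notempty[OF ne] by (rule cINF_greatest) (use ne * in auto)
    then show "dist a x = infdist a S" using infdist_le[OF assms, of a] by simp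
  qed
  then show ?thesis by (simp add: voronoi_cell_def pw_ge_0_iff)
qed

text \<open>The two distinct points common to the cells become centres of two empty circles through
  both endpoints. Demanding two of them excludes cells that touch in a single point.\<close>

lemma delaunay_edge_iff:
  "delaunay_edge S x u \<longleftrightarrow> x \<in> S \<and> u \<in> S \<and> x \<noteq> u \<and>
     (\<exists>a b. a \<noteq> b \<and> pw a x u = 0 \<and> pw b x u = 0 \<and> (\<forall>z\<in>S. 0 \<le> pw a x z) \<and> (\<forall>z\<in>S. 0 \<le> pw b x z))"
proof -
  have *: "a \<in> voronoi_cell S x \<inter> voronoi_cell S u \<longleftrightarrow> pw a x u = 0 \<and> (\<forall>z\<in>S. 0 \<le> pw a x z)"
    if "x \<in> S" "u \<in> S" for a
  proof
    assume "a \<in> voronoi_cell S x \<inter> voronoi_cell S u"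
    then have "\<forall>z\<in>S. 0 \<le> pw a x z" "\<forall>z\<in>S. 0 \<le> pw a u z"
      using that voronoi_cell_iff by blast+
    moreover from this have "pw a x u = 0"
      using that by (auto simp: pw_ge_0_iff pw_eq_0_iff intro: order_antisym)
    ultimately show "pw a x u = 0 \<and> (\<forall>z\<in>S. 0 \<le> pw a x z)" by blast
  next
    assume "pw a x u = 0 \<and> (\<forall>z\<in>S. 0 \<le> pw a x z)"
    then show "a \<in> voronoi_cell S x \<inter> voronoi_cell S u"
      using that by (auto simp: voronoi_cell_iff pw_base[of a x u])
  qed
  show ?thesis
    unfolding delaunay_edge_def using * by (auto; blast)
qed

lemma delaunay_edge_sym: "delaunay_edge S x y \<Longrightarrow> delaunay_edge S y x"
  unfolding delaunay_edge_def by blast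

text \<open>Deleting points keeps empty circles empty. The converse fails: a subset may have new
  edges around a deleted point, and counting these is what makes holes costly.\<close>

lemma delaunay_edge_mono:
  "delaunay_edge S x y \<Longrightarrow> U \<subseteq> S \<Longrightarrow> x \<in> U \<Longrightarrow> y \<in> U \<Longrightarrow> delaunay_edge U x y"
  unfolding delaunay_edge_iff by blast

section \<open>General position and Delaunay triangles\<close>

definition general_position :: "pt set \<Rightarrow> bool" where
  "general_position U \<longleftrightarrow>
     (\<forall>x\<in>U. \<forall>u\<in>U. \<forall>p\<in>U. distinct [x, u, p] \<longrightarrow> cross (u - x) (p - x) \<noteq> 0) \<and>
     (\<forall>x\<in>U. \<forall>u\<in>U. \<forall>p\<in>U. \<forall>q\<in>U. distinct [x, u, p, q] \<longrightarrow>
        (\<nexists>c. pw c x u = 0 \<and> pw c x p = 0 \<and> pw c x q = 0))"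

lemma general_position_subset: "general_position S \<Longrightarrow> U \<subseteq> S \<Longrightarrow> general_position U"
  unfolding general_position_def by blast

definition delaunay_edges :: "pt set \<Rightarrow> (pt \<times> pt) set" where
  "delaunay_edges U = {(x, u). delaunay_edge U x u}"

text \<open>Counterclockwise triples, so each triangle occurs three times, once for every cyclic
  rotation, and in general position a directed edge has at most one triangle on its left.\<close>

definition delaunay_triangles :: "pt set \<Rightarrow> (pt \<times> pt \<times> pt) set" where
  "delaunay_triangles U = {(x, u, p). x \<in> U \<and> u \<in> U \<and> p \<in> U \<and> cross (u - x) (p - x) > 0 \<and>
     (\<exists>c. pw c x u = 0 \<and> pw c x p = 0 \<and> (\<forall>z\<in>U. 0 \<le> pw c x z))}"

text \<open>The directed edges of the convex hull, with \<open>U\<close> on the right: those without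
  a triangle on their left.\<close>

definition bare_edges :: "pt set \<Rightarrow> (pt \<times> pt) set" where
  "bare_edges U = {(x, u). delaunay_edge U x u \<and> (\<forall>z\<in>U. cross (u - x) (z - x) \<le> 0)}"

text \<open>The powers for the two circumcentres differ by \<open>k * cross\<close>. The apexes
  force \<open>k \<le> 0\<close> and \<open>k \<ge> 0\<close>, so the circles coincide and four
  points would be concyclic.\<close>

lemma delaunay_triangle_unique:
  assumes gp: "general_position U"
    and p: "(x, u, p) \<in> delaunay_triangles U" and q: "(x, u, q) \<in> delaunay_triangles U"
  shows "p = q"
proof (rule ccontr)
  assume "p \<noteq> q"
  obtain a b where a: "pw a x u = 0" "pw a x p = 0" "\<forall>z\<in>U. 0 \<le> pw a x z"
    and b: "pw b x u = 0" "pw b x q = 0" "\<forall>z\<in>U. 0 \<le> pw b x z"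
    and U: "x \<in> U" "u \<in> U" "p \<in> U" "q \<in> U"
    and cp: "cross (u - x) (p - x) > 0" and cq: "cross (u - x) (q - x) > 0"
    using p q unfolding delaunay_triangles_def by blast
  have "x \<noteq> u" using cp by auto
  then obtain k where k: "\<And>z. pw a x z - pw b x z = k * cross (u - x) (z - x)"
    using pw_diff a(1) b(1) by metis
  have "k * cross (u - x) (p - x) \<le> 0" using k[of p] a b U by fastforce
  moreover have "k * cross (u - x) (q - x) \<ge> 0" using k[of q] a b U by fastforce
  ultimately have "k = 0" using cp cq
    by (metis mult_le_0_iff zero_le_mult_iff order_antisym not_less)
  then have "pw a x q = 0" using k[of q] b by simp
  moreover have "distinct [x, u, p, q]" using cp cq \<open>p \<noteq> q\<close> by (auto simp: cross_def)
  ultimately show False using gp a U unfolding general_position_def by blast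
qed

lemma delaunay_triangle_rotate:
  assumes "(x, u, p) \<in> delaunay_triangles U" shows "(u, p, x) \<in> delaunay_triangles U"
proof -
  obtain c where c: "pw c x u = 0" "pw c x p = 0" "\<forall>z\<in>U. 0 \<le> pw c x z"
    and U: "x \<in> U" "u \<in> U" "p \<in> U" and cr: "cross (u - x) (p - x) > 0"
    using assms unfolding delaunay_triangles_def by blast
  have "pw c u p = 0" "pw c u x = 0" "\<forall>z\<in>U. 0 \<le> pw c u z"
    using c by (simp_all add: pw_base[of c x u])
  then show ?thesis using U cr cross_cyclic[of p u x] unfolding delaunay_triangles_def by auto
qed

text \<open>The circumcircle is one empty circle, but an edge needs two. Moving the centre slightly
  away from the apex does not decrease the powers on the left; on the right general position makes
  the finitely many powers strictly positive, which leaves room.\<close>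

lemma delaunay_edge_of_triangle:
  assumes "finite U" and gp: "general_position U" and T: "(x, u, p) \<in> delaunay_triangles U"
  shows "delaunay_edge U x u"
proof -
  obtain c where c: "pw c x u = 0" "pw c x p = 0" "\<forall>z\<in>U. 0 \<le> pw c x z"
    and U: "x \<in> U" "u \<in> U" "p \<in> U" and cr: "cross (u - x) (p - x) > 0"
    using T unfolding delaunay_triangles_def by blast
  have "x \<noteq> u" using cr by auto
  have "\<exists>e>0. \<forall>z\<in>U. 0 \<le> pw (c + (- e) *\<^sub>R rot (u - x)) x z"
  proof -
    have "\<forall>\<^sub>F e in at_right 0. 0 \<le> pw (c + (- e) *\<^sub>R rot (u - x)) x z" if z: "z \<in> U" for z
    proof (cases "0 \<le> cross (u - x) (z - x)")
      case True
      show ?thesis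
        unfolding pw_shift using eventually_at_right_less[of 0]
      proof eventually_elim
        case (elim e)
        then have "0 \<le> e * cross (u - x) (z - x)" using True by simp
        then show ?case using c z by fastforce
      qed
    next
      case False
      then have "distinct [x, u, p, z]" using cr by (auto simp: cross_def)
      then have "pw c x z \<noteq> 0" using gp c U z unfolding general_position_def by blast
      then have pos: "0 < pw c x z" using c z by (simp add: less_le)
      have "((\<lambda>e. pw c x z - 2 * (- e) * cross (u - x) (z - x)) \<longlongrightarrow>
              pw c x z - 2 * (- 0) * cross (u - x) (z - x)) (at_right 0)"
        by (intro tendsto_intros)
      then have "\<forall>\<^sub>F e in at_right 0. 0 < pw c x z - 2 * (- e) * cross (u - x) (z - x)"
        using pos by (intro order_tendstoD(1)) auto
      then show ?thesis unfolding pw_shift by eventually_elim simp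
    qed
    then have "\<forall>\<^sub>F e in at_right 0. \<forall>z\<in>U. 0 \<le> pw (c + (- e) *\<^sub>R rot (u - x)) x z"
      using \<open>finite U\<close> by (simp add: eventually_ball_finite)
    then have "\<forall>\<^sub>F e in at_right 0. 0 < e \<and> (\<forall>z\<in>U. 0 \<le> pw (c + (- e) *\<^sub>R rot (u - x)) x z)"
      using eventually_at_right_less[of "0::real"] by eventually_elim simp
    then show ?thesis
      using eventually_happens[of _ "at_right (0::real)"] by fastforce
  qed
  then obtain e where e: "e > 0" "\<forall>z\<in>U. 0 \<le> pw (c + (- e) *\<^sub>R rot (u - x)) x z" by blast
  have "c \<noteq> c + (- e) *\<^sub>R rot (u - x)" using e \<open>x \<noteq> u\<close> by (simp add: rot_eq_0_iff)
  moreover have "pw (c + (- e) *\<^sub>R rot (u - x)) x u = 0" using c by (simp only: pw_shift) simp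
  ultimately show ?thesis
    unfolding delaunay_edge_iff using U \<open>x \<noteq> u\<close> c e by blast
qed

text \<open>The circle through \<open>x\<close> and \<open>u\<close> is pushed to the left until it
  meets the first vertex: \<open>f z\<close> is the shift at which it reaches \<open>z\<close>. On
  the left its disc only grows, which the inequality between the powers records.\<close>

lemma delaunay_apex:
  assumes "finite U" "x \<in> U" "u \<in> U" and a: "pw a x u = 0" "\<forall>z\<in>U. 0 \<le> pw a x z"
    and z0: "z0 \<in> U" "cross (u - x) (z0 - x) > 0"
  obtains p c where "p \<in> U" "cross (u - x) (p - x) > 0" "pw c x u = 0" "pw c x p = 0"
    "\<forall>z\<in>U. 0 \<le> pw c x z" "\<And>s. cross (u - x) (s - x) \<ge> 0 \<Longrightarrow> pw c x s \<le> pw a x s"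
    "(x, u, p) \<in> delaunay_triangles U"
proof -
  define V where "V = {z\<in>U. cross (u - x) (z - x) > 0}"
  define f where "f z = pw a x z / (2 * cross (u - x) (z - x))" for z
  have V: "finite V" "V \<noteq> {}" using assms by (auto simp: V_def)
  define p where "p = arg_min_on f V"
  have pV: "p \<in> V" using arg_min_if_finite(1)[OF V] by (simp add: p_def)
  have pmin: "f p \<le> f z" if "z \<in> V" for z
    using arg_min_if_finite(2)[OF V, of f] that by (auto simp: p_def not_less)
  define t where "t = f p"
  have t: "t \<ge> 0" using pV a by (auto simp: t_def f_def V_def)
  define c where "c = a + t *\<^sub>R rot (u - x)"
  have c: "pw c x z = pw a x z - 2 * t * cross (u - x) (z - x)" for z
    unfolding c_def by (rule pw_shift)
  have p: "p \<in> U" "cross (u - x) (p - x) > 0" using pV by (auto simp: V_def)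
  have 1: "pw c x u = 0" using a by (simp add: c)
  have 2: "pw c x p = 0" using p by (simp add: c t_def f_def)
  have 3: "0 \<le> pw c x z" if "z \<in> U" for z
  proof (cases "cross (u - x) (z - x) > 0")
    case True
    then have "t \<le> f z" using pmin that by (simp add: t_def V_def)
    then show ?thesis using True by (simp add: c f_def field_simps)
  next
    case False
    then have "t * cross (u - x) (z - x) \<le> 0" using t by (simp add: mult_nonneg_nonpos)
    moreover have "pw a x z \<ge> 0" using a that by blast
    ultimately show ?thesis unfolding c by linarith
  qed
  have 4: "pw c x s \<le> pw a x s" if "cross (u - x) (s - x) \<ge> 0" for s
    using t that by (simp add: c)
  show thesis
  proof (rule that[of p c])
    show "(x, u, p) \<in> delaunay_triangles U"
      unfolding delaunay_triangles_def using 1 2 3 p assms(2,3) by auto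
  qed (use 1 2 3 4 p in auto)
qed

section \<open>Counting Delaunay edges\<close>

definition lexless :: "pt \<Rightarrow> pt \<Rightarrow> bool" where
  "lexless u x \<longleftrightarrow> u$1 < x$1 \<or> (u$1 = x$1 \<and> u$2 < x$2)"

lemma lexless_linear: "lexless u x \<or> u = x \<or> lexless x u"
  unfolding lexless_def vec2_eq_iff by linarith

lemma lexless_irrefl: "\<not> lexless x x"
  unfolding lexless_def by simp

lemma lexless_trans: "lexless x y \<Longrightarrow> lexless y z \<Longrightarrow> lexless x z"
  unfolding lexless_def by linarith

lemma lexless_asym: "lexless x y \<Longrightarrow> \<not> lexless y x"
  unfolding lexless_def by linarith

lemma lexless_least:
  assumes "finite U" "U \<noteq> {}"
  shows "\<exists>m\<in>U. \<forall>z\<in>U. \<not> lexless z m"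
  using assms
proof (induction U rule: finite_ne_induct)
  case (singleton x)
  then show ?case by (simp add: lexless_irrefl)
next
  case (insert x F)
  then obtain m where m: "m \<in> F" "\<forall>z\<in>F. \<not> lexless z m" by blast
  show ?case
  proof (cases "lexless x m")
    case True
    then have "\<forall>z\<in>insert x F. \<not> lexless z x"
      using m lexless_trans lexless_irrefl by blast
    then show ?thesis by blast
  next
    case False
    then show ?thesis using m by blast
  qed
qed

text \<open>Otherwise the apex \<open>p\<close> lies to the right of \<open>x\<close>, so
  \<open>w - x\<close> is in the cone spanned by \<open>u - x\<close> and \<open>p - x\<close>. The
  difference of the powers for the centres \<open>b\<close> and \<open>c\<close> is linear in
  \<open>z - x\<close> and nonnegative at \<open>u\<close> and \<open>p\<close>, hence at
  \<open>w\<close>, where it equals \<open>- pw c x w < 0\<close>.\<close>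

lemma delaunay_left_apex:
  assumes "finite U" and gp: "general_position U"
    and xu: "delaunay_edge U x u" and xw: "delaunay_edge U x w"
    and left: "lexless u x" "lexless w x" and cr: "cross (u - x) (w - x) > 0"
  shows "\<exists>p. (x, u, p) \<in> delaunay_triangles U \<and> lexless p x"
proof -
  obtain a where a: "pw a x u = 0" "\<forall>z\<in>U. 0 \<le> pw a x z" and U: "x \<in> U" "u \<in> U" "x \<noteq> u"
    using xu unfolding delaunay_edge_iff by blast
  obtain b where b: "pw b x w = 0" "\<forall>z\<in>U. 0 \<le> pw b x z" and w: "w \<in> U"
    using xw unfolding delaunay_edge_iff by blast
  obtain p c where p: "p \<in> U" "cross (u - x) (p - x) > 0" and c: "pw c x u = 0" "pw c x p = 0"
    "\<forall>z\<in>U. 0 \<le> pw c x z" and T: "(x, u, p) \<in> delaunay_triangles U"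
    by (rule delaunay_apex[OF \<open>finite U\<close> U(1,2) a w cr]) blast
  show ?thesis
  proof (rule ccontr)
    assume "\<not> ?thesis"
    then have "\<not> lexless p x" using T by blast
    moreover have "p \<noteq> x" using p by auto
    ultimately have px: "lexless x p" using lexless_linear by blast
    define d where "d = cross (u - x) (p - x)"
    define al where "al = cross (w - x) (p - x) / d"
    define be where "be = cross (u - x) (w - x) / d"
    have d: "d > 0" using p by (simp add: d_def)
    have be: "be > 0" using cr d by (simp add: be_def)
    have "cross (w - x) (p - x) *\<^sub>R (u - x) + cross (u - x) (w - x) *\<^sub>R (p - x) = d *\<^sub>R (w - x)"
      by (simp add: vec2_eq_iff cross_def d_def algebra_simps)
    then have "(1 / d) *\<^sub>R (cross (w - x) (p - x) *\<^sub>R (u - x) + cross (u - x) (w - x) *\<^sub>R (p - x))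
        = (1 / d) *\<^sub>R (d *\<^sub>R (w - x))" by simp
    then have comb: "w - x = al *\<^sub>R (u - x) + be *\<^sub>R (p - x)"
      using d by (simp add: al_def be_def scaleR_add_right)
    \<comment> \<open>With \<open>al < 0\<close> both summands of \<open>w - x\<close> would be
      lexicographically positive, but \<open>w - x\<close> is negative.\<close>
    have al: "al \<ge> 0"
    proof (rule ccontr)
      assume "\<not> al \<ge> 0"
      then have neg: "al < 0" by simp
      have 1: "w$1 - x$1 = al * (u$1 - x$1) + be * (p$1 - x$1)"
        "w$2 - x$2 = al * (u$2 - x$2) + be * (p$2 - x$2)"
        using comb by (simp_all add: vec2_eq_iff)
      have u1: "u$1 \<le> x$1" and p1: "p$1 \<ge> x$1" and w1: "w$1 \<le> x$1"
        using left px by (auto simp: lexless_def)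
      have "al * (u$1 - x$1) \<ge> 0" "be * (p$1 - x$1) \<ge> 0"
        using neg be u1 p1 by (auto simp: mult_nonpos_nonpos)
      then have "al * (u$1 - x$1) = 0" "be * (p$1 - x$1) = 0" using 1 w1 by linarith+
      then have "u$1 = x$1" "p$1 = x$1" "w$1 = x$1" using neg be 1 by auto
      then have "u$2 < x$2" "p$2 > x$2" "w$2 < x$2" using left px by (auto simp: lexless_def)
      moreover from this have "al * (u$2 - x$2) > 0" "be * (p$2 - x$2) > 0"
        using neg be by (auto simp: mult_neg_neg)
      ultimately show False using 1 by linarith
    qed
    have lin: "pw b x w - pw c x w = al * (pw b x u - pw c x u) + be * (pw b x p - pw c x p)"
    proof -
      have *: "pw b x z - pw c x z = (2 *\<^sub>R (c - b)) \<bullet> (z - x)" for z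
        by (simp add: pw_def algebra_simps)
      show ?thesis unfolding * comb by (simp add: inner_add_right)
    qed
    have "w \<noteq> p" using px left(2) lexless_trans lexless_irrefl by blast
    moreover have "w \<noteq> u" "w \<noteq> x" using cr by auto
    ultimately have "distinct [x, u, p, w]" using U p by auto
    then have "pw c x w \<noteq> 0" using gp U p w c unfolding general_position_def by blast
    then have "pw c x w > 0" using c w by (simp add: less_le)
    moreover have "al * (pw b x u - pw c x u) \<ge> 0" "be * (pw b x p - pw c x p) \<ge> 0"
      using al be b c U p by auto
    ultimately show False using lin b by linarith
  qed
qed

lemma finite_delaunay_edges:
  assumes "finite U" shows "finite (delaunay_edges U)"
  by (rule finite_subset[of _ "U \<times> U"])
     (use assms in \<open>auto simp: delaunay_edges_def delaunay_edge_def\<close>)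

text \<open>Sweeping from left to right, every vertex other than the leftmost one has at most one more
  edge than triangles to its left; this replaces Euler's formula.\<close>

lemma card_delaunay_edges:
  assumes fin: "finite U" and "U \<noteq> {}" and gp: "general_position U"
  shows "card (delaunay_edges U) + 2 * card (bare_edges U) + 6 \<le> 6 * card U"
proof -
  define DE where "DE = delaunay_edges U"
  define TR where "TR = delaunay_triangles U"
  define BE where "BE = bare_edges U"
  define DE0 where "DE0 = {(x, u) \<in> DE. lexless u x}"
  define TR0 where "TR0 = {(x, u, p) \<in> TR. lexless u x \<and> lexless p x}"
  have finDE: "finite DE" using fin by (simp add: DE_def finite_delaunay_edges)
  have finTR: "finite TR"
    by (rule finite_subset[of _ "U \<times> U \<times> U"]) (use fin in \<open>auto simp: TR_def delaunay_triangles_def\<close>)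
  have finDE0: "finite DE0" and finTR0: "finite TR0"
    using finDE finTR by (auto simp: DE0_def TR0_def elim: finite_subset[rotated])
  obtain m where m: "m \<in> U" "\<forall>z\<in>U. \<not> lexless z m" using lexless_least fin \<open>U \<noteq> {}\<close> by blast
  \<comment> \<open>Of two leftward edges at \<open>x\<close>, the one that has the other on its
    left carries a triangle by \<open>delaunay_left_apex\<close>. So at most one per vertex carries
    none, and the leftmost vertex has no leftward edge.\<close>
  have 1: "card DE0 \<le> card TR0 + (card U - 1)"
  proof -
    define I where "I = (\<lambda>(x, u, p). (x, u)) ` TR0"
    have "inj_on fst (DE0 - I)"
    proof (rule inj_onI, clarsimp)
      fix x u w assume u: "(x, u) \<in> DE0" "(x, u) \<notin> I" and w: "(x, w) \<in> DE0" "(x, w) \<notin> I"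
      have uw: "delaunay_edge U x u" "delaunay_edge U x w" "lexless u x" "lexless w x"
        using u w by (auto simp: DE0_def DE_def delaunay_edges_def)
      have no: "\<nexists>p. (x, u, p) \<in> TR0" "\<nexists>p. (x, w, p) \<in> TR0" using u w by (force simp: I_def)+
      show "u = w"
      proof (rule ccontr)
        assume "u \<noteq> w"
        then have "cross (u - x) (w - x) \<noteq> 0"
          using uw gp unfolding general_position_def delaunay_edge_def by auto
        then consider "cross (u - x) (w - x) > 0" | "cross (w - x) (u - x) > 0"
          using cross_skew[of "u - x" "w - x"] by linarith
        then show False
        proof cases
          case 1
          from delaunay_left_apex[OF fin gp uw 1] no(1) uw show False
            by (auto simp: TR0_def TR_def)
        next
          case 2
          from delaunay_left_apex[OF fin gp uw(2,1,4,3) 2] no(2) uw show False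
            by (auto simp: TR0_def TR_def)
        qed
      qed
    qed
    moreover have "fst ` (DE0 - I) \<subseteq> U - {m}"
      using m by (auto simp: DE0_def DE_def delaunay_edges_def delaunay_edge_def)
    ultimately have "card (DE0 - I) \<le> card (U - {m})"
      using fin by (metis card_image card_mono finite_Diff)
    moreover have "card (U - {m}) = card U - 1" using m by simp
    moreover have "card I \<le> card TR0" unfolding I_def using finTR0 by (rule card_image_le)
    moreover have "card DE0 \<le> card I + card (DE0 - I)"
      proof -
      have "card DE0 \<le> card (I \<union> (DE0 - I))"
        using finDE0 finTR0 by (intro card_mono) (auto simp: I_def)
      then show ?thesis using card_Un_le[of I "DE0 - I"] by linarith
    qed
    ultimately show ?thesis by linarith
  qed
  \<comment> \<open>Each triangle has one rightmost vertex, and its three rotations are told apart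
    by the position of that vertex.\<close>
  have 2: "3 * card TR0 \<le> card TR"
  proof -
    define r1 where "r1 = (\<lambda>(x, u, p). (u, p, x) :: pt \<times> pt \<times> pt)"
    define r2 where "r2 = (\<lambda>(x, u, p). (p, x, u) :: pt \<times> pt \<times> pt)"
    have sub: "TR0 \<union> r1 ` TR0 \<union> r2 ` TR0 \<subseteq> TR"
      using delaunay_triangle_rotate by (fastforce simp: TR0_def TR_def r1_def r2_def)
    define X where "X = {(x, u, p). lexless u x \<and> lexless p x}"
    define Y where "Y = {(x, u, p). lexless u p \<and> lexless x p}"
    define Z where "Z = {(x, u, p). lexless x u \<and> lexless p u}"
    have "TR0 \<subseteq> X" "r1 ` TR0 \<subseteq> Y" "r2 ` TR0 \<subseteq> Z"
      by (auto simp: TR0_def r1_def r2_def X_def Y_def Z_def)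
    moreover have "X \<inter> Y = {}" "(X \<union> Y) \<inter> Z = {}"
      by (auto simp: X_def Y_def Z_def dest: lexless_asym)
    ultimately have "TR0 \<inter> r1 ` TR0 = {}" "(TR0 \<union> r1 ` TR0) \<inter> r2 ` TR0 = {}"
      by blast+
    then have "card (TR0 \<union> r1 ` TR0 \<union> r2 ` TR0) = card TR0 + card (r1 ` TR0) + card (r2 ` TR0)"
      using finTR0 by (simp add: card_Un_disjoint)
    moreover have "card (r1 ` TR0) = card TR0" "card (r2 ` TR0) = card TR0"
      by (intro card_image inj_onI; auto simp: r1_def r2_def)+
    ultimately show ?thesis using card_mono[OF finTR sub] by simp
  qed
  have 3: "card TR + card BE \<le> card DE"
  proof -
    have inj: "inj_on (\<lambda>(x, u, p). (x, u)) TR"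
      using delaunay_triangle_unique[OF gp] by (auto simp: inj_on_def TR_def)
    have sub: "(\<lambda>(x, u, p). (x, u)) ` TR \<subseteq> DE - BE"
    proof
      fix e assume "e \<in> (\<lambda>(x, u, p). (x, u)) ` TR"
      then obtain x u p where T: "(x, u, p) \<in> TR" and e: "e = (x, u)" by auto
      then have "delaunay_edge U x u" using delaunay_edge_of_triangle[OF fin gp] by (simp add: TR_def)
      moreover have "p \<in> U" "cross (u - x) (p - x) > 0"
        using T by (auto simp: TR_def delaunay_triangles_def)
      ultimately show "e \<in> DE - BE"
        unfolding e DE_def BE_def delaunay_edges_def bare_edges_def by force
    qed
    have BE: "BE \<subseteq> DE" by (auto simp: BE_def DE_def bare_edges_def delaunay_edges_def)
    have "card TR \<le> card (DE - BE)"
      using card_image[OF inj] card_mono[OF _ sub] finDE by simp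
    also have "\<dots> = card DE - card BE" using BE finDE finite_subset by (metis card_Diff_subset)
    finally show ?thesis using card_mono[OF finDE BE] by simp
  qed
  have 4: "card DE = 2 * card DE0"
  proof -
    have "DE = DE0 \<union> prod.swap ` DE0"
    proof
      show "DE \<subseteq> DE0 \<union> prod.swap ` DE0"
      proof
        fix e assume e: "e \<in> DE"
        obtain x u where xu: "e = (x, u)" by (cases e)
        then have "delaunay_edge U x u" using e by (simp add: DE_def delaunay_edges_def)
        then have "delaunay_edge U u x" "x \<noteq> u"
          by (simp_all add: delaunay_edge_sym) (simp add: delaunay_edge_def)
        then have "(u, x) \<in> DE0 \<or> e \<in> DE0"
          using lexless_linear[of u x] e xu by (auto simp: DE0_def DE_def delaunay_edges_def)
        then show "e \<in> DE0 \<union> prod.swap ` DE0" using xu by force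
      qed
      show "DE0 \<union> prod.swap ` DE0 \<subseteq> DE"
        using delaunay_edge_sym by (auto simp: DE0_def DE_def delaunay_edges_def)
    qed
    moreover have "DE0 \<inter> prod.swap ` DE0 = {}"
      using lexless_asym by (auto simp: DE0_def)
    moreover have "card (prod.swap ` DE0) = card DE0" by (intro card_image) simp
    ultimately show ?thesis using finDE0 by (metis card_Un_disjoint finite_imageI mult_2)
  qed
  have "card U \<ge> 1" using fin m by (metis One_nat_def Suc_leI card_gt_0_iff empty_iff)
  \<comment> \<open>\<open>3 * card DE \<le> 2 * card TR + 6 * (card U - 1)\<close>, combined with
    \<open>card TR \<le> card DE - card BE\<close>.\<close>
  then show ?thesis using 1 2 3 4 unfolding DE_def[symmetric] BE_def[symmetric] by linarith
qed

section \<open>Hull edges, and triangles whose circumcircle contains a given point\<close>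

lemma bare_edgeI:
  assumes "x \<in> U" "u \<in> U" "x \<noteq> u" and a: "pw a x u = 0" "\<forall>z\<in>U. 0 \<le> pw a x z"
    and side: "\<forall>z\<in>U. cross (u - x) (z - x) \<le> 0"
  shows "(x, u) \<in> bare_edges U"
proof -
  define b where "b = a + 1 *\<^sub>R rot (u - x)"
  have b: "pw b x z = pw a x z - 2 * cross (u - x) (z - x)" for z
    unfolding b_def pw_shift by simp
  have "a \<noteq> b" using assms(3) by (simp add: b_def rot_eq_0_iff)
  moreover have "pw b x u = 0" "\<forall>z\<in>U. 0 \<le> pw b x z" using a side by (fastforce simp: b)+
  ultimately have "delaunay_edge U x u" unfolding delaunay_edge_iff using assms by blast
  then show ?thesis using side by (simp add: bare_edges_def)
qed

text \<open>As the circle moves to the side of \<open>s\<close> its disc only grows there, so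
  \<open>s\<close> stays inside until a vertex stops it; if there is no vertex on that side, the
  edge is bare.\<close>

lemma bare_or_triangle:
  assumes "finite U" "x \<in> U" "u \<in> U" "x \<noteq> u" and a: "pw a x u = 0" "\<forall>z\<in>U. 0 \<le> pw a x z"
    and s: "cross (u - x) (s - x) \<ge> 0" "pw a x s < 0"
  shows "(x, u) \<in> bare_edges U \<or>
    (\<exists>p c. (x, u, p) \<in> delaunay_triangles U \<and> pw c x u = 0 \<and> pw c x p = 0 \<and> (\<forall>z\<in>U. 0 \<le> pw c x z) \<and> pw c x s < 0)"
proof (cases "\<forall>z\<in>U. cross (u - x) (z - x) \<le> 0")
  case True
  then show ?thesis using bare_edgeI[OF assms(2-4) a] by blast
next
  case False
  then obtain z0 where z0: "z0 \<in> U" "cross (u - x) (z0 - x) > 0" by force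
  show ?thesis
    by (rule delaunay_apex[OF assms(1-3) a z0]) (use s in force)
qed

text \<open>\<open>A\<close> lies in a closed half-plane, where directions are ordered by angle;
  opposite directions on its boundary are excluded because distinct elements are never
  parallel.\<close>

lemma extreme_direction:
  assumes "finite A" "A \<noteq> {}" "e \<noteq> 0" "\<forall>a\<in>A. e \<bullet> a \<le> 0" "0 \<notin> A"
    and "\<And>a b. a \<in> A \<Longrightarrow> b \<in> A \<Longrightarrow> a \<noteq> b \<Longrightarrow> cross a b \<noteq> 0"
  shows "\<exists>u\<in>A. \<forall>z\<in>A. cross u z \<ge> 0"
  using assms
proof (induction A rule: finite_ne_induct)
  case (singleton x)
  then show ?case by simp
next
  case (insert v F)
  then obtain u where u: "u \<in> F" "\<forall>z\<in>F. cross u z \<ge> 0" by auto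
  show ?case
  proof (cases "cross u v \<ge> 0")
    case True
    then show ?thesis using u by auto
  next
    case False
    then have vu: "cross v u > 0" using cross_skew[of u v] by linarith
    have "cross v z \<ge> 0" if z: "z \<in> F" for z
    proof -
      \<comment> \<open>The linear relation between three vectors of the plane, paired with
        \<open>e\<close>; its signs give transitivity of the angular order.\<close>
      have id: "(e \<bullet> u) * cross v z = (e \<bullet> v) * cross u z + (e \<bullet> z) * cross v u"
        by (simp add: inner_2 cross_def algebra_simps)
      have le: "e \<bullet> u \<le> 0" "e \<bullet> v \<le> 0" "e \<bullet> z \<le> 0" using insert u z by auto
      have t: "(e \<bullet> v) * cross u z \<le> 0" "(e \<bullet> z) * cross v u \<le> 0"
        using le u z vu by (auto simp: mult_nonpos_nonneg)
      show ?thesis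
      proof (cases "e \<bullet> u = 0")
        case False
        then have "e \<bullet> u < 0" using le by simp
        moreover have "(e \<bullet> u) * cross v z \<le> 0" using id t by linarith
        ultimately show ?thesis by (simp add: mult_le_0_iff)
      next
        case True
        then have "0 = (e \<bullet> v) * cross u z + (e \<bullet> z) * cross v u" using id by simp
        then have "(e \<bullet> z) * cross v u = 0" using t by linarith
        then have "e \<bullet> z = 0" using vu by simp
        then have "e$1 * cross u z = 0" "e$2 * cross u z = 0"
          using True unfolding inner_2 cross_def by algebra+
        then have "cross u z = 0" using \<open>e \<noteq> 0\<close> by (auto simp: vec2_eq_iff)
        then have "u = z" using insert.prems(4) u z by blast
        then show ?thesis using vu by simp
      qed
    qed
    then show ?thesis by auto
  qed
qed

text \<open>Take \<open>u\<close> in the extreme direction from \<open>y\<close>. Discs through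
  \<open>y\<close> and \<open>u\<close> whose centres recede on the empty side approach a half-plane
  without vertices, so one of them is empty.\<close>

lemma bare_edge_of_halfplane:
  assumes fin: "finite U" and gp: "general_position U" and y: "y \<in> U" "U \<noteq> {y}"
    and e: "e \<noteq> 0" "\<forall>z\<in>U. e \<bullet> (z - y) \<le> 0"
  shows "\<exists>u. (u, y) \<in> bare_edges U"
proof -
  define A where "A = (\<lambda>z. z - y) ` (U - {y})"
  have "\<exists>u\<in>A. \<forall>z\<in>A. cross u z \<ge> 0"
  proof (rule extreme_direction)
    show "finite A" "0 \<notin> A" "\<forall>a\<in>A. e \<bullet> a \<le> 0" "A \<noteq> {}" using fin e y by (auto simp: A_def)
    show "cross a b \<noteq> 0" if ab: "a \<in> A" "b \<in> A" "a \<noteq> b" for a b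
    proof -
      obtain p q where "p \<in> U" "q \<in> U" "p \<noteq> y" "q \<noteq> y" "a = p - y" "b = q - y"
        using ab by (auto simp: A_def)
      then show ?thesis using gp y ab unfolding general_position_def by auto
    qed
  qed (use e in auto)
  then obtain u where u: "u \<in> U" "u \<noteq> y" and ext: "\<forall>z\<in>U. cross (u - y) (z - y) \<ge> 0"
    unfolding A_def using y by fastforce
  have pos: "cross (u - y) (z - y) > 0" if "z \<in> U" "z \<noteq> u" "z \<noteq> y" for z
    using gp ext y u that unfolding general_position_def by (force simp: less_le)
  define m where "m = (1/2) *\<^sub>R (u + y)"
  have m: "pw m y u = 0" by (simp add: pw_def m_def inner_2 field_simps)
  have "\<exists>t. \<forall>z\<in>U. 0 \<le> pw (m + (- t) *\<^sub>R rot (u - y)) y z"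
  proof -
    have "\<forall>\<^sub>F t in at_top. 0 \<le> pw (m + (- t) *\<^sub>R rot (u - y)) y z" if z: "z \<in> U" for z
    proof (cases "z = u \<or> z = y")
      case True
      then show ?thesis using m by (auto simp: pw_shift simp del: scaleR_minus_left)
    next
      case False
      then have c: "cross (u - y) (z - y) > 0" using pos z by blast
      show ?thesis
        using eventually_ge_at_top[of "- pw m y z / (2 * cross (u - y) (z - y))"]
      proof eventually_elim
        case (elim t)
        then have "- pw m y z \<le> t * (2 * cross (u - y) (z - y))" using c pos_divide_le_eq[of "2 * cross (u - y) (z - y)" "- pw m y z" t] by simp
        then show ?case unfolding pw_shift by simp
      qed
    qed
    then have "\<forall>\<^sub>F t in at_top. \<forall>z\<in>U. 0 \<le> pw (m + (- t) *\<^sub>R rot (u - y)) y z"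
      using fin by (simp add: eventually_ball_finite)
    then show ?thesis
      using eventually_happens[of _ "at_top :: real filter"] by fastforce
  qed
  then obtain t where t: "\<forall>z\<in>U. 0 \<le> pw (m + (- t) *\<^sub>R rot (u - y)) y z" by blast
  define a where "a = m + (- t) *\<^sub>R rot (u - y)"
  have a: "pw a y u = 0" unfolding a_def pw_shift using m by simp
  have "(u, y) \<in> bare_edges U"
  proof (rule bare_edgeI[of u U y a])
    show "pw a u y = 0" "\<forall>z\<in>U. 0 \<le> pw a u z"
      using a t pw_base[OF a] by (simp_all add: a_def)
    have "cross (y - u) (z - u) = - cross (u - y) (z - y)" for z
      by (simp add: cross_def algebra_simps)
    then show "\<forall>z\<in>U. cross (y - u) (z - u) \<le> 0" using ext by simp
  qed (use u y in auto)
  then show ?thesis by blast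
qed

text \<open>A disc growing from \<open>y\<close> in the direction of \<open>s\<close> meets a second vertex and then a third one,
  unless it runs into a bare edge.\<close>

lemma bare_or_enclosing_triangle:
  assumes fin: "finite U" and gp: "general_position U" and y: "y \<in> U" "U \<noteq> {y}"
    and s: "s \<notin> U" "\<forall>z\<in>U. dist s y \<le> dist s z"
  shows "(\<exists>u. (y, u) \<in> bare_edges U \<or> (u, y) \<in> bare_edges U) \<or>
    (\<exists>u p c. (y, u, p) \<in> delaunay_triangles U \<and> pw c y u = 0 \<and> pw c y p = 0 \<and>
       (\<forall>z\<in>U. 0 \<le> pw c y z) \<and> pw c y s < 0)"
proof -
  define e where "e = s - y"
  have e: "e \<noteq> 0" using s y by (auto simp: e_def)
  show ?thesis
  proof (cases "\<forall>z\<in>U. e \<bullet> (z - y) \<le> 0")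
    case True
    then show ?thesis using bare_edge_of_halfplane[OF fin gp y e] by blast
  next
    case False
    define V where "V = {z\<in>U. e \<bullet> (z - y) > 0}"
    define f where "f z = ((z - y) \<bullet> (z - y)) / (2 * (e \<bullet> (z - y)))" for z
    have V: "finite V" "V \<noteq> {}" using fin False by (auto simp: V_def)
    define u where "u = arg_min_on f V"
    have uV: "u \<in> V" using arg_min_if_finite(1)[OF V] by (simp add: u_def)
    have umin: "f u \<le> f z" if "z \<in> V" for z
      using arg_min_if_finite(2)[OF V, of f] that by (auto simp: u_def not_less)
    define t where "t = f u"
    define c where "c = y + t *\<^sub>R e"
    have c: "pw c y z = (z - y) \<bullet> (z - y) - 2 * t * (e \<bullet> (z - y))" for z
      by (simp add: pw_def c_def)
    have u: "u \<in> U" "e \<bullet> (u - y) > 0" using uV by (auto simp: V_def)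
    then have uy: "y \<noteq> u" by auto
    \<comment> \<open>At \<open>t = 1\<close> the centre is \<open>s\<close>, whose nearest vertex
      is \<open>y\<close>; hence no vertex stops the disc before, and from then on \<open>s\<close>
      is strictly inside.\<close>
    have t1: "t \<ge> 1"
    proof -
      have "pw s y u \<ge> 0" using s u by (simp add: pw_ge_0_iff)
      then have "(u - y) \<bullet> (u - y) \<ge> 2 * (e \<bullet> (u - y))" by (simp add: pw_def e_def)
      then show ?thesis using u by (simp add: t_def f_def field_simps)
    qed
    have cu: "pw c y u = 0" using u by (simp add: c t_def f_def)
    have cU: "\<forall>z\<in>U. 0 \<le> pw c y z"
    proof
      fix z assume z: "z \<in> U"
      show "0 \<le> pw c y z"
      proof (cases "e \<bullet> (z - y) > 0")
        case True
        then have "t \<le> f z" using umin z by (simp add: t_def V_def)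
        then show ?thesis using True by (simp add: c f_def field_simps)
      next
        case False
        then have "t * (e \<bullet> (z - y)) \<le> 0" using t1 by (simp add: mult_nonneg_nonpos)
        then show ?thesis unfolding c using inner_ge_zero[of "z - y"] by linarith
      qed
    qed
    have cs: "pw c y s < 0"
    proof -
      have "pw c y s = (1 - 2 * t) * (e \<bullet> e)" by (simp add: c e_def algebra_simps)
      moreover have "e \<bullet> e > 0" using e by simp
      ultimately show ?thesis using t1 by (simp add: mult_neg_pos)
    qed
    \<comment> \<open>The edge is oriented so that \<open>s\<close> is on its left, which is why
      bare edges of both directions appear in the statement.\<close>
    show ?thesis
    proof (cases "cross (u - y) (s - y) \<ge> 0")
      case True
      then show ?thesis using bare_or_triangle[OF fin y(1) u(1) uy cu cU True cs] by blast
    next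
      case False
      have side: "cross (y - u) (s - u) \<ge> 0"
        using False by (simp add: cross_def algebra_simps)
      have b: "pw c u z = pw c y z" for z using cu by (rule pw_base)
      have "(u, y) \<in> bare_edges U \<or> (\<exists>p c. (u, y, p) \<in> delaunay_triangles U \<and> pw c u y = 0 \<and>
          pw c u p = 0 \<and> (\<forall>z\<in>U. 0 \<le> pw c u z) \<and> pw c u s < 0)"
        by (rule bare_or_triangle[OF fin u(1) y(1) uy[symmetric] _ _ side, of c]) (use cU cs b in auto)
      then show ?thesis
      proof
        assume "\<exists>p c. (u, y, p) \<in> delaunay_triangles U \<and> pw c u y = 0 \<and>
          pw c u p = 0 \<and> (\<forall>z\<in>U. 0 \<le> pw c u z) \<and> pw c u s < 0"
        then obtain p c where *: "(u, y, p) \<in> delaunay_triangles U" "pw c u y = 0"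
          "pw c u p = 0" "\<forall>z\<in>U. 0 \<le> pw c u z" "pw c u s < 0" by blast
        have "pw c y z = pw c u z" for z using *(2) by (rule pw_base)
        then show ?thesis using * delaunay_triangle_rotate[OF *(1)] by (metis pw_self)
      qed blast
    qed
  qed
qed

section \<open>Subsets of minimal degree six\<close>

text \<open>A finite witness is demanded because \<open>card\<close> is 0 on infinite sets.\<close>

definition many :: "nat \<Rightarrow> 'a set \<Rightarrow> bool" where
  "many n A \<longleftrightarrow> (\<exists>T\<subseteq>A. finite T \<and> card T = n)"

lemma many_mono: "many n A \<Longrightarrow> A \<subseteq> B \<Longrightarrow> many n B"
  unfolding many_def by blast

lemma many_card: "finite A \<Longrightarrow> many n A \<longleftrightarrow> n \<le> card A"
  unfolding many_def by (metis card_mono obtain_subset_with_card_n)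

definition nbrs :: "pt set \<Rightarrow> pt \<Rightarrow> pt set" where
  "nbrs S x = {y. delaunay_edge S x y}"

lemma nbrs_subset: "nbrs S x \<subseteq> S"
  by (auto simp: nbrs_def delaunay_edge_def)

text \<open>The last conjunct says that \<open>s\<close> lies in no triangle whose sides are short Delaunay edges. A
  spot is missing from every subset of minimal degree six and leaves a hole there that no
  triangle fills.\<close>

definition spot :: "real \<Rightarrow> pt set \<Rightarrow> pt \<Rightarrow> bool" where
  "spot d S s \<longleftrightarrow> s \<in> S \<and> \<not> many 6 (nbrs S s) \<and>
     (\<forall>y u p. delaunay_edge S y u \<and> delaunay_edge S u p \<and> delaunay_edge S p y \<and>
        dist y u \<le> d \<and> dist y p \<le> d \<and> s \<notin> {y, u, p} \<and> 0 < cross (u - y) (p - y) \<and> 0 \<le> cross (u - y) (s - y) \<and>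
        0 \<le> cross (p - u) (s - u) \<and> 0 \<le> cross (y - p) (s - p) \<longrightarrow> False)"

lemma locfin_finite: "locfin S \<Longrightarrow> bounded B \<Longrightarrow> finite (S \<inter> B)"
  by (simp add: locfin_def)

text \<open>The empty circle of the edge has neither \<open>p\<close> nor \<open>s\<close> inside,
  while the circle around \<open>c\<close> passes through \<open>p\<close> and contains
  \<open>s\<close>. The powers differ by a multiple of \<open>cross (u - y)\<close>, so
  \<open>s\<close> and \<open>p\<close> are on the same side of the edge.\<close>

lemma triangle_side:
  assumes c: "pw c y u = 0" "pw c y p = 0" "pw c y s < 0" and pos: "0 < cross (u - y) (p - y)"
    and e: "delaunay_edge S y u" and S: "p \<in> S" "s \<in> S"
  shows "0 \<le> cross (u - y) (s - y)"
proof -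
  obtain a where a: "pw a y u = 0" "\<forall>z\<in>S. 0 \<le> pw a y z" and "y \<noteq> u"
    using e unfolding delaunay_edge_iff by blast
  obtain k where k: "\<And>z. pw a y z - pw c y z = k * cross (u - y) (z - y)"
    using pw_diff[OF a(1) c(1) \<open>y \<noteq> u\<close>] by metis
  have "0 \<le> k * cross (u - y) (p - y)" using k[of p] a S c by force
  then have "0 \<le> k" using pos by (simp add: zero_le_mult_iff)
  moreover have "0 < k * cross (u - y) (s - y)" using k[of s] a(2) S c by force
  ultimately show ?thesis by (simp add: zero_less_mult_iff)
qed

text \<open>The points \<open>U\<close> of \<open>K\<close> in the disc have at least
  \<open>6 * card U\<close> directed edges into \<open>K\<close>, but the Delaunay graph of
  \<open>U\<close> itself has fewer. Every hull edge of \<open>U\<close>, and every edge of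
  \<open>U\<close> that is not one of \<open>S\<close>, must therefore be paid for by an edge in
  \<open>X\<close> that leaves the disc. Each spot causes such a defect nearby (the set
  \<open>B\<close>), so the defects are dense in \<open>U\<close>, and the points near the boundary
  make up a fixed fraction of \<open>U\<close>.\<close>

lemma core_growth:
  fixes S K :: "pt set" and b l w r :: real and N :: nat
  assumes S: "locfin S" "general_position S" and K: "K \<subseteq> S"
    and six: "\<And>x. x \<in> K \<Longrightarrow> dist ctr x \<le> w \<Longrightarrow> many 6 (nbrs S x \<inter> K)"
    and short: "\<And>x u. x \<in> S \<Longrightarrow> dist ctr x \<le> w \<Longrightarrow> delaunay_edge S x u \<Longrightarrow> dist x u \<le> 2 * b"
    and spots: "\<And>z. dist ctr z \<le> w \<Longrightarrow> \<exists>s. spot (2 * b) S s \<and> dist z s \<le> l"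
    and cnt: "\<And>z. dist ctr z \<le> w \<Longrightarrow> card (S \<inter> cball z (4 * l)) \<le> N"
    and bl: "0 < b" "2 * b \<le> l" and r: "r \<le> w - l"
  shows "card (K \<inter> cball ctr r) \<le> N * N * card (K \<inter> cball ctr r - cball ctr (r - 2 * b))"
proof (cases "K \<inter> cball ctr r = {}")
  case True
  then show ?thesis by simp
next
  case False
  define U where "U = K \<inter> cball ctr r"
  have U: "U \<noteq> {}" "U \<subseteq> S" "U \<subseteq> K" using False K by (auto simp: U_def)
  have finU: "finite U"
    by (rule finite_subset[OF _ locfin_finite[OF S(1) bounded_cball[of ctr r]]]) (use K in \<open>auto simp: U_def\<close>)
  have l: "l > 0" using bl by simp
  have gpU: "general_position U" using S(2) U(2) by (rule general_position_subset)
  have Uw: "dist ctr x \<le> w" if "x \<in> U" for x using that r l by (auto simp: U_def)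
  have fin_ball: "finite (S \<inter> cball z t)" for z t using S(1) by (simp add: locfin_finite)
  have nb: "nbrs S x \<subseteq> S \<inter> cball x (2 * b)" if "x \<in> U" for x
    using short[of x] that U Uw nbrs_subset by (auto simp: nbrs_def)
  have fin_nb: "finite (nbrs S x)" if "x \<in> U" for x
    using nb[OF that] fin_ball finite_subset by blast
  have ball_N: "card (S \<inter> cball z t) \<le> N" if "z \<in> U" "t \<le> 4 * l" for z t
  proof -
    have "card (S \<inter> cball z t) \<le> card (S \<inter> cball z (4 * l))"
      using that fin_ball by (intro card_mono) auto
    then show ?thesis using cnt[OF Uw[OF that(1)]] by linarith
  qed
  define DE where "DE = delaunay_edges U"
  define DS where "DS = DE \<inter> delaunay_edges S"
  define X where "X = {(x, u). x \<in> U \<and> u \<in> K - U \<and> delaunay_edge S x u}"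
  have finDE: "finite DE" using finU by (simp add: DE_def finite_delaunay_edges)
  have finDS: "finite DS" using finDE by (simp add: DS_def)
  have sigma: "DS \<union> X = (SIGMA x:U. nbrs S x \<inter> K)"
  proof -
    have "(x, u) \<in> DS \<union> X \<longleftrightarrow> x \<in> U \<and> u \<in> nbrs S x \<inter> K" for x u
    proof -
      have "(x, u) \<in> DS \<longleftrightarrow> x \<in> U \<and> u \<in> U \<and> delaunay_edge S x u"
        using delaunay_edge_mono[of S x u U] U(2)
        by (auto simp: DS_def DE_def delaunay_edges_def) (simp_all add: delaunay_edge_def)
      then show ?thesis using U(3) by (auto simp: X_def nbrs_def)
    qed
    then show ?thesis by auto
  qed
  have finSig: "finite (SIGMA x:U. nbrs S x \<inter> K)" using finU fin_nb by blast
  have finX: "finite X" using finSig sigma by (metis finite_Un)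
  have ge6: "6 * card U \<le> card DS + card X"
  proof -
    have "6 * card U = (\<Sum>x\<in>U. 6)" by simp
    also have "\<dots> \<le> (\<Sum>x\<in>U. card (nbrs S x \<inter> K))"
    proof (rule sum_mono)
      fix x assume x: "x \<in> U"
      then have "many 6 (nbrs S x \<inter> K)" using six Uw U by blast
      then show "6 \<le> card (nbrs S x \<inter> K)" using many_card fin_nb[OF x] by blast
    qed
    also have "\<dots> = card (SIGMA x:U. nbrs S x \<inter> K)" using finU fin_nb by simp
    also have "\<dots> = card (DS \<union> X)" by (simp add: sigma)
    also have "\<dots> \<le> card DS + card X" by (rule card_Un_le)
    finally show ?thesis .
  qed
  define B where "B = bare_edges U \<union> (DE - DS)"
  have bareDE: "bare_edges U \<subseteq> DE" by (auto simp: bare_edges_def DE_def delaunay_edges_def)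
  have finB: "finite B" using finDE bareDE finite_subset by (auto simp: B_def)
  have cardDE: "card DE = card DS + card (DE - DS)"
    using finDE by (metis DS_def Int_lower1 card_Diff_subset card_mono finDS le_add_diff_inverse)
  \<comment> \<open>Six edges per vertex against the exact edge count: the defects are bounded by
    the edges leaving the disc.\<close>
  have main: "card (DE - DS) + 2 * card (bare_edges U) + 6 \<le> card X"
    using card_delaunay_edges[OF finU U(1) gpU] ge6 cardDE unfolding DE_def[symmetric] by linarith
  have BX: "card B \<le> card X"
    using card_Un_le[of "bare_edges U" "DE - DS"] main unfolding B_def by linarith
  have UX: "card U \<le> N * card X"
  proof (cases "card U = 1")
    \<comment> \<open>A single vertex has no hull edge, but its edges into \<open>K\<close> all
      leave the disc.\<close>
    case True
    obtain x where x: "x \<in> U" using U by blast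
    then have "x \<in> S \<inter> cball x l" using U l by auto
    then have "card (S \<inter> cball x l) \<ge> 1"
      using fin_ball by (metis One_nat_def Suc_leI card_gt_0_iff empty_iff)
    then have "1 \<le> N" using ball_N[OF x, of l] l by simp
    then have "1 * 1 \<le> N * card X" using main by (intro mult_le_mono) auto
    then show ?thesis using True by simp
  next
    case False
    \<comment> \<open>A spot has fewer than six neighbours and is therefore not in \<open>K\<close>.
      Let \<open>y\<close> be the vertex of \<open>U\<close> nearest to it. If no defect is found
      around \<open>y\<close>, the triangle obtained there consists of short edges of
      \<open>S\<close> and contains the spot, which the definition of a spot forbids.\<close>
    have near: "\<exists>u v. (u, v) \<in> B \<and> dist u x \<le> 3 * l" if x: "x \<in> U" for x
    proof -
      obtain s where s: "spot (2 * b) S s" "dist x s \<le> l" using spots Uw[OF x] by blast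
      have sS: "s \<in> S" using s by (simp add: spot_def)
      have "s \<notin> K"
      proof
        assume "s \<in> K"
        moreover have "dist ctr s \<le> w"
          using dist_triangle[of ctr s x] x s r by (auto simp: U_def)
        ultimately have "many 6 (nbrs S s)" using six many_mono by blast
        then show False using s by (simp add: spot_def)
      qed
      then have sU: "s \<notin> U" using U by blast
      define y where "y = arg_min_on (dist s) U"
      have y: "y \<in> U" "\<forall>z\<in>U. dist s y \<le> dist s z"
        using arg_min_if_finite[OF finU U(1), of "dist s"] by (auto simp: y_def not_less)
      have sy: "dist s y \<le> l" using y(2) x s(2) dist_commute[of s x] by fastforce
      have yx: "dist y x \<le> 2 * l"
        using dist_triangle[of y x s] sy s(2) dist_commute[of s x] dist_commute[of s y] by linarith
      have Uy: "U \<noteq> {y}" using False by auto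
      have DSedge: "delaunay_edge S p q \<and> dist p q \<le> 2 * b" if "(p, q) \<in> DE" "(p, q) \<notin> B" for p q
      proof -
        have *: "delaunay_edge S p q" using that by (auto simp: B_def DS_def delaunay_edges_def)
        have "p \<in> U" using that by (auto simp: DE_def delaunay_edges_def delaunay_edge_def)
        then show ?thesis using short[of p q] * U Uw by auto
      qed
      have far: "dist u x \<le> 3 * l" if "dist y u \<le> 2 * b" for u
        using dist_triangle[of u x y] yx bl that dist_commute[of u y] by linarith
      from bare_or_enclosing_triangle[OF finU gpU y(1) Uy sU y(2)]
      show ?thesis
      proof (elim disjE exE conjE)
        fix u assume "(y, u) \<in> bare_edges U"
        then show ?thesis using yx l unfolding B_def by force
      next
        fix u assume u: "(u, y) \<in> bare_edges U"
        then have DEu: "(y, u) \<in> DE"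
          by (auto simp: bare_edges_def DE_def delaunay_edges_def delaunay_edge_sym)
        show ?thesis
        proof (cases "(y, u) \<in> B")
          case True
          then show ?thesis using yx l by force
        next
          case False
          then show ?thesis using DSedge[OF DEu] far u unfolding B_def by blast
        qed
      next
        fix u p c
        assume T: "(y, u, p) \<in> delaunay_triangles U" and c: "pw c y u = 0" "pw c y p = 0"
          "\<forall>z\<in>U. 0 \<le> pw c y z" "pw c y s < 0"
        have T2: "(u, p, y) \<in> delaunay_triangles U" and T3: "(p, y, u) \<in> delaunay_triangles U"
          using T delaunay_triangle_rotate by blast+
        have DE3: "(y, u) \<in> DE" "(u, p) \<in> DE" "(p, y) \<in> DE"
          using delaunay_edge_of_triangle[OF finU gpU] T T2 T3 by (auto simp: DE_def delaunay_edges_def)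
        have DE4: "(y, p) \<in> DE" using DE3(3) by (auto simp: DE_def delaunay_edges_def delaunay_edge_sym)
        show ?thesis
        proof (cases "(y, u) \<in> B \<or> (y, p) \<in> B")
          case True
          then show ?thesis using yx l by force
        next
          case False
          then have e: "delaunay_edge S y u" "dist y u \<le> 2 * b" "delaunay_edge S p y" "dist y p \<le> 2 * b"
            using DSedge DE3 DE4 delaunay_edge_sym by blast+
          show ?thesis
          proof (cases "(u, p) \<in> B")
            case True
            then show ?thesis using far[OF e(2)] by blast
          next
            case False
            then have e2: "delaunay_edge S u p" using DSedge DE3 by blast
            have cr: "0 < cross (u - y) (p - y)" "0 < cross (p - u) (y - u)" "0 < cross (y - p) (u - p)"
              using T T2 T3 by (auto simp: delaunay_triangles_def)
            have inU: "y \<in> U" "u \<in> U" "p \<in> U" using T by (auto simp: delaunay_triangles_def)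
            have bu: "pw c u z = pw c y z" and bp: "pw c p z = pw c y z" for z
              using c by (simp_all add: pw_base)
            have "0 \<le> cross (u - y) (s - y)"
              by (rule triangle_side[OF c(1,2,4) cr(1) e(1)]) (use inU U sS in auto)
            moreover have "0 \<le> cross (p - u) (s - u)"
              by (rule triangle_side[OF _ _ _ cr(2) e2, of c]) (use inU U sS c in \<open>auto simp: bu\<close>)
            moreover have "0 \<le> cross (y - p) (s - p)"
              by (rule triangle_side[OF _ _ _ cr(3) e(3), of c]) (use inU U sS c in \<open>auto simp: bp\<close>)
            moreover have "s \<notin> {y, u, p}" using sU inU by blast
            ultimately have False using s(1) e e2 cr(1) unfolding spot_def by blast
            then show ?thesis ..
          qed
        qed
      qed
    qed
    have "U \<subseteq> (\<Union>e\<in>B. S \<inter> cball (fst e) (3 * l))"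
    proof
      fix x assume "x \<in> U"
      with near obtain u v where "(u, v) \<in> B" "dist u x \<le> 3 * l" by blast
      then show "x \<in> (\<Union>e\<in>B. S \<inter> cball (fst e) (3 * l))" using U \<open>x \<in> U\<close> by force
    qed
    then have "card U \<le> card (\<Union>e\<in>B. S \<inter> cball (fst e) (3 * l))"
      using finB fin_ball by (intro card_mono finite_UN_I) simp_all
    also have "\<dots> \<le> (\<Sum>e\<in>B. card (S \<inter> cball (fst e) (3 * l)))" using finB by (rule card_UN_le)
    also have "\<dots> \<le> (\<Sum>e\<in>B. N)"
    proof (rule sum_mono)
      fix e assume "e \<in> B"
      then have "fst e \<in> U"
        using bareDE by (auto simp: B_def DE_def delaunay_edges_def delaunay_edge_def)
      then show "card (S \<inter> cball (fst e) (3 * l)) \<le> N" using ball_N l by simp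
    qed
    also have "\<dots> = N * card B" by simp
    also have "\<dots> \<le> N * card X" using BX by simp
    finally show ?thesis .
  qed
  have XN: "card X \<le> N * card (U - cball ctr (r - 2 * b))"
  proof -
    have "X \<subseteq> (SIGMA x:U - cball ctr (r - 2 * b). S \<inter> cball x (2 * b))"
    proof clarify
      fix x u assume "(x, u) \<in> X"
      then have *: "x \<in> U" "u \<in> K" "u \<notin> U" "delaunay_edge S x u" by (auto simp: X_def)
      then have "u \<in> nbrs S x" by (simp add: nbrs_def)
      then have "u \<in> S \<inter> cball x (2 * b)" using nb[OF *(1)] by blast
      moreover have "x \<notin> cball ctr (r - 2 * b)"
      proof
        assume "x \<in> cball ctr (r - 2 * b)"
        then have "dist ctr u \<le> r"
          using dist_triangle[of ctr u x] \<open>u \<in> S \<inter> cball x (2 * b)\<close> by auto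
        then show False using * by (auto simp: U_def)
      qed
      ultimately show "x \<in> U - cball ctr (r - 2 * b) \<and> u \<in> S \<inter> cball x (2 * b)" using * by blast
    qed
    then have "card X \<le> card (SIGMA x:U - cball ctr (r - 2 * b). S \<inter> cball x (2 * b))"
      using finU fin_ball by (intro card_mono) auto
    also have "\<dots> = (\<Sum>x\<in>U - cball ctr (r - 2 * b). card (S \<inter> cball x (2 * b)))"
      using finU fin_ball by simp
    also have "\<dots> \<le> (\<Sum>x\<in>U - cball ctr (r - 2 * b). N)"
      using ball_N bl by (intro sum_mono) auto
    finally show ?thesis by (simp add: mult.commute)
  qed
  have "card U \<le> N * (N * card (U - cball ctr (r - 2 * b)))"
    using UX XN by (meson le_trans mult_le_mono2)
  then show ?thesis by (simp add: U_def mult.assoc)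
qed

text \<open>Each inward step of \<open>2 * b\<close> multiplies the number of points of
  \<open>K\<close> by at most \<open>1 - 1 / N\<^sup>2\<close>; after \<open>j\<close> steps the
  bound is below 1, so this natural number is 0.\<close>

lemma core_avoids_ball:
  fixes S K :: "pt set" and b l w r :: real and N j :: nat
  assumes S: "locfin S" "general_position S" and K: "K \<subseteq> S"
    and six: "\<And>x. x \<in> K \<Longrightarrow> dist ctr x \<le> w \<Longrightarrow> many 6 (nbrs S x \<inter> K)"
    and short: "\<And>x u. x \<in> S \<Longrightarrow> dist ctr x \<le> w \<Longrightarrow> delaunay_edge S x u \<Longrightarrow> dist x u \<le> 2 * b"
    and spots: "\<And>z. dist ctr z \<le> w \<Longrightarrow> \<exists>s. spot (2 * b) S s \<and> dist z s \<le> l"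
    and cnt: "\<And>z. dist ctr z \<le> w \<Longrightarrow> card (S \<inter> cball z (4 * l)) \<le> N"
    and bl: "0 < b" "2 * b \<le> l" and r: "r + 2 * b * j \<le> w - l" and N: "N \<ge> 1"
    and decay: "(1 - 1 / (real N)\<^sup>2) ^ j * card (S \<inter> cball ctr w) < 1"
  shows "K \<inter> cball ctr r = {}"
proof -
  define q where "q = 1 - 1 / (real N)\<^sup>2"
  have q: "0 \<le> q" using N by (simp add: q_def)
  define f where "f t = real (card (K \<inter> cball ctr t))" for t
  have fin: "finite (K \<inter> cball ctr t)" for t
    by (rule finite_subset[OF _ locfin_finite[OF S(1) bounded_cball[of ctr t]]]) (use K in auto)
  have step: "f (t - 2 * b) \<le> q * f t" if t: "t \<le> w - l" for t
  proof -
    have sub: "K \<inter> cball ctr (t - 2 * b) \<subseteq> K \<inter> cball ctr t" using bl by auto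
    have "K \<inter> cball ctr t - cball ctr (t - 2 * b) = K \<inter> cball ctr t - K \<inter> cball ctr (t - 2 * b)" by blast
    then have "real (card (K \<inter> cball ctr t - cball ctr (t - 2 * b))) = f t - f (t - 2 * b)"
      using card_Diff_subset[OF fin sub] card_mono[OF fin sub] by (simp add: f_def of_nat_diff)
    moreover have "real (card (K \<inter> cball ctr t)) \<le> real (N * N * card (K \<inter> cball ctr t - cball ctr (t - 2 * b)))"
      using core_growth[OF S K six short spots cnt bl t] by (rule of_nat_mono)
    ultimately have "f t \<le> (real N)\<^sup>2 * (f t - f (t - 2 * b))"
      by (simp add: f_def power2_eq_square)
    then show ?thesis using N by (simp add: q_def field_simps)
  qed
  have iter: "f (w - l - 2 * b * i) \<le> q ^ i * f (w - l)" for i :: nat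
  proof (induction i)
    case (Suc i)
    have "f (w - l - 2 * b * Suc i) = f (w - l - 2 * b * i - 2 * b)" by (simp add: algebra_simps)
    also have "\<dots> \<le> q * f (w - l - 2 * b * i)" using bl by (intro step) simp
    also have "\<dots> \<le> q * (q ^ i * f (w - l))" using Suc q by (intro mult_left_mono)
    finally show ?case by simp
  qed simp
  have "f r \<le> f (w - l - 2 * b * j)"
    using r fin unfolding f_def by (intro of_nat_mono card_mono) auto
  also have "\<dots> \<le> q ^ j * f (w - l)" by (rule iter)
  also have "\<dots> \<le> q ^ j * card (S \<inter> cball ctr w)"
  proof (rule mult_left_mono)
    have "finite (S \<inter> cball ctr w)" using S(1) by (simp add: locfin_finite)
    then show "f (w - l) \<le> card (S \<inter> cball ctr w)"
      unfolding f_def using K bl by (intro of_nat_mono card_mono) auto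
  qed (use q in simp)
  also have "\<dots> < 1" using decay by (simp add: q_def)
  finally have "card (K \<inter> cball ctr r) = 0" by (simp add: f_def)
  then show ?thesis using fin by simp
qed

section \<open>A configuration containing a spot\<close>

text \<open>Shrinking a large empty disc towards \<open>x\<close> gives an empty disc of radius
  exactly \<open>r\<close> with \<open>x\<close> on its boundary, which \<open>hit\<close>
  excludes.\<close>

lemma empty_disc_radius:
  assumes a: "\<forall>z\<in>S. 0 \<le> pw a x z" and r: "r > 0"
    and hit: "\<And>c. dist c x \<le> r \<Longrightarrow> \<exists>z\<in>S. dist c z < r"
  shows "dist a x < r"
proof (rule ccontr)
  assume "\<not> dist a x < r"
  then have ge: "dist a x \<ge> r" by simp
  then have pos: "dist a x > 0" using r by linarith
  define c where "c = x + (r / dist a x) *\<^sub>R (a - x)"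
  have cx: "dist c x = r" using pos r by (simp add: c_def dist_norm)
  have "a - c = (1 - r / dist a x) *\<^sub>R (a - x)" by (simp add: c_def algebra_simps)
  moreover have "r / dist a x \<le> 1" using ge pos by simp
  ultimately have "dist a c = (1 - r / dist a x) * dist a x" by (simp add: dist_norm)
  then have ac: "dist a c = dist a x - r" using pos by (simp add: field_simps)
  obtain z where z: "z \<in> S" "dist c z < r" using hit[of c] cx by auto
  have "dist a z < dist a x" using dist_triangle[of a z c] ac z by linarith
  then show False using a z by (simp add: pw_ge_0_iff leD)
qed

lemma edge_short:
  assumes e: "delaunay_edge S x u" and r: "r > 0"
    and hit: "\<And>c. dist c x \<le> r \<Longrightarrow> \<exists>z\<in>S. dist c z < r"
  shows "dist x u < 2 * r"
proof -
  obtain a where a: "pw a x u = 0" "\<forall>z\<in>S. 0 \<le> pw a x z"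
    using e unfolding delaunay_edge_iff by blast
  have "dist a x < r" using empty_disc_radius[OF a(2) r hit] by blast
  moreover have "dist a u = dist a x" using a by (simp add: pw_eq_0_iff)
  ultimately show ?thesis using dist_triangle[of x u a] dist_commute[of x a] by linarith
qed

lemma dist_le_components: "dist (x::pt) y \<le> \<bar>x$1 - y$1\<bar> + \<bar>x$2 - y$2\<bar>"
  using norm_le_l1_cart[of "x - y"] by (simp add: dist_norm sum_2)

lemma component_le_dist: "\<bar>x$i - y$i\<bar> \<le> dist (x::pt) y"
  using component_le_norm_cart[of "x - y" i] by (simp add: dist_norm)

lemma barycentric:
  assumes D: "0 < cross (u - y) (p - y)" and s: "0 \<le> cross (u - y) (s - y)"
    "0 \<le> cross (p - u) (s - u)" "0 \<le> cross (y - p) (s - p)"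
  obtains l1 l2 l3 where "l1 \<ge> 0" "l2 \<ge> 0" "l3 \<ge> 0" "l1 + l2 + l3 = 1"
    "s = l1 *\<^sub>R y + l2 *\<^sub>R u + l3 *\<^sub>R p"
proof -
  define d where "d = cross (u - y) (p - y)"
  show thesis
  proof (rule that[of "cross (p - u) (s - u) / d" "cross (y - p) (s - p) / d" "cross (u - y) (s - y) / d"])
    have d: "d > 0" using D by (simp add: d_def)
    have sum: "cross (p - u) (s - u) + cross (y - p) (s - p) + cross (u - y) (s - y) = d"
      by (simp add: d_def cross_def algebra_simps)
    have "d *\<^sub>R s = cross (p - u) (s - u) *\<^sub>R y + cross (y - p) (s - p) *\<^sub>R u + cross (u - y) (s - y) *\<^sub>R p"
      by (simp add: d_def vec2_eq_iff cross_def algebra_simps)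
    then have "(1 / d) *\<^sub>R (d *\<^sub>R s) = (1 / d) *\<^sub>R (cross (p - u) (s - u) *\<^sub>R y +
        cross (y - p) (s - p) *\<^sub>R u + cross (u - y) (s - y) *\<^sub>R p)" by simp
    then show "s = (cross (p - u) (s - u) / d) *\<^sub>R y + (cross (y - p) (s - p) / d) *\<^sub>R u +
        (cross (u - y) (s - y) / d) *\<^sub>R p"
      using d by (simp add: scaleR_add_right)
    show "cross (p - u) (s - u) / d + cross (y - p) (s - p) / d + cross (u - y) (s - y) / d = 1"
      using sum d by (simp add: add_divide_distrib[symmetric])
  qed (use D s in \<open>simp_all add: d_def\<close>)
qed

lemma barycentric_dist:
  fixes s y u p :: pt
  assumes "l1 \<ge> 0" "l2 \<ge> 0" "l3 \<ge> 0" "l1 + l2 + l3 = 1" "s = l1 *\<^sub>R y + l2 *\<^sub>R u + l3 *\<^sub>R p"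
    and d: "dist y u \<le> r" "dist y p \<le> r"
  shows "dist y s \<le> r"
proof -
  have "s - y = l2 *\<^sub>R (u - y) + l3 *\<^sub>R (p - y)"
  proof -
    have "(l1 + l2 + l3) *\<^sub>R y = y" using assms(4) by simp
    then show ?thesis unfolding assms(5) by (simp add: algebra_simps)
  qed
  then have "norm (s - y) \<le> norm (l2 *\<^sub>R (u - y)) + norm (l3 *\<^sub>R (p - y))"
    by (simp only: norm_triangle_ineq)
  also have "\<dots> = l2 * norm (u - y) + l3 * norm (p - y)" using assms(2,3) by simp
  also have "\<dots> \<le> l2 * r + l3 * r"
    using assms(2,3) d by (intro add_mono mult_left_mono) (simp_all add: dist_norm norm_minus_commute)
  also have "\<dots> = (l2 + l3) * r" by (simp add: distrib_right)
  also have "\<dots> \<le> 1 * r"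
    using assms(1-4) d zero_le_dist[of y u] by (intro mult_right_mono) linarith+
  finally show ?thesis by (simp add: dist_norm norm_minus_commute)
qed

section \<open>Separating three integer points from the origin\<close>

lemma int_triple_cases:
  fixes a b c :: int
  assumes "\<bar>a - b\<bar> \<le> 1" "\<bar>b - c\<bar> \<le> 1" "\<bar>c - a\<bar> \<le> 1"
  shows "(1 \<le> a \<and> 1 \<le> b \<and> 1 \<le> c) \<or> (a \<le> -1 \<and> b \<le> -1 \<and> c \<le> -1) \<or>
      (0 \<le> a \<and> a \<le> 1 \<and> 0 \<le> b \<and> b \<le> 1 \<and> 0 \<le> c \<and> c \<le> 1) \<or>
      (-1 \<le> a \<and> a \<le> 0 \<and> -1 \<le> b \<and> b \<le> 0 \<and> -1 \<le> c \<and> c \<le> 0)"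
proof -
  have 1: "a \<le> b + 1" "b \<le> a + 1" "b \<le> c + 1" "c \<le> b + 1" "c \<le> a + 1" "a \<le> c + 1" using assms by linarith+
  show ?thesis
  proof (cases "1 \<le> a \<and> 1 \<le> b \<and> 1 \<le> c \<or> a \<le> -1 \<and> b \<le> -1 \<and> c \<le> -1")
    case False
    then have 2: "a \<le> 0 \<or> b \<le> 0 \<or> c \<le> 0" "a \<ge> 0 \<or> b \<ge> 0 \<or> c \<ge> 0" by auto
    have 3: "a \<le> 1" "b \<le> 1" "c \<le> 1" using 2(1) 1 by auto
    have 4: "a \<ge> -1" "b \<ge> -1" "c \<ge> -1" using 2(2) 1 by auto
    show ?thesis
    proof (cases "a = 1 \<or> b = 1 \<or> c = 1")
      case True
      then have "0 \<le> a" "0 \<le> b" "0 \<le> c" using 1 by auto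
      then show ?thesis using 3 by simp
    next
      case False
      then have "a \<le> 0" "b \<le> 0" "c \<le> 0" using 3 by auto
      then show ?thesis using 4 by simp
    qed
  qed auto
qed
text \<open>Coordinates differing by at most 1 are all positive, all negative, in
  \<open>{0, 1}\<close> or in \<open>{-1, 0}\<close>; one of the eight directions with entries in
  \<open>{-1, 0, 1}\<close> then works. In \<open>pattern_spot\<close> this keeps the spot out of
  all triangles of the lattice.\<close>

lemma separating_direction:
  fixes i1 i2 i3 j1 j2 j3 :: int
  assumes "\<bar>i1 - i2\<bar> \<le> 1" "\<bar>i2 - i3\<bar> \<le> 1" "\<bar>i3 - i1\<bar> \<le> 1" "\<bar>j1 - j2\<bar> \<le> 1" "\<bar>j2 - j3\<bar> \<le> 1" "\<bar>j3 - j1\<bar> \<le> 1"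
    and "(i1, j1) \<noteq> (0, 0)" "(i2, j2) \<noteq> (0, 0)" "(i3, j3) \<noteq> (0, 0)"
  obtains a b :: int where "\<bar>a\<bar> \<le> 1" "\<bar>b\<bar> \<le> 1" "a * i1 + b * j1 \<ge> 1" "a * i2 + b * j2 \<ge> 1" "a * i3 + b * j3 \<ge> 1"
proof -
  note i = int_triple_cases[OF assms(1-3)] and j = int_triple_cases[OF assms(4-6)]
  show thesis
    using i
  proof (elim disjE)
    assume "1 \<le> i1 \<and> 1 \<le> i2 \<and> 1 \<le> i3"
    then show thesis by (intro that[of 1 0]) auto
  next
    assume "i1 \<le> -1 \<and> i2 \<le> -1 \<and> i3 \<le> -1"
    then show thesis by (intro that[of "-1" 0]) auto
  next
    assume i: "0 \<le> i1 \<and> i1 \<le> 1 \<and> 0 \<le> i2 \<and> i2 \<le> 1 \<and> 0 \<le> i3 \<and> i3 \<le> 1"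
    show thesis
      using j
    proof (elim disjE)
      assume "1 \<le> j1 \<and> 1 \<le> j2 \<and> 1 \<le> j3"
      then show thesis by (intro that[of 0 1]) auto
    next
      assume "j1 \<le> -1 \<and> j2 \<le> -1 \<and> j3 \<le> -1"
      then show thesis by (intro that[of 0 "-1"]) auto
    next
      assume "0 \<le> j1 \<and> j1 \<le> 1 \<and> 0 \<le> j2 \<and> j2 \<le> 1 \<and> 0 \<le> j3 \<and> j3 \<le> 1"
      then show thesis using i assms(7-9) by (intro that[of 1 1]) auto
    next
      assume "-1 \<le> j1 \<and> j1 \<le> 0 \<and> -1 \<le> j2 \<and> j2 \<le> 0 \<and> -1 \<le> j3 \<and> j3 \<le> 0"
      then show thesis using i assms(7-9) by (intro that[of 1 "-1"]) auto
    qed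
  next
    assume i: "-1 \<le> i1 \<and> i1 \<le> 0 \<and> -1 \<le> i2 \<and> i2 \<le> 0 \<and> -1 \<le> i3 \<and> i3 \<le> 0"
    show thesis
      using j
    proof (elim disjE)
      assume "1 \<le> j1 \<and> 1 \<le> j2 \<and> 1 \<le> j3"
      then show thesis by (intro that[of 0 1]) auto
    next
      assume "j1 \<le> -1 \<and> j2 \<le> -1 \<and> j3 \<le> -1"
      then show thesis by (intro that[of 0 "-1"]) auto
    next
      assume "0 \<le> j1 \<and> j1 \<le> 1 \<and> 0 \<le> j2 \<and> j2 \<le> 1 \<and> 0 \<le> j3 \<and> j3 \<le> 1"
      then show thesis using i assms(7-9) by (intro that[of "-1" 1]) auto
    next
      assume "-1 \<le> j1 \<and> j1 \<le> 0 \<and> -1 \<le> j2 \<and> j2 \<le> 0 \<and> -1 \<le> j3 \<and> j3 \<le> 0"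
      then show thesis using i assms(7-9) by (intro that[of "-1" "-1"]) auto
    qed
  qed
qed

text \<open>The square lattice with the four neighbours of the origin pulled in by a tenth: this makes the
  four diagonal neighbours lose contact with the origin.\<close>

definition lattice_pt :: "int \<Rightarrow> int \<Rightarrow> pt" where
  "lattice_pt i j = (if \<bar>i\<bar> + \<bar>j\<bar> = 1 then 9 / 10 else 1) *\<^sub>R vector [of_int i, of_int j]"

definition near :: "pt \<Rightarrow> pt \<Rightarrow> bool" where
  "near x y \<longleftrightarrow> \<bar>x$1 - y$1\<bar> \<le> 1 / 1000 \<and> \<bar>x$2 - y$2\<bar> \<le> 1 / 1000"

text \<open>1/10 comes from pulling in the four neighbours, 1/1000 from the tolerance of
  \<open>near\<close>.\<close>

lemma near_lattice:
  assumes "near x (c + lattice_pt i j)"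
  shows "\<bar>x$1 - c$1 - of_int i\<bar> \<le> 101 / 1000" "\<bar>x$2 - c$2 - of_int j\<bar> \<le> 101 / 1000"
proof -
  have "\<bar>lattice_pt i j $ 1 - of_int i\<bar> \<le> 1 / 10 \<and> \<bar>lattice_pt i j $ 2 - of_int j\<bar> \<le> 1 / 10"
  proof (cases "\<bar>i\<bar> + \<bar>j\<bar> = 1")
    case True
    then have "\<bar>i\<bar> \<le> 1" "\<bar>j\<bar> \<le> 1" by linarith+
    then have "\<bar>real_of_int i\<bar> \<le> 1" "\<bar>real_of_int j\<bar> \<le> 1" by linarith+
    then show ?thesis using True by (simp add: lattice_pt_def)
  qed (simp add: lattice_pt_def)
  then show "\<bar>x$1 - c$1 - of_int i\<bar> \<le> 101 / 1000" "\<bar>x$2 - c$2 - of_int j\<bar> \<le> 101 / 1000"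
    using assms unfolding near_def vector_add_component by linarith+
qed

text \<open>The ideal positions are \<open>(9/10, 0)\<close>, \<open>(0, 9/10)\<close> and
  \<open>(1, 1)\<close>. For a circle through the origin with centre \<open>(al, be)\<close>, the
  first two being outside gives \<open>al, be \<le> 9/20\<close>, but the third being on it needs
  \<open>al + be = 1\<close>. Errors of 1/500 do not close this gap.\<close>

lemma diagonal_not_adjacent:
  fixes al be n1 n2 n3 n4 m1 m2 m3 m4 q1 q2 :: real
  assumes n: "2 * (al * n1 + be * m1) \<le> n1\<^sup>2 + m1\<^sup>2" "2 * (al * n2 + be * m2) \<le> n2\<^sup>2 + m2\<^sup>2"
    and q: "2 * (al * q1 + be * q2) = q1\<^sup>2 + q2\<^sup>2"
    and b1: "\<bar>n1 - 9/10\<bar> \<le> 1/500" "\<bar>m1\<bar> \<le> 1/500" and b2: "\<bar>n2\<bar> \<le> 1/500" "\<bar>m2 - 9/10\<bar> \<le> 1/500"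
    and b3: "\<bar>q1 - 1\<bar> \<le> 1/500" "\<bar>q2 - 1\<bar> \<le> 1/500"
    and nonneg: "al \<ge> -1" "be \<ge> -1" "al \<le> 1" "be \<le> 1"
  shows False
proof -
  have sq: "n1\<^sup>2 \<le> (902/1000)\<^sup>2" "m1\<^sup>2 \<le> (1/500)\<^sup>2" "n2\<^sup>2 \<le> (1/500)\<^sup>2" "m2\<^sup>2 \<le> (902/1000)\<^sup>2"
    "q1\<^sup>2 \<ge> (998/1000)\<^sup>2" "q2\<^sup>2 \<ge> (998/1000)\<^sup>2"
    unfolding abs_le_square_iff[symmetric] using b1 b2 b3 by linarith+
  have e: "\<bar>al * n1 - al * (9/10)\<bar> \<le> 1/500" "\<bar>be * m1\<bar> \<le> 1/500" "\<bar>al * n2\<bar> \<le> 1/500"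
     "\<bar>be * m2 - be * (9/10)\<bar> \<le> 1/500" "\<bar>al * q1 - al\<bar> \<le> 1/500" "\<bar>be * q2 - be\<bar> \<le> 1/500"
  proof -
    have *: "\<bar>c * v\<bar> \<le> 1/500" if "\<bar>c\<bar> \<le> 1" "\<bar>v\<bar> \<le> 1/500" for c v :: real
      using mult_mono[OF that] by (simp add: abs_mult)
    have c: "\<bar>al\<bar> \<le> 1" "\<bar>be\<bar> \<le> 1" using nonneg by auto
    show "\<bar>al * n1 - al * (9/10)\<bar> \<le> 1/500" using *[OF c(1) b1(1)] by (simp add: algebra_simps)
    show "\<bar>be * m1\<bar> \<le> 1/500" using *[OF c(2) b1(2)] .
    show "\<bar>al * n2\<bar> \<le> 1/500" using *[OF c(1) b2(1)] .
    show "\<bar>be * m2 - be * (9/10)\<bar> \<le> 1/500" using *[OF c(2) b2(2)] by (simp add: algebra_simps)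
    show "\<bar>al * q1 - al\<bar> \<le> 1/500" using *[OF c(1) b3(1)] by (simp add: algebra_simps)
    show "\<bar>be * q2 - be\<bar> \<le> 1/500" using *[OF c(2) b3(2)] by (simp add: algebra_simps)
  qed
  have "n1\<^sup>2 + m1\<^sup>2 \<le> 8137 / 10000" "n2\<^sup>2 + m2\<^sup>2 \<le> 8137 / 10000" "1992 / 1000 \<le> q1\<^sup>2 + q2\<^sup>2"
    using sq by (simp_all add: power2_eq_square)
  then show False
    using n q e(1-4)[THEN abs_le_D2] e(5,6)[THEN abs_le_D1] by (simp add: field_simps)
qed

text \<open>Rounding leaves 1/2 in each coordinate and the points are off by at most 101/1000;
  601/1000 times the square root of 2 is below 87/100.\<close>

lemma lattice_hit:
  assumes pat: "\<And>i j. \<bar>i\<bar> \<le> 52 \<Longrightarrow> \<bar>j\<bar> \<le> 52 \<Longrightarrow> \<exists>x\<in>S. near x (ctr + lattice_pt i j)"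
    and c: "\<bar>c$1 - ctr$1\<bar> \<le> 51" "\<bar>c$2 - ctr$2\<bar> \<le> 51"
  shows "\<exists>z\<in>S. dist c z < 87 / 100"
proof -
  define i where "i = round (c$1 - ctr$1)"
  define j where "j = round (c$2 - ctr$2)"
  have i: "\<bar>of_int i - (c$1 - ctr$1)\<bar> \<le> 1/2" and j: "\<bar>of_int j - (c$2 - ctr$2)\<bar> \<le> 1/2"
    using of_int_round_abs_le by (auto simp: i_def j_def)
  have "\<bar>real_of_int i\<bar> \<le> 52" "\<bar>real_of_int j\<bar> \<le> 52" using i j c by linarith+
  then have "\<bar>i\<bar> \<le> 52" "\<bar>j\<bar> \<le> 52" by linarith+
  then obtain x where x: "x \<in> S" "near x (ctr + lattice_pt i j)" using pat by blast
  have d: "\<bar>c$1 - x$1\<bar> \<le> 601/1000" "\<bar>c$2 - x$2\<bar> \<le> 601/1000"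
    using near_lattice[OF x(2)] i j by linarith+
  have "(dist c x)\<^sup>2 = (c$1 - x$1)\<^sup>2 + (c$2 - x$2)\<^sup>2"
    unfolding dist_norm power2_norm_eq_inner by (simp add: inner_2 power2_eq_square)
  also have "\<dots> \<le> (601/1000)\<^sup>2 + (601/1000)\<^sup>2"
    using d by (intro add_mono power2_le_iff_abs_le[THEN iffD2]) auto
  also have "\<dots> < (87/100)\<^sup>2" by (simp add: power2_eq_square)
  finally have "dist c x < 87 / 100" by (rule power2_less_imp_less) simp
  then show ?thesis using x by blast
qed

text \<open>Multiplying coordinates relative to \<open>s\<close> by the signs \<open>sx\<close> and
  \<open>sy\<close> moves the diagonal neighbour to the first quadrant. The tolerance 1/500 is the
  error of a point plus that of \<open>s\<close>, and \<open>hit\<close> bounds the centre.\<close>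

lemma not_adjacent_diagonal:
  assumes ss: "near s ctr" and sg: "\<bar>sx\<bar> = 1" "\<bar>sy\<bar> = (1::real)"
    and n1: "n1 \<in> S" "near n1 (ctr + vector [sx * (9/10), 0])"
    and n2: "n2 \<in> S" "near n2 (ctr + vector [0, sy * (9/10)])"
    and q: "near q (ctr + vector [sx, sy])" 
    and hit: "\<And>c. dist c s \<le> 87/100 \<Longrightarrow> \<exists>z\<in>S. dist c z < 87/100"
  shows "\<not> delaunay_edge S s q"
proof
  assume "delaunay_edge S s q"
  then obtain a where a0: "pw a s q = 0" and a1: "\<forall>z\<in>S. 0 \<le> pw a s z"
    unfolding delaunay_edge_iff by blast
  have sxy: "sx * sx = 1" "sy * sy = 1" using sg by (simp_all add: abs_mult_self_eq[symmetric, of sx] abs_mult_self_eq[symmetric, of sy])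
  define al where "al = sx * (a$1 - s$1)"
  define be where "be = sy * (a$2 - s$2)"
  define u where "u z = sx * (z$1 - s$1)" for z :: pt
  define v where "v z = sy * (z$2 - s$2)" for z :: pt
  have pm: "sx = 1 \<or> sx = -1" "sy = 1 \<or> sy = -1" using sg by (auto simp: abs_if split: if_splits)
  have pwz: "pw a s z = (u z)\<^sup>2 + (v z)\<^sup>2 - 2 * (al * u z + be * v z)" for z
    using pm by (elim disjE) (simp_all add: pw_def inner_2 u_def v_def al_def be_def power2_eq_square algebra_simps)
  have tol: "\<bar>u z - w1\<bar> \<le> 1/500 \<and> \<bar>v z - w2\<bar> \<le> 1/500"
    if "near z (ctr + vector [sx * w1, sy * w2])" for z w1 w2
  proof -
    have "\<bar>(z$1 - s$1) - sx * w1\<bar> \<le> 1/500" "\<bar>(z$2 - s$2) - sy * w2\<bar> \<le> 1/500"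
      using that ss unfolding near_def vector_add_component vector_2 by linarith+
    moreover have "u z - w1 = sx * ((z$1 - s$1) - sx * w1)" "v z - w2 = sy * ((z$2 - s$2) - sy * w2)"
      using sxy by (simp_all add: u_def v_def right_diff_distrib mult.assoc[symmetric])
    ultimately show ?thesis using sg by (simp add: abs_mult)
  qed
  have "dist a s < 87/100" using empty_disc_radius[OF a1 _ hit] by simp
  then have "\<bar>a$1 - s$1\<bar> \<le> 1" "\<bar>a$2 - s$2\<bar> \<le> 1"
    using component_le_dist[of a 1 s] component_le_dist[of a 2 s] by linarith+
  then have "\<bar>al\<bar> \<le> 1" "\<bar>be\<bar> \<le> 1" using sg by (simp_all add: al_def be_def abs_mult)
  then have albe: "al \<ge> -1" "be \<ge> -1" "al \<le> 1" "be \<le> 1" by linarith+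
  have t1: "\<bar>u n1 - 9/10\<bar> \<le> 1/500 \<and> \<bar>v n1 - 0\<bar> \<le> 1/500" using n1 by (intro tol) simp
  have t2: "\<bar>u n2 - 0\<bar> \<le> 1/500 \<and> \<bar>v n2 - 9/10\<bar> \<le> 1/500" using n2 by (intro tol) simp
  have t3: "\<bar>u q - 1\<bar> \<le> 1/500 \<and> \<bar>v q - 1\<bar> \<le> 1/500" using q by (intro tol) simp
  have "2 * (al * u n1 + be * v n1) \<le> (u n1)\<^sup>2 + (v n1)\<^sup>2"
    "2 * (al * u n2 + be * v n2) \<le> (u n2)\<^sup>2 + (v n2)\<^sup>2"
    "2 * (al * u q + be * v q) = (u q)\<^sup>2 + (v q)\<^sup>2"
    using a1 n1(1) n2(1) a0 pwz by force+
  from diagonal_not_adjacent[OF this] t1 t2 t3 albe show False by simp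
qed

text \<open>Near the centre all edges are shorter than 174/100 and join points whose indices differ
  by at most 1, so only the four pulled-in points can be neighbours of \<open>s\<close>. For a
  triangle around \<open>s\<close> with sides up to \<open>d\<close>, \<open>env\<close> first cuts
  the empty discs down to radius 10; this brings the triangle into the lattice, where
  \<open>separating_direction\<close> keeps \<open>s\<close> outside.\<close>

lemma pattern_spot:
  assumes pat1: "\<And>i j. \<bar>i\<bar> \<le> 52 \<Longrightarrow> \<bar>j\<bar> \<le> 52 \<Longrightarrow> \<exists>x\<in>S. near x (ctr + lattice_pt i j)"
    and uniq: "\<And>x y i j. \<bar>i\<bar> \<le> 52 \<Longrightarrow> \<bar>j\<bar> \<le> 52 \<Longrightarrow> x \<in> S \<Longrightarrow> y \<in> S \<Longrightarrow>
        near x (ctr + lattice_pt i j) \<Longrightarrow> near y (ctr + lattice_pt i j) \<Longrightarrow> x = y"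
    and pat2: "\<And>x. x \<in> S \<Longrightarrow> \<bar>x$1 - ctr$1\<bar> < 52 \<Longrightarrow> \<bar>x$2 - ctr$2\<bar> < 52 \<Longrightarrow>
        \<exists>i j. \<bar>i\<bar> \<le> 52 \<and> \<bar>j\<bar> \<le> 52 \<and> near x (ctr + lattice_pt i j)"
    and env: "\<And>c. \<bar>c$1 - ctr$1\<bar> \<le> L \<Longrightarrow> \<bar>c$2 - ctr$2\<bar> \<le> L \<Longrightarrow> \<exists>z\<in>S. dist c z < 10"
    and L: "d + 35 \<le> L"
  obtains s where "spot d S s" "near s ctr"
proof -
  obtain s where s: "s \<in> S" "near s (ctr + lattice_pt 0 0)" using pat1[of 0 0] by auto
  have l0: "ctr + lattice_pt 0 0 = ctr" by (simp add: lattice_pt_def vec2_eq_iff)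
  have s0: "near s ctr" using s l0 by simp
  have sc: "\<bar>s$1 - ctr$1\<bar> \<le> 1/1000" "\<bar>s$2 - ctr$2\<bar> \<le> 1/1000" using s0 by (auto simp: near_def)
  have cdist: "\<bar>z$1 - ctr$1\<bar> \<le> dist z s + 1/1000" "\<bar>z$2 - ctr$2\<bar> \<le> dist z s + 1/1000" for z
    using component_le_dist[of z 1 s] component_le_dist[of z 2 s] sc by linarith+
  have core: "dist x u < 174/100" if e: "delaunay_edge S x u" and x: "dist x s \<le> 45" for x u
  proof -
    have "dist x u < 2 * (87/100)"
    proof (rule edge_short[OF e])
      fix c assume "dist c x \<le> 87/100"
      then have "dist c s \<le> 46" using dist_triangle[of c s x] x by linarith
      then have "\<bar>c$1 - ctr$1\<bar> \<le> 51" "\<bar>c$2 - ctr$2\<bar> \<le> 51" using cdist[of c] by linarith+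
      then show "\<exists>z\<in>S. dist c z < 87 / 100" using lattice_hit pat1 by blast
    qed simp
    then show ?thesis by simp
  qed
  have idx: "\<exists>i j. \<bar>i\<bar> \<le> 52 \<and> \<bar>j\<bar> \<le> 52 \<and> near x (ctr + lattice_pt i j)" if "x \<in> S" "dist x s \<le> 45" for x
  proof (rule pat2[OF that(1)])
    show "\<bar>x$1 - ctr$1\<bar> < 52" "\<bar>x$2 - ctr$2\<bar> < 52" using cdist[of x] that(2) by linarith+
  qed
  \<comment> \<open>The integers differ by less than
    \<open>174/100 + 2 * 101/1000 < 2\<close>.\<close>
  have king: "\<bar>i - k\<bar> \<le> 1 \<and> \<bar>j - l\<bar> \<le> 1"
    if "near x (ctr + lattice_pt i j)" "near u (ctr + lattice_pt k l)" "dist x u < 174/100" for x u i j k l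
  proof -
    have "\<bar>x$1 - u$1\<bar> < 174/100" "\<bar>x$2 - u$2\<bar> < 174/100"
      using component_le_dist[of x 1 u] component_le_dist[of x 2 u] that by linarith+
    then have "\<bar>real_of_int i - real_of_int k\<bar> < 2" "\<bar>real_of_int j - real_of_int l\<bar> < 2"
      using near_lattice[OF that(1)] near_lattice[OF that(2)] by linarith+
    then show ?thesis by linarith
  qed
  have "\<not> many 6 (nbrs S s)"
  proof -
    have hit: "\<exists>z\<in>S. dist c z < 87/100" if "dist c s \<le> 87/100" for c
    proof -
      have "\<bar>c$1 - ctr$1\<bar> \<le> 51" "\<bar>c$2 - ctr$2\<bar> \<le> 51" using cdist[of c] that by linarith+
      then show "\<exists>z\<in>S. dist c z < 87 / 100" using lattice_hit pat1 by blast
    qed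
    define P where "P = (\<lambda>(i, j). SOME x. x \<in> S \<and> near x (ctr + lattice_pt i j))"
    have "nbrs S s \<subseteq> P ` {(1, 0), (-1, 0), (0, 1), (0, -1)}"
    proof
      fix q assume "q \<in> nbrs S s"
      then have e: "delaunay_edge S s q" and qS: "q \<in> S" "q \<noteq> s"
        by (auto simp: nbrs_def delaunay_edge_def)
      have dq: "dist s q < 174/100" using core[OF e] by simp
      obtain i j where ij: "\<bar>i\<bar> \<le> 52" "\<bar>j\<bar> \<le> 52" "near q (ctr + lattice_pt i j)"
        using idx[OF qS(1)] dq by (auto simp: dist_commute)
      have "\<bar>0 - i\<bar> \<le> 1 \<and> \<bar>0 - j\<bar> \<le> 1" using king[OF s(2) ij(3) dq] .
      moreover have "(i, j) \<noteq> (0, 0)" using uniq[of 0 0 q s] qS s ij by auto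
      moreover have False if "\<bar>i\<bar> = 1" "\<bar>j\<bar> = 1"
      proof -
        have sij: "\<bar>real_of_int i\<bar> = 1" "\<bar>real_of_int j\<bar> = 1" using that by linarith+
        obtain n1 where n1: "n1 \<in> S" "near n1 (ctr + lattice_pt i 0)" using pat1[of i 0] ij by auto
        obtain n2 where n2: "n2 \<in> S" "near n2 (ctr + lattice_pt 0 j)" using pat1[of 0 j] ij by auto
        have "lattice_pt i 0 = vector [of_int i * (9/10), 0]" "lattice_pt 0 j = vector [0, of_int j * (9/10)]"
          "lattice_pt i j = vector [of_int i, of_int j]"
          using that by (simp_all add: lattice_pt_def vec2_eq_iff)
        then have "\<not> delaunay_edge S s q"
          using not_adjacent_diagonal[OF s0 sij n1(1) _ n2(1) _ _ hit] n1 n2 ij by simp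
        then show False using e by blast
      qed
      ultimately have "(i, j) \<in> {(1, 0), (-1, 0), (0, 1), (0, -1)}"
        by (cases "\<bar>i\<bar> = 1"; cases "\<bar>j\<bar> = 1") (auto simp: abs_if split: if_splits)
      moreover have "P (i, j) = q"
        unfolding P_def case_prod_conv
        by (rule some_equality) (use qS ij uniq[OF ij(1,2)] in blast)+
      ultimately show "q \<in> P ` {(1, 0), (-1, 0), (0, 1), (0, -1)}" by (metis imageI)
    qed
    moreover have "card (P ` {(1, 0), (-1, 0), (0, 1), (0, -1)}) \<le> card {(1::int, 0::int), (-1, 0), (0, 1), (0, -1)}"
      by (rule card_image_le) simp
    ultimately have "\<not> 6 \<le> card (nbrs S s)" "finite (nbrs S s)"
      using card_mono[of "P ` {(1, 0), (-1, 0), (0, 1), (0, -1)}" "nbrs S s"] finite_subset by fastforce+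
    then show ?thesis using many_card by blast
  qed
  moreover have False if e: "delaunay_edge S y u" "delaunay_edge S u p" "delaunay_edge S p y"
    and len: "dist y u \<le> d" "dist y p \<le> d" and ns: "s \<notin> {y, u, p}"
    and cr: "0 < cross (u - y) (p - y)" "0 \<le> cross (u - y) (s - y)"
      "0 \<le> cross (p - u) (s - u)" "0 \<le> cross (y - p) (s - p)" for y u p
  proof -
    obtain l1 l2 l3 where l: "l1 \<ge> 0" "l2 \<ge> 0" "l3 \<ge> 0" "l1 + l2 + l3 = 1"
      "s = l1 *\<^sub>R y + l2 *\<^sub>R u + l3 *\<^sub>R p" using barycentric[OF cr] by blast
    have yS: "y \<in> S" "u \<in> S" "p \<in> S" using e by (auto simp: delaunay_edge_def)
    have yd: "dist y s \<le> d" using barycentric_dist[OF l len] .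
    have mid: "dist y v < 20" if "delaunay_edge S y v" for v
    proof -
      have "dist y v < 2 * 10"
      proof (rule edge_short[OF that])
        fix c assume "dist c y \<le> 10"
        then have "dist c s \<le> d + 10" using dist_triangle[of c s y] yd by linarith
        then have "\<bar>c$1 - ctr$1\<bar> \<le> L" "\<bar>c$2 - ctr$2\<bar> \<le> L" using cdist[of c] L by linarith+
        then show "\<exists>z\<in>S. dist c z < 10" using env by blast
      qed simp
      then show ?thesis by simp
    qed
    have m: "dist y u \<le> 20" "dist y p \<le> 20" using mid e(1) delaunay_edge_sym[OF e(3)] by fastforce+
    have y20: "dist y s \<le> 20" using barycentric_dist[OF l m] .
    have u40: "dist u s \<le> 40" "dist p s \<le> 40"
      using dist_triangle[of u s y] dist_triangle[of p s y] y20 m dist_commute[of u y] dist_commute[of p y]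
      by linarith+
    have c: "dist y u < 174/100" "dist u p < 174/100" "dist p y < 174/100"
      using core e y20 u40 by fastforce+
    obtain i1 j1 where 1: "\<bar>i1\<bar> \<le> 52" "\<bar>j1\<bar> \<le> 52" "near y (ctr + lattice_pt i1 j1)"
      using idx[OF yS(1)] y20 by auto
    obtain i2 j2 where 2: "\<bar>i2\<bar> \<le> 52" "\<bar>j2\<bar> \<le> 52" "near u (ctr + lattice_pt i2 j2)"
      using idx[OF yS(2)] u40 by auto
    obtain i3 j3 where 3: "\<bar>i3\<bar> \<le> 52" "\<bar>j3\<bar> \<le> 52" "near p (ctr + lattice_pt i3 j3)"
      using idx[OF yS(3)] u40 by auto
    have nz: "(i1, j1) \<noteq> (0, 0)" "(i2, j2) \<noteq> (0, 0)" "(i3, j3) \<noteq> (0, 0)"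
      using uniq[of 0 0 y s] uniq[of 0 0 u s] uniq[of 0 0 p s] yS s 1 2 3 ns by auto
    obtain a b where ab: "\<bar>a\<bar> \<le> 1" "\<bar>b\<bar> \<le> 1" "a * i1 + b * j1 \<ge> 1" "a * i2 + b * j2 \<ge> 1" "a * i3 + b * j3 \<ge> 1"
      using separating_direction[of i1 i2 i3 j1 j2 j3] king[OF 1(3) 2(3) c(1)] king[OF 2(3) 3(3) c(2)]
        king[OF 3(3) 1(3) c(3)] nz by metis
    \<comment> \<open>A function that is affine, at least 79/100 at the three corners and at most
      1/500 at \<open>s\<close>, although \<open>s\<close> is a convex combination of the
      corners.\<close>
    define h where "h z = of_int a * (z$1 - ctr$1) + of_int b * (z$2 - ctr$2)" for z :: pt
    have rab: "\<bar>real_of_int a\<bar> \<le> 1" "\<bar>real_of_int b\<bar> \<le> 1" using ab by linarith+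
    have hz: "h z \<ge> 79/100" if "near z (ctr + lattice_pt i j)" "a * i + b * j \<ge> 1" for z i j
    proof -
      have "\<bar>of_int a * (z$1 - ctr$1 - of_int i)\<bar> \<le> 1 * (101/1000)"
        "\<bar>of_int b * (z$2 - ctr$2 - of_int j)\<bar> \<le> 1 * (101/1000)"
        unfolding abs_mult using near_lattice[OF that(1)] rab by (intro mult_mono; simp)+
      moreover have "real_of_int (a * i + b * j) \<ge> 1" using that(2) by linarith
      ultimately show ?thesis
        unfolding h_def right_diff_distrib abs_le_iff of_int_add of_int_mult by linarith
    qed
    have hs: "h s \<le> 1/500"
    proof -
      have "\<bar>of_int a * (s$1 - ctr$1)\<bar> \<le> 1 * (1/1000)" "\<bar>of_int b * (s$2 - ctr$2)\<bar> \<le> 1 * (1/1000)"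
        unfolding abs_mult using sc rab by (intro mult_mono; simp)+
      then show ?thesis unfolding h_def by (simp add: abs_le_iff)
    qed
    have "h s = l1 * h y + l2 * h u + l3 * h p"
    proof -
      have "ctr = (l1 + l2 + l3) *\<^sub>R ctr" using l(4) by simp
      then have "ctr$1 = (l1 + l2 + l3) * ctr$1" "ctr$2 = (l1 + l2 + l3) * ctr$2" by (simp_all add: l(4))
      moreover have "s$1 = l1 * y$1 + l2 * u$1 + l3 * p$1" "s$2 = l1 * y$2 + l2 * u$2 + l3 * p$2"
        using l(5) by simp_all
      ultimately have "s$1 - ctr$1 = l1 * (y$1 - ctr$1) + l2 * (u$1 - ctr$1) + l3 * (p$1 - ctr$1)"
        "s$2 - ctr$2 = l1 * (y$2 - ctr$2) + l2 * (u$2 - ctr$2) + l3 * (p$2 - ctr$2)"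
        by (simp_all add: algebra_simps)
      then show ?thesis unfolding h_def by (simp only:) (simp add: algebra_simps)
    qed
    also have "\<dots> \<ge> l1 * (79/100) + l2 * (79/100) + l3 * (79/100)"
      using hz[OF 1(3) ab(3)] hz[OF 2(3) ab(4)] hz[OF 3(3) ab(5)] l
      by (intro add_mono mult_left_mono) auto
    finally show False using hs l(4) by (simp add: distrib_right[symmetric])
  qed
  ultimately have "spot d S s" unfolding spot_def using s(1) by blast
  then show thesis using that s0 by blast
qed

section \<open>Peeling and greedy colourings\<close>

text \<open>All removable vertices go at once, because an order among them could not be chosen
  equivariantly. \<open>R\<close> restricts which vertices may go, not which neighbours
  count.\<close>

fun peel :: "('a \<Rightarrow> 'a set) \<Rightarrow> 'a set \<Rightarrow> 'a set \<Rightarrow> nat \<Rightarrow> 'a set" where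
  "peel nb R V 0 = V"
| "peel nb R V (Suc n) = peel nb R V n - {x \<in> R. \<not> many 6 (nb x \<inter> peel nb R V n)}"

definition peel_core :: "('a \<Rightarrow> 'a set) \<Rightarrow> 'a set \<Rightarrow> 'a set \<Rightarrow> 'a set" where
  "peel_core nb R V = (\<Inter>n. peel nb R V n)"

definition lex_less :: "(nat \<Rightarrow> nat) \<Rightarrow> (nat \<Rightarrow> nat) \<Rightarrow> bool" where
  "lex_less f g \<longleftrightarrow> (\<exists>i. f i < g i \<and> (\<forall>j<i. f j = g j))"

definition removed_before :: "(nat \<Rightarrow> 'a set) \<Rightarrow> 'a \<Rightarrow> 'a \<Rightarrow> bool" where
  "removed_before P x y \<longleftrightarrow> (\<exists>n. x \<notin> P n \<and> y \<in> P n)"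

definition removed_together :: "(nat \<Rightarrow> 'a set) \<Rightarrow> 'a \<Rightarrow> 'a \<Rightarrow> bool" where
  "removed_together P x y \<longleftrightarrow> (\<forall>n. x \<in> P n \<longleftrightarrow> y \<in> P n)"

text \<open>Compares the stages of removal in the first round, then in the second, then the labels.
  Core vertices never leave in the first round, so they come after all others and are ordered by the
  second.\<close>

definition earlier :: "('a \<Rightarrow> 'a set) \<Rightarrow> 'a set \<Rightarrow> 'a set \<Rightarrow> ('a \<Rightarrow> nat \<Rightarrow> nat) \<Rightarrow> 'a \<Rightarrow> 'a \<Rightarrow> bool" where
  "earlier nb R V lab x y \<longleftrightarrow>
     removed_before (peel nb R V) x y \<or>
     (removed_together (peel nb R V) x y \<and>
       (removed_before (peel nb UNIV (peel_core nb R V)) x y \<or>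
         (removed_together (peel nb UNIV (peel_core nb R V)) x y \<and> lex_less (lab x) (lab y))))"

text \<open>\<open>A x y\<close> means that \<open>y\<close> chooses before \<open>x\<close>.
  Iteration instead of recursion along this order gives a total function without any
  well-foundedness; \<open>greedy_class\<close> keeps the values that become stable.\<close>

fun greedy :: "('a \<Rightarrow> 'a \<Rightarrow> bool) \<Rightarrow> nat \<Rightarrow> 'a \<Rightarrow> nat" where
  "greedy A 0 x = 0"
| "greedy A (Suc n) x = (LEAST i. \<forall>y. A x y \<longrightarrow> greedy A n y \<noteq> i)"

definition greedy_class :: "('a \<Rightarrow> 'a \<Rightarrow> bool) \<Rightarrow> 'a set \<Rightarrow> nat \<Rightarrow> 'a set" where
  "greedy_class A V i = {x \<in> V. \<exists>N. \<forall>n\<ge>N. greedy A n x = i}"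

lemma peel_antimono: "m \<le> n \<Longrightarrow> peel nb R V n \<subseteq> peel nb R V m"
  by (induction n rule: dec_induct) auto

lemma peel_subset: "peel nb R V n \<subseteq> V"
  using peel_antimono[of 0 n] by simp

lemma peel_outside: "x \<in> V \<Longrightarrow> x \<notin> R \<Longrightarrow> x \<in> peel nb R V n"
  by (induction n) auto

lemma peel_removed:
  assumes "x \<in> V" "x \<notin> peel_core nb R V"
  obtains n where "x \<in> peel nb R V n" "x \<notin> peel nb R V (Suc n)" "\<not> many 6 (nb x \<inter> peel nb R V n)"
proof -
  obtain m where "x \<notin> peel nb R V m" using assms by (auto simp: peel_core_def)
  then have ex: "\<exists>m. x \<notin> peel nb R V m" ..
  define m where "m = (LEAST m. x \<notin> peel nb R V m)"
  have m: "x \<notin> peel nb R V m" unfolding m_def by (rule LeastI_ex[OF ex])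
  then obtain n where n: "m = Suc n" using assms by (cases m) auto
  have "x \<in> peel nb R V n" using not_less_Least[of n "\<lambda>m. x \<notin> peel nb R V m"] n m_def by auto
  then show thesis using that m n by auto
qed

lemma decreasing_stabilizes:
  fixes P :: "nat \<Rightarrow> 'a set"
  assumes "finite F" and mono: "\<And>m n. m \<le> n \<Longrightarrow> P n \<subseteq> P m"
  obtains n where "F \<inter> P n \<subseteq> (\<Inter>n. P n)"
proof -
  define Q where "Q = (\<Inter>n. P n)"
  have "\<exists>n. \<forall>m\<ge>n. F \<inter> P m \<subseteq> Q"
    using assms(1)
  proof (induction F rule: finite_induct)
    case (insert a F)
    then obtain n where n: "\<forall>m\<ge>n. F \<inter> P m \<subseteq> Q" by blast
    show ?case
    proof (cases "a \<in> Q")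
      case True
      then show ?thesis using n by auto
    next
      case False
      then obtain k where k: "a \<notin> P k" by (auto simp: Q_def)
      have "insert a F \<inter> P m \<subseteq> Q" if m: "m \<ge> max n k" for m
      proof -
        have "a \<notin> P m" "F \<inter> P m \<subseteq> Q" using m n k mono[of k m] by auto
        then show ?thesis by blast
      qed
      then show ?thesis by blast
    qed
  qed simp
  then obtain n where "F \<inter> P n \<subseteq> Q" by blast
  then show thesis using that unfolding Q_def by blast
qed

text \<open>A finite neighbourhood meets the limit in the same points as some finite stage, so a
  surviving vertex still sees six surviving neighbours.\<close>

lemma peel_core_many:
  assumes "x \<in> peel_core nb R V" "x \<in> R" "finite (nb x)"
  shows "many 6 (nb x \<inter> peel_core nb R V)"
proof -
  obtain n where n: "nb x \<inter> peel nb R V n \<subseteq> peel_core nb R V"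
    unfolding peel_core_def
    by (rule decreasing_stabilizes[OF assms(3), where P = "peel nb R V"]) (rule peel_antimono)
  have "x \<in> peel nb R V (Suc n)" using assms by (auto simp: peel_core_def simp del: peel.simps)
  then have "many 6 (nb x \<inter> peel nb R V n)" using assms by auto
  moreover have "nb x \<inter> peel nb R V n \<subseteq> nb x \<inter> peel_core nb R V" using n by blast
  ultimately show ?thesis by (rule many_mono)
qed

section \<open>Orders by time of removal\<close>

lemma removed_before_trans:
  assumes "\<And>m n. m \<le> n \<Longrightarrow> P n \<subseteq> (P m :: 'a set)" "removed_before P x y" "removed_before P y z"
  shows "removed_before P x z"
  using assms unfolding removed_before_def by (metis le_cases subsetD)

lemma removed_before_irrefl: "\<not> removed_before P x x"
  by (simp add: removed_before_def)

lemma removed_trichotomy: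
  "removed_before P x y \<or> removed_together P x y \<or> removed_before P y x"
  unfolding removed_before_def removed_together_def by blast

lemma removed_before_together:
  "removed_before P x y \<Longrightarrow> removed_together P y z \<Longrightarrow> removed_before P x z"
  "removed_together P x y \<Longrightarrow> removed_before P y z \<Longrightarrow> removed_before P x z"
  "removed_together P x y \<Longrightarrow> removed_together P y z \<Longrightarrow> removed_together P x z"
  unfolding removed_before_def removed_together_def by blast+

lemma removed_together_sym: "removed_together P x y \<Longrightarrow> removed_together P y x"
  unfolding removed_together_def by blast

lemma lex_less_trans: "lex_less f g \<Longrightarrow> lex_less g h \<Longrightarrow> lex_less f h"
  unfolding lex_less_def
proof clarify
  fix i j assume i: "f i < g i" "\<forall>k<i. f k = g k" and j: "g j < h j" "\<forall>k<j. g k = h k"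
  then show "\<exists>i. f i < h i \<and> (\<forall>j<i. f j = h j)"
    by (intro exI[of _ "min i j"]) (cases i j rule: linorder_cases; auto)
qed

lemma lex_less_irrefl: "\<not> lex_less f f"
  by (simp add: lex_less_def)

lemma lex_less_linear:
  assumes "f \<noteq> g" shows "lex_less f g \<or> lex_less g f"
proof -
  have ex: "\<exists>i. f i \<noteq> g i" using assms by auto
  define i where "i = (LEAST i. f i \<noteq> g i)"
  have "f i \<noteq> g i" unfolding i_def by (rule LeastI_ex[OF ex])
  moreover have "\<forall>j<i. f j = g j" using not_less_Least i_def by blast
  ultimately show ?thesis unfolding lex_less_def by (metis nat_neq_iff)
qed

lemma lexicographic_trans:
  fixes L :: "'a \<Rightarrow> 'a \<Rightarrow> bool"
  assumes P: "\<And>m n. m \<le> n \<Longrightarrow> P n \<subseteq> (P m :: 'a set)"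
    and L: "L x y \<Longrightarrow> L y z \<Longrightarrow> L x z"
    and xy: "removed_before P x y \<or> (removed_together P x y \<and> L x y)"
    and yz: "removed_before P y z \<or> (removed_together P y z \<and> L y z)"
  shows "removed_before P x z \<or> (removed_together P x z \<and> L x z)"
  using xy yz removed_before_trans[where P = P and x = x and y = y and z = z] P
    removed_before_together[where P = P and x = x and y = y and z = z] L by blast

lemma earlier_trans:
  assumes "earlier nb R V lab x y" "earlier nb R V lab y z"
  shows "earlier nb R V lab x z"
proof -
  define Q where "Q = peel nb UNIV (peel_core nb R V)"
  define L where "L u v \<longleftrightarrow> removed_before Q u v \<or> (removed_together Q u v \<and> lex_less (lab u) (lab v))" for u v
  have Q: "m \<le> n \<Longrightarrow> Q n \<subseteq> Q m" for m n unfolding Q_def by (rule peel_antimono)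
  have "L x y \<Longrightarrow> L y z \<Longrightarrow> L x z"
    unfolding L_def
    by (rule lexicographic_trans[where P = Q and L = "\<lambda>u v. lex_less (lab u) (lab v)" and y = y])
       (use Q lex_less_trans in blast)+
  moreover have "m \<le> n \<Longrightarrow> peel nb R V n \<subseteq> peel nb R V m" for m n by (rule peel_antimono)
  ultimately show ?thesis
    using assms unfolding earlier_def Q_def[symmetric] L_def[symmetric]
    by (intro lexicographic_trans[where P = "peel nb R V" and L = L and y = y and x = x and z = z]) blast+
qed

lemma earlier_irrefl: "\<not> earlier nb R V lab x x"
  by (simp add: earlier_def removed_before_irrefl lex_less_irrefl)

lemma earlier_linear:
  "lab x \<noteq> lab y \<Longrightarrow> earlier nb R V lab x y \<or> earlier nb R V lab y x"
  unfolding earlier_def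
  using removed_trichotomy[of "peel nb R V" x y]
    removed_trichotomy[of "peel nb UNIV (peel_core nb R V)" x y]
    lex_less_linear[of "lab x" "lab y"] removed_together_sym[of _ x y]
  by blast

text \<open>A step either stays in \<open>C\<close>, where a strict order on a finite set is
  well-founded, or ends in an accessible point. The second case serves for steps from the region
  into the core of the first round.\<close>

lemma accp_of_finite:
  assumes C: "finite C" and step: "\<And>x y. x \<in> C \<Longrightarrow> A x y \<Longrightarrow> y \<in> C \<or> Wellfounded.accp (\<lambda>y x. A x y) y"
    and less: "\<And>x y. A x y \<Longrightarrow> L x y" and tr: "\<And>x y z. L x y \<Longrightarrow> L y z \<Longrightarrow> L x z" and irr: "\<And>x. \<not> L x x"
    and x: "x \<in> C"
  shows "Wellfounded.accp (\<lambda>y x. A x y) x"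
proof -
  define r where "r = {(y, x). x \<in> C \<and> y \<in> C \<and> L x y}"
  have "r \<subseteq> C \<times> C" by (auto simp: r_def)
  then have "finite r" using C finite_subset by blast
  moreover have "trans r" unfolding r_def trans_def using tr by blast
  then have "acyclic r" using irr by (auto simp: acyclic_irrefl irrefl_def r_def)
  ultimately have "wf r" by (rule finite_acyclic_wf)
  then show ?thesis using x
  proof (induction x rule: wf_induct_rule)
    case (less x)
    show ?case
    proof (rule accp.accI)
      fix y assume "A x y"
      then show "Wellfounded.accp (\<lambda>y x. A x y) y"
        using step[OF less.prems] less.IH[of y] assms(3)[of x y] less.prems by (auto simp: r_def)
    qed
  qed
qed

text \<open>At most five vertices choose before \<open>x\<close>, and their colours are final from
  some stage on; the next stage then fixes a colour below 6.\<close>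

lemma greedy_stable:
  assumes acc: "Wellfounded.accp (\<lambda>y x. A x y) x" and "x \<in> V"
    and out: "\<And>x. x \<in> V \<Longrightarrow> \<not> many 6 {y. A x y}" "\<And>x y. x \<in> V \<Longrightarrow> A x y \<Longrightarrow> y \<in> V"
  shows "\<exists>c<6. \<exists>N. \<forall>n\<ge>N. greedy A n x = c"
  using acc \<open>x \<in> V\<close>
proof (induction x rule: accp.induct)
  case (accI x)
  define Y where "Y = {y. A x y}"
  have Y: "\<not> many 6 Y" using out(1) accI.prems by (simp add: Y_def)
  have finY: "finite Y"
  proof (rule ccontr)
    assume "infinite Y"
    then obtain T where "T \<subseteq> Y" "finite T" "card T = 6" using infinite_arbitrarily_large by blast
    then show False using Y by (auto simp: many_def)
  qed
  have cardY: "card Y \<le> 5" using many_card[OF finY] Y by force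
  have "\<forall>y\<in>Y. \<exists>c N. \<forall>n\<ge>N. greedy A n y = c" using accI out(2) by (auto simp: Y_def) metis
  then obtain c N where cN: "\<And>y n. y \<in> Y \<Longrightarrow> n \<ge> N y \<Longrightarrow> greedy A n y = c y" by metis
  define M where "M = Max (insert 0 (N ` Y))"
  have M: "N y \<le> M" if "y \<in> Y" for y using that finY by (simp add: M_def)
  have stable: "greedy A (Suc n) x = (LEAST i. i \<notin> c ` Y)" if n: "n \<ge> M" for n
  proof -
    have "(\<forall>y. A x y \<longrightarrow> greedy A n y \<noteq> i) \<longleftrightarrow> i \<notin> c ` Y" for i
      using cN M n by (fastforce simp: Y_def)
    then show ?thesis by simp
  qed
  have "\<exists>i<6. i \<notin> c ` Y"
  proof (rule ccontr)
    assume "\<not> ?thesis"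
    then have "{..<6} \<subseteq> c ` Y" by auto
    then have "card {..<6::nat} \<le> card (c ` Y)" using finY by (intro card_mono) auto
    also have "\<dots> \<le> card Y" using finY by (rule card_image_le)
    finally show False using cardY by simp
  qed
  then obtain i where i: "i < 6" "i \<notin> c ` Y" by blast
  have "(LEAST i. i \<notin> c ` Y) < 6" using Least_le[of "\<lambda>i. i \<notin> c ` Y", OF i(2)] i(1) by linarith
  moreover have "\<forall>n\<ge>Suc M. greedy A n x = (LEAST i. i \<notin> c ` Y)"
    using stable by (metis Suc_le_D Suc_le_mono)
  ultimately show ?case by blast
qed

lemma greedy_proper:
  assumes "greedy A n y = c" "greedy A (Suc n) x = c" "A x y" "\<not> many 6 {y. A x y}"
  shows False
proof -
  have "finite {y. A x y}"
  proof (rule ccontr)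
    assume "infinite {y. A x y}"
    then show False using assms(4) infinite_arbitrarily_large unfolding many_def by metis
  qed
  then have "finite (greedy A n ` {y. A x y})" by simp
  then obtain i where "i \<notin> greedy A n ` {y. A x y}" using ex_new_if_finite infinite_UNIV_nat by blast
  then have "\<forall>y. A x y \<longrightarrow> greedy A n y \<noteq> i" by blast
  then have "\<forall>y. A x y \<longrightarrow> greedy A n y \<noteq> greedy A (Suc n) x"
    unfolding greedy.simps by (rule LeastI)
  then have "greedy A n y \<noteq> greedy A (Suc n) x" using assms(3) by blast
  then show False using assms(1,2) by simp
qed

lemma greedy_coloring:
  assumes acc: "\<And>x. x \<in> V \<Longrightarrow> Wellfounded.accp (\<lambda>y x. A x y) x"
    and out: "\<And>x. x \<in> V \<Longrightarrow> \<not> many 6 {y. A x y}" "\<And>x y. x \<in> V \<Longrightarrow> A x y \<Longrightarrow> y \<in> V"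
  shows "V = (\<Union>i<6. greedy_class A V i)"
    and "i \<noteq> j \<Longrightarrow> greedy_class A V i \<inter> greedy_class A V j = {}"
    and "x \<in> greedy_class A V i \<Longrightarrow> y \<in> greedy_class A V i \<Longrightarrow> \<not> A x y"
proof -
  show "V = (\<Union>i<6. greedy_class A V i)"
  proof
    show "V \<subseteq> (\<Union>i<6. greedy_class A V i)"
    proof
      fix x assume x: "x \<in> V"
      have "\<exists>c<6. \<exists>N. \<forall>n\<ge>N. greedy A n x = c"
        by (rule greedy_stable[OF acc[OF x] x]) (use out in blast)+
      then show "x \<in> (\<Union>i<6. greedy_class A V i)" using x by (auto simp: greedy_class_def)
    qed
  qed (auto simp: greedy_class_def)
  show "greedy_class A V i \<inter> greedy_class A V j = {}" if "i \<noteq> j"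
  proof -
    have False if i: "\<forall>n\<ge>N. greedy A n x = i" and j: "\<forall>n\<ge>M. greedy A n x = j" for x N M
      using i[rule_format, of "N + M"] j[rule_format, of "N + M"] \<open>i \<noteq> j\<close> by simp
    then show ?thesis unfolding greedy_class_def by blast
  qed
  show "\<not> A x y" if x: "x \<in> greedy_class A V i" and y: "y \<in> greedy_class A V i"
  proof
    assume "A x y"
    obtain N M where "\<forall>n\<ge>N. greedy A n x = i" "\<forall>n\<ge>M. greedy A n y = i"
      using x y by (auto simp: greedy_class_def)
    then have "greedy A (N + M) y = i" "greedy A (Suc (N + M)) x = i" by (simp_all del: greedy.simps)
    then show False using greedy_proper[of A "N + M" y i x] \<open>A x y\<close> out(1) x
      by (auto simp: greedy_class_def simp del: greedy.simps)
  qed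
qed

text \<open>Two rounds of peeling: first the vertices of the region \<open>R\<close>, whose components are finite, then
  what is left, whose components are finite as well. Colours are chosen in reverse order.\<close>

lemma peeling_coloring:
  fixes nb :: "'a \<Rightarrow> 'a set" and V R :: "'a set" and lab :: "'a \<Rightarrow> nat \<Rightarrow> nat"
  defines "K \<equiv> peel_core nb R V"
  defines "A \<equiv> \<lambda>x y. y \<in> nb x \<and> earlier nb R V lab x y"
  assumes nb: "\<And>x. nb x \<subseteq> V" "\<And>x y. y \<in> nb x \<Longrightarrow> x \<in> nb y"
    and fin: "\<And>x. x \<in> V \<Longrightarrow> finite (nb x)"
    and degen: "\<And>U. finite U \<Longrightarrow> U \<noteq> {} \<Longrightarrow> U \<subseteq> V \<Longrightarrow> \<exists>x\<in>U. \<not> many 6 (nb x \<inter> U)"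
    and finR: "\<And>x. x \<in> R \<inter> V \<Longrightarrow> finite {y. (x, y) \<in> {(x, y). y \<in> nb x \<and> x \<in> R \<and> y \<in> R}\<^sup>*}"
    and finK: "\<And>x. x \<in> K \<Longrightarrow> finite {y. (x, y) \<in> {(x, y). y \<in> nb x \<and> x \<in> K \<and> y \<in> K}\<^sup>*}"
    and lab: "\<And>x y. x \<in> V \<Longrightarrow> y \<in> V \<Longrightarrow> y \<in> nb x \<Longrightarrow> lab x \<noteq> lab y"
  shows "V = (\<Union>i<6. greedy_class A V i)"
    and "i \<noteq> j \<Longrightarrow> greedy_class A V i \<inter> greedy_class A V j = {}"
    and "x \<in> greedy_class A V i \<Longrightarrow> y \<in> greedy_class A V i \<Longrightarrow> y \<notin> nb x"
proof -
  define P where "P = peel nb R V"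
  define Q where "Q = peel nb UNIV K"
  have Pmono: "m \<le> n \<Longrightarrow> P n \<subseteq> P m" and Qmono: "m \<le> n \<Longrightarrow> Q n \<subseteq> Q m" for m n
    unfolding P_def Q_def by (rule peel_antimono, assumption)+
  have KP: "K = (\<Inter>n. P n)" by (simp add: K_def P_def peel_core_def)
  have KV: "K \<subseteq> V" using KP Pmono[of 0] by (auto simp: P_def)
  have VR: "x \<in> R" if "x \<in> V" "x \<notin> K" for x
    using that peel_outside[of x V R nb] by (auto simp: KP P_def)
  have A_less: "A x y \<Longrightarrow> earlier nb R V lab x y" and A_nb: "A x y \<Longrightarrow> y \<in> nb x" for x y
    by (simp_all add: A_def)
  have A_V: "A x y \<Longrightarrow> y \<in> V" for x y using A_nb nb by blast
  have A_K: "y \<in> K" if "x \<in> K" "A x y" for x y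
    using that by (auto simp: A_def earlier_def KP P_def removed_before_def removed_together_def)
  \<comment> \<open>A nonempty remainder would meet a finite component in a finite set all of whose
    vertices have six neighbours in it, contrary to \<open>degen\<close>.\<close>
  have Q_empty: "(\<Inter>n. Q n) = {}"
  proof (rule ccontr)
    assume "(\<Inter>n. Q n) \<noteq> {}"
    then obtain x where x: "x \<in> (\<Inter>n. Q n)" by blast
    have QK: "(\<Inter>n. Q n) \<subseteq> K" using peel_subset[of nb UNIV K] by (auto simp: Q_def)
    define E where "E = {(x, y). y \<in> nb x \<and> x \<in> K \<and> y \<in> K}"
    define U where "U = {y. (x, y) \<in> E\<^sup>*} \<inter> (\<Inter>n. Q n)"
    have "finite U" using finK[of x] x QK by (auto simp: U_def E_def)
    moreover have "U \<noteq> {}" using x by (auto simp: U_def)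
    moreover have "U \<subseteq> V" using QK KV by (auto simp: U_def)
    ultimately obtain z where z: "z \<in> U" "\<not> many 6 (nb z \<inter> U)" using degen by blast
    have "nb z \<inter> (\<Inter>n. Q n) \<subseteq> U"
    proof
      fix y assume y: "y \<in> nb z \<inter> (\<Inter>n. Q n)"
      then have "(z, y) \<in> E" using z QK by (auto simp: E_def U_def)
      then show "y \<in> U" using z y by (auto simp: U_def intro: rtrancl_into_rtrancl)
    qed
    moreover have "many 6 (nb z \<inter> (\<Inter>n. Q n))"
      using peel_core_many[of z nb UNIV K] fin[of z] z QK KV
      by (auto simp: U_def Q_def peel_core_def)
    ultimately show False using z many_mono by blast
  qed
  \<comment> \<open>All vertices choosing before \<open>x\<close> are still present at the stage
    that removes \<open>x\<close>, when it has fewer than six neighbours left.\<close>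
  have out: "\<not> many 6 {y. A x y}" if x: "x \<in> V" for x
  proof (cases "x \<in> K")
    case False
    then obtain n where n: "x \<in> P n" "x \<notin> P (Suc n)" "\<not> many 6 (nb x \<inter> P n)"
      using peel_removed[of x V nb R] x unfolding K_def P_def by blast
    have "y \<in> P n" if "A x y" for y
    proof -
      from A_less[OF that] consider m where "x \<notin> P m" "y \<in> P m" | "\<forall>m. x \<in> P m \<longleftrightarrow> y \<in> P m"
        unfolding earlier_def P_def removed_before_def removed_together_def by blast
      then show ?thesis
      proof cases
        case 1
        then have "n \<le> m" using n Pmono[of m n] by (meson linorder_le_cases subsetD)
        then show ?thesis using 1 Pmono[of n m] by blast
      qed (use n in blast)
    qed
    then have "{y. A x y} \<subseteq> nb x \<inter> P n" using A_nb by blast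
    then show ?thesis using n many_mono by blast
  next
    case True
    then obtain n where n: "x \<in> Q n" "x \<notin> Q (Suc n)" "\<not> many 6 (nb x \<inter> Q n)"
      using peel_removed[of x K nb UNIV] Q_empty unfolding Q_def peel_core_def by blast
    have "y \<in> Q n" if "A x y" for y
    proof -
      have "\<not> removed_before P x y" using True by (auto simp: removed_before_def KP)
      with A_less[OF that] consider m where "x \<notin> Q m" "y \<in> Q m" | "\<forall>m. x \<in> Q m \<longleftrightarrow> y \<in> Q m"
        unfolding earlier_def P_def Q_def K_def removed_before_def removed_together_def by blast
      then show ?thesis
      proof cases
        case 1
        then have "n \<le> m" using n Qmono[of m n] by (meson linorder_le_cases subsetD)
        then show ?thesis using 1 Qmono[of n m] by blast
      qed (use n in blast)
    qed
    then have "{y. A x y} \<subseteq> nb x \<inter> Q n" using A_nb by blast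
    then show ?thesis using n many_mono by blast
  qed
  have accK: "Wellfounded.accp (\<lambda>y x. A x y) x" if x: "x \<in> K" for x
  proof -
    define E where "E = {(x, y). y \<in> nb x \<and> x \<in> K \<and> y \<in> K}"
    show ?thesis
    proof (rule accp_of_finite[where C = "{y. (x, y) \<in> E\<^sup>*}" and L = "earlier nb R V lab"])
      show "finite {y. (x, y) \<in> E\<^sup>*}" using finK[OF x] by (simp add: E_def)
      fix u v assume u: "u \<in> {y. (x, y) \<in> E\<^sup>*}" and uv: "A u v"
      then have "(x, u) \<in> E\<^sup>*" by simp
      then have "u \<in> K" by (cases rule: rtranclE) (use x in \<open>auto simp: E_def\<close>)
      then have "(u, v) \<in> E" using A_K[OF _ uv] A_nb[OF uv] by (simp add: E_def)
      with \<open>(x, u) \<in> E\<^sup>*\<close> have "(x, v) \<in> E\<^sup>*" by (rule rtrancl_into_rtrancl)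
      then show "v \<in> {y. (x, y) \<in> E\<^sup>*} \<or> Wellfounded.accp (\<lambda>y x. A x y) v" by simp
    next
      fix u v w assume "earlier nb R V lab u v" "earlier nb R V lab v w"
      then show "earlier nb R V lab u w" by (rule earlier_trans)
    qed (use A_less in \<open>simp_all add: earlier_irrefl\<close>)
  qed
  \<comment> \<open>From a vertex of the region a step of \<open>A\<close> stays in its finite
    component or enters the core, which \<open>accK\<close> settles.\<close>
  have acc: "Wellfounded.accp (\<lambda>y x. A x y) x" if x: "x \<in> V" for x
  proof (cases "x \<in> K")
    case False
    have xR: "x \<in> R \<inter> V" using VR x False by blast
    define E where "E = {(x, y). y \<in> nb x \<and> x \<in> R \<and> y \<in> R}"
    show ?thesis
    proof (rule accp_of_finite[where C = "{y. (x, y) \<in> E\<^sup>*}" and L = "earlier nb R V lab"])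
      show "finite {y. (x, y) \<in> E\<^sup>*}" using finR[OF xR] by (simp add: E_def)
      fix u v assume u: "u \<in> {y. (x, y) \<in> E\<^sup>*}" and uv: "A u v"
      then have xu: "(x, u) \<in> E\<^sup>*" by simp
      show "v \<in> {y. (x, y) \<in> E\<^sup>*} \<or> Wellfounded.accp (\<lambda>y x. A x y) v"
      proof (cases "v \<in> K")
        case False
        have "u \<in> R" using xu by (cases rule: rtranclE) (use xR in \<open>auto simp: E_def\<close>)
        moreover have "v \<in> R" using VR[OF A_V[OF uv] False] .
        ultimately have "(u, v) \<in> E" using A_nb[OF uv] by (simp add: E_def)
        with xu have "(x, v) \<in> E\<^sup>*" by (rule rtrancl_into_rtrancl)
        then show ?thesis by simp
      next
        case True
        then show ?thesis using accK by blast
      qed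
    next
      fix u v w assume "earlier nb R V lab u v" "earlier nb R V lab v w"
      then show "earlier nb R V lab u w" by (rule earlier_trans)
    qed (use A_less in \<open>simp_all add: earlier_irrefl\<close>)
  qed (use accK in blast)
  have A_V': "A x y \<Longrightarrow> x \<in> V \<Longrightarrow> y \<in> V" for x y using A_V by blast
  show "V = (\<Union>i<6. greedy_class A V i)"
    by (rule greedy_coloring(1)) (use acc out A_V' in blast)+
  show "i \<noteq> j \<Longrightarrow> greedy_class A V i \<inter> greedy_class A V j = {}"
    by (rule greedy_coloring(2)) (use acc out A_V' in blast)+
  have indep: "\<not> A u v" if "u \<in> greedy_class A V i" "v \<in> greedy_class A V i" for u v
    by (rule greedy_coloring(3)[of V A u i v]) (use acc out A_V' that in blast)+
  show "y \<notin> nb x" if x: "x \<in> greedy_class A V i" and y: "y \<in> greedy_class A V i"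
  proof
    assume e: "y \<in> nb x"
    have V: "x \<in> V" "y \<in> V" using x y by (auto simp: greedy_class_def)
    have "A x y \<or> A y x"
      unfolding A_def using earlier_linear[OF lab[OF V e]] e nb(2) by blast
    then show False
      using indep x y by blast
  qed
qed

section \<open>Measurable quantification over points\<close>

text \<open>Half-open, so that the boxes of a grid partition the plane.\<close>

definition grid_box :: "pt \<Rightarrow> real \<Rightarrow> int \<Rightarrow> int \<Rightarrow> pt set" where
  "grid_box c e i j = {z. c$1 + e * of_int i \<le> z$1 \<and> z$1 < c$1 + e * (of_int i + 1) \<and>
                          c$2 + e * of_int j \<le> z$2 \<and> z$2 < c$2 + e * (of_int j + 1)}"

lemma measurable_vec_nth [measurable (raw)]:
  fixes f :: "'a \<Rightarrow> pt"
  shows "f \<in> borel_measurable M \<Longrightarrow> (\<lambda>x. f x $ i) \<in> borel_measurable M"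
  by (rule measurable_compose[of f M borel])
     (auto intro!: borel_measurable_continuous_onI continuous_intros)

lemma grid_box_borel [measurable]: "grid_box c e i j \<in> sets borel"
proof -
  have "{z \<in> space borel. c$1 + e * of_int i \<le> z$1 \<and> z$1 < c$1 + e * (of_int i + 1) \<and>
                          c$2 + e * of_int j \<le> z$2 \<and> z$2 < c$2 + e * (of_int j + 1)} \<in> sets (borel :: pt measure)"
    by measurable
  then show ?thesis by (simp add: grid_box_def)
qed

lemma grid_box_dist: "x \<in> grid_box c e i j \<Longrightarrow> y \<in> grid_box c e i j \<Longrightarrow> dist x y < 2 * e"
proof -
  assume "x \<in> grid_box c e i j" "y \<in> grid_box c e i j"
  then have "\<bar>x$1 - y$1\<bar> < e" "\<bar>x$2 - y$2\<bar> < e"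
    unfolding grid_box_def mem_Collect_eq distrib_left mult_1_right by linarith+
  then show "dist x y < 2 * e" using dist_le_components[of x y] by linarith
qed

lemma grid_box_bounded: "bounded (grid_box c e i j)"
proof (cases "grid_box c e i j = {}")
  case False
  then obtain x where x: "x \<in> grid_box c e i j" by blast
  then have "grid_box c e i j \<subseteq> cball x (2 * e)" using grid_box_dist by fastforce
  then show ?thesis using bounded_cball bounded_subset by blast
qed simp

lemma grid_box_mem_iff:
  assumes "e > 0"
  shows "z \<in> grid_box c e i j \<longleftrightarrow> i = \<lfloor>(z$1 - c$1) / e\<rfloor> \<and> j = \<lfloor>(z$2 - c$2) / e\<rfloor>"
proof -
  have "a + e * of_int k \<le> t \<and> t < a + e * (of_int k + 1) \<longleftrightarrow> k = \<lfloor>(t - a) / e\<rfloor>" for a t :: real and k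
  proof -
    have "a + e * of_int k \<le> t \<longleftrightarrow> of_int k \<le> (t - a) / e"
      "t < a + e * (of_int k + 1) \<longleftrightarrow> (t - a) / e < of_int k + 1"
      using assms by (auto simp: field_simps)
    then show ?thesis by (auto simp: floor_eq_iff eq_commute[of k])
  qed
  from this[of "c$1" i "z$1"] this[of "c$2" j "z$2"] show ?thesis
    unfolding grid_box_def mem_Collect_eq by blast
qed

lemma grid_box_ex: "e > 0 \<Longrightarrow> \<exists>i j. z \<in> grid_box c e i j"
  by (simp add: grid_box_mem_iff)

lemma grid_box_disjoint:
  "e > 0 \<Longrightarrow> (i, j) \<noteq> (k, l) \<Longrightarrow> grid_box c e i j \<inter> grid_box c e k l = {}"
  by (auto simp: grid_box_mem_iff)

lemma count_measurable:
  assumes "B \<in> sets borel" "bounded B"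
  shows "(\<lambda>S. card (S \<inter> B)) \<in> measurable Msp (count_space UNIV)"
proof -
  define G where "G = {{S \<in> Mspace. card (S \<inter> B) = n} | B n. B \<in> sets borel \<and> bounded B}"
  have G: "G \<subseteq> Pow Mspace" by (auto simp: G_def)
  have sp: "space Msp = Mspace" and st: "sets Msp = sigma_sets Mspace G"
    unfolding Msp_def G_def[symmetric] using G by (simp_all add: space_measure_of sets_measure_of)
  show ?thesis
  proof (rule measurable_count_space_eq2_countable[THEN iffD2], intro conjI ballI)
    fix n :: nat
    have "(\<lambda>S. card (S \<inter> B)) -` {n} \<inter> space Msp = {S \<in> Mspace. card (S \<inter> B) = n}"
      by (auto simp: sp)
    also have "\<dots> \<in> sets Msp" unfolding st using assms by (intro sigma_sets.Basic) (auto simp: G_def)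
    finally show "(\<lambda>S. card (S \<inter> B)) -` {n} \<inter> space Msp \<in> sets Msp" .
  qed auto
qed

lemma space_Msp: "space Msp = Mspace"
  unfolding Msp_def by (rule space_measure_of) auto

lemma measurable_MspI:
  assumes "\<And>w. w \<in> space M \<Longrightarrow> f w \<in> Mspace"
    and "\<And>B n. B \<in> sets borel \<Longrightarrow> bounded B \<Longrightarrow> Measurable.pred M (\<lambda>w. card (f w \<inter> B) = n)"
  shows "f \<in> measurable M Msp"
  unfolding Msp_def
proof (rule measurable_measure_of)
  show "f \<in> space M \<rightarrow> Mspace" using assms(1) by auto
  fix A assume "A \<in> {{S \<in> Mspace. card (S \<inter> B) = n} | B n. B \<in> sets borel \<and> bounded B}"
  then obtain B n where A: "A = {S \<in> Mspace. card (S \<inter> B) = n}" "B \<in> sets borel" "bounded B" by blast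
  have "f -` A \<inter> space M = {w \<in> space M. card (f w \<inter> B) = n}" using assms(1) A by auto
  then show "f -` A \<inter> space M \<in> sets M" using assms(2)[OF A(2,3), of n] by (simp add: pred_def)
qed auto

text \<open>Every point of a locally finite set is the only one in some dyadic box; picking these points
  turns a quantifier over the set into a countable one.\<close>

definition dyadic :: "nat \<Rightarrow> pt set" where
  "dyadic c = (case from_nat c of (m :: nat, i, j) \<Rightarrow> grid_box 0 (1 / 2 ^ m) i j)"

text \<open>The default 0 never counts as a point: statements about points use \<open>pick c\<close>
  together with the test that the box holds exactly one.\<close>

definition pick :: "nat \<Rightarrow> pt set \<Rightarrow> pt" where
  "pick c S = (if card (S \<inter> dyadic c) = 1 then the_elem (S \<inter> dyadic c) else 0)"

lemma dyadic_borel: "dyadic c \<in> sets borel" and dyadic_bounded: "bounded (dyadic c)"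
  by (auto simp: dyadic_def grid_box_bounded split: prod.split)

lemma pick_eq: "S \<inter> dyadic c = {x} \<Longrightarrow> pick c S = x"
  by (simp add: pick_def)

lemma pick_mem: "card (S \<inter> dyadic c) = 1 \<Longrightarrow> pick c S \<in> S \<and> S \<inter> dyadic c = {pick c S}"
  by (metis Int_iff card_1_singletonE insertI1 pick_eq)

lemma dyadic_isolates:
  assumes "locfin S" "x \<in> S"
  obtains c where "S \<inter> dyadic c = {x}"
proof -
  have fin: "finite (S \<inter> ball x 1)" using assms by (simp add: locfin_def)
  obtain d where d: "d > 0" "\<forall>y\<in>S \<inter> ball x 1. y \<noteq> x \<longrightarrow> d \<le> dist x y"
    using finite_set_avoid[OF fin, of x] by blast
  obtain m where m: "(1/2) ^ m < min d 1 / (2::real)"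
    using real_arch_pow_inv[of "min d 1 / 2" "1/2"] d by auto
  have e: "(1::real) / 2 ^ m > 0" by simp
  obtain i j where ij: "x \<in> grid_box 0 (1 / 2 ^ m) i j" using grid_box_ex[OF e] by blast
  define c where "c = to_nat (m, i, j)"
  have c: "dyadic c = grid_box 0 (1 / 2 ^ m) i j" by (simp add: dyadic_def c_def)
  have "S \<inter> dyadic c = {x}"
  proof
    show "{x} \<subseteq> S \<inter> dyadic c" using assms ij c by simp
    show "S \<inter> dyadic c \<subseteq> {x}"
    proof
      fix y assume y: "y \<in> S \<inter> dyadic c"
      then have "dist x y < 2 * (1 / 2 ^ m)" using grid_box_dist[OF ij] c by simp
      then have "dist x y < min d 1" using m unfolding power_one_over[symmetric] by linarith
      then show "y \<in> {x}" using d y by force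
    qed
  qed
  then show thesis by (rule that)
qed

lemma pick_measurable [measurable]: "pick c \<in> borel_measurable Msp"
proof (rule measurableI)
  fix A :: "pt set" assume A: "A \<in> sets borel"
  have 1: "(\<lambda>S. card (S \<inter> dyadic c)) \<in> measurable Msp (count_space UNIV)"
    by (rule count_measurable[OF dyadic_borel dyadic_bounded])
  have 2: "(\<lambda>S. card (S \<inter> (dyadic c \<inter> A))) \<in> measurable Msp (count_space UNIV)"
    using A dyadic_borel dyadic_bounded bounded_Int by (intro count_measurable) auto
  have "pick c -` A \<inter> space Msp = {S \<in> space Msp. (card (S \<inter> dyadic c) = 1 \<and> card (S \<inter> (dyadic c \<inter> A)) = 1)
      \<or> (card (S \<inter> dyadic c) \<noteq> 1 \<and> 0 \<in> A)}"
  proof -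
    have "pick c S \<in> A \<longleftrightarrow> card (S \<inter> (dyadic c \<inter> A)) = 1" if "card (S \<inter> dyadic c) = 1" for S
    proof -
      have *: "S \<inter> dyadic c = {pick c S}" using pick_mem[OF that] by blast
      then have "S \<inter> (dyadic c \<inter> A) = {pick c S} \<inter> A" by blast
      then show ?thesis by (cases "pick c S \<in> A") auto
    qed
    moreover have "pick c S = 0" if "card (S \<inter> dyadic c) \<noteq> 1" for S using that by (simp add: pick_def)
    ultimately show ?thesis by (auto; metis One_nat_def)
  qed
  also have "\<dots> \<in> sets Msp" using 1 2 by measurable
  finally show "pick c -` A \<inter> space Msp \<in> sets Msp" .
qed auto

lemma ex_pick:
  assumes "locfin S"
  shows "(\<exists>x\<in>S. P x) \<longleftrightarrow> (\<exists>c. card (S \<inter> dyadic c) = 1 \<and> P (pick c S))"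
proof
  assume "\<exists>x\<in>S. P x"
  then obtain x where x: "x \<in> S" "P x" by blast
  obtain c where c: "S \<inter> dyadic c = {x}" using dyadic_isolates[OF assms x(1)] by blast
  then show "\<exists>c. card (S \<inter> dyadic c) = 1 \<and> P (pick c S)" using x pick_eq[OF c] by (intro exI[of _ c]) simp
next
  assume "\<exists>c. card (S \<inter> dyadic c) = 1 \<and> P (pick c S)"
  then show "\<exists>x\<in>S. P x" using pick_mem by blast
qed

lemma measurable_isolated [measurable (raw)]:
  assumes "S \<in> measurable M Msp"
  shows "Measurable.pred M (\<lambda>w. card (S w \<inter> dyadic c) = Suc 0)"
  using measurable_compose[OF assms count_measurable[OF dyadic_borel dyadic_bounded, of c]]
  by measurable

lemma measurable_Bex [measurable (raw)]:
  assumes S: "S \<in> measurable M Msp"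
    and P: "Measurable.pred (M \<Otimes>\<^sub>M borel) (\<lambda>z. P (fst z) (snd z))"
  shows "Measurable.pred M (\<lambda>w. \<exists>x\<in>S w. P w x)"
proof -
  have "Measurable.pred M (\<lambda>w. \<exists>c. card (S w \<inter> dyadic c) = 1 \<and> P w (pick c (S w)))"
  proof -
    have "Measurable.pred M (\<lambda>w. P w (pick c (S w)))" for c
    proof -
      have "(\<lambda>w. (w, pick c (S w))) \<in> measurable M (M \<Otimes>\<^sub>M borel)"
        using S by measurable
      from measurable_compose[OF this P] show ?thesis by simp
    qed
    then show ?thesis using S by simp
  qed
  moreover have "w \<in> space M \<Longrightarrow> (\<exists>x\<in>S w. P w x) \<longleftrightarrow> (\<exists>c. card (S w \<inter> dyadic c) = 1 \<and> P w (pick c (S w)))" for w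
    using ex_pick[of "S w" "P w"] measurable_space[OF S] by (auto simp: space_Msp Mspace_def)
  ultimately show ?thesis by (simp cong: measurable_cong)
qed

lemma measurable_Ball [measurable (raw)]:
  assumes S: "S \<in> measurable M Msp"
    and P: "Measurable.pred (M \<Otimes>\<^sub>M borel) (\<lambda>z. P (fst z) (snd z))"
  shows "Measurable.pred M (\<lambda>w. \<forall>x\<in>S w. P w x)"
proof -
  have "Measurable.pred M (\<lambda>w. \<not> (\<exists>x\<in>S w. \<not> P w x))"
    using measurable_Bex[OF S, of "\<lambda>w x. \<not> P w x"] P by measurable
  then show ?thesis by simp
qed

text \<open>A finite subset is coded by a list of box codes, and there are only countably many
  lists.\<close>

lemma many_pick:
  assumes "locfin S"
  shows "many n {x\<in>S. P x} \<longleftrightarrow> (\<exists>cs. length cs = n \<and>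
     (\<forall>i<n. card (S \<inter> dyadic (cs ! i)) = 1 \<and> P (pick (cs ! i) S) \<and>
       (\<forall>j<n. i \<noteq> j \<longrightarrow> pick (cs ! i) S \<noteq> pick (cs ! j) S)))"
proof
  assume "many n {x\<in>S. P x}"
  then obtain T where T: "T \<subseteq> {x\<in>S. P x}" "finite T" "card T = n" by (auto simp: many_def)
  then obtain xs where xs: "set xs = T" "distinct xs" "length xs = n"
    using finite_distinct_list distinct_card by metis
  have "\<forall>x\<in>S. \<exists>c. S \<inter> dyadic c = {x}" using dyadic_isolates[OF assms] by blast
  then obtain h where h: "\<And>x. x \<in> S \<Longrightarrow> S \<inter> dyadic (h x) = {x}" by metis
  have hp: "pick (h x) S = x" if "x \<in> S" for x using h[OF that] by (rule pick_eq)
  have xS: "xs ! i \<in> S \<and> P (xs ! i)" if "i < n" for i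
  proof -
    have "xs ! i \<in> T" using nth_mem[of i xs] that xs(1,3) by simp
    then show ?thesis using T(1) by blast
  qed
  show "\<exists>cs. length cs = n \<and>
     (\<forall>i<n. card (S \<inter> dyadic (cs ! i)) = 1 \<and> P (pick (cs ! i) S) \<and>
       (\<forall>j<n. i \<noteq> j \<longrightarrow> pick (cs ! i) S \<noteq> pick (cs ! j) S))"
  proof (rule exI[of _ "map h xs"], intro conjI allI impI)
    fix i j assume ij: "i < n" "j < n" "i \<noteq> j"
    then have "xs ! i \<noteq> xs ! j" using xs(2,3) by (simp add: nth_eq_iff_index_eq)
    then show "pick (map h xs ! i) S \<noteq> pick (map h xs ! j) S" using xS ij xs(3) hp by simp
  qed (use xs(3) xS h hp in simp_all)
next
  assume "\<exists>cs. length cs = n \<and>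
     (\<forall>i<n. card (S \<inter> dyadic (cs ! i)) = 1 \<and> P (pick (cs ! i) S) \<and>
       (\<forall>j<n. i \<noteq> j \<longrightarrow> pick (cs ! i) S \<noteq> pick (cs ! j) S))"
  then obtain cs where cs: "length cs = n" "\<And>i. i < n \<Longrightarrow> card (S \<inter> dyadic (cs ! i)) = 1"
    "\<And>i. i < n \<Longrightarrow> P (pick (cs ! i) S)"
    "\<And>i j. i < n \<Longrightarrow> j < n \<Longrightarrow> i \<noteq> j \<Longrightarrow> pick (cs ! i) S \<noteq> pick (cs ! j) S" by blast
  define T where "T = (\<lambda>i. pick (cs ! i) S) ` {..<n}"
  have "card T = n" unfolding T_def using cs(4) by (subst card_image) (auto simp: inj_on_def)
  moreover have "T \<subseteq> {x\<in>S. P x}" using cs(2,3) pick_mem by (force simp: T_def)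
  ultimately show "many n {x\<in>S. P x}" unfolding many_def T_def by blast
qed

lemma measurable_many [measurable (raw)]:
  assumes S: "S \<in> measurable M Msp"
    and P: "Measurable.pred (M \<Otimes>\<^sub>M borel) (\<lambda>z. P (fst z) (snd z))"
  shows "Measurable.pred M (\<lambda>w. many n {x\<in>S w. P w x})"
proof -
  have p: "(\<lambda>w. pick c (S w)) \<in> borel_measurable M" for c using S by measurable
  have Pp: "Measurable.pred M (\<lambda>w. P w (pick c (S w)))" for c
  proof -
    have "(\<lambda>w. (w, pick c (S w))) \<in> measurable M (M \<Otimes>\<^sub>M borel)" using p by measurable
    from measurable_compose[OF this P] show ?thesis by simp
  qed
  have pred: "Measurable.pred M (\<lambda>w. \<exists>cs. length cs = n \<and>
     (\<forall>i<n. card (S w \<inter> dyadic (cs ! i)) = Suc 0 \<and> P w (pick (cs ! i) (S w)) \<and>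
       (\<forall>j<n. i \<noteq> j \<longrightarrow> pick (cs ! i) (S w) \<noteq> pick (cs ! j) (S w))))"
  proof -
    have e: "Measurable.pred M (\<lambda>w. pick a (S w) \<noteq> pick b (S w))" for a b
      using p[of a] p[of b] by measurable
    have 1: "Measurable.pred M (\<lambda>w. \<forall>j<n. i \<noteq> j \<longrightarrow> pick (cs ! i) (S w) \<noteq> pick (cs ! j) (S w))" for cs i
      by (intro pred_intros_countable pred_intros_imp' e)
    show ?thesis
      by (intro pred_intros_countable pred_intros_imp' pred_intros_conj1' pred_intros_logic 1 Pp
          measurable_isolated S)
  qed
  have eq: "many n {x\<in>S w. P w x} \<longleftrightarrow> (\<exists>cs. length cs = n \<and>
     (\<forall>i<n. card (S w \<inter> dyadic (cs ! i)) = Suc 0 \<and> P w (pick (cs ! i) (S w)) \<and>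
       (\<forall>j<n. i \<noteq> j \<longrightarrow> pick (cs ! i) (S w) \<noteq> pick (cs ! j) (S w))))" if w: "w \<in> space M" for w
  proof (rule many_pick[unfolded One_nat_def])
    show "locfin (S w)" using measurable_space[OF S w] unfolding space_Msp Mspace_def by blast
  qed
  show ?thesis by (rule measurable_cong[OF eq, THEN iffD2, OF _ pred])
qed

lemma card_eq_many: "finite A \<Longrightarrow> card A = n \<longleftrightarrow> many n A \<and> \<not> many (Suc n) A"
  by (auto simp: many_card)

lemma measurable_thinning:
  assumes S: "S \<in> measurable M Msp"
    and P: "Measurable.pred (M \<Otimes>\<^sub>M borel) (\<lambda>z. P (fst z) (snd z))"
  shows "(\<lambda>w. {x\<in>S w. P w x}) \<in> measurable M Msp"
proof (rule measurable_MspI)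
  have lf: "locfin (S w)" if "w \<in> space M" for w
    using measurable_space[OF S that] by (simp add: space_Msp Mspace_def)
  show "{x\<in>S w. P w x} \<in> Mspace" if "w \<in> space M" for w
    using lf[OF that] unfolding Mspace_def locfin_def
    by (auto intro: finite_subset[of "{x\<in>S w. P w x} \<inter> _" "S w \<inter> _"])
  fix B :: "pt set" and n assume B: "B \<in> sets borel" "bounded B"
  have 1: "Measurable.pred (M \<Otimes>\<^sub>M borel) (\<lambda>z. P (fst z) (snd z) \<and> snd z \<in> B)"
    using P B by measurable
  have "Measurable.pred M (\<lambda>w. many n {x\<in>S w. P w x \<and> x \<in> B} \<and> \<not> many (Suc n) {x\<in>S w. P w x \<and> x \<in> B})"
    using measurable_many[OF S, of "\<lambda>w x. P w x \<and> x \<in> B"] 1 by measurable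
  moreover have "card ({x\<in>S w. P w x} \<inter> B) = n \<longleftrightarrow>
      many n {x\<in>S w. P w x \<and> x \<in> B} \<and> \<not> many (Suc n) {x\<in>S w. P w x \<and> x \<in> B}"
    if "w \<in> space M" for w
  proof -
    have eq: "{x\<in>S w. P w x} \<inter> B = {x\<in>S w. P w x \<and> x \<in> B}" by blast
    have "finite {x\<in>S w. P w x \<and> x \<in> B}"
      by (rule finite_subset[of _ "S w \<inter> B"]) (use lf[OF that] B in \<open>auto simp: locfin_def\<close>)
    then show ?thesis unfolding eq by (rule card_eq_many)
  qed
  ultimately show "Measurable.pred M (\<lambda>w. card ({x\<in>S w. P w x} \<inter> B) = n)"
    by (simp cong: measurable_cong)
qed

section \<open>The colouring scheme\<close>

definition sites :: "real \<Rightarrow> pt set \<Rightarrow> pt set" where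
  "sites h S = {x \<in> S. \<exists>y\<in>S. y \<noteq> x \<and> dist x y \<le> h}"

text \<open>Depth \<open>t\<close> inside the Voronoi cell of \<open>p\<close>. Since both partners of a close pair are sites, the
  cells are those of clusters of sites, and the sites within distance 1 of \<open>p\<close> do not compete.\<close>

definition deep_at :: "real \<Rightarrow> real \<Rightarrow> real \<Rightarrow> pt set \<Rightarrow> pt \<Rightarrow> pt \<Rightarrow> bool" where
  "deep_at D h t S z p \<longleftrightarrow> p \<in> sites h S \<and> dist z p \<le> D - t \<and>
     (\<forall>q\<in>sites h S. dist q p \<le> 1 \<or> dist z p + t \<le> dist z q)"

definition deep :: "real \<Rightarrow> real \<Rightarrow> real \<Rightarrow> pt set \<Rightarrow> pt \<Rightarrow> bool" where
  "deep D h t S z \<longleftrightarrow> (\<exists>p\<in>S. deep_at D h t S z p)"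

text \<open>Depths from \<open>2 * w\<close> to \<open>10 * w\<close> leave room for a disc of
  radius \<open>w\<close> around a vertex whose depth has just fallen below \<open>8 * w\<close>;
  this is where the core argument runs. Admitting only vertices with short edges prevents a path in
  the zone from jumping to another cell.\<close>

definition zone :: "real \<Rightarrow> real \<Rightarrow> real \<Rightarrow> pt set \<Rightarrow> pt set" where
  "zone w D h S = {x \<in> S. deep D h (2 * w) S x \<and> \<not> deep D h (10 * w) S x \<and>
     (\<forall>y\<in>S. delaunay_edge S x y \<longrightarrow> dist x y \<le> w)}"

definition region :: "(nat \<Rightarrow> real) \<Rightarrow> (nat \<Rightarrow> real) \<Rightarrow> (nat \<Rightarrow> real) \<Rightarrow> pt set \<Rightarrow> pt set" where
  "region w D h S = (\<Union>k. zone (w k) (D k) (h k) S)"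

text \<open>Rational radii suffice, because a distance shows up as a jump of the count between two
  of them.\<close>

definition label :: "pt set \<Rightarrow> pt \<Rightarrow> nat \<Rightarrow> nat" where
  "label S x i = card (S \<inter> cball x (of_rat (from_nat i)))"

definition chooses_after :: "(nat \<Rightarrow> real) \<Rightarrow> (nat \<Rightarrow> real) \<Rightarrow> (nat \<Rightarrow> real) \<Rightarrow> pt set \<Rightarrow> pt \<Rightarrow> pt \<Rightarrow> bool" where
  "chooses_after w D h S x y \<longleftrightarrow> y \<in> nbrs S x \<and> earlier (nbrs S) (region w D h S) S (label S) x y"

definition coloring :: "(nat \<Rightarrow> real) \<Rightarrow> (nat \<Rightarrow> real) \<Rightarrow> (nat \<Rightarrow> real) \<Rightarrow> pt set \<Rightarrow> nat \<Rightarrow> pt set" where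
  "coloring w D h S = (\<lambda>i\<in>{..<6}. greedy_class (chooses_after w D h S) S i)"

section \<open>Measurability of the scheme\<close>

lemma mem_nbrs: "y \<in> nbrs S x \<longleftrightarrow> delaunay_edge S x y"
  by (simp add: nbrs_def)

lemma measurable_pair_pred:
  assumes "Measurable.pred (Msp \<Otimes>\<^sub>M borel) (\<lambda>z. P (fst z) (snd z))"
    and "S \<in> measurable M Msp" "f \<in> borel_measurable M"
  shows "Measurable.pred M (\<lambda>w. P (S w) (f w))"
  using measurable_compose[OF measurable_Pair[OF assms(2,3)] assms(1)] by simp

lemma measurable_mem:
  assumes S [measurable]: "S \<in> measurable M Msp" and f [measurable]: "f \<in> borel_measurable M"
  shows "Measurable.pred M (\<lambda>w. f w \<in> S w)"
proof -
  have "Measurable.pred M (\<lambda>w. \<exists>y\<in>S w. f w = y)"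
    by (rule measurable_Bex[OF S]) measurable
  then show ?thesis by (rule measurable_cong[THEN iffD1, rotated]) auto
qed

lemma measurable_cross [measurable (raw)]:
  assumes [measurable]: "f \<in> borel_measurable M" "g \<in> borel_measurable M"
  shows "(\<lambda>w. cross (f w) (g w)) \<in> borel_measurable M"
  unfolding cross_def by measurable

lemma measurable_pw [measurable (raw)]:
  assumes [measurable]: "f \<in> borel_measurable M" "g \<in> borel_measurable M" "h \<in> borel_measurable M"
  shows "(\<lambda>w. pw (f w) (g w) (h w)) \<in> borel_measurable M"
  unfolding pw_def by measurable

text \<open>Centres on the bisector are parametrised by a real number, and the conditions on it are
  affine, so the admissible parameters form an interval. Two distinct ones have two rational ones
  between them, and the quantifier over centres becomes countable.\<close>

lemma delaunay_edge_rat: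
  "delaunay_edge S x u \<longleftrightarrow> x \<in> S \<and> u \<in> S \<and> x \<noteq> u \<and>
     (\<exists>r t :: rat. r \<noteq> t \<and> (\<forall>z\<in>S. 0 \<le> pw ((1/2) *\<^sub>R (x + u)) x z - 2 * of_rat r * cross (u - x) (z - x)) \<and>
        (\<forall>z\<in>S. 0 \<le> pw ((1/2) *\<^sub>R (x + u)) x z - 2 * of_rat t * cross (u - x) (z - x)))"
  (is "?L \<longleftrightarrow> ?R")
proof -
  define m where "m = (1/2) *\<^sub>R (x + u)"
  have m: "pw m x u = 0" by (simp add: pw_def m_def inner_2 field_simps)
  define e where "e t \<longleftrightarrow> (\<forall>z\<in>S. 0 \<le> pw m x z - 2 * t * cross (u - x) (z - x))" for t :: real
  have "?L \<longleftrightarrow> x \<in> S \<and> u \<in> S \<and> x \<noteq> u \<and> (\<exists>a b. a \<noteq> b \<and> e a \<and> e b)"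
  proof -
    have "(\<exists>a b. a \<noteq> b \<and> pw a x u = 0 \<and> pw b x u = 0 \<and> (\<forall>z\<in>S. 0 \<le> pw a x z) \<and> (\<forall>z\<in>S. 0 \<le> pw b x z))
       \<longleftrightarrow> (\<exists>a b. a \<noteq> b \<and> e a \<and> e b)" if xu: "x \<noteq> u"
    proof
      assume "\<exists>a b. a \<noteq> b \<and> e a \<and> e b"
      then obtain a b where ab: "a \<noteq> b" "e a" "e b" by blast
      have "m + a *\<^sub>R rot (u - x) \<noteq> m + b *\<^sub>R rot (u - x)" using ab xu by (simp add: rot_eq_0_iff)
      moreover have "\<forall>z\<in>S. 0 \<le> pw (m + a *\<^sub>R rot (u - x)) x z" "\<forall>z\<in>S. 0 \<le> pw (m + b *\<^sub>R rot (u - x)) x z"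
        using ab by (simp_all add: e_def pw_shift)
      moreover have "pw (m + a *\<^sub>R rot (u - x)) x u = 0" "pw (m + b *\<^sub>R rot (u - x)) x u = 0"
        using m by (simp_all add: pw_shift)
      ultimately show "\<exists>a b. a \<noteq> b \<and> pw a x u = 0 \<and> pw b x u = 0 \<and> (\<forall>z\<in>S. 0 \<le> pw a x z) \<and> (\<forall>z\<in>S. 0 \<le> pw b x z)"
        by blast
    next
      assume "\<exists>a b. a \<noteq> b \<and> pw a x u = 0 \<and> pw b x u = 0 \<and> (\<forall>z\<in>S. 0 \<le> pw a x z) \<and> (\<forall>z\<in>S. 0 \<le> pw b x z)"
      then obtain a b where ab: "a \<noteq> b" "pw a x u = 0" "pw b x u = 0" "\<forall>z\<in>S. 0 \<le> pw a x z" "\<forall>z\<in>S. 0 \<le> pw b x z"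
        by blast
      obtain k where k: "a = m + (- k / 2) *\<^sub>R rot (u - x)" using pw_diff[OF ab(2) m xu] by blast
      obtain l where l: "b = m + (- l / 2) *\<^sub>R rot (u - x)" using pw_diff[OF ab(3) m xu] by blast
      have "e (- k / 2)" "e (- l / 2)" unfolding e_def pw_shift[symmetric] k[symmetric] l[symmetric] using ab by auto
      moreover have "- k / 2 \<noteq> - l / 2" using ab(1) k l by auto
      ultimately show "\<exists>a b. a \<noteq> b \<and> e a \<and> e b" by blast
    qed
    then show ?thesis unfolding delaunay_edge_iff by blast
  qed
  also have "(\<exists>a b. a \<noteq> b \<and> e a \<and> e b) \<longleftrightarrow> (\<exists>r t :: rat. r \<noteq> t \<and> e (of_rat r) \<and> e (of_rat t))"
  proof
    assume "\<exists>a b. a \<noteq> b \<and> e a \<and> e b"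
    then obtain a b where ab: "a < b" "e a" "e b" by (metis linorder_neqE)
    have conv: "e t" if "a < t" "t < b" for t
      unfolding e_def
    proof
      fix z assume z: "z \<in> S"
      show "0 \<le> pw m x z - 2 * t * cross (u - x) (z - x)"
      proof (cases "0 \<le> cross (u - x) (z - x)")
        case True
        then have "t * cross (u - x) (z - x) \<le> b * cross (u - x) (z - x)" using that by (intro mult_right_mono) auto
        then show ?thesis using ab(3) z by (force simp: e_def)
      next
        case False
        then have "t * cross (u - x) (z - x) \<le> a * cross (u - x) (z - x)" using that by (intro mult_right_mono_neg) auto
        then show ?thesis using ab(2) z by (force simp: e_def)
      qed
    qed
    obtain r where r: "a < of_rat r" "of_rat r < b" using of_rat_dense[OF ab(1)] by blast
    obtain t where t: "of_rat r < (of_rat t :: real)" "of_rat t < b" using of_rat_dense[OF r(2)] by blast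
    have "r \<noteq> t" using t by auto
    then show "\<exists>r t :: rat. r \<noteq> t \<and> e (of_rat r) \<and> e (of_rat t)" using conv r t by (metis less_trans)
  next
    assume "\<exists>r t :: rat. r \<noteq> t \<and> e (of_rat r) \<and> e (of_rat t)"
    then show "\<exists>a b. a \<noteq> b \<and> e a \<and> e b" by (metis of_rat_eq_iff)
  qed
  finally show ?thesis unfolding e_def m_def .
qed

lemma measurable_delaunay:
  assumes S [measurable]: "S \<in> measurable M Msp"
    and f [measurable]: "f \<in> borel_measurable M" and g [measurable]: "g \<in> borel_measurable M"
  shows "Measurable.pred M (\<lambda>w. delaunay_edge (S w) (f w) (g w))"
  unfolding delaunay_edge_rat
proof (intro pred_intros_logic pred_intros_countable measurable_mem assms pred_intros_conj1' measurable_Ball[OF S])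
  show "Measurable.pred M (\<lambda>w. f w = g w)" by measurable
next
  fix r t :: rat
  show "Measurable.pred (M \<Otimes>\<^sub>M borel) (\<lambda>z. 0 \<le> pw ((1/2) *\<^sub>R (f (fst z) + g (fst z))) (f (fst z)) (snd z) -
      2 * of_rat r * cross (g (fst z) - f (fst z)) (snd z - f (fst z)))"
    by measurable
  show "Measurable.pred (M \<Otimes>\<^sub>M borel) (\<lambda>z. 0 \<le> pw ((1/2) *\<^sub>R (f (fst z) + g (fst z))) (f (fst z)) (snd z) -
      2 * of_rat t * cross (g (fst z) - f (fst z)) (snd z - f (fst z)))"
    by measurable
qed simp_all

lemma measurable_sites:
  assumes S [measurable]: "S \<in> measurable M Msp" and f [measurable]: "f \<in> borel_measurable M"
  shows "Measurable.pred M (\<lambda>w. f w \<in> sites h (S w))"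
proof -
  have "Measurable.pred M (\<lambda>w. f w \<in> S w \<and> (\<exists>y\<in>S w. y \<noteq> f w \<and> dist (f w) y \<le> h))"
    by (intro pred_intros_logic measurable_mem S f measurable_Bex[OF S]) measurable
  then show ?thesis by (simp add: sites_def)
qed

lemma measurable_deep_at:
  assumes S [measurable]: "S \<in> measurable M Msp" and f [measurable]: "f \<in> borel_measurable M"
    and g [measurable]: "g \<in> borel_measurable M"
  shows "Measurable.pred M (\<lambda>w. deep_at D h t (S w) (f w) (g w))"
proof -
  have eq: "deep_at D h t T z p \<longleftrightarrow> p \<in> sites h T \<and> dist z p \<le> D - t \<and>
     (\<forall>q\<in>T. q \<in> sites h T \<longrightarrow> dist q p \<le> 1 \<or> dist z p + t \<le> dist z q)" for T z p
    unfolding deep_at_def by (auto simp: sites_def)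
  have 1: "Measurable.pred M (\<lambda>w. dist (f w) (g w) \<le> D - t)" by measurable
  have 2: "Measurable.pred (M \<Otimes>\<^sub>M borel) (\<lambda>z. dist (snd z) (g (fst z)) \<le> 1 \<or>
      dist (f (fst z)) (g (fst z)) + t \<le> dist (f (fst z)) (snd z))" by measurable
  have 3: "Measurable.pred (M \<Otimes>\<^sub>M borel) (\<lambda>z. snd z \<in> sites h (S (fst z)))"
    by (rule measurable_sites) measurable
  have 4: "Measurable.pred M (\<lambda>w. \<forall>q\<in>S w. q \<in> sites h (S w) \<longrightarrow>
      dist q (g w) \<le> 1 \<or> dist (f w) (g w) + t \<le> dist (f w) q)"
    by (rule measurable_Ball[OF S], rule pred_intros_logic(4), rule 3, rule 2)
  show ?thesis unfolding eq using measurable_sites[OF S g, of h] 1 4 by (intro pred_intros_logic)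
qed

lemma measurable_deep:
  assumes S [measurable]: "S \<in> measurable M Msp" and f [measurable]: "f \<in> borel_measurable M"
  shows "Measurable.pred M (\<lambda>w. deep D h t (S w) (f w))"
  unfolding deep_def by (intro measurable_Bex[OF S] measurable_deep_at) measurable

lemma measurable_region:
  assumes S [measurable]: "S \<in> measurable M Msp" and f [measurable]: "f \<in> borel_measurable M"
  shows "Measurable.pred M (\<lambda>w. f w \<in> region u D h (S w))"
proof -
  have "Measurable.pred M (\<lambda>w. \<exists>k. f w \<in> S w \<and> deep (D k) (h k) (2 * u k) (S w) (f w) \<and>
      \<not> deep (D k) (h k) (10 * u k) (S w) (f w) \<and>
      (\<forall>y\<in>S w. delaunay_edge (S w) (f w) y \<longrightarrow> dist (f w) y \<le> u k))"
    by (intro pred_intros_logic pred_intros_countable measurable_mem S f measurable_deep measurable_Ball[OF S]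
        measurable_delaunay) measurable
  then show ?thesis by (simp add: region_def zone_def)
qed

lemma measurable_peel:
  fixes R :: "pt set \<Rightarrow> pt set" and V :: "pt set \<Rightarrow> pt set"
  assumes R: "Measurable.pred (Msp \<Otimes>\<^sub>M borel) (\<lambda>z. snd z \<in> R (fst z))"
    and V: "Measurable.pred (Msp \<Otimes>\<^sub>M borel) (\<lambda>z. snd z \<in> V (fst z))"
  shows "Measurable.pred (Msp \<Otimes>\<^sub>M borel) (\<lambda>z. snd z \<in> peel (nbrs (fst z)) (R (fst z)) (V (fst z)) n)"
proof (induction n)
  case 0
  then show ?case using V by simp
next
  case (Suc n)
  have "Measurable.pred (Msp \<Otimes>\<^sub>M borel) (\<lambda>z. many 6 {y\<in>fst z. delaunay_edge (fst z) (snd z) y \<and>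
      y \<in> peel (nbrs (fst z)) (R (fst z)) (V (fst z)) n})"
    by (intro measurable_many pred_intros_logic measurable_delaunay
        measurable_pair_pred[where P = "\<lambda>T x. x \<in> peel (nbrs T) (R T) (V T) n", OF Suc]) measurable
  moreover have "nbrs T x \<inter> P = {y\<in>T. delaunay_edge T x y \<and> y \<in> P}" for T x P
    by (auto simp: nbrs_def delaunay_edge_def)
  ultimately have "Measurable.pred (Msp \<Otimes>\<^sub>M borel) (\<lambda>z. many 6 (nbrs (fst z) (snd z) \<inter>
      peel (nbrs (fst z)) (R (fst z)) (V (fst z)) n))"
    by simp
  then have "Measurable.pred (Msp \<Otimes>\<^sub>M borel) (\<lambda>z. snd z \<in> peel (nbrs (fst z)) (R (fst z)) (V (fst z)) n \<and>
      \<not> (snd z \<in> R (fst z) \<and> \<not> many 6 (nbrs (fst z) (snd z) \<inter>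
      peel (nbrs (fst z)) (R (fst z)) (V (fst z)) n)))"
    using Suc R by (intro pred_intros_logic)
  then show ?case by simp
qed

lemma measurable_peel_core:
  assumes R: "Measurable.pred (Msp \<Otimes>\<^sub>M borel) (\<lambda>z. snd z \<in> R (fst z))"
    and V: "Measurable.pred (Msp \<Otimes>\<^sub>M borel) (\<lambda>z. snd z \<in> V (fst z))"
  shows "Measurable.pred (Msp \<Otimes>\<^sub>M borel) (\<lambda>z. snd z \<in> peel_core (nbrs (fst z)) (R (fst z)) (V (fst z)))"
proof -
  have "Measurable.pred (Msp \<Otimes>\<^sub>M borel) (\<lambda>z. \<forall>n. snd z \<in> peel (nbrs (fst z)) (R (fst z)) (V (fst z)) n)"
    using measurable_peel[OF R V] by (intro pred_intros_countable)
  then show ?thesis by (simp add: peel_core_def)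
qed

lemma measurable_label:
  assumes S [measurable]: "S \<in> measurable M Msp" and f [measurable]: "f \<in> borel_measurable M"
  shows "(\<lambda>w. label (S w) (f w) i) \<in> measurable M (count_space UNIV)"
proof (rule measurable_count_space_eq2_countable[THEN iffD2], intro conjI ballI)
  fix n :: nat
  define r where "r = (of_rat (from_nat i) :: real)"
  have "Measurable.pred M (\<lambda>w. many k {y\<in>S w. dist (f w) y \<le> r})" for k
    by (intro measurable_many[OF S]) measurable
  then have "Measurable.pred M (\<lambda>w. many n {y\<in>S w. dist (f w) y \<le> r} \<and> \<not> many (Suc n) {y\<in>S w. dist (f w) y \<le> r})"
    by (intro pred_intros_logic)
  moreover have "label (S w) (f w) i = n \<longleftrightarrow>
      many n {y\<in>S w. dist (f w) y \<le> r} \<and> \<not> many (Suc n) {y\<in>S w. dist (f w) y \<le> r}" if "w \<in> space M" for w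
  proof -
    have "locfin (S w)" using measurable_space[OF S that] by (simp add: space_Msp Mspace_def)
    then have "finite (S w \<inter> cball (f w) r)" by (simp add: locfin_def)
    moreover have "S w \<inter> cball (f w) r = {y\<in>S w. dist (f w) y \<le> r}" by auto
    ultimately show ?thesis unfolding label_def r_def[symmetric] using card_eq_many by simp
  qed
  ultimately have "Measurable.pred M (\<lambda>w. label (S w) (f w) i = n)"
    by (rule measurable_cong[THEN iffD2, rotated])
  then show "(\<lambda>w. label (S w) (f w) i) -` {n} \<inter> space M \<in> sets M"
    by (simp add: pred_def vimage_def Int_def conj_commute)
qed auto

lemma measurable_earlier:
  fixes R :: "pt set \<Rightarrow> pt set"
  assumes R: "Measurable.pred (Msp \<Otimes>\<^sub>M borel) (\<lambda>z. snd z \<in> R (fst z))"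
    and S [measurable]: "S \<in> measurable M Msp" and f [measurable]: "f \<in> borel_measurable M"
    and g [measurable]: "g \<in> borel_measurable M"
  shows "Measurable.pred M (\<lambda>w. earlier (nbrs (S w)) (R (S w)) (S w) (label (S w)) (f w) (g w))"
proof -
  have V: "Measurable.pred (Msp \<Otimes>\<^sub>M borel) (\<lambda>z. snd z \<in> fst z)"
    by (rule measurable_mem) measurable
  have U: "Measurable.pred (Msp \<Otimes>\<^sub>M borel) (\<lambda>z. snd z \<in> (UNIV :: pt set))" by simp
  have P: "Measurable.pred M (\<lambda>w. v w \<in> peel (nbrs (S w)) (R (S w)) (S w) n)"
    if v: "v \<in> borel_measurable M" for v n
    using measurable_pair_pred[where P = "\<lambda>T x. x \<in> peel (nbrs T) (R T) T n", OF measurable_peel[OF R V] S v] .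
  have Q: "Measurable.pred M (\<lambda>w. v w \<in> peel (nbrs (S w)) UNIV (peel_core (nbrs (S w)) (R (S w)) (S w)) n)"
    if v: "v \<in> borel_measurable M" for v n
    using measurable_pair_pred[where P = "\<lambda>T x. x \<in> peel (nbrs T) UNIV (peel_core (nbrs T) (R T) T) n",
        OF measurable_peel[where R = "\<lambda>_. UNIV", OF U measurable_peel_core[OF R V]] S v] .
  have L: "Measurable.pred M (\<lambda>w. label (S w) (v w) i = n)" if v: "v \<in> borel_measurable M" for v i n
    using measurable_label[OF S v, of i] by measurable
  have "Measurable.pred M (\<lambda>w. \<exists>i. (\<exists>n m. n < m \<and> label (S w) (f w) i = n \<and> label (S w) (g w) i = m) \<and>
      (\<forall>j<i. \<exists>n. label (S w) (f w) j = n \<and> label (S w) (g w) j = n))"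
    by (intro pred_intros_countable pred_intros_logic pred_intros_imp' pred_intros_conj1' L f g)
  then have lab: "Measurable.pred M (\<lambda>w. lex_less (label (S w) (f w)) (label (S w) (g w)))"
    by (simp add: lex_less_def eq_commute[of "label (S _) (g _) _"])
  show ?thesis
    unfolding earlier_def removed_before_def removed_together_def
    by (intro pred_intros_logic pred_intros_countable P Q f g lab)
qed

lemma measurable_chooses_after:
  assumes S [measurable]: "S \<in> measurable M Msp" and f [measurable]: "f \<in> borel_measurable M"
    and g [measurable]: "g \<in> borel_measurable M"
  shows "Measurable.pred M (\<lambda>w. chooses_after u D h (S w) (f w) (g w))"
proof -
  have R: "Measurable.pred (Msp \<Otimes>\<^sub>M borel) (\<lambda>z. snd z \<in> region u D h (fst z))"
    by (rule measurable_region) measurable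
  show ?thesis
    unfolding chooses_after_def mem_nbrs
    using measurable_earlier[OF R S f g] measurable_delaunay[OF S f g] by (intro pred_intros_logic)
qed

lemma measurable_greedy:
  "(\<lambda>z. greedy (chooses_after u D h (fst z)) n (snd z)) \<in> measurable (Msp \<Otimes>\<^sub>M borel) (count_space UNIV)"
proof (induction n)
  case 0
  then show ?case by simp
next
  case (Suc n)
  define G where "G z = greedy (chooses_after u D h (fst z)) n (snd z)" for z
  have G: "G \<in> measurable (Msp \<Otimes>\<^sub>M borel) (count_space UNIV)" using Suc by (simp add: G_def[abs_def])
  have "Measurable.pred (Msp \<Otimes>\<^sub>M borel) (\<lambda>z. \<forall>y\<in>fst z. chooses_after u D h (fst z) (snd z) y \<longrightarrow> G (fst z, y) \<noteq> i)" for i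
  proof (intro measurable_Ball pred_intros_logic measurable_chooses_after)
    have "(\<lambda>z. G (fst (fst z), snd z)) \<in> measurable ((Msp \<Otimes>\<^sub>M borel) \<Otimes>\<^sub>M borel) (count_space UNIV)"
      by (rule measurable_compose[OF _ G]) measurable
    then show "Measurable.pred ((Msp \<Otimes>\<^sub>M borel) \<Otimes>\<^sub>M borel) (\<lambda>z. G (fst (fst z), snd z) = i)"
      by measurable
  qed measurable
  \<comment> \<open>Only points of \<open>T\<close> choose earlier, so the quantifier may be
    restricted to \<open>T\<close>, where it is measurable.\<close>
  moreover have "(\<forall>y\<in>T. chooses_after u D h T x y \<longrightarrow> G (T, y) \<noteq> i) \<longleftrightarrow>
      (\<forall>y. chooses_after u D h T x y \<longrightarrow> greedy (chooses_after u D h T) n y \<noteq> i)" for T x i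
    using nbrs_subset by (auto simp: chooses_after_def G_def)
  ultimately have "Measurable.pred (Msp \<Otimes>\<^sub>M borel)
      (\<lambda>z. \<forall>y. chooses_after u D h (fst z) (snd z) y \<longrightarrow> greedy (chooses_after u D h (fst z)) n y \<noteq> i)" for i
    by simp
  then show ?case unfolding greedy.simps by (rule measurable_Least)
qed

lemma measurable_coloring:
  "coloring u D h \<in> measurable Msp (Msp_pow 6)"
proof -
  have "(\<lambda>S. greedy_class (chooses_after u D h S) S i) \<in> measurable Msp Msp" for i
  proof -
  have "Measurable.pred (Msp \<Otimes>\<^sub>M borel) (\<lambda>z. \<exists>N. \<forall>n\<ge>N. greedy (chooses_after u D h (fst z)) n (snd z) = i)"
  proof (intro pred_intros_countable pred_intros_imp')
    fix n
    show "Measurable.pred (Msp \<Otimes>\<^sub>M borel) (\<lambda>z. greedy (chooses_after u D h (fst z)) n (snd z) = i)"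
      using measurable_greedy by measurable
  qed
    then show ?thesis
      unfolding greedy_class_def
      by (rule measurable_thinning[OF measurable_ident_sets[OF refl],
            where P = "\<lambda>S x. \<exists>N. \<forall>n\<ge>N. greedy (chooses_after u D h S) n x = i"])
  qed
  then have "(\<lambda>S. \<lambda>i\<in>{..<6::nat}. greedy_class (chooses_after u D h S) S i) \<in> measurable Msp (PiM {..<6} (\<lambda>_. Msp))"
    by (intro measurable_restrict)
  then show ?thesis unfolding Msp_pow_def coloring_def[abs_def] .
qed

section \<open>Equivariance\<close>

text \<open>After a translation that fixes the origin a distance-preserving map is linear and
  orthogonal, hence onto in finite dimension.\<close>

lemma isometry_bij:
  assumes "isometry g" shows "inj g" "surj g"
proof -
  have d: "dist (g x) (g y) = dist x y" for x y using assms by (simp add: isometry_def)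
  show "inj g" by (rule injI) (metis d dist_eq_0_iff)
  define f where "f x = g x - g 0" for x
  have "orthogonal_transformation f"
    unfolding orthogonal_transformation_isometry f_def using d by (simp add: dist_norm)
  then have "surj f" by (rule orthogonal_transformation_surj)
  then have "\<exists>x. y - g 0 = g x - g 0" for y unfolding surj_def f_def by blast
  then have "\<exists>x. y = g x" for y by simp
  then show "surj g" unfolding surj_def by blast
qed

lemma inj_image_many: "inj g \<Longrightarrow> many n (g ` A) \<longleftrightarrow> many n A"
proof
  assume g: "inj g" and "many n (g ` A)"
  then obtain T where T: "T \<subseteq> g ` A" "finite T" "card T = n" by (auto simp: many_def)
  then obtain U where U: "U \<subseteq> A" "T = g ` U" by (auto simp: subset_image_iff)
  then have "finite U" "card U = n"
    using T g by (auto simp: finite_image_iff card_image inj_on_subset)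
  then show "many n A" using U by (auto simp: many_def)
next
  assume g: "inj g" and "many n A"
  then obtain T where "T \<subseteq> A" "finite T" "card T = n" by (auto simp: many_def)
  then have "g ` T \<subseteq> g ` A" "finite (g ` T)" "card (g ` T) = n"
    using g by (auto simp: card_image inj_on_subset)
  then show "many n (g ` A)" unfolding many_def by blast
qed

lemma peel_image:
  assumes g: "inj g" and nb: "\<And>x. nb' (g x) = g ` nb x"
  shows "peel nb' (g ` R) (g ` V) n = g ` peel nb R V n"
proof (induction n)
  case (Suc n)
  have "nb' (g x) \<inter> g ` peel nb R V n = g ` (nb x \<inter> peel nb R V n)" for x
    using g by (simp add: nb image_Int)
  then have "{x \<in> g ` R. \<not> many 6 (nb' x \<inter> g ` peel nb R V n)} = g ` {x \<in> R. \<not> many 6 (nb x \<inter> peel nb R V n)}"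
    using inj_image_many[OF g] by auto
  then show ?case using Suc g by (simp add: image_set_diff)
qed simp

lemma peel_core_image:
  assumes g: "inj g" and nb: "\<And>x. nb' (g x) = g ` nb x"
  shows "peel_core nb' (g ` R) (g ` V) = g ` peel_core nb R V"
  unfolding peel_core_def peel_image[where nb = nb, OF assms] using g by (simp add: image_INT[of g UNIV])

lemma earlier_image:
  assumes g: "inj g" "surj g" and nb: "\<And>x. nb' (g x) = g ` nb x" and lab: "\<And>x. lab' (g x) = lab x"
  shows "earlier nb' (g ` R) (g ` V) lab' (g x) (g y) \<longleftrightarrow> earlier nb R V lab x y"
proof -
  \<comment> \<open>The second round may remove every vertex, so \<open>UNIV\<close> has to be
    written as an image.\<close>
  have U: "(UNIV :: 'b set) = g ` UNIV" using g by simp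
  show ?thesis
    unfolding earlier_def removed_before_def removed_together_def lab
      peel_core_image[where nb = nb, OF g(1) nb] peel_image[where nb = nb and R = R, OF g(1) nb]
    unfolding U peel_image[where nb = nb and R = UNIV, OF g(1) nb]
    by (simp only: inj_image_mem_iff[OF g(1)])
qed

lemma greedy_image:
  assumes g: "surj g" and A: "\<And>x y. A' (g x) (g y) \<longleftrightarrow> A x y"
  shows "greedy A' n (g x) = greedy A n x"
proof (induction n arbitrary: x)
  case (Suc n)
  have "(\<forall>y. A' (g x) y \<longrightarrow> greedy A' n y \<noteq> i) \<longleftrightarrow> (\<forall>y. A x y \<longrightarrow> greedy A n y \<noteq> i)" for i
    using g A Suc by (metis surjD)
  then show ?case by simp
qed simp

text \<open>Everything reduces to distances: \<open>pw\<close> is a difference of two squared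
  distances, and labels count points in discs. Orientation by \<open>cross\<close> occurs in proofs
  but not in the scheme, so reflections are covered.\<close>

lemma coloring_image:
  assumes "isometry g" and i: "i < 6"
  shows "g ` coloring w D h S i = coloring w D h (g ` S) i"
proof -
  have d: "dist (g x) (g y) = dist x y" for x y using assms by (simp add: isometry_def)
  have g: "inj g" "surj g" using isometry_bij[OF assms(1)] by blast+
  have ex: "(\<exists>a. P a) \<longleftrightarrow> (\<exists>a. P (g a))" for P using g(2) by (metis surjD)
  have mem: "g x \<in> g ` S \<longleftrightarrow> x \<in> S" for x using g(1) by (rule inj_image_mem_iff)
  have eq: "g x = g y \<longleftrightarrow> x = y" for x y using g(1) by (simp add: inj_eq)
  have pw: "pw (g a) (g x) (g z) = pw a x z" for a x z
    using d[of z a] d[of x a] by (simp add: pw_eq_norm dist_norm)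
  have del: "delaunay_edge (g ` S) (g x) (g y) \<longleftrightarrow> delaunay_edge S x y" for x y
  proof -
    have "(\<exists>a b. a \<noteq> b \<and> pw a (g x) (g y) = 0 \<and> pw b (g x) (g y) = 0 \<and> (\<forall>z\<in>g ` S. 0 \<le> pw a (g x) z) \<and>
        (\<forall>z\<in>g ` S. 0 \<le> pw b (g x) z)) \<longleftrightarrow>
      (\<exists>a b. g a \<noteq> g b \<and> pw (g a) (g x) (g y) = 0 \<and> pw (g b) (g x) (g y) = 0 \<and>
        (\<forall>z\<in>g ` S. 0 \<le> pw (g a) (g x) z) \<and> (\<forall>z\<in>g ` S. 0 \<le> pw (g b) (g x) z))"
      by (rule iffI, elim exE) (metis surjD[OF g(2)], blast)
    then show ?thesis unfolding delaunay_edge_iff mem by (simp add: eq pw)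
  qed
  have nb: "nbrs (g ` S) (g x) = g ` nbrs S x" for x
  proof -
    have "y \<in> nbrs (g ` S) (g x) \<longleftrightarrow> y \<in> g ` nbrs S x" for y
    proof -
      obtain z where "y = g z" using g(2) by (metis surjD)
      then show ?thesis by (simp add: nbrs_def del inj_image_mem_iff[OF g(1)])
    qed
    then show ?thesis by blast
  qed
  have st: "g x \<in> sites t (g ` S) \<longleftrightarrow> x \<in> sites t S" for x t
    by (simp add: sites_def mem d eq)
  have sites_sub: "sites t T \<subseteq> T" for t T by (auto simp: sites_def)
  have st': "sites t (g ` S) = g ` sites t S" for t
    using st sites_sub[of t "g ` S"] by (auto simp: image_iff) (metis imageE st subsetD)
  have dp: "deep D0 t r (g ` S) (g x) \<longleftrightarrow> deep D0 t r S x" for D0 t r x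
    by (simp add: deep_def deep_at_def inj_image_mem_iff[OF g(1)] st' d)
  have zn: "g x \<in> zone u D0 t (g ` S) \<longleftrightarrow> x \<in> zone u D0 t S" for u D0 t x
    by (simp add: zone_def mem dp del d)
  have rg: "region w D h (g ` S) = g ` region w D h S"
  proof -
    have "y \<in> region w D h (g ` S) \<longleftrightarrow> y \<in> g ` region w D h S" for y
    proof -
      obtain z where "y = g z" using g(2) by (metis surjD)
      then show ?thesis by (simp add: region_def zn inj_image_mem_iff[OF g(1)])
    qed
    then show ?thesis by blast
  qed
  have lab: "label (g ` S) (g x) = label S x" for x
  proof
    fix i
    define r where "r = (of_rat (from_nat i) :: real)"
    have "g ` S \<inter> cball (g x) r = g ` (S \<inter> cball x r)" by (auto simp: d)
    then show "label (g ` S) (g x) i = label S x i"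
      unfolding label_def r_def[symmetric] using g(1) by (metis card_image inj_on_subset subset_UNIV)
  qed
  have ch: "chooses_after w D h (g ` S) (g x) (g y) \<longleftrightarrow> chooses_after w D h S x y" for x y
    unfolding chooses_after_def nb rg
    using earlier_image[where nb = "nbrs S" and nb' = "nbrs (g ` S)" and lab = "label S", OF g nb lab]
    by (simp add: inj_image_mem_iff[OF g(1)])
  have "greedy (chooses_after w D h (g ` S)) n (g x) = greedy (chooses_after w D h S) n x" for n x
    by (rule greedy_image[OF g(2)]) (rule ch)
  then have "g x \<in> greedy_class (chooses_after w D h (g ` S)) (g ` S) i \<longleftrightarrow>
      x \<in> greedy_class (chooses_after w D h S) S i" for x
    by (simp add: greedy_class_def inj_image_mem_iff[OF g(1)])
  then have "y \<in> greedy_class (chooses_after w D h (g ` S)) (g ` S) i \<longleftrightarrow>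
      y \<in> g ` greedy_class (chooses_after w D h S) S i" for y
    using g by (metis inj_image_mem_iff surjD)
  then show ?thesis using i by (auto simp: coloring_def)
qed

section \<open>Poisson probabilities\<close>

locale poisson =
  fixes P :: "pt set measure"
  assumes poisson_law: "poisson_law P"

sublocale poisson \<subseteq> prob_space P
  using poisson_law by (simp add: poisson_law_def)

context poisson
begin

lemma sets_P: "sets P = sets Msp" and space_P: "space P = Mspace"
  using poisson_law by (auto simp: poisson_law_def)

lemma locfin_space: "S \<in> space P \<Longrightarrow> locfin S"
  by (simp add: space_P Mspace_def)

lemma count_measurable_P [measurable]:
  "B \<in> sets borel \<Longrightarrow> bounded B \<Longrightarrow> (\<lambda>S. card (S \<inter> B)) \<in> measurable P (count_space UNIV)"
  using count_measurable measurable_cong_sets[OF sets_P refl] by blast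

lemma count_event [measurable]:
  assumes "B \<in> sets borel" "bounded B"
  shows "{S \<in> space P. card (S \<inter> B) \<in> A} \<in> events"
  using measurable_sets[OF count_measurable_P[OF assms], of A] by (simp add: vimage_def Int_def conj_commute)

lemma prob_count:
  "B \<in> sets borel \<Longrightarrow> bounded B \<Longrightarrow>
    prob {S \<in> space P. card (S \<inter> B) = k} = exp (- measure lborel B) * measure lborel B ^ k / fact k"
  using poisson_law unfolding poisson_law_def by blast

lemma prob_joint:
  fixes B :: "'i \<Rightarrow> pt set" and A :: "'i \<Rightarrow> nat set"
  assumes "finite I" and B: "\<And>i. i \<in> I \<Longrightarrow> B i \<in> sets borel" "\<And>i. i \<in> I \<Longrightarrow> bounded (B i)"
    and disj: "disjoint_family_on B I"
  shows "prob {S \<in> space P. \<forall>i\<in>I. card (S \<inter> B i) \<in> A i} = (\<Prod>i\<in>I. prob {S \<in> space P. card (S \<inter> B i) \<in> A i})"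
proof (cases "I = {}")
  case True
  then show ?thesis by (simp add: prob_space)
next
  case False
  obtain h where h: "bij_betw h {..<card I} I"
    using ex_bij_betw_nat_finite[OF assms(1)] by (auto simp: atLeast0LessThan)
  define n where "n = card I"
  have n: "n > 0" using False assms(1) by (simp add: n_def card_gt_0_iff)
  have hI: "h i \<in> I" if "i < n" for i using h that by (auto simp: bij_betw_def n_def)
  have inj: "inj_on h {..<n}" using h by (simp add: bij_betw_def n_def)
  have "disjoint_family_on (\<lambda>i. B (h i)) {..<n}"
    using disj inj hI unfolding disjoint_family_on_def inj_on_def by blast
  moreover have "\<forall>i<n. B (h i) \<in> sets borel \<and> bounded (B (h i))" using B hI by blast
  ultimately have ind: "indep_vars (\<lambda>_. count_space UNIV) (\<lambda>i S. card (S \<inter> B (h i))) {..<n}"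
    using poisson_law unfolding poisson_law_def by (elim conjE allE[of _ "\<lambda>i. B (h i)"]) blast
  have im: "h ` {..<n} = I" using h by (simp add: bij_betw_def n_def)
  have "{S \<in> space P. \<forall>i\<in>I. card (S \<inter> B i) \<in> A i} =
      (\<Inter>i\<in>{..<n}. (\<lambda>S. card (S \<inter> B (h i))) -` A (h i) \<inter> space P)"
    using n unfolding im[symmetric] by auto
  also have "prob \<dots> = (\<Prod>i\<in>{..<n}. prob ((\<lambda>S. card (S \<inter> B (h i))) -` A (h i) \<inter> space P))"
    using n by (intro indep_varsD[OF ind]) auto
  also have "\<dots> = (\<Prod>i\<in>{..<n}. prob {S \<in> space P. card (S \<inter> B (h i)) \<in> A (h i)})"
    by (intro prod.cong arg_cong[of _ _ prob]) auto
  also have "\<dots> = (\<Prod>i\<in>I. prob {S \<in> space P. card (S \<inter> B i) \<in> A i})"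
    using prod.reindex[OF inj, of "\<lambda>i. prob {S \<in> space P. card (S \<inter> B i) \<in> A i}"] im by simp
  finally show ?thesis .
qed

text \<open>Independence gives the probability that several windows all occur. Avoidance follows by
  induction on the set \<open>U\<close> of avoided windows: avoiding one more is a difference of two
  probabilities, in the second of which that window occurs.\<close>

lemma prob_avoid:
  fixes B :: "'w \<Rightarrow> 'i \<Rightarrow> pt set" and A :: "'i \<Rightarrow> nat set"
  assumes W: "finite W" and I: "finite I"
    and B: "\<And>w i. w \<in> W \<Longrightarrow> i \<in> I \<Longrightarrow> B w i \<in> sets borel" "\<And>w i. w \<in> W \<Longrightarrow> i \<in> I \<Longrightarrow> bounded (B w i)"
    and disj: "disjoint_family_on (\<lambda>x. B (fst x) (snd x)) (W \<times> I)"
  shows "prob {S \<in> space P. \<forall>w\<in>W. \<not> (\<forall>i\<in>I. card (S \<inter> B w i) \<in> A i)} =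
    (\<Prod>w\<in>W. 1 - (\<Prod>i\<in>I. prob {S \<in> space P. card (S \<inter> B w i) \<in> A i}))"
proof -
  define E where "E w = {S \<in> space P. \<forall>i\<in>I. card (S \<inter> B w i) \<in> A i}" for w
  define p where "p w = (\<Prod>i\<in>I. prob {S \<in> space P. card (S \<inter> B w i) \<in> A i})" for w
  have Eev: "E w \<in> events" if "w \<in> W" for w
  proof -
    have "E w = {S \<in> space P. \<forall>i\<in>I. S \<in> {S \<in> space P. card (S \<inter> B w i) \<in> A i}}" by (auto simp: E_def)
    also have "\<dots> \<in> events" using I B that by (intro sets.sets_Collect_finite_All) (auto simp: Collect_conj_eq[symmetric])
    finally show ?thesis .
  qed
  have joint: "prob {S \<in> space P. \<forall>w\<in>V. S \<in> E w} = (\<Prod>w\<in>V. p w)" if V: "V \<subseteq> W" for V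
  proof -
    have fV: "finite V" using V W finite_subset by blast
    have "{S \<in> space P. \<forall>w\<in>V. S \<in> E w} = {S \<in> space P. \<forall>x\<in>V \<times> I. card (S \<inter> B (fst x) (snd x)) \<in> A (snd x)}"
      unfolding E_def by auto
    also have "prob \<dots> = (\<Prod>x\<in>V \<times> I. prob {S \<in> space P. card (S \<inter> B (fst x) (snd x)) \<in> A (snd x)})"
    proof (rule prob_joint)
      show "disjoint_family_on (\<lambda>x. B (fst x) (snd x)) (V \<times> I)"
        by (rule disjoint_family_on_mono[OF _ disj]) (use V in auto)
    qed (use fV I B V in auto)
    also have "\<dots> = (\<Prod>w\<in>V. p w)"
      unfolding p_def prod.cartesian_product using I fV by (intro prod.cong) auto
    finally show ?thesis .
  qed
  have main: "prob {S \<in> space P. (\<forall>w\<in>V. S \<in> E w) \<and> (\<forall>w\<in>U. S \<notin> E w)} = (\<Prod>w\<in>V. p w) * (\<Prod>w\<in>U. 1 - p w)"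
    if "finite U" "U \<subseteq> W" "V \<subseteq> W" "U \<inter> V = {}" for U V
    using that
  proof (induction U arbitrary: V rule: finite_induct)
    case empty
    then show ?case using joint[of V] by simp
  next
    case (insert u U)
    have fV: "finite V" using insert.prems W finite_subset by blast
    have u: "u \<notin> V" "u \<in> W" using insert by auto
    define X where "X = {S \<in> space P. (\<forall>w\<in>V. S \<in> E w) \<and> (\<forall>w\<in>U. S \<notin> E w)}"
    define Y where "Y = {S \<in> space P. (\<forall>w\<in>insert u V. S \<in> E w) \<and> (\<forall>w\<in>U. S \<notin> E w)}"
    have ev: "{S \<in> space P. (\<forall>w\<in>V'. S \<in> E w) \<and> (\<forall>w\<in>U. S \<notin> E w)} \<in> events" if "V' \<subseteq> W" "finite V'" for V'
    proof -
      have "{S \<in> space P. \<forall>w\<in>V'. S \<in> E w} \<in> events"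
        using that Eev by (intro sets.sets_Collect_finite_All) (auto simp: E_def)
      moreover have "{S \<in> space P. \<forall>w\<in>U. S \<notin> E w} \<in> events"
        using insert Eev by (intro sets.sets_Collect_finite_All sets.sets_Collect_neg) (auto simp: E_def)
      ultimately show ?thesis by (rule sets.sets_Collect_conj[rotated])
    qed
    have "{S \<in> space P. (\<forall>w\<in>V. S \<in> E w) \<and> (\<forall>w\<in>insert u U. S \<notin> E w)} = X - Y"
      by (auto simp: X_def Y_def)
    also have "prob (X - Y) = prob X - prob Y"
    proof (rule finite_measure_Diff)
      show "X \<in> events" unfolding X_def using insert.prems fV by (intro ev)
      show "Y \<in> events" unfolding Y_def using insert.prems fV by (intro ev) auto
      show "Y \<subseteq> X" by (auto simp: X_def Y_def)
    qed
    also have "prob X = (\<Prod>w\<in>V. p w) * (\<Prod>w\<in>U. 1 - p w)"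
      unfolding X_def using insert by (intro insert.IH) auto
    also have "prob Y = (\<Prod>w\<in>insert u V. p w) * (\<Prod>w\<in>U. 1 - p w)"
      unfolding Y_def using insert by (intro insert.IH) auto
    also have "(\<Prod>w\<in>insert u V. p w) = p u * (\<Prod>w\<in>V. p w)" using fV u by simp
    also have "(\<Prod>w\<in>V. p w) * (\<Prod>w\<in>U. 1 - p w) - p u * (\<Prod>w\<in>V. p w) * (\<Prod>w\<in>U. 1 - p w) =
        (\<Prod>w\<in>V. p w) * (\<Prod>w\<in>insert u U. 1 - p w)"
      using insert by (simp add: algebra_simps)
    finally show ?case .
  qed
  have "{S \<in> space P. \<forall>w\<in>W. \<not> (\<forall>i\<in>I. card (S \<inter> B w i) \<in> A i)} = {S \<in> space P. (\<forall>w\<in>{}. S \<in> E w) \<and> (\<forall>w\<in>W. S \<notin> E w)}"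
    by (auto simp: E_def)
  then show ?thesis using main[of W "{}"] W by (simp add: p_def)
qed

lemma prob_empty:
  assumes "B \<in> sets borel" "bounded B"
  shows "prob {S \<in> space P. card (S \<inter> B) \<in> {0}} = exp (- measure lborel B)"
  using prob_count[OF assms, of 0] by simp

lemma prob_single:
  assumes "B \<in> sets borel" "bounded B"
  shows "prob {S \<in> space P. card (S \<inter> B) \<in> {1}} = exp (- measure lborel B) * measure lborel B"
  using prob_count[OF assms, of 1] by simp

lemma prob_count_less:
  assumes "B \<in> sets borel" "bounded B"
  shows "prob {S \<in> space P. card (S \<inter> B) \<in> {..<n}} =
    exp (- measure lborel B) * (\<Sum>k<n. measure lborel B ^ k / fact k)"
proof -
  have "{S \<in> space P. card (S \<inter> B) \<in> {..<n}} = (\<Union>k<n. {S \<in> space P. card (S \<inter> B) \<in> {k}})" by auto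
  also have "prob \<dots> = (\<Sum>k<n. prob {S \<in> space P. card (S \<inter> B) \<in> {k}})"
    by (rule finite_measure_finite_Union) (use assms in \<open>auto simp: disjoint_family_on_def\<close>)
  also have "\<dots> = (\<Sum>k<n. exp (- measure lborel B) * measure lborel B ^ k / fact k)"
    using prob_count[OF assms] by simp
  finally show ?thesis by (simp add: sum_distrib_left)
qed

lemma prob_count_ge:
  assumes "B \<in> sets borel" "bounded B"
  shows "prob {S \<in> space P. card (S \<inter> B) \<in> {n..}} =
    1 - exp (- measure lborel B) * (\<Sum>k<n. measure lborel B ^ k / fact k)"
proof -
  have "{S \<in> space P. card (S \<inter> B) \<in> {n..}} = space P - {S \<in> space P. card (S \<inter> B) \<in> {..<n}}" by auto
  then show ?thesis using prob_compl[OF count_event[OF assms, of "{..<n}"]] prob_count_less[OF assms, of n] by simp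
qed

text \<open>The remainder of the exponential series in Lagrange form, whose factor
  \<open>exp (t - a)\<close> is at most 1.\<close>

lemma prob_count_ge_le:
  assumes "B \<in> sets borel" "bounded B"
  shows "prob {S \<in> space P. card (S \<inter> B) \<in> {n..}} \<le> measure lborel B ^ n / fact n"
proof -
  define a where "a = measure lborel B"
  have a: "a \<ge> 0" by (simp add: a_def)
  obtain t where t: "\<bar>t\<bar> \<le> \<bar>a\<bar>" "exp a = (\<Sum>m<n. a ^ m / fact m) + exp t / fact n * a ^ n"
    using Maclaurin_exp_le[of a n] by blast
  have "1 - exp (- a) * (\<Sum>k<n. a ^ k / fact k) = exp (- a) * (exp a - (\<Sum>k<n. a ^ k / fact k))"
    by (simp add: right_diff_distrib mult_exp_exp)
  also have "\<dots> = exp (- a) * (exp t / fact n * a ^ n)" unfolding t(2) by simp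
  also have "\<dots> = exp (t - a) * (a ^ n / fact n)" by (simp add: exp_diff exp_minus divide_inverse)
  also have "\<dots> \<le> 1 * (a ^ n / fact n)" using t(1) a by (intro mult_right_mono) auto
  finally show ?thesis using prob_count_ge[OF assms, of n] by (simp add: a_def)
qed

lemma prob_nonempty:
  assumes "B \<in> sets borel" "bounded B"
  shows "prob {S \<in> space P. card (S \<inter> B) \<in> {1..}} = 1 - exp (- measure lborel B)"
  using prob_count_ge[OF assms, of 1] by simp

text \<open>From \<open>exp a \<ge> 1 + a + a\<^sup>2 / 2\<close>; the constant 1/4 instead of 1/2
  absorbs the terms of higher order.\<close>

lemma prob_at_most_one:
  assumes "B \<in> sets borel" "bounded B" and small: "measure lborel B \<le> 1 / 2"
  shows "prob {S \<in> space P. card (S \<inter> B) \<in> {..<2}} \<le> 1 - (measure lborel B)\<^sup>2 / 4"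
proof -
  define a where "a = measure lborel B"
  have a: "0 \<le> a" "a \<le> 1/2" using small by (simp_all add: a_def)
  have e: "1 + a + a\<^sup>2 / 2 \<le> exp a" using exp_lower_Taylor_quadratic[of a] a by simp
  have q: "a\<^sup>2 \<le> 1/4" using a power_mono[of a "1/2" 2] by (simp add: power2_eq_square)
  have "1 + a \<le> (1 + a + a\<^sup>2 / 2) * (1 - a\<^sup>2 / 4)"
  proof -
    have "(1 + a + a\<^sup>2 / 2) * (1 - a\<^sup>2 / 4) - (1 + a) = a\<^sup>2 * (1 / 4 - a / 4 - a\<^sup>2 / 8)"
      by (simp add: power2_eq_square algebra_simps)
    also have "\<dots> \<ge> 0" using a q by (intro mult_nonneg_nonneg) auto
    finally show ?thesis by simp
  qed
  also have "\<dots> \<le> exp a * (1 - a\<^sup>2 / 4)" using e q by (intro mult_right_mono) auto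
  finally have "exp (- a) * (1 + a) \<le> exp (- a) * (exp a * (1 - a\<^sup>2 / 4))" by (intro mult_left_mono) auto
  then have "exp (- a) * (1 + a) \<le> 1 - a\<^sup>2 / 4" by (simp add: mult.assoc[symmetric] mult_exp_exp)
  moreover have "{..<2::nat} = {0, 1}" by auto
  ultimately show ?thesis using prob_count_less[OF assms(1,2), of 2] by (simp add: a_def)
qed

lemma prob_Bex_le:
  fixes c :: real
  assumes "finite I" and "\<And>i. i \<in> I \<Longrightarrow> {S \<in> space P. Q i S} \<in> events"
    and "\<And>i. i \<in> I \<Longrightarrow> prob {S \<in> space P. Q i S} \<le> c"
  shows "{S \<in> space P. \<exists>i\<in>I. Q i S} \<in> events" "prob {S \<in> space P. \<exists>i\<in>I. Q i S} \<le> card I * c"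
proof -
  show "{S \<in> space P. \<exists>i\<in>I. Q i S} \<in> events"
    using assms by (intro sets.sets_Collect_finite_Ex) auto
  have "{S \<in> space P. \<exists>i\<in>I. Q i S} = (\<Union>i\<in>I. {S \<in> space P. Q i S})" by auto
  also have "prob \<dots> \<le> (\<Sum>i\<in>I. prob {S \<in> space P. Q i S})"
    by (rule finite_measure_subadditive_finite) (use assms in auto)
  also have "\<dots> \<le> (\<Sum>i\<in>I. c)" using assms by (intro sum_mono)
  finally show "prob {S \<in> space P. \<exists>i\<in>I. Q i S} \<le> card I * c" by simp
qed

end

section \<open>Windows that force a spot\<close>

lemma lborel_grid_box:
  assumes "e > 0" shows "emeasure lborel (grid_box c e i j) = ennreal (e\<^sup>2)"
proof -
  define a :: pt where "a = vector [c$1 + e * of_int i, c$2 + e * of_int j]"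
  define b :: pt where "b = vector [c$1 + e * (of_int i + 1), c$2 + e * (of_int j + 1)]"
  have ab: "a$1 = c$1 + e * of_int i" "a$2 = c$2 + e * of_int j"
    "b$1 = c$1 + e * (of_int i + 1)" "b$2 = c$2 + e * (of_int j + 1)" by (simp_all add: a_def b_def)
  have sub: "box a b \<subseteq> grid_box c e i j" "grid_box c e i j \<subseteq> cbox a b"
    unfolding grid_box_def by (auto simp: mem_box_cart forall_2 ab intro: less_imp_le)
  have le: "a \<bullet> k \<le> b \<bullet> k" if "k \<in> Basis" for k
  proof -
    have "a \<le> b" using assms by (simp add: less_eq_vec_def forall_2 ab)
    then show ?thesis using that by (simp add: eucl_le[where 'a = "real^2"])
  qed
  have pr: "(\<Prod>k\<in>Basis. (b - a) \<bullet> k) = e\<^sup>2"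
  proof -
    have "measure lborel (cbox a b) = (\<Prod>i\<in>UNIV. b$i - a$i)"
      using le by (intro content_cbox_cart) (simp add: box_ne_empty)
    also have "\<dots> = e\<^sup>2" by (simp add: UNIV_2 ab algebra_simps power2_eq_square)
    finally show ?thesis using le by (simp add: content_cbox)
  qed
  have "emeasure lborel (box a b) = ennreal (e\<^sup>2)" "emeasure lborel (cbox a b) = ennreal (e\<^sup>2)"
    using le pr by (simp_all add: emeasure_lborel_box emeasure_lborel_cbox)
  moreover have "emeasure lborel (box a b) \<le> emeasure lborel (grid_box c e i j)"
    "emeasure lborel (grid_box c e i j) \<le> emeasure lborel (cbox a b)"
    using sub grid_box_borel by (auto intro!: emeasure_mono)
  ultimately show ?thesis by (simp add: order_antisym)
qed

lemma measure_grid_box: "e > 0 \<Longrightarrow> measure lborel (grid_box c e i j) = e\<^sup>2"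
  by (simp add: measure_def lborel_grid_box)

definition lattice_cell :: "pt \<Rightarrow> int \<Rightarrow> int \<Rightarrow> pt set" where
  "lattice_cell c i j = {z. near z (c + lattice_pt i j)}"

definition half :: "real \<Rightarrow> pt" where
  "half t = vector [t / 2, t / 2]"

lemma half_nth [simp]: "half t $ 1 = t / 2" "half t $ 2 = t / 2"
  by (simp_all add: half_def)

text \<open>The window around \<open>c\<close> is tiled by boxes of side 5. The tag 0 stands for those of them that are
  required to be nonempty. The central \<open>21 \<times> 21\<close> of them are cut into unit boxes, in which the only
  point has to be close to the lattice point (tag 1) and not elsewhere (tag 2).\<close>

definition window_cell :: "pt \<Rightarrow> nat \<times> int \<times> int \<Rightarrow> pt set" where
  "window_cell c = (\<lambda>(t, i, j). if t = 0 then grid_box (c - half 5) 5 i j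
     else if t = 1 then lattice_cell c i j else grid_box (c - half 1) 1 i j - lattice_cell c i j)"

definition window_count :: "nat \<times> int \<times> int \<Rightarrow> nat set" where
  "window_count = (\<lambda>(t, i, j). if t = 0 then {1..} else if t = 1 then {1} else {0})"

definition outer_index :: "nat \<Rightarrow> (int \<times> int) set" where
  "outer_index n = {- int (10 * n)..int (10 * n)} \<times> {- int (10 * n)..int (10 * n)} - {-10..10} \<times> {-10..10}"

definition core_index :: "(int \<times> int) set" where
  "core_index = {-52..52} \<times> {-52..52}"

definition window_index :: "nat \<Rightarrow> (nat \<times> int \<times> int) set" where
  "window_index n = {0} \<times> outer_index n \<union> {1, 2} \<times> core_index"

lemma finite_window_index: "finite (window_index n)"
  by (simp add: window_index_def outer_index_def core_index_def)

lemma window_index_cases: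
  assumes "x \<in> window_index n"
  obtains (outer) i j where "x = (0, i, j)" "(i, j) \<in> outer_index n"
  | (lat) i j where "x = (1, i, j)" "(i, j) \<in> core_index"
  | (rest) i j where "x = (2, i, j)" "(i, j) \<in> core_index"
  using assms unfolding window_index_def by auto

lemma lattice_cell_subset: "lattice_cell c i j \<subseteq> grid_box (c - half 1) 1 i j"
proof
  fix z assume "z \<in> lattice_cell c i j"
  then have "near z (c + lattice_pt i j)" by (simp add: lattice_cell_def)
  note l = near_lattice[OF this]
  from l[THEN abs_le_D1] l[THEN abs_le_D2] show "z \<in> grid_box (c - half 1) 1 i j"
    by (simp add: grid_box_def)
qed

lemma lattice_cell_cbox:
  "lattice_cell c i j = cbox (c + lattice_pt i j - half (1/500)) (c + lattice_pt i j + half (1/500))"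
  unfolding lattice_cell_def near_def set_eq_iff mem_Collect_eq mem_box_cart forall_2
    vector_minus_component vector_add_component half_nth abs_le_iff
  by auto

lemma lattice_cell_borel: "lattice_cell c i j \<in> sets borel"
  by (simp add: lattice_cell_cbox)

lemma measure_lattice_cell: "measure lborel (lattice_cell c i j) = (1/500)\<^sup>2"
proof -
  have "cbox (c + lattice_pt i j - half (1/500)) (c + lattice_pt i j + half (1/500)) \<noteq> {}"
    by (simp add: interval_ne_empty_cart forall_2)
  from content_cbox_cart[OF this] show ?thesis
    unfolding lattice_cell_cbox by (simp add: UNIV_2 power2_eq_square)
qed

lemma measure_lattice_rest: "measure lborel (grid_box (c - half 1) 1 i j - lattice_cell c i j) = 1 - (1/500)\<^sup>2"
proof -
  have "measure lborel (grid_box (c - half 1) 1 i j - lattice_cell c i j) =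
      measure lborel (grid_box (c - half 1) 1 i j) - measure lborel (lattice_cell c i j)"
    by (rule measure_Diff)
       (use lattice_cell_subset lattice_cell_borel grid_box_borel lborel_grid_box[of 1] in auto)
  then show ?thesis by (simp add: measure_grid_box measure_lattice_cell)
qed

lemma window_cell_borel: "window_cell c x \<in> sets borel"
  by (auto simp: window_cell_def lattice_cell_borel split: prod.split)

lemma window_cell_bounded: "bounded (window_cell c x)"
  using bounded_subset[OF grid_box_bounded lattice_cell_subset] bounded_subset[OF grid_box_bounded Diff_subset]
  by (auto simp: window_cell_def grid_box_bounded split: prod.split)

lemma grid_box_centered:
  assumes "z \<in> grid_box (c - half e) e i j"
  shows "e * (of_int i - 1/2) \<le> z$1 - c$1" "z$1 - c$1 < e * (of_int i + 1/2)"
    "e * (of_int j - 1/2) \<le> z$2 - c$2" "z$2 - c$2 < e * (of_int j + 1/2)"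
  using assms by (simp_all add: grid_box_def algebra_simps)

lemma core_cell_bound:
  assumes "(i, j) \<in> core_index" "z \<in> grid_box (c - half 1) 1 i j"
  shows "- (105/2) \<le> z$1 - c$1" "z$1 - c$1 < 105/2" "- (105/2) \<le> z$2 - c$2" "z$2 - c$2 < 105/2"
proof -
  have "real_of_int i \<le> 52" "real_of_int i \<ge> -52" "real_of_int j \<le> 52" "real_of_int j \<ge> -52"
    using assms(1) by (auto simp: core_index_def)
  with grid_box_centered[OF assms(2)] show "- (105/2) \<le> z$1 - c$1" "z$1 - c$1 < 105/2"
    "- (105/2) \<le> z$2 - c$2" "z$2 - c$2 < 105/2" by simp_all
qed

lemma window_cell_core_subset:
  assumes "t \<noteq> 0" shows "window_cell c (t, i, j) \<subseteq> grid_box (c - half 1) 1 i j"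
  using assms lattice_cell_subset by (auto simp: window_cell_def)

lemma window_cell_bound:
  assumes x: "x \<in> window_index n" and z: "z \<in> window_cell c x" and n: "n \<ge> 1"
  shows "- (50 * real n + 5/2) \<le> z$1 - c$1" "z$1 - c$1 < 50 * real n + 5/2"
    "- (50 * real n + 5/2) \<le> z$2 - c$2" "z$2 - c$2 < 50 * real n + 5/2"
proof -
  have n': "real n \<ge> 1" using n by simp
  from x have "- (50 * real n + 5/2) \<le> z$1 - c$1 \<and> z$1 - c$1 < 50 * real n + 5/2 \<and>
    - (50 * real n + 5/2) \<le> z$2 - c$2 \<and> z$2 - c$2 < 50 * real n + 5/2"
  proof (cases rule: window_index_cases)
    case (outer i j)
    then have zb: "z \<in> grid_box (c - half 5) 5 i j" using z by (simp add: window_cell_def)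
    have "\<bar>i\<bar> \<le> int (10 * n)" "\<bar>j\<bar> \<le> int (10 * n)" using outer by (auto simp: outer_index_def)
    then have "\<bar>real_of_int i\<bar> \<le> 10 * real n" "\<bar>real_of_int j\<bar> \<le> 10 * real n" by linarith+
    then have "real_of_int i \<le> 10 * real n" "- real_of_int i \<le> 10 * real n"
      "real_of_int j \<le> 10 * real n" "- real_of_int j \<le> 10 * real n" by linarith+
    then show ?thesis using grid_box_centered[OF zb] by simp
  next
    case (lat i j)
    then have "z \<in> grid_box (c - half 1) 1 i j" using z window_cell_core_subset[of 1 c i j] by auto
    from core_cell_bound[OF lat(2) this] show ?thesis using n' by (intro conjI) linarith+
  next
    case (rest i j)
    then have "z \<in> grid_box (c - half 1) 1 i j" using z window_cell_core_subset[of 2 c i j] by auto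
    from core_cell_bound[OF rest(2) this] show ?thesis using n' by (intro conjI) linarith+
  qed
  then show "- (50 * real n + 5/2) \<le> z$1 - c$1" "z$1 - c$1 < 50 * real n + 5/2"
    "- (50 * real n + 5/2) \<le> z$2 - c$2" "z$2 - c$2 < 50 * real n + 5/2" by blast+
qed

text \<open>Unit boxes with indices up to 52 and boxes of side 5 with indices up to 10 cover the
  same square, since \<open>52 + 1/2 = 5 * (10 + 1/2)\<close>.\<close>

lemma outer_core_disjoint:
  assumes "(i, j) \<in> outer_index n" "z \<in> grid_box (c - half 5) 5 i j"
    "(k, l) \<in> core_index" "z \<in> grid_box (c - half 1) 1 k l"
  shows False
proof -
  note b = grid_box_centered[OF assms(2)] core_cell_bound[OF assms(3,4)]
  have "5 * (real_of_int i - 1/2) < 105/2" "- 105/2 < 5 * (real_of_int i + 1/2)"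
    "5 * (real_of_int j - 1/2) < 105/2" "- 105/2 < 5 * (real_of_int j + 1/2)"
    using b by linarith+
  then have "real_of_int i < 11" "-11 < real_of_int i" "real_of_int j < 11" "-11 < real_of_int j" by auto
  then have "i < 11" "-11 < i" "j < 11" "-11 < j" by linarith+
  then show False using assms(1) by (auto simp: outer_index_def)
qed

lemma window_cells_disjoint:
  assumes x: "x \<in> window_index n" and y: "y \<in> window_index n" and xy: "x \<noteq> y"
  shows "window_cell c x \<inter> window_cell c y = {}"
proof (rule ccontr)
  assume "window_cell c x \<inter> window_cell c y \<noteq> {}"
  then obtain z where zx: "z \<in> window_cell c x" and zy: "z \<in> window_cell c y" by blast
  obtain t i j where x': "x = (t, i, j)" by (cases x)
  obtain s k l where y': "y = (s, k, l)" by (cases y)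
  have ox: "t = 0 \<Longrightarrow> (i, j) \<in> outer_index n \<and> z \<in> grid_box (c - half 5) 5 i j"
    and oy: "s = 0 \<Longrightarrow> (k, l) \<in> outer_index n \<and> z \<in> grid_box (c - half 5) 5 k l"
    using x y zx zy by (auto simp: x' y' window_index_def window_cell_def)
  have cx: "t \<noteq> 0 \<Longrightarrow> (i, j) \<in> core_index \<and> z \<in> grid_box (c - half 1) 1 i j"
    and cy: "s \<noteq> 0 \<Longrightarrow> (k, l) \<in> core_index \<and> z \<in> grid_box (c - half 1) 1 k l"
    using x y zx zy window_cell_core_subset[of t c i j] window_cell_core_subset[of s c k l]
    by (auto simp: x' y' window_index_def)
  consider "t = 0" "s = 0" | "t = 0" "s \<noteq> 0" | "t \<noteq> 0" "s = 0" | "t \<noteq> 0" "s \<noteq> 0" by blast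
  then show False
  proof cases
    case 1
    then show False using ox oy grid_box_disjoint[of 5 i j k l] xy by (auto simp: x' y')
  next
    case 2
    then show False using ox cy outer_core_disjoint by blast
  next
    case 3
    then show False using oy cx outer_core_disjoint by blast
  next
    case 4
    then have ij: "(i, j) = (k, l)" using cx cy grid_box_disjoint[of 1 i j k l "c - half 1"] by fastforce
    have "t \<in> {1, 2}" "s \<in> {1, 2}" using x y 4 by (auto simp: x' y' window_index_def)
    then show False using xy ij zx zy by (auto simp: x' y' window_cell_def)
  qed
qed

text \<open>Boxes of side 5 have diameter below 10, so there is no empty disc of radius 10 with
  centre in the window. The length \<open>28 * n\<close> is twice the radius \<open>14 * n\<close>
  that later bounds empty discs, and \<open>28 * n + 35 \<le> 50 * n\<close> uses
  \<open>n \<ge> 2\<close>.\<close>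

lemma window_pattern_spot:
  assumes S: "locfin S" and n: "n \<ge> 2"
    and pat: "\<forall>x\<in>window_index n. card (S \<inter> window_cell c x) \<in> window_count x"
  obtains s where "spot (28 * n) S s" "near s c"
proof -
  have fin: "finite (S \<inter> window_cell c x)" for x
    using S window_cell_bounded by (simp add: locfin_def)
  have lat: "card (S \<inter> lattice_cell c i j) = 1" if "(i, j) \<in> core_index" for i j
    using pat[rule_format, of "(1, i, j)"] that by (auto simp: window_index_def window_cell_def window_count_def)
  have rest: "S \<inter> grid_box (c - half 1) 1 i j \<subseteq> lattice_cell c i j" if "(i, j) \<in> core_index" for i j
  proof -
    have "card (S \<inter> window_cell c (2, i, j)) = 0"
      using pat[rule_format, of "(2, i, j)"] that by (auto simp: window_index_def window_count_def)
    then have "S \<inter> window_cell c (2, i, j) = {}" using fin by simp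
    then show ?thesis by (auto simp: window_cell_def)
  qed
  have outer: "S \<inter> grid_box (c - half 5) 5 i j \<noteq> {}" if "(i, j) \<in> outer_index n" for i j
    using pat[rule_format, of "(0, i, j)"] that
    by (auto simp: window_index_def window_cell_def window_count_def)
  have core: "(i, j) \<in> core_index \<longleftrightarrow> \<bar>i\<bar> \<le> 52 \<and> \<bar>j\<bar> \<le> 52" for i j
    by (auto simp: core_index_def)
  have in_core: "\<exists>i j. (i, j) \<in> core_index \<and> z \<in> grid_box (c - half 1) 1 i j"
    if z: "- 105/2 \<le> z$1 - c$1" "z$1 - c$1 < 105/2" "- 105/2 \<le> z$2 - c$2" "z$2 - c$2 < 105/2" for z
  proof -
    obtain i j where ij: "z \<in> grid_box (c - half 1) 1 i j" using grid_box_ex[of 1] by fastforce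
    from grid_box_centered[OF this] z have "real_of_int i < 53" "-53 < real_of_int i" "real_of_int j < 53" "-53 < real_of_int j"
      by auto
    then have "(i, j) \<in> core_index" by (auto simp: core_index_def)
    then show ?thesis using ij by blast
  qed
  have ex1: "\<exists>x\<in>S. near x (c + lattice_pt i j)" if "\<bar>i\<bar> \<le> 52" "\<bar>j\<bar> \<le> 52" for i j
  proof -
    have "S \<inter> lattice_cell c i j \<noteq> {}" using lat[of i j] that core by force
    then show ?thesis by (auto simp: lattice_cell_def)
  qed
  obtain s where "spot (28 * real n) S s" "near s c"
  proof (rule pattern_spot[of S c "50 * real n" "28 * real n"])
    show "\<exists>x\<in>S. near x (c + lattice_pt i j)" if "\<bar>i\<bar> \<le> 52" "\<bar>j\<bar> \<le> 52" for i j using ex1 that .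
    show "x = y" if "\<bar>i\<bar> \<le> 52" "\<bar>j\<bar> \<le> 52" "x \<in> S" "y \<in> S" "near x (c + lattice_pt i j)"
        "near y (c + lattice_pt i j)" for x y i j
    proof -
      have "x \<in> S \<inter> lattice_cell c i j" "y \<in> S \<inter> lattice_cell c i j" using that by (auto simp: lattice_cell_def)
      then show ?thesis using lat[of i j] that(1,2) core by (metis card_1_singletonE singletonD)
    qed
    show "\<exists>i j. \<bar>i\<bar> \<le> 52 \<and> \<bar>j\<bar> \<le> 52 \<and> near x (c + lattice_pt i j)"
      if "x \<in> S" "\<bar>x$1 - c$1\<bar> < 52" "\<bar>x$2 - c$2\<bar> < 52" for x
    proof -
      have "- 105/2 \<le> x$1 - c$1" "x$1 - c$1 < 105/2" "- 105/2 \<le> x$2 - c$2" "x$2 - c$2 < 105/2"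
        using that by linarith+
      then obtain i j where "(i, j) \<in> core_index" "x \<in> grid_box (c - half 1) 1 i j"
        using in_core[of x] by blast
      then show ?thesis using rest[of i j] that core by (auto simp: lattice_cell_def)
    qed
    show "\<exists>x\<in>S. dist z x < 10" if z: "\<bar>z$1 - c$1\<bar> \<le> 50 * real n" "\<bar>z$2 - c$2\<bar> \<le> 50 * real n" for z
    proof (cases "- 105/2 \<le> z$1 - c$1 \<and> z$1 - c$1 < 105/2 \<and> - 105/2 \<le> z$2 - c$2 \<and> z$2 - c$2 < 105/2")
      case True
      then obtain i j where ij: "(i, j) \<in> core_index" "z \<in> grid_box (c - half 1) 1 i j" using in_core by blast
      obtain x where x: "x \<in> S" "near x (c + lattice_pt i j)" using ex1 ij core by blast
      have "x \<in> grid_box (c - half 1) 1 i j" using lattice_cell_subset x by (auto simp: lattice_cell_def)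
      then have "dist z x < 2 * 1" using grid_box_dist ij by blast
      then show ?thesis using x by force
    next
      case False
      obtain i j where ij: "z \<in> grid_box (c - half 5) 5 i j" using grid_box_ex[of 5] by fastforce
      note b = grid_box_centered[OF ij]
      have "real_of_int i < 10 * real n + 1" "-(10 * real n + 1) < real_of_int i" "real_of_int j < 10 * real n + 1" "-(10 * real n + 1) < real_of_int j"
        using b z by (auto simp: abs_le_iff)
      then have "i \<le> int (10 * n)" "- int (10 * n) \<le> i" "j \<le> int (10 * n)" "- int (10 * n) \<le> j" by linarith+
      moreover have "\<not> (-10 \<le> i \<and> i \<le> 10 \<and> -10 \<le> j \<and> j \<le> 10)"
      proof
        assume "-10 \<le> i \<and> i \<le> 10 \<and> -10 \<le> j \<and> j \<le> 10"
        then have "-10 \<le> real_of_int i" "real_of_int i \<le> 10" "-10 \<le> real_of_int j" "real_of_int j \<le> 10" by linarith+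
        then show False using b False by auto
      qed
      ultimately have "(i, j) \<in> outer_index n" by (auto simp: outer_index_def)
      then obtain x where "x \<in> S" "x \<in> grid_box (c - half 5) 5 i j" using outer by blast
      moreover from this have "dist z x < 2 * 5" using grid_box_dist ij by blast
      ultimately show ?thesis by force
    qed
    show "28 * real n + 35 \<le> 50 * real n" using n by simp
  qed
  then show thesis using that by simp
qed

text \<open>The core costs a constant factor. Outside it there are at most
  \<open>441 * n\<^sup>2\<close> boxes, each nonempty with probability \<open>1 - exp (-25)\<close>,
  and \<open>(1 - exp (-25)) ^ 441 \<ge> 1/2\<close> by Bernoulli's inequality. Hence the choice of
  \<open>2 ^ n\<^sup>2\<close> as the scale.\<close>

lemma (in poisson) prob_window_pattern:
  fixes n :: nat
  defines "K0 \<equiv> ((1/500)\<^sup>2 * exp (-1)) ^ card core_index"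
  assumes n: "n \<ge> 1"
  shows "(\<Prod>x\<in>window_index n. prob {S \<in> space P. card (S \<inter> window_cell c x) \<in> window_count x}) \<ge> K0 / 2 ^ n\<^sup>2"
proof -
  define f where "f x = prob {S \<in> space P. card (S \<inter> window_cell c x) \<in> window_count x}" for x
  note wb = window_cell_borel window_cell_bounded
  have f0: "f (0, i, j) = 1 - exp (- 25)" for i j
    unfolding f_def window_count_def using prob_nonempty[OF wb, of c "(0, i, j)"]
    by (simp add: window_cell_def measure_grid_box)
  have f1: "f (1, i, j) = exp (- ((1/500)\<^sup>2)) * (1/500)\<^sup>2" for i j
    unfolding f_def window_count_def using prob_single[OF wb, of c "(1, i, j)"]
    by (simp add: window_cell_def measure_lattice_cell)
  have f2: "f (2, i, j) = exp (- (1 - (1/500)\<^sup>2))" for i j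
    unfolding f_def window_count_def using prob_empty[OF wb, of c "(2, i, j)"]
    by (simp add: window_cell_def measure_lattice_rest)
  have fin: "finite (outer_index n)" "finite core_index" by (simp_all add: outer_index_def core_index_def)
  have prod_tag: "(\<Prod>x\<in>{t} \<times> X. f x) = (\<Prod>y\<in>X. f (t, y))" for t and X :: "(int \<times> int) set"
    by (rule prod.reindex_bij_witness[of _ "\<lambda>y. (t, y)" snd]) auto
  define X where "X t = {t} \<times> core_index" for t :: nat
  define Y where "Y = {0 :: nat} \<times> outer_index n"
  have finXY: "finite (X t)" "finite Y" for t using fin by (simp_all add: X_def Y_def)
  have disj: "X 1 \<inter> X 2 = {}" "Y \<inter> (X 1 \<union> X 2) = {}" by (auto simp: X_def Y_def)
  have "window_index n = Y \<union> (X 1 \<union> X 2)"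
    by (auto simp: window_index_def X_def Y_def)
  then have "(\<Prod>x\<in>window_index n. f x) = (\<Prod>x\<in>Y. f x) * ((\<Prod>x\<in>X 1. f x) * (\<Prod>x\<in>X 2. f x))"
    using finXY disj by (simp only: prod.union_disjoint finite_Un simp_thms)
  also have "(\<Prod>x\<in>Y. f x) = (1 - exp (-25)) ^ card (outer_index n)"
  proof -
    have "f (0, y) = 1 - exp (-25)" for y using f0 by (cases y) simp
    then show ?thesis unfolding Y_def prod_tag by simp
  qed
  also have "(\<Prod>x\<in>X 1. f x) = (exp (- ((1/500)\<^sup>2)) * (1/500)\<^sup>2) ^ card core_index"
  proof -
    have "f (1, y) = exp (- ((1/500)\<^sup>2)) * (1/500)\<^sup>2" for y using f1 by (cases y) simp
    then show ?thesis unfolding X_def prod_tag by simp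
  qed
  also have "(\<Prod>x\<in>X 2. f x) = exp (- (1 - (1/500)\<^sup>2)) ^ card core_index"
  proof -
    have "f (2, y) = exp (- (1 - (1/500)\<^sup>2))" for y using f2 by (cases y) simp
    then show ?thesis unfolding X_def prod_tag by simp
  qed
  also have "(1 - exp (-25)) ^ card (outer_index n) *
      ((exp (- ((1/500)\<^sup>2)) * (1/500)\<^sup>2) ^ card core_index * exp (- (1 - (1/500)\<^sup>2)) ^ card core_index)
    = (1 - exp (-25)) ^ card (outer_index n) * K0"
  proof -
    have "exp (- ((1/500)\<^sup>2)) * (1/500)\<^sup>2 * exp (- (1 - (1/500)\<^sup>2)) = (1/500)\<^sup>2 * exp (-1 :: real)"
      by (simp add: mult_exp_exp)
    then show ?thesis unfolding K0_def power_mult_distrib[symmetric] by (simp only:)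
  qed
  finally have eq: "(\<Prod>x\<in>window_index n. f x) = (1 - exp (-25)) ^ card (outer_index n) * K0" .
  have e: "0 \<le> 1 - exp (-25 :: real)" "1 - exp (-25 :: real) \<le> 1" by simp_all
  have co: "card (outer_index n) \<le> 441 * n\<^sup>2"
  proof -
    have "card (outer_index n) \<le> card ({- int (10 * n)..int (10 * n)} \<times> {- int (10 * n)..int (10 * n)})"
      unfolding outer_index_def by (intro card_mono) auto
    also have "\<dots> = (20 * n + 1)\<^sup>2" by (simp add: card_cartesian_product power2_eq_square nat_add_distrib nat_mult_distrib algebra_simps)
    also have "\<dots> \<le> (21 * n)\<^sup>2" using n by (intro power_mono) auto
    finally show ?thesis by (simp add: power_mult_distrib)
  qed
  have half: "1/2 \<le> (1 - exp (-25 :: real)) ^ 441"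
  proof -
    have "(2::real) ^ 25 \<le> exp 1 ^ 25" using exp_ge_add_one_self[of 1] by (intro power_mono) auto
    also have "\<dots> = exp 25" by (simp add: exp_of_nat_mult[symmetric])
    finally have "exp (-25) \<le> (1 / 2 ^ 25 :: real)" by (simp add: exp_minus field_simps)
    then have "1/2 \<le> 1 + real 441 * (- exp (-25))" by simp
    also have "\<dots> \<le> (1 + (- exp (-25))) ^ 441" by (rule Bernoulli_inequality) simp
    finally show ?thesis by simp
  qed
  have "1 / 2 ^ n\<^sup>2 = (1/2 :: real) ^ n\<^sup>2" by (simp add: power_one_over)
  also have "\<dots> \<le> ((1 - exp (-25)) ^ 441) ^ n\<^sup>2" using half by (intro power_mono) auto
  also have "\<dots> = (1 - exp (-25)) ^ (441 * n\<^sup>2)" by (simp add: power_mult)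
  also have "\<dots> \<le> (1 - exp (-25)) ^ card (outer_index n)" using e co by (intro power_decreasing)
  finally have "1 / 2 ^ n\<^sup>2 * K0 \<le> (1 - exp (-25)) ^ card (outer_index n) * K0"
    by (intro mult_right_mono) (auto simp: K0_def)
  then show ?thesis using eq by (simp add: f_def)
qed

section \<open>Covering discs and rings by boxes\<close>

definition square :: "nat \<Rightarrow> (int \<times> int) set" where
  "square m = {- int m..int m} \<times> {- int m..int m}"

lemma finite_square [simp]: "finite (square m)"
  by (simp add: square_def)

lemma card_square: "card (square m) = (2 * m + 1)\<^sup>2"
  by (simp add: square_def card_cartesian_product power2_eq_square nat_add_distrib nat_mult_distrib algebra_simps)

lemma square_cover:
  assumes e: "e > 0" and z: "\<bar>z$1 - q$1\<bar> \<le> e * m" "\<bar>z$2 - q$2\<bar> \<le> e * m"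
  obtains i j where "(i, j) \<in> square m" "z \<in> grid_box q e i j"
proof -
  have *: "- int m \<le> \<lfloor>t / e\<rfloor> \<and> \<lfloor>t / e\<rfloor> \<le> int m" if "\<bar>t\<bar> \<le> e * m" for t
  proof -
    have "- real m \<le> t / e" "t / e \<le> real m"
      using that e by (simp_all add: abs_le_iff field_simps)
    then show ?thesis by (auto simp: le_floor_iff floor_le_iff)
  qed
  show thesis
    by (rule that[of "\<lfloor>(z$1 - q$1) / e\<rfloor>" "\<lfloor>(z$2 - q$2) / e\<rfloor>"])
       (use * z e in \<open>auto simp: square_def grid_box_mem_iff\<close>)
qed

lemma square_cover_dist:
  assumes "e > 0" "dist q z \<le> e * m"
  obtains i j where "(i, j) \<in> square m" "z \<in> grid_box q e i j"
  using square_cover[OF assms(1), of z q m] component_le_dist[of z 1 q] component_le_dist[of z 2 q] assms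
  by (auto simp: dist_commute)

text \<open>Disjoint boxes that meet the ring lie in a slightly wider annulus, whose area bounds
  their number. When the wider annulus reaches the centre, the outer disc alone gives the
  bound.\<close>

lemma ring_count:
  fixes e r t :: real
  assumes I: "finite I" and e: "e > 0" and r: "r \<ge> 0" "t \<ge> 0"
    and ring: "\<And>i j. (i, j) \<in> I \<Longrightarrow> \<exists>p\<in>grid_box q e i j. \<bar>dist q p - r\<bar> \<le> t"
  shows "card I * e\<^sup>2 \<le> 4 * pi * (t + 2 * e) * (r + t + 2 * e)"
proof -
  define t' where "t' = t + 2 * e"
  have t': "t' > 0" using r e by (simp add: t'_def)
  define A where "A = ball q (r + t') - ball q (r - t')"
  define b where "b x = grid_box q e (fst x) (snd x)" for x
  have sub: "b x \<subseteq> A" if "x \<in> I" for x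
  proof
    fix z assume z: "z \<in> b x"
    have "(fst x, snd x) \<in> I" using that by simp
    then obtain p where p: "p \<in> b x" "\<bar>dist q p - r\<bar> \<le> t" using ring unfolding b_def by blast
    have "dist p z < 2 * e" using grid_box_dist p z unfolding b_def by blast
    then have "dist q z < r + t'" "r - t' < dist q z"
      using p(2) dist_triangle[of q z p] dist_triangle[of q p z] dist_commute[of p z] unfolding t'_def by linarith+
    then show "z \<in> A" by (simp add: A_def)
  qed
  have disj: "disjoint_family_on b I"
    unfolding disjoint_family_on_def b_def using grid_box_disjoint[OF e] by (metis prod.collapse)
  have "emeasure lborel (\<Union>x\<in>I. b x) = (\<Sum>x\<in>I. emeasure lborel (b x))"
    by (rule sum_emeasure[symmetric, OF _ disj I]) (auto simp: b_def)
  also have "\<dots> = ennreal (card I * e\<^sup>2)"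
    using e by (simp add: b_def lborel_grid_box ennreal_mult ennreal_of_nat_eq_real_of_nat)
  finally have U: "emeasure lborel (\<Union>x\<in>I. b x) = ennreal (card I * e\<^sup>2)" .
  have circ: "emeasure lborel (ball q s) = ennreal (s\<^sup>2 * pi)" if "s \<ge> 0" for s
    using that emeasure_ball[of s q] by (simp add: unit_ball_vol_2 mult.commute)
  have "emeasure lborel (\<Union>x\<in>I. b x) \<le> emeasure lborel A"
    using sub by (intro emeasure_mono) (auto simp: A_def)
  also have "emeasure lborel A \<le> ennreal (4 * pi * t' * (r + t'))"
  proof (cases "r \<ge> t'")
    case True
    have "emeasure lborel A = emeasure lborel (ball q (r + t')) - emeasure lborel (ball q (r - t'))"
      unfolding A_def using True t' circ[of "r - t'"] by (intro emeasure_Diff) auto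
    also have "\<dots> = ennreal ((r + t')\<^sup>2 * pi - (r - t')\<^sup>2 * pi)"
      using True t' r by (simp add: circ ennreal_minus)
    also have "(r + t')\<^sup>2 * pi - (r - t')\<^sup>2 * pi = 4 * pi * t' * r"
      by (simp add: power2_eq_square algebra_simps)
    also have "\<dots> \<le> 4 * pi * t' * (r + t')" using t' by (intro mult_left_mono) auto
    finally show ?thesis by (simp add: ennreal_leI)
  next
    case False
    have "emeasure lborel A \<le> emeasure lborel (ball q (r + t'))"
      by (intro emeasure_mono) (auto simp: A_def)
    also have "\<dots> = ennreal ((r + t')\<^sup>2 * pi)" using r t' by (simp add: circ)
    also have "(r + t')\<^sup>2 * pi \<le> 4 * pi * t' * (r + t')"
    proof -
      have "(r + t') * (r + t') \<le> (4 * t') * (r + t')" using False r t' by (intro mult_right_mono) auto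
      then show ?thesis using mult_right_mono[of _ _ pi] by (fastforce simp: power2_eq_square mult_ac)
    qed
    finally show ?thesis by (simp add: ennreal_leI)
  qed
  finally have "ennreal (card I * e\<^sup>2) \<le> ennreal (4 * pi * t' * (r + t'))" unfolding U .
  then have "card I * e\<^sup>2 \<le> 4 * pi * t' * (r + t')"
    using t' r by (simp add: ennreal_le_iff)
  then show ?thesis by (simp add: t'_def add.assoc)
qed

text \<open>The width of \<open>20 * n + 1\<close> boxes of side 5.\<close>

definition window_side :: "nat \<Rightarrow> real" where
  "window_side n = 100 * real n + 5"

definition window_centre :: "nat \<Rightarrow> pt \<Rightarrow> int \<times> int \<Rightarrow> pt" where
  "window_centre n q x = q + half (window_side n) +
     vector [window_side n * of_int (fst x), window_side n * of_int (snd x)]"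

lemma window_cell_in_grid:
  assumes "n \<ge> 1" "x \<in> window_index n"
  shows "window_cell (window_centre n q (u, v)) x \<subseteq> grid_box q (window_side n) u v"
proof
  fix z assume "z \<in> window_cell (window_centre n q (u, v)) x"
  note b = window_cell_bound[OF assms(2) this assms(1)]
  have c: "window_centre n q (u, v) $ 1 = q$1 + window_side n / 2 + window_side n * of_int u"
    "window_centre n q (u, v) $ 2 = q$2 + window_side n / 2 + window_side n * of_int v"
    by (simp_all add: window_centre_def)
  have a: "50 * real n + 5 / 2 = window_side n / 2" by (simp add: window_side_def)
  show "z \<in> grid_box q (window_side n) u v"
    using b unfolding grid_box_def mem_Collect_eq distrib_left c a by auto
qed

lemma centre_in_grid:
  assumes "n \<ge> 1" "near s (window_centre n q (u, v))"
  shows "s \<in> grid_box q (window_side n) u v"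
proof -
  have "1 / 1000 < window_side n / 2" by (simp add: window_side_def)
  moreover have "window_centre n q (u, v) $ 1 = q$1 + window_side n / 2 + window_side n * of_int u"
    "window_centre n q (u, v) $ 2 = q$2 + window_side n / 2 + window_side n * of_int v"
    by (simp_all add: window_centre_def)
  ultimately show ?thesis
    using assms(2)[unfolded near_def, THEN conjunct1, THEN abs_le_D1] assms(2)[unfolded near_def, THEN conjunct1, THEN abs_le_D2]
      assms(2)[unfolded near_def, THEN conjunct2, THEN abs_le_D1] assms(2)[unfolded near_def, THEN conjunct2, THEN abs_le_D2]
    unfolding grid_box_def by (simp add: algebra_simps)
qed

definition block :: "nat \<Rightarrow> int \<times> int \<Rightarrow> (int \<times> int) set" where
  "block k x = {int k * fst x..<int k * fst x + int k} \<times> {int k * snd x..<int k * snd x + int k}"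

lemma card_block: "finite (block k x)" "card (block k x) = k\<^sup>2"
  by (simp_all add: block_def card_cartesian_product power2_eq_square)

lemma block_grid:
  assumes "a > 0" "(u, v) \<in> block k (i, j)"
  shows "grid_box q a u v \<subseteq> grid_box q (a * k) i j"
proof
  fix z assume z: "z \<in> grid_box q a u v"
  have b: "int k * i \<le> u" "u + 1 \<le> int k * i + int k" "int k * j \<le> v" "v + 1 \<le> int k * j + int k"
    using assms(2) by (auto simp: block_def)
  have "real k * of_int i \<le> of_int u" "of_int u + 1 \<le> real k * of_int i + real k"
    "real k * of_int j \<le> of_int v" "of_int v + 1 \<le> real k * of_int j + real k"
    using b[THEN of_int_le_iff[where 'a = real, THEN iffD2]] by simp_all
  then have "a * (real k * of_int i) \<le> a * of_int u" "a * (of_int u + 1) \<le> a * (real k * of_int i + real k)"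
    "a * (real k * of_int j) \<le> a * of_int v" "a * (of_int v + 1) \<le> a * (real k * of_int j + real k)"
    using assms(1) by (auto intro: mult_left_mono)
  moreover have "q$1 + a * of_int u \<le> z$1" "z$1 < q$1 + a * (of_int u + 1)"
    "q$2 + a * of_int v \<le> z$2" "z$2 < q$2 + a * (of_int v + 1)"
    using z by (simp_all add: grid_box_def)
  ultimately show "z \<in> grid_box q (a * k) i j"
    unfolding grid_box_def mem_Collect_eq distrib_left mult.assoc mult_1_right
    by (intro conjI) linarith+
qed

definition pattern :: "nat \<Rightarrow> pt \<Rightarrow> int \<times> int \<Rightarrow> pt set \<Rightarrow> bool" where
  "pattern n q u S \<longleftrightarrow> (\<forall>x\<in>window_index n. card (S \<inter> window_cell (window_centre n q u) x) \<in> window_count x)"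

definition pattern_const :: real where
  "pattern_const = ((1/500)\<^sup>2 * exp (-1)) ^ card core_index"

context poisson
begin

lemma prob_some_box:
  assumes e: "e > 0" and c: "\<And>i j. prob {S \<in> space P. card (S \<inter> grid_box q e i j) \<in> A} \<le> c"
  shows "{S \<in> space P. \<exists>x\<in>square m. card (S \<inter> grid_box q e (fst x) (snd x)) \<in> A} \<in> events"
    and "prob {S \<in> space P. \<exists>x\<in>square m. card (S \<inter> grid_box q e (fst x) (snd x)) \<in> A} \<le> (2 * real m + 1)\<^sup>2 * c"
proof -
  have ev: "{S \<in> space P. card (S \<inter> grid_box q e (fst x) (snd x)) \<in> A} \<in> events" for x
    by (rule count_event) (auto simp: grid_box_bounded)
  show "{S \<in> space P. \<exists>x\<in>square m. card (S \<inter> grid_box q e (fst x) (snd x)) \<in> A} \<in> events"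
    by (rule prob_Bex_le(1)[where c = c]) (use ev c in auto)
  have "prob {S \<in> space P. \<exists>x\<in>square m. card (S \<inter> grid_box q e (fst x) (snd x)) \<in> A} \<le> card (square m) * c"
    by (rule prob_Bex_le(2)) (use ev c in auto)
  then show "prob {S \<in> space P. \<exists>x\<in>square m. card (S \<inter> grid_box q e (fst x) (snd x)) \<in> A} \<le> (2 * real m + 1)\<^sup>2 * c"
    by (simp add: card_square add.commute)
qed

lemma pattern_event: "{S \<in> space P. pattern n q u S} \<in> events"
proof -
  have "{S \<in> space P. card (S \<inter> window_cell c x) \<in> A} \<in> events" for c x A
    by (rule count_event[OF window_cell_borel window_cell_bounded])
  then show ?thesis unfolding pattern_def using finite_window_index by (intro sets.sets_Collect_finite_All)
qed

text \<open>A block consists of \<open>k\<^sup>2\<close> disjoint, hence independent, windows, each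
  showing the pattern with probability at least \<open>c / k\<close> for
  \<open>c = pattern_const\<close>. So it has none with probability at most
  \<open>exp (- c / k)\<close> to the power \<open>k\<^sup>2\<close>.\<close>

lemma prob_no_pattern:
  assumes n: "n \<ge> 1" and k: "k = 2 ^ n\<^sup>2"
  shows "{S \<in> space P. \<exists>x\<in>square m. \<forall>u\<in>block k x. \<not> pattern n q u S} \<in> events"
    and "prob {S \<in> space P. \<exists>x\<in>square m. \<forall>u\<in>block k x. \<not> pattern n q u S}
      \<le> (2 * real m + 1)\<^sup>2 * exp (- pattern_const * k)"
proof -
  define Q where "Q x S \<longleftrightarrow> (\<forall>u\<in>block k x. \<not> pattern n q u S)" for x S
  have ev: "{S \<in> space P. Q x S} \<in> events" for x
    unfolding Q_def using pattern_event card_block by (intro sets.sets_Collect_finite_All sets.sets_Collect_neg)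
  have pc: "0 \<le> pattern_const" "pattern_const \<le> 1"
  proof -
    have "exp (-1 :: real) \<le> 1" by simp
    then have "(1/500)\<^sup>2 * exp (-1 :: real) \<le> 1" unfolding power2_eq_square by linarith
    then show "0 \<le> pattern_const" "pattern_const \<le> 1"
      unfolding pattern_const_def by (auto intro!: power_le_one)
  qed
  have kpos: "real k > 0" using k by simp
  have le: "prob {S \<in> space P. Q x S} \<le> exp (- pattern_const * k)" for x
  proof -
    define f where "f u = (\<Prod>y\<in>window_index n. prob {S \<in> space P. card (S \<inter> window_cell (window_centre n q u) y) \<in> window_count y})" for u
    have disj: "disjoint_family_on (\<lambda>z. window_cell (window_centre n q (fst z)) (snd z)) (block k x \<times> window_index n)"
      unfolding disjoint_family_on_def
    proof (intro ballI impI)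
      fix z z' assume z: "z \<in> block k x \<times> window_index n" "z' \<in> block k x \<times> window_index n" "z \<noteq> z'"
      have w: "window_side n > 0" by (simp add: window_side_def)
      show "window_cell (window_centre n q (fst z)) (snd z) \<inter> window_cell (window_centre n q (fst z')) (snd z') = {}"
      proof (cases "fst z = fst z'")
        case True
        then have "snd z \<noteq> snd z'" using z(3) by (simp add: prod_eq_iff)
        moreover have "snd z \<in> window_index n" "snd z' \<in> window_index n" using z(1,2) by (simp_all add: mem_Times_iff)
        ultimately show ?thesis using window_cells_disjoint True by metis
      next
        case False
        obtain u v where uv: "fst z = (u, v)" by (cases "fst z")
        obtain u' v' where uv': "fst z' = (u', v')" by (cases "fst z'")
        have "grid_box q (window_side n) u v \<inter> grid_box q (window_side n) u' v' = {}"
          by (rule grid_box_disjoint[OF w]) (use False uv uv' in metis)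
        moreover have "snd z \<in> window_index n" "snd z' \<in> window_index n" using z(1,2) by (simp_all add: mem_Times_iff)
        ultimately show ?thesis
          unfolding uv uv' using window_cell_in_grid[OF n] by blast
      qed
    qed
    have "prob {S \<in> space P. Q x S} = (\<Prod>u\<in>block k x. 1 - f u)"
      unfolding Q_def pattern_def f_def
      by (rule prob_avoid[OF card_block(1) finite_window_index window_cell_borel window_cell_bounded disj])
    also have "\<dots> \<le> (\<Prod>u\<in>block k x. 1 - pattern_const / k)"
    proof (rule prod_mono, intro conjI)
      fix u
      have "pattern_const / k \<le> f u"
        using prob_window_pattern[OF n, of "window_centre n q u"] k by (simp add: f_def pattern_const_def)
      then show "1 - f u \<le> 1 - pattern_const / k" by simp
      have "f u \<le> 1" unfolding f_def by (intro prod_le_1) auto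
      then show "0 \<le> 1 - f u" by simp
    qed
    also have "\<dots> = (1 - pattern_const / k) ^ (k\<^sup>2)" by (simp add: card_block)
    also have "\<dots> \<le> exp (- (pattern_const / k)) ^ (k\<^sup>2)"
    proof (rule power_mono)
      show "1 - pattern_const / k \<le> exp (- (pattern_const / k))"
        using exp_ge_add_one_self[of "- (pattern_const / k)"] by simp
      have "pattern_const / k \<le> 1" using pc kpos k by (simp add: divide_le_eq)  (metis one_le_power one_le_numeral order_trans)
      then show "0 \<le> 1 - pattern_const / k" by simp
    qed
    also have "\<dots> = exp (- pattern_const * k)"
      using kpos by (simp add: exp_of_nat_mult[symmetric] power2_eq_square)
    finally show ?thesis .
  qed
  show "{S \<in> space P. \<exists>x\<in>square m. \<forall>u\<in>block k x. \<not> pattern n q u S} \<in> events"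
    using prob_Bex_le(1)[of "square m" Q "exp (- pattern_const * k)"] ev le by (simp add: Q_def)
  have "prob {S \<in> space P. \<exists>x\<in>square m. Q x S} \<le> card (square m) * exp (- pattern_const * k)"
    by (rule prob_Bex_le(2)) (use ev le in auto)
  then show "prob {S \<in> space P. \<exists>x\<in>square m. \<forall>u\<in>block k x. \<not> pattern n q u S}
      \<le> (2 * real m + 1)\<^sup>2 * exp (- pattern_const * k)"
    by (simp add: card_square Q_def add.commute)
qed

lemma prob_no_pair:
  assumes e: "0 < e" "e \<le> 1" "e\<^sup>2 \<le> 1/2"
  shows "{S \<in> space P. \<forall>x\<in>{0..<int M} \<times> {0..<int M}. card (S \<inter> grid_box q e (fst x) (snd x)) \<in> {..<2}} \<in> events"
    and "prob {S \<in> space P. \<forall>x\<in>{0..<int M} \<times> {0..<int M}. card (S \<inter> grid_box q e (fst x) (snd x)) \<in> {..<2}}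
      \<le> exp (- (real (M\<^sup>2) * e ^ 4 / 4))"
proof -
  let ?I = "{0..<int M} \<times> {0..<int M}"
  have ev: "{S \<in> space P. card (S \<inter> grid_box q e (fst x) (snd x)) \<in> {..<2}} \<in> events" for x
    by (rule count_event) (auto simp: grid_box_bounded)
  show "{S \<in> space P. \<forall>x\<in>?I. card (S \<inter> grid_box q e (fst x) (snd x)) \<in> {..<2}} \<in> events"
    using ev by (intro sets.sets_Collect_finite_All) auto
  have "prob {S \<in> space P. \<forall>x\<in>?I. card (S \<inter> grid_box q e (fst x) (snd x)) \<in> {..<2}} =
      (\<Prod>x\<in>?I. prob {S \<in> space P. card (S \<inter> grid_box q e (fst x) (snd x)) \<in> {..<2}})"
  proof (rule prob_joint)
    show "disjoint_family_on (\<lambda>x. grid_box q e (fst x) (snd x)) ?I"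
      unfolding disjoint_family_on_def using grid_box_disjoint[OF e(1)] by (metis prod.collapse)
  qed (auto simp: grid_box_bounded)
  also have "\<dots> \<le> (\<Prod>x\<in>?I. 1 - e ^ 4 / 4)"
  proof (rule prod_mono, intro conjI)
    fix x
    show "prob {S \<in> space P. card (S \<inter> grid_box q e (fst x) (snd x)) \<in> {..<2}} \<le> 1 - e ^ 4 / 4"
      using prob_at_most_one[of "grid_box q e (fst x) (snd x)"] e
      by (simp add: measure_grid_box grid_box_bounded power_mult[symmetric])
  qed simp
  also have "\<dots> = (1 - e ^ 4 / 4) ^ (M\<^sup>2)" by (simp add: card_cartesian_product power2_eq_square)
  also have "\<dots> \<le> exp (- (e ^ 4 / 4)) ^ (M\<^sup>2)"
  proof (rule power_mono)
    show "1 - e ^ 4 / 4 \<le> exp (- (e ^ 4 / 4))" using exp_ge_add_one_self[of "- (e ^ 4 / 4)"] by simp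
    have "e ^ 4 \<le> 1" using e by (simp add: power_le_one)
    then show "0 \<le> 1 - e ^ 4 / 4" by simp
  qed
  also have "\<dots> = exp (- (real (M\<^sup>2) * e ^ 4 / 4))" by (simp add: exp_of_nat_mult[symmetric])
  finally show "prob {S \<in> space P. \<forall>x\<in>?I. card (S \<inter> grid_box q e (fst x) (snd x)) \<in> {..<2}}
      \<le> exp (- (real (M\<^sup>2) * e ^ 4 / 4))" .
qed

end

section \<open>Good scales\<close>

text \<open>The box together with its eight neighbours. It contains the partner, within distance
  \<open>e\<close>, of every site in the box.\<close>

definition enlarged :: "pt \<Rightarrow> real \<Rightarrow> int \<times> int \<Rightarrow> pt set" where
  "enlarged q e x = grid_box (q + vector [e * (of_int (fst x) - 1), e * (of_int (snd x) - 1)]) (3 * e) 0 0"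

lemma enlargedI:
  assumes "p \<in> grid_box q e (fst x) (snd x)" "dist p y \<le> e"
  shows "y \<in> enlarged q e x"
proof -
  have "\<bar>p$1 - y$1\<bar> \<le> e" "\<bar>p$2 - y$2\<bar> \<le> e"
    using component_le_dist[of p 1 y] component_le_dist[of p 2 y] assms(2) by linarith+
  moreover have "q$1 + e * of_int (fst x) \<le> p$1" "p$1 < q$1 + e * (of_int (fst x) + 1)"
    "q$2 + e * of_int (snd x) \<le> p$2" "p$2 < q$2 + e * (of_int (snd x) + 1)"
    using assms(1) by (simp_all add: grid_box_def)
  ultimately show ?thesis
    unfolding enlarged_def grid_box_def mem_Collect_eq vector_add_component vector_2
      distrib_left right_diff_distrib of_int_0 mult_1_right mult_zero_right
    by (intro conjI) linarith+
qed

text \<open>Index set of a union bound: pairs of boxes that could hold two competing clusters at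
  nearly equal distance from \<open>q\<close>. The distance above 1 makes the enlarged boxes
  disjoint when \<open>e\<close> is small.\<close>

definition close_pairs :: "pt \<Rightarrow> real \<Rightarrow> real \<Rightarrow> real \<Rightarrow> nat \<Rightarrow> ((int \<times> int) \<times> (int \<times> int)) set" where
  "close_pairs q e D t m = {(x, y). x \<in> square m \<and> y \<in> square m \<and>
     (\<exists>p\<in>grid_box q e (fst x) (snd x). \<exists>p'\<in>grid_box q e (fst y) (snd y).
       dist q p \<le> D \<and> \<bar>dist q p - dist q p'\<bar> \<le> t \<and> 1 < dist p p')}"

lemma finite_close_pairs: "finite (close_pairs q e D t m)"
  by (rule finite_subset[of _ "square m \<times> square m"]) (auto simp: close_pairs_def)

text \<open>The first box is arbitrary; the second then meets a ring around \<open>q\<close> of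
  width of order \<open>t + e\<close>, and \<open>ring_count\<close> applies.\<close>

lemma card_close_pairs:
  fixes e t D :: real
  assumes e: "e > 0" and t: "t \<ge> 0" and D: "D \<ge> 0"
  shows "card (close_pairs q e D t m) * e\<^sup>2 \<le> (2 * real m + 1)\<^sup>2 * (4 * pi * (t + 4 * e) * (D + t + 4 * e))"
proof -
  define I where "I x = {y. (x, y) \<in> close_pairs q e D t m}" for x
  have finI: "finite (I x)" for x
    by (rule finite_subset[of _ "square m"]) (auto simp: I_def close_pairs_def)
  have I: "card (I x) * e\<^sup>2 \<le> 4 * pi * (t + 4 * e) * (D + t + 4 * e)" for x
  proof (cases "I x = {}")
    case True
    then show ?thesis using e t D by simp
  next
    case False
    then obtain p where p: "p \<in> grid_box q e (fst x) (snd x)" "dist q p \<le> D"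
      by (auto simp: I_def close_pairs_def)
    define r where "r = dist q p"
    have "card (I x) * e\<^sup>2 \<le> 4 * pi * ((t + 2 * e) + 2 * e) * (r + (t + 2 * e) + 2 * e)"
    proof (rule ring_count[OF finI e])
      fix i j assume "(i, j) \<in> I x"
      then obtain p1 p2 where 1: "p1 \<in> grid_box q e (fst x) (snd x)" "p2 \<in> grid_box q e i j"
        "\<bar>dist q p1 - dist q p2\<bar> \<le> t" by (auto simp: I_def close_pairs_def)
      have "dist p1 p < 2 * e" using grid_box_dist 1(1) p(1) by blast
      then have "\<bar>dist q p1 - r\<bar> \<le> 2 * e"
        using dist_triangle[of q p1 p] dist_triangle[of q p p1] dist_commute[of p p1] by (simp add: r_def abs_le_iff)
      then have "\<bar>dist q p2 - r\<bar> \<le> t + 2 * e" using 1(3) by linarith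
      then show "\<exists>p\<in>grid_box q e i j. \<bar>dist q p - r\<bar> \<le> t + 2 * e" using 1(2) by blast
    qed (use e t in \<open>simp_all add: r_def\<close>)
    also have "\<dots> \<le> 4 * pi * ((t + 2 * e) + 2 * e) * (D + (t + 2 * e) + 2 * e)"
      using p(2) e t by (intro mult_left_mono) (simp_all add: r_def)
    finally show ?thesis by (simp add: add.assoc)
  qed
  have "close_pairs q e D t m = (SIGMA x:square m. I x)"
    by (auto simp: I_def close_pairs_def)
  then have "real (card (close_pairs q e D t m)) * e\<^sup>2 = (\<Sum>x\<in>square m. card (I x) * e\<^sup>2)"
    using finI by (simp add: sum_distrib_right)
  also have "\<dots> \<le> (\<Sum>x\<in>square m. 4 * pi * (t + 4 * e) * (D + t + 4 * e))" using I by (intro sum_mono)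
  also have "\<dots> = (2 * real m + 1)\<^sup>2 * (4 * pi * (t + 4 * e) * (D + t + 4 * e))"
    by (simp add: card_square add.commute)
  finally show ?thesis .
qed

text \<open>A box of area \<open>(3 * e)\<^sup>2\<close> holds two points with probability at most
  \<open>81/2 * e ^ 4\<close>. The two enlarged boxes are disjoint, so a pair costs the square of
  this; 1641 rounds up 6561/4.\<close>

lemma (in poisson) prob_close_pairs:
  assumes e: "0 < e" "e \<le> 1 / 20" and t: "t \<ge> 0" and D: "D \<ge> 0"
  shows "{S \<in> space P. \<exists>z\<in>close_pairs q e D t m. card (S \<inter> enlarged q e (fst z)) \<in> {2..} \<and>
      card (S \<inter> enlarged q e (snd z)) \<in> {2..}} \<in> events"
    and "prob {S \<in> space P. \<exists>z\<in>close_pairs q e D t m. card (S \<inter> enlarged q e (fst z)) \<in> {2..} \<and>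
      card (S \<inter> enlarged q e (snd z)) \<in> {2..}}
      \<le> (2 * real m + 1)\<^sup>2 * (4 * pi * (t + 4 * e) * (D + t + 4 * e)) / e\<^sup>2 * (1641 * e ^ 8)"
proof -
  let ?Q = "\<lambda>z S. card (S \<inter> enlarged q e (fst z)) \<in> {2..} \<and> card (S \<inter> enlarged q e (snd z)) \<in> {2..}"
  have en: "enlarged q e x \<in> sets borel" "bounded (enlarged q e x)" "measure lborel (enlarged q e x) = (3 * e)\<^sup>2" for x
    using e by (simp_all add: enlarged_def grid_box_bounded measure_grid_box)
  have ev: "{S \<in> space P. ?Q z S} \<in> events" for z
    using count_event[OF en(1,2)] by (intro sets.sets_Collect_conj)
  have le: "prob {S \<in> space P. ?Q z S} \<le> 1641 * e ^ 8" if z: "z \<in> close_pairs q e D t m" for z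
  proof -
    obtain x y where xy: "z = (x, y)" by (cases z)
    obtain p p' where p: "p \<in> grid_box q e (fst x) (snd x)" "p' \<in> grid_box q e (fst y) (snd y)" "1 < dist p p'"
      using z by (auto simp: close_pairs_def xy)
    have "p \<in> enlarged q e x" "p' \<in> enlarged q e y" using p enlargedI[of _ q e] e by auto
    then have disj: "enlarged q e x \<inter> enlarged q e y = {}"
    proof (intro equals0I)
      fix s assume s: "s \<in> enlarged q e x \<inter> enlarged q e y"
      then have "dist p s < 2 * (3 * e)" "dist p' s < 2 * (3 * e)"
        using \<open>p \<in> enlarged q e x\<close> \<open>p' \<in> enlarged q e y\<close> grid_box_dist unfolding enlarged_def by blast+
      then show False using p(3) dist_triangle[of p p' s] dist_commute[of p' s] e by linarith
    qed
    have "x \<noteq> y" using disj \<open>p \<in> enlarged q e x\<close> by auto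
    have "prob {S \<in> space P. \<forall>i\<in>{x, y}. card (S \<inter> enlarged q e i) \<in> {2..}} =
        (\<Prod>i\<in>{x, y}. prob {S \<in> space P. card (S \<inter> enlarged q e i) \<in> {2..}})"
      by (rule prob_joint) (use en disj in \<open>auto simp: disjoint_family_on_def\<close>)
    also have "\<dots> = prob {S \<in> space P. card (S \<inter> enlarged q e x) \<in> {2..}} *
        prob {S \<in> space P. card (S \<inter> enlarged q e y) \<in> {2..}}"
      using \<open>x \<noteq> y\<close> by simp
    also have "\<dots> \<le> (81/2 * e ^ 4) * (81/2 * e ^ 4)"
    proof -
      have "prob {S \<in> space P. card (S \<inter> enlarged q e i) \<in> {2..}} \<le> 81/2 * e ^ 4" for i
        using prob_count_ge_le[OF en(1)[of i] en(2)[of i], of 2] en(3)[of i]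
        by (simp add: power_mult_distrib power_mult[symmetric])
      then show ?thesis by (intro mult_mono) auto
    qed
    also have "\<dots> = 6561/4 * (e ^ 4 * e ^ 4)" by simp
    also have "\<dots> = 6561/4 * e ^ 8" by (simp add: power_add[symmetric])
    also have "\<dots> \<le> 1641 * e ^ 8" using e by (intro mult_right_mono) auto
    finally show ?thesis by (simp add: xy)
  qed
  show "{S \<in> space P. \<exists>z\<in>close_pairs q e D t m. ?Q z S} \<in> events"
    by (rule prob_Bex_le(1)[OF finite_close_pairs ev le])
  have "prob {S \<in> space P. \<exists>z\<in>close_pairs q e D t m. ?Q z S} \<le> card (close_pairs q e D t m) * (1641 * e ^ 8)"
    by (rule prob_Bex_le(2)[OF finite_close_pairs ev le])
  also have "\<dots> \<le> (2 * real m + 1)\<^sup>2 * (4 * pi * (t + 4 * e) * (D + t + 4 * e)) / e\<^sup>2 * (1641 * e ^ 8)"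
    using card_close_pairs[OF e(1) t D, of q m] e by (intro mult_right_mono) (simp_all add: le_divide_eq)
  finally show "prob {S \<in> space P. \<exists>z\<in>close_pairs q e D t m. ?Q z S}
      \<le> (2 * real m + 1)\<^sup>2 * (4 * pi * (t + 4 * e) * (D + t + 4 * e)) / e\<^sup>2 * (1641 * e ^ 8)" .
qed

text \<open>The nearest site serves as \<open>p\<close>. A site further than 1 from
  \<open>p\<close>, but less than \<open>t\<close> farther from \<open>q\<close> than
  \<open>p\<close>, would give an occupied pair in \<open>close_pairs\<close>.\<close>

lemma sites_isolated:
  assumes S: "locfin S" and e: "0 < e" and p0: "p0 \<in> sites e S" "dist q p0 \<le> D - t"
    and t: "t \<ge> 0" and m: "D \<le> e * real m"
    and no: "\<not> (\<exists>z\<in>close_pairs q e D t m. card (S \<inter> enlarged q e (fst z)) \<in> {2..} \<and>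
      card (S \<inter> enlarged q e (snd z)) \<in> {2..})"
  shows "deep D e t S q"
proof -
  have D: "dist q p0 \<le> D" using p0 t by linarith
  have fin: "finite (S \<inter> cball q D)" using S by (simp add: locfin_def)
  define T where "T = sites e S \<inter> cball q D"
  have T: "finite T" "T \<noteq> {}"
    using fin p0 D by (auto simp: T_def sites_def intro: finite_subset[of _ "S \<inter> cball q D"])
  define p where "p = arg_min_on (dist q) T"
  have pT: "p \<in> T" and pmin: "\<And>y. y \<in> T \<Longrightarrow> dist q p \<le> dist q y"
    using arg_min_if_finite[OF T, of "dist q"] by (auto simp: p_def not_less)
  have p: "p \<in> sites e S" "dist q p \<le> D - t"
    using pT pmin[of p0] p0 D by (auto simp: T_def)
  have two: "card (S \<inter> enlarged q e x) \<in> {2..}" if v: "v \<in> sites e S" "v \<in> grid_box q e (fst x) (snd x)" for v x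
  proof -
    obtain y where y: "v \<in> S" "y \<in> S" "y \<noteq> v" "dist v y \<le> e" using v(1) by (auto simp: sites_def)
    have "{v, y} \<subseteq> S \<inter> enlarged q e x" using y enlargedI[OF v(2)] e by auto
    moreover have "finite (S \<inter> enlarged q e x)"
      using S by (simp add: locfin_def enlarged_def grid_box_bounded)
    ultimately have "card {v, y} \<le> card (S \<inter> enlarged q e x)" by (intro card_mono)
    then show ?thesis using y by simp
  qed
  have "deep_at D e t S q p"
    unfolding deep_at_def
  proof (intro conjI ballI p)
    fix v assume v: "v \<in> sites e S"
    show "dist v p \<le> 1 \<or> dist q p + t \<le> dist q v"
    proof (rule ccontr)
      assume "\<not> ?thesis"
      then have *: "1 < dist v p" "dist q v < dist q p + t" by auto
      have vD: "dist q v \<le> D" using * p by linarith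
      then have "v \<in> T" using v by (simp add: T_def)
      then have ge: "dist q p \<le> dist q v" by (rule pmin)
      have pD: "dist q p \<le> D" using p t by linarith
      obtain i j where ij: "(i, j) \<in> square m" "p \<in> grid_box q e i j"
        using square_cover_dist[OF e, of q p m] pD m by auto
      obtain k l where kl: "(k, l) \<in> square m" "v \<in> grid_box q e k l"
        using square_cover_dist[OF e, of q v m] vD m by auto
      have "\<exists>p\<in>grid_box q e i j. \<exists>p'\<in>grid_box q e k l. dist q p \<le> D \<and> \<bar>dist q p - dist q p'\<bar> \<le> t \<and> 1 < dist p p'"
        by (rule bexI[OF bexI[OF _ kl(2)] ij(2)]) (use pD ge * in \<open>auto simp: dist_commute[of p v]\<close>)
      then have "((i, j), (k, l)) \<in> close_pairs q e D t m"
        using ij(1) kl(1) by (simp add: close_pairs_def)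
      moreover have "card (S \<inter> enlarged q e (i, j)) \<in> {2..}" "card (S \<inter> enlarged q e (k, l)) \<in> {2..}"
        using two p(1) v ij(2) kl(2) by auto
      ultimately show False using no by fastforce
    qed
  qed
  then show ?thesis using p(1) by (auto simp: deep_def sites_def)
qed

text \<open>Depth \<open>12 * w\<close> at \<open>q\<close> leaves enough depth at distance 2, and
  radius \<open>4 * D\<close> covers the whole cell. The last clause quantifies over arbitrary
  \<open>K\<close> so that it applies to the core, which depends on the whole configuration.\<close>

definition good_at :: "real \<Rightarrow> real \<Rightarrow> real \<Rightarrow> pt \<Rightarrow> pt set \<Rightarrow> bool" where
  "good_at w D h q S \<longleftrightarrow> deep D h (12 * w) S q \<and> many 4 S \<and>
     (\<forall>x\<in>S. dist q x \<le> 4 * D \<longrightarrow> (\<forall>y. delaunay_edge S x y \<longrightarrow> dist x y \<le> w / 4)) \<and>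
     (\<forall>z K. dist q z \<le> 4 * D \<and> K \<subseteq> S \<and> (\<forall>x\<in>K. dist z x \<le> w \<longrightarrow> many 6 (nbrs S x \<inter> K)) \<longrightarrow> z \<notin> K)"

lemma square_points_le:
  assumes fin: "finite (S \<inter> cball z r)" and r: "r \<ge> 0"
    and m: "dist q z + r \<le> real m"
    and box: "\<And>i j. (i, j) \<in> square m \<Longrightarrow> card (S \<inter> grid_box q 1 i j) \<le> k"
    and S: "locfin S"
  shows "real (card (S \<inter> cball z r)) \<le> (2 * r + 2)\<^sup>2 * k"
proof -
  define J where "J i = {\<lfloor>z$i - q$i - r\<rfloor>..\<lfloor>z$i - q$i + r\<rfloor>}" for i :: 2
  have cJ: "real (card (J i)) \<le> 2 * r + 2" for i
  proof -
    have "\<lfloor>z$i - q$i - r\<rfloor> \<le> \<lfloor>z$i - q$i + r\<rfloor>" using r by (intro floor_mono) auto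
    then have "real (card (J i)) = of_int \<lfloor>z$i - q$i + r\<rfloor> - of_int \<lfloor>z$i - q$i - r\<rfloor> + 1"
      by (simp add: J_def)
    then show ?thesis by linarith
  qed
  have sub: "S \<inter> cball z r \<subseteq> (\<Union>x\<in>J 1 \<times> J 2 \<inter> square m. S \<inter> grid_box q 1 (fst x) (snd x))"
  proof
    fix y assume y: "y \<in> S \<inter> cball z r"
    then have d: "\<bar>y$i - z$i\<bar> \<le> r" for i using component_le_dist[of y i z] by (auto simp: dist_commute)
    have "dist q y \<le> 1 * real m" using m dist_triangle[of q y z] y by auto
    then obtain i j where ij: "(i, j) \<in> square m" "y \<in> grid_box q 1 i j"
      using square_cover_dist[of 1 q y m] by auto
    then have "i = \<lfloor>y$1 - q$1\<rfloor>" "j = \<lfloor>y$2 - q$2\<rfloor>" by (simp_all add: grid_box_mem_iff)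
    moreover have "\<lfloor>y$l - q$l\<rfloor> \<in> J l" for l
      using d[of l] unfolding J_def abs_le_iff by (auto intro!: floor_mono)
    ultimately have "(i, j) \<in> J 1 \<times> J 2" by simp
    then show "y \<in> (\<Union>x\<in>J 1 \<times> J 2 \<inter> square m. S \<inter> grid_box q 1 (fst x) (snd x))"
      using ij y by (intro UN_I[of "(i, j)"]) auto
  qed
  have finb: "finite (S \<inter> grid_box q 1 i j)" for i j using S by (simp add: locfin_def grid_box_bounded)
  have "card (S \<inter> cball z r) \<le> card (\<Union>x\<in>J 1 \<times> J 2 \<inter> square m. S \<inter> grid_box q 1 (fst x) (snd x))"
    using sub finb by (intro card_mono finite_UN_I) (simp_all add: J_def)
  also have "\<dots> \<le> (\<Sum>x\<in>J 1 \<times> J 2 \<inter> square m. card (S \<inter> grid_box q 1 (fst x) (snd x)))"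
    by (rule card_UN_le) simp
  also have "\<dots> \<le> (\<Sum>x\<in>J 1 \<times> J 2 \<inter> square m. k)" using box by (intro sum_mono) auto
  also have "\<dots> = card (J 1 \<times> J 2 \<inter> square m) * k" by simp
  also have "\<dots> \<le> card (J 1 \<times> J 2) * k" by (intro mult_right_mono card_mono) (auto simp: J_def)
  finally have "real (card (S \<inter> cball z r)) \<le> real (card (J 1) * card (J 2) * k)"
    by (simp add: card_cartesian_product del: of_nat_mult)
  also have "\<dots> \<le> (2 * r + 2) * (2 * r + 2) * k"
    using cJ r by (simp del: of_nat_mult add: of_nat_mult) (intro mult_right_mono mult_mono; simp)
  finally show ?thesis by (simp add: power2_eq_square)
qed

text \<open>At the scale \<open>x = 2 ^ n\<^sup>2\<close> the sites are the points with another point within \<open>h = 1 / x ^ 14\<close>. Their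
  density is of order \<open>h\<^sup>2\<close>, so that their spacing is below the radius \<open>D = x ^ 15\<close>. The zones have
  width of order \<open>w = x ^ 10\<close>. Discs of radius \<open>14 * n\<close> contain points because \<open>exp (- 49 * n\<^sup>2)\<close> beats every
  power of \<open>x\<close> that is needed.\<close>

definition large_enough :: "nat \<Rightarrow> bool" where
  "large_enough n \<longleftrightarrow> (let x = (2::real) ^ n\<^sup>2 in n \<ge> 2 \<and> 14 * n \<le> x ^ 10 / 8 \<and>
     28 * n * x ^ 9 + 2 * x * (100 * n + 5) \<le> x ^ 10 \<and>
     (16 * x * (100 * n + 5) + 2)\<^sup>2 * x \<le> x ^ 4 \<and> exp (- x) * ((2 * x ^ 10 + 2)\<^sup>2 * x) < 1 \<and>
     12 * x ^ 10 \<le> x ^ 15 / 2 \<and> 4 * x ^ 15 + 4 * x ^ 10 \<le> x ^ 20 \<and> 20 \<le> x)"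

lemma eventually_large_enough: "eventually large_enough at_top"
  unfolding large_enough_def Let_def by (intro eventually_conj; real_asymp)

lemma large_enoughD:
  fixes x :: real
  assumes "large_enough n" "x = 2 ^ n\<^sup>2"
  shows "n \<ge> 2" "14 * n \<le> x ^ 10 / 8" "28 * n * x ^ 9 + 2 * x * (100 * n + 5) \<le> x ^ 10"
    "(16 * x * (100 * n + 5) + 2)\<^sup>2 * x \<le> x ^ 4" "exp (- x) * ((2 * x ^ 10 + 2)\<^sup>2 * x) < 1"
    "12 * x ^ 10 \<le> x ^ 15 / 2" "4 * x ^ 15 + 4 * x ^ 10 \<le> x ^ 20" "20 \<le> x"
  using assms unfolding large_enough_def Let_def by auto

text \<open>Five bad events are excluded: an empty box, a crowded box, a block without pattern, the
  absence of sites, and two clusters at nearly equal distance. All are expressed by box counts, so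
  that their probabilities are accessible.\<close>

lemma good_scale_deterministic:
  fixes n k :: nat and x :: real
  defines "k \<equiv> 2 ^ n\<^sup>2"
  defines "x \<equiv> real k"
  assumes S: "locfin S" "general_position S" and n: "large_enough n"
    and void: "\<not> (\<exists>y\<in>square (3 * k ^ 20). card (S \<inter> grid_box q (7 * n) (fst y) (snd y)) \<in> {0})"
    and crowd: "\<not> (\<exists>y\<in>square (3 * k ^ 20). card (S \<inter> grid_box q 1 (fst y) (snd y)) \<in> {k..})"
    and spotless: "\<not> (\<exists>y\<in>square (3 * k ^ 20). \<forall>u\<in>block k y. \<not> pattern n q u S)"
    and siteless: "\<not> (\<forall>y\<in>{0..<int (k ^ 29)} \<times> {0..<int (k ^ 29)}.
        card (S \<inter> grid_box q (1 / x ^ 14 / 4) (fst y) (snd y)) \<in> {..<2})"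
    and twins: "\<not> (\<exists>z\<in>close_pairs q (1 / x ^ 14) (x ^ 15) (12 * x ^ 10) (k ^ 29).
        card (S \<inter> enlarged q (1 / x ^ 14) (fst z)) \<in> {2..} \<and>
        card (S \<inter> enlarged q (1 / x ^ 14) (snd z)) \<in> {2..})"
  shows "good_at (x ^ 10) (x ^ 15) (1 / x ^ 14) q S"
proof -
  have x2: "x = 2 ^ n\<^sup>2" by (simp add: x_def k_def)
  note L = large_enoughD[OF n x2]
  have x0: "x > 0" using L(8) by linarith
  have x1: "1 \<le> x" using L(8) by linarith
  have nat_pow: "real (k ^ i) = x ^ i" for i by (simp add: x_def)
  define m where "m = 3 * k ^ 20"
  have m: "real m = 3 * x ^ 20" by (simp add: m_def x_def)
  have pos: "x ^ i \<ge> 1" for i using x1 by simp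
  have pow_div: "x ^ (i + j) / x ^ i = x ^ j" for i j using x0 by (simp add: power_add)
  have le20: "x ^ 10 \<le> x ^ 15" "x ^ 15 \<le> x ^ 20" "x ^ 10 \<le> x ^ 20" using x1 by (intro power_increasing; simp)+
  have hit: "\<exists>y\<in>S. dist z y < 14 * n" if z: "dist q z \<le> 3 * x ^ 20" for z
  proof -
    have n7: "0 < real (7 * n)" "1 \<le> real (7 * n)" using L(1) by auto
    have "dist q z \<le> real (7 * n) * real m"
      using z n7 mult_right_mono[of 1 "real (7 * n)" "real m"] m by simp
    then obtain i j where ij: "(i, j) \<in> square m" "z \<in> grid_box q (real (7 * n)) i j"
      using square_cover_dist[OF n7(1), of q z m] by blast
    then have "card (S \<inter> grid_box q (real (7 * n)) i j) \<noteq> 0" using void by (force simp: m_def)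
    then have "S \<inter> grid_box q (real (7 * n)) i j \<noteq> {}" using card.empty by metis
    then obtain y where y: "y \<in> S" "y \<in> grid_box q (real (7 * n)) i j" by blast
    have "dist z y < 2 * real (7 * n)" by (rule grid_box_dist[OF ij(2) y(2)])
    then show ?thesis using y(1) by (intro bexI[of _ y]) simp_all
  qed
  have short: "dist y u \<le> 28 * n" if y: "dist q y \<le> 2 * x ^ 20" and e: "delaunay_edge S y u" for y u
  proof -
    have "dist y u < 2 * (14 * real n)"
    proof (rule edge_short[OF e])
      fix c assume "dist c y \<le> 14 * real n"
      then have "dist q c \<le> 2 * x ^ 20 + 14 * n" using dist_triangle[of q c y] y dist_commute[of c y] by linarith
      also have "\<dots> \<le> 3 * x ^ 20" using L(2) le20 pos[of 10] by linarith
      finally show "\<exists>z\<in>S. dist c z < 14 * real n" using hit by auto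
    qed (use L(1) in simp)
    then show ?thesis by simp
  qed
  define l where "l = 2 * x * (100 * real n + 5)"
  have l28: "28 * real n \<le> l"
  proof -
    have "1 * (100 * real n + 5) \<le> (2 * x) * (100 * real n + 5)" using x1 by (intro mult_right_mono) auto
    moreover have "28 * real n \<le> 1 * (100 * real n + 5)" by simp
    ultimately show ?thesis unfolding l_def by (rule order_trans[rotated])
  qed
  have l10: "l \<le> x ^ 10"
  proof -
    have "0 \<le> 28 * real n * x ^ 9" using x0 by simp
    then show ?thesis using L(3) unfolding l_def by simp
  qed
  have spots: "\<exists>s. spot (28 * n) S s \<and> dist z s \<le> l" if z: "dist q z \<le> 3 * x ^ 20" for z
  proof -
    define a where "a = window_side n * k"
    have w: "window_side n \<ge> 1" "window_side n > 0" by (simp_all add: window_side_def)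
    have a: "a \<ge> 1" "a > 0" using mult_mono[of 1 "window_side n" 1 x] w x1 by (simp_all add: a_def x_def)
    have "dist q z \<le> a * real m"
      using z a mult_right_mono[of 1 a "real m"] m by simp
    then obtain i j where ij: "(i, j) \<in> square m" "z \<in> grid_box q a i j"
      using square_cover_dist[OF a(2), of q z m] by blast
    then obtain u v where uv: "(u, v) \<in> block k (i, j)" "pattern n q (u, v) S"
      using spotless by (fastforce simp: m_def)
    obtain s where s: "spot (28 * n) S s" "near s (window_centre n q (u, v))"
      using window_pattern_spot[OF S(1) L(1) uv(2)[unfolded pattern_def]] by blast
    have "s \<in> grid_box q (window_side n) u v" using centre_in_grid s(2) L(1) by simp
    then have "s \<in> grid_box q a i j" using block_grid[OF w(2) uv(1), of q] by (auto simp: a_def)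
    then have "dist z s < 2 * a" using grid_box_dist ij(2) by blast
    also have "2 * a = l" by (simp add: a_def l_def window_side_def x_def)
    finally show ?thesis using s by auto
  qed
  have count: "real (card (S \<inter> cball z r)) \<le> (2 * r + 2)\<^sup>2 * x"
    if "dist q z + r \<le> 3 * x ^ 20" "r \<ge> 0" for z r
    unfolding x_def
  proof (rule square_points_le[OF _ that(2) _ _ S(1), where q = q and m = m])
    show "finite (S \<inter> cball z r)" using S(1) by (simp add: locfin_def)
    show "dist q z + r \<le> real m" using that m by simp
    show "card (S \<inter> grid_box q 1 i j) \<le> k" if "(i, j) \<in> square m" for i j
      using crowd that by (fastforce simp: m_def)
  qed
  have core: "z \<notin> K" if z: "dist q z \<le> 4 * x ^ 15" and K: "K \<subseteq> S"
    and six: "\<And>y. y \<in> K \<Longrightarrow> dist z y \<le> x ^ 10 \<Longrightarrow> many 6 (nbrs S y \<inter> K)" for z K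
  proof -
    have zq: "dist q y \<le> x ^ 20" if "dist z y \<le> x ^ 10" for y
      using that z L(7) dist_triangle[of q y z] pos[of 10] by linarith
    have "K \<inter> cball z 0 = {}"
    \<comment> \<open>Here \<open>N\<^sup>2\<close> is \<open>x ^ 8\<close>, so \<open>x ^ 9\<close>
      steps of length \<open>28 * n\<close> shrink the core by a factor \<open>exp (- x)\<close>,
      which beats the number of points.\<close>
    proof (rule core_avoids_ball[where b = "14 * real n" and l = l and w = "x ^ 10" and N = "k ^ 4" and j = "k ^ 9", OF S K six])
      show "dist y u \<le> 2 * (14 * real n)" if "y \<in> S" "dist z y \<le> x ^ 10" "delaunay_edge S y u" for y u
        using short[of y u] zq[of y] that pos[of 20] by simp
      show "\<exists>s. spot (2 * (14 * real n)) S s \<and> dist y s \<le> l" if "dist z y \<le> x ^ 10" for y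
        using spots[of y] zq[of y] that pos[of 20] by simp
      show "card (S \<inter> cball y (4 * l)) \<le> k ^ 4" if y: "dist z y \<le> x ^ 10" for y
      proof -
        have "dist q y + 4 * l \<le> 3 * x ^ 20" using zq[OF y] l10 L(7) pos[of 15] pos[of 20] by linarith
        then have "real (card (S \<inter> cball y (4 * l))) \<le> (2 * (4 * l) + 2)\<^sup>2 * x"
          using l28 by (intro count) auto
        also have "\<dots> \<le> x ^ 4" using L(4) by (simp add: l_def algebra_simps)
        also have "\<dots> = real (k ^ 4)" by (simp add: x_def)
        finally show ?thesis by linarith
      qed
      show "0 < 14 * real n" using L(1) by simp
      show "2 * (14 * real n) \<le> l" using l28 by simp
      show "0 + 2 * (14 * real n) * real (k ^ 9) \<le> x ^ 10 - l"
        using L(3) unfolding l_def nat_pow by simp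
      show "1 \<le> k ^ 4" by (simp add: k_def)
      show "(1 - 1 / (real (k ^ 4))\<^sup>2) ^ k ^ 9 * real (card (S \<inter> cball z (x ^ 10))) < 1"
      proof -
        have "(1 - 1 / (real (k ^ 4))\<^sup>2) ^ k ^ 9 \<le> exp (- (1 / x ^ 8)) ^ k ^ 9"
        proof (rule power_mono)
          have "(real (k ^ 4))\<^sup>2 = x ^ 8" unfolding nat_pow by (simp add: power_mult[symmetric])
          moreover have "1 / x ^ 8 \<le> 1" using pos[of 8] x0 by (subst divide_le_eq_1) auto
          ultimately show "1 - 1 / (real (k ^ 4))\<^sup>2 \<le> exp (- (1 / x ^ 8))" "0 \<le> 1 - 1 / (real (k ^ 4))\<^sup>2"
            using exp_ge_add_one_self[of "- (1 / x ^ 8)"] by simp_all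
        qed
        also have "\<dots> = exp (- (x ^ 9 / x ^ 8))" by (simp add: exp_of_nat_mult[symmetric] nat_pow del: of_nat_power)
        also have "x ^ 9 / x ^ 8 = x" using x0 by (simp add: power_diff[symmetric])
        finally have 1: "(1 - 1 / (real (k ^ 4))\<^sup>2) ^ k ^ 9 \<le> exp (- x)" .
        have 2: "real (card (S \<inter> cball z (x ^ 10))) \<le> (2 * x ^ 10 + 2)\<^sup>2 * x"
          using z L(7) pos[of 15] pos[of 10] by (intro count) linarith+
        have "(1 - 1 / (real (k ^ 4))\<^sup>2) ^ k ^ 9 * real (card (S \<inter> cball z (x ^ 10)))
            \<le> exp (- x) * ((2 * x ^ 10 + 2)\<^sup>2 * x)"
          using 1 2 by (intro mult_mono) auto
        then show ?thesis using L(5) by linarith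
      qed
    qed
    then show ?thesis by auto
  qed
  have deep: "deep (x ^ 15) (1 / x ^ 14) (12 * x ^ 10) S q"
  proof -
    \<comment> \<open>Two points in a box of side \<open>h / 4\<close> are closer than
      \<open>h / 2\<close>, and \<open>k ^ 29\<close> such boxes in a row have length
      \<open>x ^ 15 / 4\<close>, so a site is found well within \<open>D\<close>.\<close>
    obtain i j where ij: "i \<in> {0..<int (k ^ 29)}" "j \<in> {0..<int (k ^ 29)}"
      "2 \<le> card (S \<inter> grid_box q (1 / x ^ 14 / 4) i j)" using siteless by (auto simp: not_less)
    define G where "G = S \<inter> grid_box q (1 / x ^ 14 / 4) i j"
    have finG: "finite G" using S(1) by (simp add: G_def locfin_def grid_box_bounded)
    have "card G > 1" using ij(3) by (simp add: G_def)
    then obtain p y where py: "p \<in> G" "y \<in> G" "y \<noteq> p"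
      using finG by (metis card_le_Suc0_iff_eq not_less One_nat_def)
    have "dist p y < 2 * (1 / x ^ 14 / 4)" by (rule grid_box_dist) (use py in \<open>auto simp: G_def\<close>)
    also have "\<dots> \<le> 1 / x ^ 14"
    proof -
      have "2 * (a / 4) \<le> a" if "0 \<le> a" for a :: real using that by simp
      from this[of "1 / x ^ 14"] show ?thesis using x0 by simp
    qed
    finally have p: "p \<in> sites (1 / x ^ 14) S" using py by (auto simp: sites_def G_def)
    have e4: "1 / x ^ 14 / 4 * x ^ 29 = x ^ 15 / 4"
      using pow_div[of 14 15] by simp
    have coord: "0 \<le> 1 / x ^ 14 / 4 * of_int t" "1 / x ^ 14 / 4 * (of_int t + 1) \<le> x ^ 15 / 4"
      if t: "t \<in> {0..<int (k ^ 29)}" for t :: int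
    proof -
      have "t + 1 \<le> int (k ^ 29)" using t by simp
      then have "real_of_int (t + 1) \<le> real_of_int (int (k ^ 29))" by (rule of_int_le_iff[THEN iffD2])
      then have "of_int t + 1 \<le> x ^ 29" by (simp add: x_def)
      then have "1 / x ^ 14 / 4 * (of_int t + 1) \<le> 1 / x ^ 14 / 4 * x ^ 29" using x0 by (intro mult_left_mono) auto
      then show "1 / x ^ 14 / 4 * (of_int t + 1) \<le> x ^ 15 / 4" unfolding e4 .
      show "0 \<le> 1 / x ^ 14 / 4 * of_int t" using t x0 by simp
    qed
    have "q$1 + 1 / x ^ 14 / 4 * of_int i \<le> p$1" "p$1 < q$1 + 1 / x ^ 14 / 4 * (of_int i + 1)"
      "q$2 + 1 / x ^ 14 / 4 * of_int j \<le> p$2" "p$2 < q$2 + 1 / x ^ 14 / 4 * (of_int j + 1)"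
      using py(1) by (simp_all add: G_def grid_box_def)
    then have "\<bar>q$1 - p$1\<bar> \<le> x ^ 15 / 4" "\<bar>q$2 - p$2\<bar> \<le> x ^ 15 / 4"
      using coord[OF ij(1)] coord[OF ij(2)] by linarith+
    then have pd: "dist q p \<le> x ^ 15 - 12 * x ^ 10" using dist_le_components[of q p] L(6) by linarith
    show ?thesis
    proof (rule sites_isolated[OF S(1) _ p pd _ _ twins])
      have "1 / x ^ 14 * x ^ 29 = x ^ 15" using pow_div[of 14 15] by simp
      then show "x ^ 15 \<le> 1 / x ^ 14 * real (k ^ 29)" unfolding nat_pow by simp
    qed (use x0 in simp_all)
  qed
  have many: "many 4 S"
  proof -
    \<comment> \<open>Open discs of radius \<open>14 * n\<close> with centres \<open>28 * n\<close>
      apart are disjoint, so the points found in them differ.\<close>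
    define z where "z i = q + vector [28 * real n * real i, 0]" for i :: nat
    have dz: "dist (z i) (z j) = 28 * real n * \<bar>real i - real j\<bar>" for i j
    proof -
      have "z i - z j = (28 * real n * (real i - real j)) *\<^sub>R axis 1 1"
        by (simp add: z_def vec2_eq_iff axis_def algebra_simps)
      then show ?thesis by (simp add: dist_norm abs_mult)
    qed
    have z0: "z 0 = q" by (simp add: z_def vec2_eq_iff)
    have "\<exists>y. y \<in> S \<and> dist (z i) y < 14 * n" if "i < 4" for i
    proof -
      have "dist q (z i) = 28 * real n * real i" using dz[of 0 i] z0 by simp
      also have "\<dots> \<le> 28 * real n * 4" using that by (intro mult_left_mono) auto
      also have "\<dots> \<le> 3 * x ^ 20" using L(2) le20 pos[of 10] by linarith
      finally show ?thesis using hit by blast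
    qed
    then obtain f where f: "\<And>i. i < 4 \<Longrightarrow> f i \<in> S \<and> dist (z i) (f i) < 14 * n" by metis
    have "inj_on f {..<4}"
    proof (rule inj_onI, rule ccontr)
      fix i j assume ij: "i \<in> {..<4::nat}" "j \<in> {..<4}" "f i = f j" "i \<noteq> j"
      then have "\<bar>real i - real j\<bar> \<ge> 1" by linarith
      then have "28 * real n * 1 \<le> dist (z i) (z j)" unfolding dz by (intro mult_left_mono) auto
      moreover have "dist (z i) (z j) < 14 * n + 14 * n"
        using f[of i] f[of j] ij dist_triangle[of "z i" "z j" "f i"] dist_commute[of "f i" "z j"] by auto
      ultimately show False by simp
    qed
    then have "card (f ` {..<4}) = 4" by (simp add: card_image)
    moreover have "f ` {..<4} \<subseteq> S" using f by auto
    ultimately show ?thesis unfolding many_def by blast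
  qed
  show ?thesis
    unfolding good_at_def
  proof (intro conjI deep many ballI allI impI)
    fix y u assume y: "y \<in> S" "dist q y \<le> 4 * x ^ 15" "delaunay_edge S y u"
    have "dist q y \<le> 2 * x ^ 20" using y L(7) pos[of 10] pos[of 20] by linarith
    then have "dist y u \<le> 28 * n" using short y by blast
    then show "dist y u \<le> x ^ 10 / 4" using L(2) by simp
  next
    fix z K assume "dist q z \<le> 4 * x ^ 15 \<and> K \<subseteq> S \<and> (\<forall>y\<in>K. dist z y \<le> x ^ 10 \<longrightarrow> many 6 (nbrs S y \<inter> K))"
    then show "z \<notin> K" using core by blast
  qed
qed

text \<open>The summands bound the five bad events in turn. Convergence to 0 is enough, because the
  scales are chosen along a sparse sequence.\<close>

definition failure_bound :: "real \<Rightarrow> real" where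
  "failure_bound x = (6 * x ^ 20 + 1)\<^sup>2 / x ^ 49 + (6 * x ^ 20 + 1)\<^sup>2 * (2 / 2 powr x) +
     (6 * x ^ 20 + 1)\<^sup>2 * exp (- pattern_const * x) + exp (- (x\<^sup>2 / 1024)) + 7561728 / x"

lemma pattern_const_pos: "pattern_const > 0"
  by (simp add: pattern_const_def)

lemma failure_bound_tendsto: "(failure_bound \<longlongrightarrow> 0) at_top"
proof -
  have *: "((\<lambda>x. (6 * x ^ 20 + 1)\<^sup>2 / x ^ 49 + (6 * x ^ 20 + 1)\<^sup>2 * (2 / 2 powr x) +
     (6 * x ^ 20 + 1)\<^sup>2 * exp (- c * x) + exp (- (x\<^sup>2 / 1024)) + 7561728 / x) \<longlongrightarrow> 0) at_top"
    if "c > 0" for c :: real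
    using that by real_asymp
  show ?thesis using *[OF pattern_const_pos] by (simp add: failure_bound_def[abs_def])
qed

text \<open>\<open>good_at\<close> quantifies over arbitrary subsets \<open>K\<close>, so failure is
  enclosed in an event \<open>B\<close> made of box counts instead of being treated as an event
  itself.\<close>

lemma (in poisson) good_scale_prob:
  fixes n k :: nat and x :: real
  defines "k \<equiv> 2 ^ n\<^sup>2"
  defines "x \<equiv> real k"
  assumes n: "large_enough n"
  shows "\<exists>B\<in>events. prob B \<le> failure_bound x \<and>
    (\<forall>S\<in>space P - B. general_position S \<longrightarrow> good_at (x ^ 10) (x ^ 15) (1 / x ^ 14) q S)"
proof -
  have x2: "x = 2 ^ n\<^sup>2" by (simp add: x_def k_def)
  note L = large_enoughD[OF n x2]
  have x0: "x > 0" and x1: "x \<ge> 1" using L(8) by linarith+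
  have pos: "x ^ i \<ge> 1" for i using x1 by simp
  have n1: "n \<ge> 1" using L(1) by simp
  define m where "m = 3 * k ^ 20"
  have m: "2 * real m + 1 = 6 * x ^ 20 + 1" by (simp add: m_def x_def)
  define e where "e = 1 / x ^ 14"
  have e: "0 < e" "e \<le> 1 / 20" "e \<le> 1"
  proof -
    have "20 * 1 \<le> x * x ^ 13" using L(8) pos[of 13] by (intro mult_mono) auto
    then have "20 \<le> x ^ 14" by (simp add: power_Suc[symmetric] del: power_Suc)
    then show "0 < e" "e \<le> 1 / 20" "e \<le> 1" using x0 by (simp_all add: e_def field_simps)
  qed
  define B1 where "B1 = {S \<in> space P. \<exists>y\<in>square m. card (S \<inter> grid_box q (7 * n) (fst y) (snd y)) \<in> {0}}"
  define B2 where "B2 = {S \<in> space P. \<exists>y\<in>square m. card (S \<inter> grid_box q 1 (fst y) (snd y)) \<in> {k..}}"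
  define B3 where "B3 = {S \<in> space P. \<exists>y\<in>square m. \<forall>u\<in>block k y. \<not> pattern n q u S}"
  define B4 where "B4 = {S \<in> space P. \<forall>y\<in>{0..<int (k ^ 29)} \<times> {0..<int (k ^ 29)}.
        card (S \<inter> grid_box q (e / 4) (fst y) (snd y)) \<in> {..<2}}"
  define B5 where "B5 = {S \<in> space P. \<exists>z\<in>close_pairs q e (x ^ 15) (12 * x ^ 10) (k ^ 29).
        card (S \<inter> enlarged q e (fst z)) \<in> {2..} \<and> card (S \<inter> enlarged q e (snd z)) \<in> {2..}}"
  have b1: "B1 \<in> events" "prob B1 \<le> (6 * x ^ 20 + 1)\<^sup>2 / x ^ 49"
  proof -
    have n7: "real (7 * n) > 0" using n1 by simp
    \<comment> \<open>\<open>exp (- 49 * n\<^sup>2)\<close> is at most \<open>1 / x ^ 49\<close>,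
      which outweighs the number of boxes, of order \<open>x ^ 40\<close>.\<close>
    have "exp (- ((real (7 * n))\<^sup>2)) \<le> 1 / x ^ 49"
    proof -
      have "(2::real) ^ (49 * n\<^sup>2) \<le> exp 1 ^ (49 * n\<^sup>2)" using exp_ge_add_one_self[of 1] by (intro power_mono) auto
      also have "\<dots> = exp ((real (7 * n))\<^sup>2)" by (simp add: exp_of_nat_mult[symmetric] power_mult_distrib)
      finally have "x ^ 49 \<le> exp ((real (7 * n))\<^sup>2)" unfolding x2 by (simp add: power_mult[symmetric] mult.commute)
      then show ?thesis using x0 by (simp add: exp_minus field_simps)
    qed
    then have c: "prob {S \<in> space P. card (S \<inter> grid_box q (real (7 * n)) i j) \<in> {0}} \<le> 1 / x ^ 49" for i j
      using prob_empty[OF grid_box_borel grid_box_bounded, of q "real (7 * n)" i j] measure_grid_box[OF n7] by simp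
    show "B1 \<in> events" unfolding B1_def by (rule prob_some_box(1)[OF n7 c])
    show "prob B1 \<le> (6 * x ^ 20 + 1)\<^sup>2 / x ^ 49"
      using prob_some_box(2)[OF n7 c, of m] unfolding B1_def m by simp
  qed
  have b2: "B2 \<in> events" "prob B2 \<le> (6 * x ^ 20 + 1)\<^sup>2 * (2 / 2 powr x)"
  proof -
    have "1 / fact k \<le> 2 / 2 powr x"
    proof -
      have "(2::nat) ^ (k - 1) \<le> fact k"
      proof -
        have "(2::nat) ^ i \<le> fact (Suc i)" for i
        proof (induction i)
          case (Suc i)
          have "2 * (2::nat) ^ i \<le> Suc (Suc i) * fact (Suc i)" using Suc by (intro mult_mono) auto
          then show ?case by simp
        qed simp
        from this[of "k - 1"] show ?thesis by (simp add: k_def)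
      qed
      then have "real (2 ^ (k - 1)) \<le> real (fact k)" by (rule of_nat_mono)
      then have f: "(2::real) ^ (k - 1) \<le> fact k" by simp
      have "2 powr x = 2 ^ k" by (simp add: x_def powr_realpow)
      also have "\<dots> = 2 * 2 ^ (k - 1)" by (simp add: k_def power_Suc[symmetric] del: power_Suc)
      finally show ?thesis using f by (simp add: field_simps)
    qed
    then have c: "prob {S \<in> space P. card (S \<inter> grid_box q 1 i j) \<in> {k..}} \<le> 2 / 2 powr x" for i j
      using prob_count_ge_le[OF grid_box_borel grid_box_bounded, of q 1 i j k] measure_grid_box[of 1 q i j] by simp
    show "B2 \<in> events" unfolding B2_def by (rule prob_some_box(1)[OF _ c]) simp
    show "prob B2 \<le> (6 * x ^ 20 + 1)\<^sup>2 * (2 / 2 powr x)"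
      using prob_some_box(2)[OF _ c, of m] unfolding B2_def m by simp
  qed
  have b3: "B3 \<in> events" "prob B3 \<le> (6 * x ^ 20 + 1)\<^sup>2 * exp (- pattern_const * x)"
    using prob_no_pattern[OF n1 k_def[THEN meta_eq_to_obj_eq], of m q] unfolding B3_def m x_def by blast+
  have b4: "B4 \<in> events" "prob B4 \<le> exp (- (x\<^sup>2 / 1024))"
  proof -
    have e4: "0 < e / 4" "e / 4 \<le> 1" "(e / 4)\<^sup>2 \<le> 1 / 2"
      using e power_mono[of "e/4" "1/2" 2] by (simp_all add: power2_eq_square)
    show "B4 \<in> events" unfolding B4_def by (rule prob_no_pair(1)[OF e4])
    have eq: "real ((k ^ 29)\<^sup>2) * (e / 4) ^ 4 / 4 = x\<^sup>2 / 1024"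
    proof -
      have "real ((k ^ 29)\<^sup>2) = x ^ 2 * x ^ 56" by (simp add: x_def power_mult[symmetric] power_add[symmetric])
      moreover have "(e / 4) ^ 4 = 1 / x ^ 56 / 256"
        by (simp add: e_def power_divide power_mult[symmetric])
      moreover have "x ^ 2 * x ^ 56 * (1 / x ^ 56 / 256) / 4 = x\<^sup>2 / 1024" proof -
        have "a * b * (1 / b / 256) / 4 = a / 1024" if "b \<noteq> 0" for a b :: real using that by simp
        from this[of "x ^ 56" "x\<^sup>2"] pos[of 56] show ?thesis by linarith
      qed
      ultimately show ?thesis by (simp only:)
    qed
    show "prob B4 \<le> exp (- (x\<^sup>2 / 1024))"
      using prob_no_pair(2)[OF e4, of "k ^ 29" q] unfolding B4_def eq .
  qed
  \<comment> \<open>About \<open>x ^ 58\<close> first boxes, \<open>x ^ 25 / e\<^sup>2\<close>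
    second ones and probability \<open>e ^ 8\<close> give \<open>x ^ 83 * e ^ 6 = 1 / x\<close>. The
    constant is \<open>9 * 4 * 4 * 16 * 2 * 1641\<close>.\<close>
  have b5: "B5 \<in> events" "prob B5 \<le> 7561728 / x"
  proof -
    have t: "0 \<le> 12 * x ^ 10" "0 \<le> x ^ 15" using x0 by simp_all
    show "B5 \<in> events" unfolding B5_def by (rule prob_close_pairs(1)[OF e(1,2) t])
    have "prob B5 \<le> (2 * real (k ^ 29) + 1)\<^sup>2 * (4 * pi * (12 * x ^ 10 + 4 * e) * (x ^ 15 + 12 * x ^ 10 + 4 * e)) / e\<^sup>2 * (1641 * e ^ 8)"
      unfolding B5_def by (rule prob_close_pairs(2)[OF e(1,2) t])
    also have "\<dots> \<le> (3 * x ^ 29)\<^sup>2 * (4 * 4 * (16 * x ^ 10) * (2 * x ^ 15)) / e\<^sup>2 * (1641 * e ^ 8)"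
    proof (intro mult_right_mono divide_right_mono mult_mono power_mono)
      show "2 * real (k ^ 29) + 1 \<le> 3 * x ^ 29" using pos[of 29] by (simp add: x_def)
      show "pi \<le> 4" using pi_less_4 by simp
      show "12 * x ^ 10 + 4 * e \<le> 16 * x ^ 10" using e(3) pos[of 10] by linarith
      have "12 * x ^ 10 + 4 \<le> x ^ 15" 
        using L(6) pos[of 15] mult_left_mono[OF pos[of 10], of 4] L(8) pos[of 10] by linarith
      then show "x ^ 15 + 12 * x ^ 10 + 4 * e \<le> 2 * x ^ 15" using e(3) by linarith
    qed (use x0 e in auto)
    also have "\<dots> = 7561728 * (x ^ 83 * e ^ 6)"
    proof -
      have "e ^ 8 = e\<^sup>2 * e ^ 6" by (simp add: power_add[symmetric])
      moreover have "(x ^ 29)\<^sup>2 * x ^ 10 * x ^ 15 = x ^ 83" by (simp add: power_add[symmetric] power_mult[symmetric])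
      moreover have "(3 * x ^ 29)\<^sup>2 * (4 * 4 * (16 * x ^ 10) * (2 * x ^ 15)) / e\<^sup>2 * (1641 * (e\<^sup>2 * e ^ 6))
          = 7561728 * ((x ^ 29)\<^sup>2 * x ^ 10 * x ^ 15) * e ^ 6"
        unfolding power_mult_distrib[of 3] using e(1) by (simp add: divide_simps)
      ultimately show ?thesis by simp
    qed
    also have "x ^ 83 * e ^ 6 = 1 / x"
    proof -
      have "e ^ 6 = 1 / x ^ 84" by (simp add: e_def power_divide power_mult[symmetric])
      moreover have "x ^ 84 = x * x ^ 83" by (simp add: power_Suc[symmetric] del: power_Suc)
      ultimately show ?thesis using x0 by simp
    qed
    finally show "prob B5 \<le> 7561728 / x" by simp
  qed
  define B where "B = B1 \<union> B2 \<union> B3 \<union> B4 \<union> B5"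
  have "B \<in> events" unfolding B_def using b1 b2 b3 b4 b5 by auto
  moreover have "prob B \<le> failure_bound x"
  proof -
    have "prob B \<le> prob B1 + prob B2 + prob B3 + prob B4 + prob B5"
      unfolding B_def using measure_Un_le[OF b1(1) b2(1)] measure_Un_le[of "B1 \<union> B2" P B3]
        measure_Un_le[of "B1 \<union> B2 \<union> B3" P B4] measure_Un_le[of "B1 \<union> B2 \<union> B3 \<union> B4" P B5] b1 b2 b3 b4 b5
      by (simp del: Un_assoc)
    then show ?thesis using b1 b2 b3 b4 b5 unfolding failure_bound_def by linarith
  qed
  moreover have "good_at (x ^ 10) (x ^ 15) (1 / x ^ 14) q S" if S: "S \<in> space P - B" "general_position S" for S
    unfolding x_def k_def
    by (rule good_scale_deterministic[OF locfin_space S(2) n])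
       (use S in \<open>auto simp: B_def B1_def B2_def B3_def B4_def B5_def m_def e_def x_def k_def\<close>)
  ultimately show ?thesis by blast
qed

section \<open>General position\<close>

type_synonym cell = "int \<times> int"

definition unit_cell :: "real \<Rightarrow> cell \<Rightarrow> pt set" where
  "unit_cell e x = grid_box 0 e (fst x) (snd x)"

definition quad_cell :: "real \<Rightarrow> cell \<times> cell \<times> cell \<times> cell \<Rightarrow> (pt \<times> pt \<times> pt \<times> pt) set" where
  "quad_cell e w = (case w of (a, b, c, d) \<Rightarrow> unit_cell e a \<times> unit_cell e b \<times> unit_cell e c \<times> unit_cell e d)"

lemma unit_cell_disjoint: "e > 0 \<Longrightarrow> x \<noteq> y \<Longrightarrow> unit_cell e x \<inter> unit_cell e y = {}"
  using grid_box_disjoint[of e "fst x" "snd x" "fst y" "snd y"] by (auto simp: unit_cell_def prod_eq_iff)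

lemma dist_Pair_le: "dist (a, b) (c, d) \<le> dist a c + dist b d"
  unfolding dist_Pair_Pair by (rule sqrt_sum_squares_le_sum) auto

lemma quad_cell_dist:
  assumes "x \<in> quad_cell e w" "y \<in> quad_cell e w" shows "dist x y \<le> 8 * e"
proof -
  obtain a b c d where w: "w = (a, b, c, d)" by (cases w)
  obtain x1 x2 x3 x4 where x: "x = (x1, x2, x3, x4)" by (cases x)
  obtain y1 y2 y3 y4 where y: "y = (y1, y2, y3, y4)" by (cases y)
  have "dist x1 y1 < 2 * e" "dist x2 y2 < 2 * e" "dist x3 y3 < 2 * e" "dist x4 y4 < 2 * e"
    using assms unfolding w x y quad_cell_def unit_cell_def by (auto intro: grid_box_dist)
  then show ?thesis
    using dist_Pair_le[of x1 "(x2, x3, x4)" y1 "(y2, y3, y4)"] dist_Pair_le[of x2 "(x3, x4)" y2 "(y3, y4)"]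
      dist_Pair_le[of x3 x4 y3 y4] unfolding x y by linarith
qed

lemma lborel_Times:
  fixes A :: "'a::euclidean_space set" and B :: "'b::euclidean_space set"
  assumes "A \<in> sets borel" "B \<in> sets borel"
  shows "emeasure lborel (A \<times> B) = emeasure lborel A * emeasure lborel B"
proof -
  have "emeasure (lborel \<Otimes>\<^sub>M lborel) (A \<times> B) = emeasure lborel A * emeasure lborel B"
    using assms by (intro lborel.emeasure_pair_measure_Times) auto
  then show ?thesis by (simp add: lborel_prod)
qed

lemma quad_cell_lborel:
  assumes "e > 0"
  shows "quad_cell e w \<in> sets borel" "emeasure lborel (quad_cell e w) = ennreal (e ^ 8)"
proof -
  obtain a b c d where w: "w = (a, b, c, d)" by (cases w)
  have b: "unit_cell e x \<in> sets borel" for x by (simp add: unit_cell_def)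
  show "quad_cell e w \<in> sets borel"
    unfolding w quad_cell_def by (simp add: borel_Times b)
  have "emeasure lborel (quad_cell e w) = ennreal (e\<^sup>2) * (ennreal (e\<^sup>2) * (ennreal (e\<^sup>2) * ennreal (e\<^sup>2)))"
    unfolding w quad_cell_def prod.case
    by (simp add: lborel_Times borel_Times b) (simp add: unit_cell_def lborel_grid_box assms)
  also have "\<dots> = ennreal (e ^ 8)" by (simp add: ennreal_mult[symmetric] power_add[symmetric])
  finally show "emeasure lborel (quad_cell e w) = ennreal (e ^ 8)" .
qed

section \<open>Null sets of quadruples of points\<close>

lemma compact_null_product:
  fixes T :: "('a::euclidean_space \<times> 'b::euclidean_space) set"
  assumes T: "compact T" and null: "\<And>y. negligible {x. (x, y) \<in> T}"
  shows "emeasure lborel T = 0"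
proof -
  have b: "T \<in> sets (lborel \<Otimes>\<^sub>M lborel)"
    using T unfolding lborel_prod by (simp add: borel_compact)
  have "emeasure lborel ((\<lambda>x. (x, y)) -` T) = 0" for y
  proof -
    have "closed ((\<lambda>x. (x, y)) -` T)"
      using T by (intro closed_vimage compact_imp_closed continuous_intros)
    moreover have "(\<lambda>x. (x, y)) -` T \<in> null_sets lebesgue"
      using null[of y] by (simp add: negligible_iff_null_sets vimage_def)
    ultimately show ?thesis by (simp add: null_sets_completion_iff null_setsD1)
  qed
  then have "emeasure (lborel \<Otimes>\<^sub>M lborel) T = 0"
    by (simp add: lborel_pair.emeasure_pair_measure_alt2[OF b])
  then show ?thesis by (simp add: lborel_prod)
qed

text \<open>Outer regularity gives an open set of measure at most \<open>\<epsilon>\<close> around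
  \<open>T\<close>. By compactness it contains a neighbourhood of \<open>T\<close>, hence all small
  cells that meet \<open>T\<close>; these are disjoint and have volume \<open>e ^ 8\<close>
  each.\<close>

lemma few_cells_meet_null_set:
  fixes T :: "(pt \<times> pt \<times> pt \<times> pt) set" and \<epsilon> :: real
  assumes T: "compact T" "emeasure lborel T = 0" and \<epsilon>: "\<epsilon> > 0"
  shows "\<exists>r>0. \<forall>(e::real) W. 0 < e \<and> e \<le> r \<and> finite W \<and> (\<forall>w\<in>W. quad_cell e w \<inter> T \<noteq> {}) \<longrightarrow> card W * e ^ 8 \<le> \<epsilon>"
proof (cases "T = {}")
  case True
  then show ?thesis using \<epsilon> by (intro exI[of _ 1] conjI allI impI zero_less_one) (subgoal_tac "W = {}"; fastforce)
next
  case False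
  have bT: "T \<in> sets borel" using T by (simp add: borel_compact)
  obtain U where U: "open U" "T \<subseteq> U" "emeasure lborel (U - T) < ennreal \<epsilon>"
    using outer_regular_lborel[OF bT \<epsilon>] by blast
  have mU: "emeasure lborel U \<le> ennreal \<epsilon>"
  proof -
    have "emeasure lborel U = emeasure lborel (U - T) + emeasure lborel T"
      using U bT by (subst plus_emeasure) (auto simp: Un_absorb1 Un_commute)
    then show ?thesis using T(2) U(3) by simp
  qed
  obtain r where r: "r > 0" "{x. infdist x T \<le> r} \<subseteq> U"
    using compact_in_open_separated[OF False T(1) U(1,2)] by blast
  show ?thesis
  proof (intro exI[of _ "r / 8"] conjI allI impI)
    show "r / 8 > 0" using r by simp
    fix e :: real and W assume *: "0 < e \<and> e \<le> r / 8 \<and> finite W \<and> (\<forall>w\<in>W. quad_cell e w \<inter> T \<noteq> {})"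
    have sub: "(\<Union>w\<in>W. quad_cell e w) \<subseteq> U"
    proof
      fix x assume "x \<in> (\<Union>w\<in>W. quad_cell e w)"
      then obtain w y where "w \<in> W" "x \<in> quad_cell e w" "y \<in> quad_cell e w" "y \<in> T" using * by blast
      then have "infdist x T \<le> r" using infdist_le[of y T x] quad_cell_dist[of x e w y] * by linarith
      then show "x \<in> U" using r by blast
    qed
    have disj: "disjoint_family_on (quad_cell e) W"
    unfolding disjoint_family_on_def
    proof (intro ballI impI)
      fix v w :: "cell \<times> cell \<times> cell \<times> cell" assume "v \<noteq> w"
      then show "quad_cell e v \<inter> quad_cell e w = {}"
        using unit_cell_disjoint[of e] * by (cases v; cases w) (simp add: quad_cell_def Times_Int_Times, blast)
    qed
    have "ennreal (card W * e ^ 8) = (\<Sum>w\<in>W. emeasure lborel (quad_cell e w))"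
      using * by (simp add: quad_cell_lborel ennreal_mult ennreal_of_nat_eq_real_of_nat)
    also have "\<dots> = emeasure lborel (\<Union>w\<in>W. quad_cell e w)"
      using * disj by (intro sum_emeasure) (auto simp: quad_cell_lborel)
    also have "\<dots> \<le> emeasure lborel U" using sub U by (intro emeasure_mono) auto
    also have "\<dots> \<le> ennreal \<epsilon>" by (rule mU)
    finally show "card W * e ^ 8 \<le> \<epsilon>" using \<epsilon> by simp
  qed
qed

context poisson
begin

lemma prob_quad:
  assumes e: "e > 0" and d: "distinct [a, b, c, d]"
  shows "prob {S \<in> space P. \<forall>x\<in>{a, b, c, d}. card (S \<inter> unit_cell e x) \<in> {1..}} \<le> e ^ 8"
proof -
  have p: "prob {S \<in> space P. card (S \<inter> unit_cell e x) \<in> {1..}} \<le> e\<^sup>2" for x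
    using prob_nonempty[OF grid_box_borel grid_box_bounded, of 0 e "fst x" "snd x"] measure_grid_box[OF e, of 0 "fst x" "snd x"]
      exp_ge_add_one_self[of "- e\<^sup>2"] by (simp add: unit_cell_def)
  have "prob {S \<in> space P. \<forall>x\<in>{a, b, c, d}. card (S \<inter> unit_cell e x) \<in> {1..}} =
     (\<Prod>x\<in>{a, b, c, d}. prob {S \<in> space P. card (S \<inter> unit_cell e x) \<in> {1..}})"
    by (rule prob_joint[where A = "\<lambda>_. {1..}"])
       (use unit_cell_disjoint[OF e] in \<open>auto simp: unit_cell_def grid_box_bounded disjoint_family_on_def\<close>)
  also have "\<dots> \<le> (\<Prod>x\<in>{a, b, c, d}. e\<^sup>2)" using p by (intro prod_mono) auto
  also have "\<dots> = e ^ 8" using d by (simp add: power_mult[symmetric])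
  finally show ?thesis .
qed

text \<open>If distinct points form a quadruple in \<open>T\<close>, then at every fine resolution
  some quadruple of distinct cells meeting \<open>T\<close> is occupied. The probability of this is
  at most the total volume of such cells, which tends to 0. Distinctness of the cells provides
  independence.\<close>

lemma AE_avoids_null_quadruples:
  fixes T :: "(pt \<times> pt \<times> pt \<times> pt) set"
  assumes T: "compact T" and null: "\<And>y. negligible {x. (x, y) \<in> T}"
  shows "AE S in P. \<forall>p\<in>S. \<forall>a\<in>S. \<forall>b\<in>S. \<forall>c\<in>S. distinct [p, a, b, c] \<longrightarrow> (p, a, b, c) \<notin> T"
proof -
  define e :: "nat \<Rightarrow> real" where "e n = 1 / 2 ^ n" for n
  have e0: "e n > 0" for n by (simp add: e_def)
  define W where "W n = {w \<in> square (n * 2 ^ n) \<times> square (n * 2 ^ n) \<times> square (n * 2 ^ n) \<times> square (n * 2 ^ n).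
     distinct [fst w, fst (snd w), fst (snd (snd w)), snd (snd (snd w))] \<and> quad_cell (e n) w \<inter> T \<noteq> {}}" for n
  have finW: "finite (W n)" for n by (simp add: W_def)
  define A where "A n = {S \<in> space P. \<exists>w\<in>W n. \<forall>x\<in>{fst w, fst (snd w), fst (snd (snd w)), snd (snd (snd w))}.
     card (S \<inter> unit_cell (e n) x) \<in> {1..}}" for n
  have ev: "{S \<in> space P. \<forall>x\<in>I. card (S \<inter> unit_cell (e n) x) \<in> {1..}} \<in> events" if "finite I" for n I
    using that by (intro sets.sets_Collect_finite_All count_event) (auto simp: unit_cell_def grid_box_bounded)
  have pq: "prob {S \<in> space P. \<forall>x\<in>{fst w, fst (snd w), fst (snd (snd w)), snd (snd (snd w))}.
     card (S \<inter> unit_cell (e n) x) \<in> {1..}} \<le> e n ^ 8" if "w \<in> W n" for w n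
    using that by (intro prob_quad e0) (simp add: W_def)
  have A: "A n \<in> events" "prob (A n) \<le> card (W n) * e n ^ 8" for n
  proof -
    show "A n \<in> events" unfolding A_def by (rule prob_Bex_le(1)[OF finW ev pq]) simp
    show "prob (A n) \<le> card (W n) * e n ^ 8" unfolding A_def by (rule prob_Bex_le(2)[OF finW ev pq]) simp
  qed
  \<comment> \<open>A bad configuration lies in all late \<open>A n\<close>, so probabilities
    tending to 0 are enough and no summability is involved.\<close>
  define B where "B N = (\<Inter>n\<in>{N..}. A n)" for N
  have BE: "B N \<in> events" for N unfolding B_def using A by (intro sets.countable_INT) auto
  have lim: "e \<longlonglongrightarrow> 0"
    using LIMSEQ_inverse_realpow_zero[of 2] by (simp add: e_def[abs_def] inverse_eq_divide)
  have "prob (B N) = 0" for N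
  proof -
    have "prob (B N) \<le> \<epsilon>" if \<epsilon>: "\<epsilon> > 0" for \<epsilon>
    proof -
      obtain r where r: "r > 0" "\<forall>(e::real) W. 0 < e \<and> e \<le> r \<and> finite W \<and> (\<forall>w\<in>W. quad_cell e w \<inter> T \<noteq> {})
          \<longrightarrow> card W * e ^ 8 \<le> \<epsilon>"
        using few_cells_meet_null_set[OF T compact_null_product[OF T null] \<epsilon>] by (elim exE conjE) (rule that)
      have "eventually (\<lambda>n. e n < r \<and> N \<le> n) sequentially"
        using order_tendstoD(2)[OF lim r(1)] eventually_ge_at_top[of N] by eventually_elim simp
      then obtain n where n: "e n < r" "N \<le> n" by (auto simp: eventually_sequentially)
      have "prob (B N) \<le> prob (A n)" using n A by (intro finite_measure_mono) (auto simp: B_def)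
      also have "\<dots> \<le> card (W n) * e n ^ 8" by (rule A)
      also have "\<dots> \<le> \<epsilon>"
      proof (rule r(2)[rule_format], intro conjI ballI)
        show "quad_cell (e n) w \<inter> T \<noteq> {}" if "w \<in> W n" for w using that by (simp add: W_def)
      qed (use e0 n finW in simp_all)
      finally show ?thesis .
    qed
    then have "prob (B N) \<le> 0" by (rule field_le_epsilon[of _ 0, simplified]) 
    then show ?thesis using measure_nonneg[of P "B N"] by linarith
  qed
  then have nullB: "B N \<in> null_sets P" for N using BE by (simp add: null_sets_def emeasure_eq_measure)
  have "(\<Union>N. B N) \<in> null_sets P" using nullB by (rule null_sets_UN)
  note B = this
  have key: "S \<in> (\<Union>N. B N)"
    if S: "S \<in> space P" "p \<in> S" "a \<in> S" "b \<in> S" "c \<in> S" "distinct [p, a, b, c]" "(p, a, b, c) \<in> T" for S p a b c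
  proof -
    define d where "d = Min ((\<lambda>x. dist (fst x) (snd x)) ` {(p, a), (p, b), (p, c), (a, b), (a, c), (b, c)})"
    have d: "d > 0" "d \<le> dist p a" "d \<le> dist p b" "d \<le> dist p c" "d \<le> dist a b" "d \<le> dist a c" "d \<le> dist b c"
      using S(6) by (auto simp: d_def)
    define R where "R = Max (norm ` {p, a, b, c})"
    have R: "norm p \<le> R" "norm a \<le> R" "norm b \<le> R" "norm c \<le> R" by (auto simp: R_def)
    have "eventually (\<lambda>n. e n < d / 2 \<and> nat \<lceil>R\<rceil> \<le> n) sequentially"
      using order_tendstoD(2)[OF lim, of "d / 2"] eventually_ge_at_top[of "nat \<lceil>R\<rceil>"] d(1) by (simp add: eventually_conj)
    then obtain N where N: "\<And>n. n \<ge> N \<Longrightarrow> e n < d / 2 \<and> nat \<lceil>R\<rceil> \<le> n" by (auto simp: eventually_sequentially)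
    have "S \<in> A n" if n: "n \<ge> N" for n
    proof -
      have *: "\<exists>x. x \<in> square (n * 2 ^ n) \<and> y \<in> unit_cell (e n) x" if "norm y \<le> R" for y :: pt
      proof -
        have "dist 0 y \<le> real n" using N[OF n] that by simp
        then have "dist 0 y \<le> e n * real (n * 2 ^ n)" by (simp add: e_def)
        then obtain i j where "(i, j) \<in> square (n * 2 ^ n)" "y \<in> grid_box 0 (e n) i j"
          using square_cover_dist[OF e0] by blast
        then show ?thesis by (intro exI[of _ "(i, j)"]) (simp add: unit_cell_def)
      qed
      obtain p' a' b' c' where q: "p' \<in> square (n * 2 ^ n)" "p \<in> unit_cell (e n) p'"
        "a' \<in> square (n * 2 ^ n)" "a \<in> unit_cell (e n) a'" "b' \<in> square (n * 2 ^ n)" "b \<in> unit_cell (e n) b'"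
        "c' \<in> square (n * 2 ^ n)" "c \<in> unit_cell (e n) c'"
        using *[OF R(1)] *[OF R(2)] *[OF R(3)] *[OF R(4)] by blast
      have ne: "x' \<noteq> y'" if "x \<in> unit_cell (e n) x'" "y \<in> unit_cell (e n) y'" "d \<le> dist x y" for x y x' y'
        using grid_box_dist[of x 0 "e n" "fst x'" "snd x'" y] that N[OF n] by (auto simp: unit_cell_def)
      have dist': "distinct [p', a', b', c']"
        using ne[OF q(2,4)] ne[OF q(2,6)] ne[OF q(2,8)] ne[OF q(4,6)] ne[OF q(4,8)] ne[OF q(6,8)] d by simp
      have ge1: "card (S \<inter> unit_cell (e n) x') \<in> {1..}" if "x \<in> S" "x \<in> unit_cell (e n) x'" for x x'
      proof -
        have "finite (S \<inter> unit_cell (e n) x')"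
          using locfin_space[OF S(1)] by (simp add: locfin_def unit_cell_def grid_box_bounded)
        then show ?thesis using that by (auto simp: Suc_le_eq card_gt_0_iff)
      qed
      have "(p, a, b, c) \<in> quad_cell (e n) (p', a', b', c')" using q by (simp add: quad_cell_def)
      then have "(p', a', b', c') \<in> W n" using S(7) q dist' by (auto simp: W_def)
      moreover have "\<forall>x\<in>{p', a', b', c'}. card (S \<inter> unit_cell (e n) x) \<in> {1..}"
        using ge1[OF S(2) q(2)] ge1[OF S(3) q(4)] ge1[OF S(4) q(6)] ge1[OF S(5) q(8)] by simp
      ultimately show ?thesis using S(1)
        unfolding A_def mem_Collect_eq by (intro conjI bexI[of _ "(p', a', b', c')"]) simp_all
    qed
    then show ?thesis by (auto simp: B_def)
  qed
  from AE_not_in[OF B] AE_space show ?thesis by eventually_elim (use key in blast)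
qed

end

text \<open>Positivity of \<open>g\<close> removes degenerate positions, where the zero set may be
  large. What remains is exhausted by the compact sets \<open>T n\<close>, on which \<open>g\<close>
  is at least \<open>1 / n\<close>.\<close>

lemma (in poisson) AE_avoids_zero_set:
  fixes f g :: "pt \<times> pt \<times> pt \<times> pt \<Rightarrow> real"
  assumes f: "continuous_on UNIV f" and g: "continuous_on UNIV g"
    and null: "\<And>a b c. negligible {p. f (p, a, b, c) = 0 \<and> 0 < g (p, a, b, c)}"
  shows "AE S in P. \<forall>p\<in>S. \<forall>a\<in>S. \<forall>b\<in>S. \<forall>c\<in>S. distinct [p, a, b, c] \<longrightarrow>
    f (p, a, b, c) = 0 \<longrightarrow> g (p, a, b, c) \<le> 0"
proof -
  define T where "T n = (cball 0 (real n) \<times> cball 0 (real n) \<times> cball 0 (real n) \<times> cball 0 (real n)) \<inter>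
    ({z. f z = 0} \<inter> {z. 1 / real n \<le> g z})" for n :: nat
  have "AE S in P. \<forall>p\<in>S. \<forall>a\<in>S. \<forall>b\<in>S. \<forall>c\<in>S. distinct [p, a, b, c] \<longrightarrow> (p, a, b, c) \<notin> T n" if "n > 0" for n
  proof (rule AE_avoids_null_quadruples)
    show "compact (T n)"
      unfolding T_def using f g
      by (intro compact_Int_closed compact_Times compact_cball closed_Int closed_Collect_eq closed_Collect_le continuous_on_const)
    fix y :: "pt \<times> pt \<times> pt"
    obtain a b c where y: "y = (a, b, c)" by (cases y)
    have "g z > 0" if "1 / real n \<le> g z" for z
      using that \<open>n > 0\<close> less_le_trans[of 0 "1 / real n" "g z"] by simp
    then have "{x. (x, y) \<in> T n} \<subseteq> {p. f (p, a, b, c) = 0 \<and> 0 < g (p, a, b, c)}"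
      by (auto simp: T_def y)
    then show "negligible {x. (x, y) \<in> T n}" using null negligible_subset by blast
  qed
  then have "AE S in P. \<forall>n\<in>{0<..}. \<forall>p\<in>S. \<forall>a\<in>S. \<forall>b\<in>S. \<forall>c\<in>S. distinct [p, a, b, c] \<longrightarrow> (p, a, b, c) \<notin> T n"
    by (subst AE_ball_countable) auto
  then show ?thesis
  proof eventually_elim
    case (elim S)
    show ?case
    proof (intro ballI impI, rule ccontr)
      fix p a b c assume *: "p \<in> S" "a \<in> S" "b \<in> S" "c \<in> S" "distinct [p, a, b, c]" "f (p, a, b, c) = 0"
        "\<not> g (p, a, b, c) \<le> 0"
      define n where "n = nat \<lceil>Max {norm p, norm a, norm b, norm c, 1 / g (p, a, b, c)}\<rceil>"
      have n: "norm p \<le> n" "norm a \<le> n" "norm b \<le> n" "norm c \<le> n" "1 / g (p, a, b, c) \<le> n"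
        unfolding n_def by (rule order_trans[OF Max_ge real_nat_ceiling_ge]; simp)+
      have "0 < 1 / g (p, a, b, c)" using * by simp
      then have n0: "n > 0" using n(5) by (metis gr0I of_nat_0 not_less)
      then have "1 / real n \<le> g (p, a, b, c)" using n(5) * by (simp add: field_simps)
      then have "(p, a, b, c) \<in> T n" using n * by (simp add: T_def)
      then show False using elim n0 * by (meson greaterThan_iff)
    qed
  qed
qed

section \<open>Degenerate triples and quadruples\<close>

lemma negligible_collinear: "negligible {p. cross (a - p) (b - p) = 0 \<and> 0 < dist a b}"
proof (cases "a = b")
  case False
  have "cross (a - p) (b - p) = cross a b - rot (a - b) \<bullet> p" for p
    by (simp add: cross_def inner_2 algebra_simps)
  then have "{p. cross (a - p) (b - p) = 0 \<and> 0 < dist a b} \<subseteq> {p. rot (a - b) \<bullet> p = cross a b}" by auto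
  moreover have "rot (a - b) \<noteq> 0" using False by (simp add: rot_eq_0_iff)
  ultimately show ?thesis using negligible_hyperplane negligible_subset by blast
qed simp

text \<open>Vanishes on concyclic quadruples, because the three vectors \<open>p - a\<close>, \<open>b - a\<close>, \<open>c - a\<close> of the
  plane are linearly dependent with these coefficients.\<close>

definition concyclic :: "pt \<Rightarrow> pt \<Rightarrow> pt \<Rightarrow> pt \<Rightarrow> real" where
  "concyclic p a b c = cross (b - a) (c - a) * ((p - a) \<bullet> (p - a)) + cross (c - a) (p - a) * ((b - a) \<bullet> (b - a)) +
     cross (p - a) (b - a) * ((c - a) \<bullet> (c - a))"

lemma concyclic_pw:
  "concyclic p a b c = cross (b - a) (c - a) * pw v a p + cross (c - a) (p - a) * pw v a b + cross (p - a) (b - a) * pw v a c"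
  unfolding concyclic_def pw_def inner_2 cross_def vector_minus_component by algebra

text \<open>If \<open>a\<close>, \<open>b\<close>, \<open>c\<close> are not collinear,
  \<open>v\<close> is their circumcentre, and vanishing at \<open>p\<close> puts \<open>p\<close> on
  their circle.\<close>

lemma negligible_concyclic: "negligible {p. concyclic p a b c = 0 \<and> 0 < \<bar>cross (b - a) (c - a)\<bar>}"
proof (cases "cross (b - a) (c - a) = 0")
  case False
  define m where "m = a + (1 / 2) *\<^sub>R (b - a)"
  define v where "v = m + (pw m a c / (2 * cross (b - a) (c - a))) *\<^sub>R rot (b - a)"
  have "pw m a b = 0" by (simp add: m_def pw_def)
  then have v: "pw v a b = 0" "pw v a c = 0" using False by (simp_all add: v_def pw_shift)
  have "p \<in> sphere v (dist v a)" if "concyclic p a b c = 0" for p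
    using that concyclic_pw[of p a b c v] v False by (simp add: pw_eq_0_iff)
  then have "{p. concyclic p a b c = 0 \<and> 0 < \<bar>cross (b - a) (c - a)\<bar>} \<subseteq> sphere v (dist v a)" by blast
  then show ?thesis using negligible_sphere negligible_subset by blast
qed simp

lemma negligible_equidistant: "negligible {p. dist p (a::pt) = r}"
  using negligible_sphere[of a r] by (simp add: sphere_def dist_commute)

lemma continuous_cross [continuous_intros]:
  "continuous_on A f \<Longrightarrow> continuous_on A g \<Longrightarrow> continuous_on A (\<lambda>x. cross (f x) (g x))"
  unfolding cross_def by (intro continuous_intros)

lemma many_4_pick:
  assumes "many 4 S" "finite F" "card F \<le> 3"
  obtains d where "d \<in> S" "d \<notin> F"
proof -
  obtain Q where Q: "Q \<subseteq> S" "finite Q" "card Q = 4" using assms(1) by (auto simp: many_def)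
  have "\<not> Q \<subseteq> F" using card_mono[of F Q] Q assms by auto
  then show thesis using that Q by blast
qed

definition generic_distances :: "pt set \<Rightarrow> bool" where
  "generic_distances S \<longleftrightarrow> (\<forall>x\<in>S. \<forall>y\<in>S. \<forall>z\<in>S. distinct [x, y, z] \<longrightarrow> dist x y \<noteq> dist x z) \<and>
     (\<forall>x\<in>S. \<forall>y\<in>S. \<forall>u\<in>S. \<forall>v\<in>S. distinct [x, y, u, v] \<longrightarrow> dist x y \<noteq> dist u v)"

text \<open>Conditions on three points are phrased for quadruples as well; \<open>many 4 S\<close>
  supplies the fourth point.\<close>

lemma (in poisson) AE_general_position:
  "AE S in P. many 4 S \<longrightarrow> general_position S \<and> generic_distances S"
proof -
  have 1: "AE S in P. \<forall>p\<in>S. \<forall>a\<in>S. \<forall>b\<in>S. \<forall>c\<in>S. distinct [p, a, b, c] \<longrightarrow>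
    cross (a - p) (b - p) = 0 \<longrightarrow> dist a b \<le> 0"
    using AE_avoids_zero_set[of "\<lambda>z. cross (fst (snd z) - fst z) (fst (snd (snd z)) - fst z)"
        "\<lambda>z. dist (fst (snd z)) (fst (snd (snd z)))"] negligible_collinear
    by (simp add: continuous_intros)
  have 2: "AE S in P. \<forall>p\<in>S. \<forall>a\<in>S. \<forall>b\<in>S. \<forall>c\<in>S. distinct [p, a, b, c] \<longrightarrow>
    concyclic p a b c = 0 \<longrightarrow> \<bar>cross (b - a) (c - a)\<bar> \<le> 0"
    using AE_avoids_zero_set[of "\<lambda>z. concyclic (fst z) (fst (snd z)) (fst (snd (snd z))) (snd (snd (snd z)))"
        "\<lambda>z. \<bar>cross (fst (snd (snd z)) - fst (snd z)) (snd (snd (snd z)) - fst (snd z))\<bar>"] negligible_concyclic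
    by (simp add: concyclic_def continuous_intros)
  have 3: "AE S in P. \<forall>p\<in>S. \<forall>a\<in>S. \<forall>b\<in>S. \<forall>c\<in>S. distinct [p, a, b, c] \<longrightarrow>
    dist p a - dist b c = 0 \<longrightarrow> (1::real) \<le> 0"
    using AE_avoids_zero_set[of "\<lambda>z. dist (fst z) (fst (snd z)) - dist (fst (snd (snd z))) (snd (snd (snd z)))"
        "\<lambda>z. 1"] negligible_equidistant
    by (simp add: continuous_intros)
  have 4: "AE S in P. \<forall>p\<in>S. \<forall>a\<in>S. \<forall>b\<in>S. \<forall>c\<in>S. distinct [p, a, b, c] \<longrightarrow>
    dist p a - dist a b = 0 \<longrightarrow> (1::real) \<le> 0"
    using AE_avoids_zero_set[of "\<lambda>z. dist (fst z) (fst (snd z)) - dist (fst (snd z)) (fst (snd (snd z)))"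
        "\<lambda>z. 1"] negligible_equidistant
    by (simp add: continuous_intros)
  from 1 2 3 4 show ?thesis
  proof eventually_elim
    case (elim S)
    show ?case
    proof
      assume m: "many 4 S"
      have third: "\<exists>d. d \<in> S \<and> distinct [x, y, z, d]" if "distinct [x, y, z]" for x y z :: pt
        using many_4_pick[OF m, of "{x, y, z}"] that card_length[of "[x, y, z]"] by auto
      have col: "cross (u - x) (p - x) \<noteq> 0" if *: "x \<in> S" "u \<in> S" "p \<in> S" "distinct [x, u, p]" for x u p
      proof
        assume c: "cross (u - x) (p - x) = 0"
        obtain d where "d \<in> S" "distinct [x, u, p, d]" using third[OF *(4)] by blast
        then have "dist u p \<le> 0" using elim(1) * c by blast
        then show False using * by simp
      qed
      have "\<nexists>c. pw c x u = 0 \<and> pw c x p = 0 \<and> pw c x q = 0"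
        if *: "x \<in> S" "u \<in> S" "p \<in> S" "q \<in> S" "distinct [x, u, p, q]" for x u p q
      proof
        assume "\<exists>c. pw c x u = 0 \<and> pw c x p = 0 \<and> pw c x q = 0"
        then obtain c where "pw c x u = 0" "pw c x p = 0" "pw c x q = 0" by blast
        then have "concyclic q x u p = 0" by (simp add: concyclic_pw[of _ _ _ _ c])
        moreover have "distinct [q, x, u, p]" using * by auto
        ultimately have "\<bar>cross (u - x) (p - x)\<bar> \<le> 0" using elim(2) * by blast
        then show False using col[of x u p] * by simp
      qed
      moreover have "dist x y \<noteq> dist u v" if *: "x \<in> S" "y \<in> S" "u \<in> S" "v \<in> S" "distinct [x, y, u, v]" for x y u v
        using elim(3) * by force
      moreover have "dist x y \<noteq> dist x z" if *: "x \<in> S" "y \<in> S" "z \<in> S" "distinct [x, y, z]" for x y z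
      proof
        assume e: "dist x y = dist x z"
        have "distinct [y, x, z]" using * by auto
        then obtain d where "d \<in> S" "distinct [y, x, z, d]" using third by blast
        then show False using elim(4) * e dist_commute[of x y] by force
      qed
      ultimately show "general_position S \<and> generic_distances S"
        unfolding general_position_def generic_distances_def using col by (intro conjI ballI impI)
    qed
  qed
qed

text \<open>Equal labels force every distance \<open>t\<close> from \<open>x\<close> to a third
  point to occur from \<open>y\<close> as well: otherwise, between two rationals around
  \<open>t\<close>, one count jumps and the other does not. This repeats a distance, contrary to
  genericity.\<close>

lemma label_distinct:
  assumes S: "locfin S" and m: "many 4 S" and gen: "generic_distances S" and xy: "x \<in> S" "y \<in> S" "x \<noteq> y"
  shows "label S x \<noteq> label S y"
proof
  assume eq: "label S x = label S y"
  have cnt: "card (S \<inter> cball x (of_rat r)) = card (S \<inter> cball y (of_rat r))" for r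
    using fun_cong[OF eq, of "to_nat r"] by (simp add: label_def)
  have fin: "finite (S \<inter> cball p r)" for p r using S by (simp add: locfin_def)
  obtain z where z: "z \<in> S" "z \<notin> {x, y}" by (rule many_4_pick[OF m, of "{x, y}"]) (auto simp: card_insert_if)
  define t where "t = dist x z"
  have t: "t > 0" using z by (auto simp: t_def)
  have "\<exists>v\<in>S. dist y v = t"
  proof (rule ccontr)
    assume no: "\<not> (\<exists>v\<in>S. dist y v = t)"
    define F where "F = (\<lambda>v. \<bar>dist y v - t\<bar>) ` (S \<inter> cball y (t + 1))"
    define \<epsilon> where "\<epsilon> = Min (insert 1 F)"
    have finF: "finite F" using fin by (simp add: F_def)
    have pos: "\<epsilon> > 0" using finF no by (auto simp: \<epsilon>_def F_def)
    have le: "\<epsilon> \<le> 1" using finF by (simp add: \<epsilon>_def)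
    have far: "\<epsilon> \<le> \<bar>dist y v - t\<bar>" if "v \<in> S" "dist y v \<le> t + 1" for v
      unfolding \<epsilon>_def using finF that by (intro Min_le) (auto simp: F_def)
    obtain r1 where r1: "t - \<epsilon> < of_rat r1" "of_rat r1 < t" using of_rat_dense[of "t - \<epsilon>" t] pos by auto
    obtain r2 where r2: "t < of_rat r2" "of_rat r2 < t + \<epsilon>" using of_rat_dense[of t "t + \<epsilon>"] pos by auto
    have "S \<inter> cball y (of_rat r2) = S \<inter> cball y (of_rat r1)"
    proof -
      have "dist y v \<le> of_rat r1" if "v \<in> S" "dist y v \<le> of_rat r2" for v
        using far[of v] that r1 r2 le by linarith
      moreover have "dist y v \<le> of_rat r2" if "dist y v \<le> of_rat r1" for v using that r1 r2 by linarith
      ultimately show ?thesis by auto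
    qed
    then have "card (S \<inter> cball x (of_rat r1)) = card (S \<inter> cball x (of_rat r2))" using cnt by simp
    moreover have "S \<inter> cball x (of_rat r1) \<subset> S \<inter> cball x (of_rat r2)"
    proof
      show "S \<inter> cball x (of_rat r1) \<subseteq> S \<inter> cball x (of_rat r2)" using r1 r2 by auto
      have "z \<in> S \<inter> cball x (of_rat r2)" "z \<notin> S \<inter> cball x (of_rat r1)" using z r1 r2 by (auto simp: t_def)
      then show "S \<inter> cball x (of_rat r1) \<noteq> S \<inter> cball x (of_rat r2)" by blast
    qed
    ultimately show False using psubset_card_mono[OF fin] by (metis less_irrefl)
  qed
  then obtain v where v: "v \<in> S" "dist y v = dist x z" by (auto simp: t_def)
  have vy: "v \<noteq> y" using v t by (auto simp: t_def)
  consider "v = z" | "v = x" | "distinct [x, z, y, v]" using vy z xy by auto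
  then show False
  proof cases
    case 1
    then have "dist z x = dist z y" using v by (simp add: dist_commute)
    then show False using gen z xy unfolding generic_distances_def by (auto simp: dist_commute)
  next
    case 2
    then have "dist x y = dist x z" using v by (simp add: dist_commute)
    then show False using gen z xy unfolding generic_distances_def by auto
  next
    case 3
    then show False using gen z xy v unfolding generic_distances_def by metis
  qed
qed

section \<open>Finite components\<close>

text \<open>Moving by \<open>\<delta>\<close> changes either of the two compared distances by at
  most \<open>\<delta>\<close>, so at most \<open>2 * \<delta>\<close> of depth is lost.\<close>

lemma deep_at_shift:
  assumes "deep_at D h t S z p" "dist z z' \<le> \<delta>"
  shows "deep_at D h (t - 2 * \<delta>) S z' p"
  unfolding deep_at_def
proof (intro conjI ballI)
  note * = assms(1)[unfolded deep_at_def]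
  have d: "0 \<le> \<delta>" using assms(2) zero_le_dist[of z z'] by linarith
  show "p \<in> sites h S" using * by blast
  have "dist z p \<le> D - t" using * by blast
  then show "dist z' p \<le> D - (t - 2 * \<delta>)"
    using dist_triangle[of z' p z] assms(2) d dist_commute[of z z'] by linarith
  fix q assume q: "q \<in> sites h S"
  have "dist q p \<le> 1 \<or> dist z p + t \<le> dist z q" using * q by blast
  then show "dist q p \<le> 1 \<or> dist z' p + (t - 2 * \<delta>) \<le> dist z' q"
    using dist_triangle[of z' p z] dist_triangle[of z q z'] assms(2) dist_commute[of z z'] by linarith
qed

lemma deep_at_antimono:
  assumes "deep_at D h t S z p" "s \<le> t"
  shows "deep_at D h s S z p"
  using assms unfolding deep_at_def by force

lemma deep_iff: "deep D h t S z \<longleftrightarrow> (\<exists>p. deep_at D h t S z p)"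
  by (auto simp: deep_def deep_at_def sites_def)

lemma deep_shift: "deep D h t S z \<Longrightarrow> dist z z' \<le> \<delta> \<Longrightarrow> s \<le> t - 2 * \<delta> \<Longrightarrow> deep D h s S z'"
  unfolding deep_iff using deep_at_shift deep_at_antimono by blast

text \<open>At \<open>z\<close> the site \<open>p\<close> wins by \<open>t\<close>, at
  \<open>z'\<close> the site \<open>p'\<close> does; a step shorter than \<open>t\<close> changes
  the difference of the distances by less than \<open>2 * t\<close> and cannot reverse it so
  far.\<close>

lemma same_cluster:
  assumes "deep_at D h t S z p" "deep_at D h t S z' p'" "dist z z' < t"
  shows "dist p p' \<le> 1"
proof (rule ccontr)
  assume far: "\<not> dist p p' \<le> 1"
  have "dist z p + t \<le> dist z p'" "dist z' p' + t \<le> dist z' p"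
    using assms(1,2) far dist_commute[of p p'] unfolding deep_at_def by metis+
  then show False
    using dist_triangle[of z p' z'] dist_triangle[of z' p z] assms(3) dist_commute[of z z'] by linarith
qed

text \<open>Nearness of clusters is transitive along paths, so that the cluster of a path does not drift.\<close>

lemma cluster_step:
  assumes "deep_at D h t S z p" "deep_at D h t S z' p'" "dist z z' < t" "2 < t"
    and "p0 \<in> sites h S" "dist p p0 \<le> 1"
  shows "dist p' p0 \<le> 1"
proof (rule ccontr)
  assume far: "\<not> dist p' p0 \<le> 1"
  have "dist p p' \<le> 1" using same_cluster assms by blast
  moreover have "dist z' p' + t \<le> dist z' p0"
    using assms(2,5) far dist_commute[of p' p0] unfolding deep_at_def by metis
  ultimately show False
    using dist_triangle[of z' p0 p'] dist_triangle[of p' p0 p] dist_commute[of p p'] assms by linarith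
qed

section \<open>Paths and the size of components\<close>

definition paths :: "pt set \<Rightarrow> pt set \<Rightarrow> (pt \<times> pt) set" where
  "paths S A = {(x, y). y \<in> nbrs S x \<and> x \<in> A \<and> y \<in> A}\<^sup>*"

lemma pathsD: "(x, y) \<in> paths S A \<Longrightarrow> x \<in> A \<Longrightarrow> y \<in> A"
  unfolding paths_def by (erule rtranclE) auto

lemma paths_step: "(x, y) \<in> paths S A \<Longrightarrow> y \<in> A \<Longrightarrow> z \<in> A \<Longrightarrow> z \<in> nbrs S y \<Longrightarrow> (x, z) \<in> paths S A"
  unfolding paths_def by (erule rtrancl_into_rtrancl) simp

lemma paths_refl [simp]: "(x, x) \<in> paths S A"
  by (simp add: paths_def)

definition tight :: "pt set \<Rightarrow> pt set \<Rightarrow> real \<Rightarrow> bool" where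
  "tight S A B \<longleftrightarrow> (\<forall>x\<in>A. \<forall>y. y \<in> nbrs S x \<longrightarrow> dist x y \<le> B) \<and> (\<forall>x\<in>A. \<forall>y. (x, y) \<in> paths S A \<longrightarrow> dist x y \<le> B)"

text \<open>Components of \<open>Z\<close> have diameter at most \<open>w / 4\<close>, so an
  excursion into \<open>Z\<close> between two zone vertices is short compared with their depth and
  cannot change the cluster. A component thus stays within reach of a single cluster.\<close>

lemma tight_zone:
  assumes Z: "tight S Z B" and B: "0 \<le> B" "4 * B \<le> w" and w: "2 < w" "w \<le> D"
  shows "tight S (Z \<union> zone w D h S) (3 * D)"
proof -
  let ?O = "zone w D h S"
  have zn: "dist x y \<le> w" if "x \<in> ?O" "y \<in> nbrs S x" for x y
    using that unfolding zone_def mem_nbrs by (auto simp: delaunay_edge_def)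
  have Ze: "dist x y \<le> B" if "x \<in> Z" "y \<in> nbrs S x" for x y using Z that unfolding tight_def by blast
  have Zp: "dist x y \<le> B" if "x \<in> Z" "(x, y) \<in> paths S Z" for x y using Z that unfolding tight_def by blast
  have wit: "\<exists>p. deep_at D h (2 * w) S x p" if "x \<in> ?O" for x using that unfolding zone_def deep_iff by blast
  have site: "p \<in> sites h S" "dist x p \<le> D - 2 * w" if "deep_at D h (2 * w) S x p" for x p
    using that unfolding deep_at_def by blast+
  have "dist x y \<le> 3 * D" if x: "x \<in> Z \<union> ?O" and xy: "(x, y) \<in> paths S (Z \<union> ?O)" for x y
  proof -
    \<comment> \<open>Invariant from the first visit to the zone on: \<open>v\<close> is the last
      zone vertex, its site \<open>p\<close> is within 1 of the first site \<open>p0\<close>, and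
      since \<open>v\<close> the path has run in one component of \<open>Z\<close>.\<close>
    define late where "late y \<longleftrightarrow> (\<exists>p0 v p. p0 \<in> sites h S \<and> dist x p0 \<le> D - w \<and> v \<in> ?O \<and> deep_at D h (2 * w) S v p \<and>
       dist p p0 \<le> 1 \<and> (y = v \<or> y \<in> Z \<and> (\<exists>y0\<in>nbrs S v. y0 \<in> Z \<and> (y0, y) \<in> paths S Z)))" for y
    have start: "late y" if y: "y \<in> ?O" "dist x y \<le> w" for y
    proof -
      obtain p where p: "deep_at D h (2 * w) S y p" using wit[OF y(1)] by blast
      have "dist x p \<le> D - w" using site(2)[OF p] y(2) dist_triangle[of x p y] by linarith
      then show ?thesis unfolding late_def using site(1)[OF p] p y(1)
        by (intro exI[of _ p] exI[of _ y]) simp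
    qed
    have "(y \<in> Z \<and> x \<in> Z \<and> (x, y) \<in> paths S Z) \<or> late y"
      using xy unfolding paths_def[of S "Z \<union> ?O"]
    proof (induction rule: rtrancl_induct)
      case base
      show ?case
      proof (cases "x \<in> ?O")
        case True
        then have "late x" using start[of x] w by simp
        then show ?thesis ..
      next
        case False
        then show ?thesis using x by simp
      qed
    next
      case (step y y')
      have e: "y' \<in> nbrs S y" "y' \<in> Z \<union> ?O" using step.hyps by auto
      from step.IH show ?case
      proof
        assume y: "y \<in> Z \<and> x \<in> Z \<and> (x, y) \<in> paths S Z"
        show ?thesis
        proof (cases "y' \<in> ?O")
          case True
          have "dist x y' \<le> w" using Zp[of x y] Ze[of y y'] y e dist_triangle[of x y' y] B by linarith
          then show ?thesis using start[OF True] by blast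
        next
          case False
          then show ?thesis using e y paths_step by blast
        qed
      next
        assume "late y"
        then obtain p0 v p where l: "p0 \<in> sites h S" "dist x p0 \<le> D - w" "v \<in> ?O" "deep_at D h (2 * w) S v p"
          "dist p p0 \<le> 1" "y = v \<or> y \<in> Z \<and> (\<exists>y0\<in>nbrs S v. y0 \<in> Z \<and> (y0, y) \<in> paths S Z)"
          unfolding late_def by blast
        have "late y'"
        proof (cases "y' \<in> ?O")
          case True
          have "dist v y' < 2 * w" using l(6)
          proof
            assume "y = v" then show ?thesis using zn[OF l(3), of y'] e w by simp
          next
            assume "y \<in> Z \<and> (\<exists>y0\<in>nbrs S v. y0 \<in> Z \<and> (y0, y) \<in> paths S Z)"
            then obtain y0 where y0: "y \<in> Z" "y0 \<in> nbrs S v" "y0 \<in> Z" "(y0, y) \<in> paths S Z" by blast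
            show ?thesis
              using zn[OF l(3) y0(2)] Zp[OF y0(3,4)] Ze[OF y0(1) e(1)] dist_triangle[of v y' y]
                dist_triangle[of v y y0] B w by linarith
          qed
          moreover obtain p' where p': "deep_at D h (2 * w) S y' p'" using wit True by blast
          ultimately have "dist p' p0 \<le> 1" using cluster_step[OF l(4) p' _ _ l(1,5)] w by simp
          then show ?thesis unfolding late_def using l(1,2) True p'
            by (intro exI[of _ p0] exI[of _ y'] exI[of _ p']) simp
        next
          case False
          then have y': "y' \<in> Z" using e by blast
          from l(6) have "\<exists>y0\<in>nbrs S v. y0 \<in> Z \<and> (y0, y') \<in> paths S Z"
          proof
            assume "y = v" then show ?thesis using e y' by (intro bexI[of _ y']) simp_all
          next
            assume "y \<in> Z \<and> (\<exists>y0\<in>nbrs S v. y0 \<in> Z \<and> (y0, y) \<in> paths S Z)"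
            then show ?thesis using paths_step e y' by blast
          qed
          then show ?thesis unfolding late_def using l(1-5) y'
            by (intro exI[of _ p0] exI[of _ v] exI[of _ p]) simp
        qed
        then show ?thesis ..
      qed
    qed
    then show ?thesis
    proof
      assume "y \<in> Z \<and> x \<in> Z \<and> (x, y) \<in> paths S Z"
      then show ?thesis using Zp[of x y] B w by linarith
    next
      assume "late y"
      then obtain p0 v p where l: "p0 \<in> sites h S" "dist x p0 \<le> D - w" "v \<in> ?O" "deep_at D h (2 * w) S v p"
        "dist p p0 \<le> 1" "y = v \<or> y \<in> Z \<and> (\<exists>y0\<in>nbrs S v. y0 \<in> Z \<and> (y0, y) \<in> paths S Z)"
        unfolding late_def by blast
      have "dist v y \<le> w + B" using l(6)
      proof
        assume "y = v" then show ?thesis using w B by simp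
      next
        assume "y \<in> Z \<and> (\<exists>y0\<in>nbrs S v. y0 \<in> Z \<and> (y0, y) \<in> paths S Z)"
        then obtain y0 where y0: "y \<in> Z" "y0 \<in> nbrs S v" "y0 \<in> Z" "(y0, y) \<in> paths S Z" by blast
        show ?thesis
          using zn[OF l(3) y0(2)] Zp[OF y0(3,4)] dist_triangle[of v y y0] by linarith
      qed
      then show ?thesis
        using l(2,5) site(2)[OF l(4)] dist_triangle[of x y p0] dist_triangle[of p0 y p] dist_triangle[of p y v]
          dist_commute[of p p0] dist_commute[of p v] B w by linarith
    qed
  qed
  moreover have "dist x y \<le> 3 * D" if "x \<in> Z \<union> ?O" "y \<in> nbrs S x" for x y
    using that zn[of x y] Ze[of x y] B w by (elim UnE) force+
  ultimately show ?thesis unfolding tight_def by blast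
qed

lemma locfin_cball_subset: "locfin S \<Longrightarrow> A \<subseteq> S \<inter> cball x r \<Longrightarrow> finite A"
  unfolding locfin_def using bounded_cball finite_subset by blast

text \<open>Components of the zones up to scale \<open>k\<close> have diameter at most
  \<open>3 * D k\<close>, and \<open>tight_zone\<close> asks the next width to be four times as
  large; hence 12.\<close>

definition good_scales :: "(nat \<Rightarrow> real) \<Rightarrow> (nat \<Rightarrow> real) \<Rightarrow> bool" where
  "good_scales w D \<longleftrightarrow> (\<forall>k. 8 \<le> w k \<and> 24 * w k \<le> D k \<and> 12 * D k \<le> w (Suc k))"

lemma good_scales_mono:
  assumes "good_scales w D" "j \<le> k" shows "w j \<le> w k"
  by (rule lift_Suc_mono_le[OF _ assms(2)]) (smt (verit) assms(1) good_scales_def)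

context
  fixes w D h :: "nat \<Rightarrow> real" and S :: "pt set"
  assumes S: "locfin S" and sc: "good_scales w D"
    and good: "\<And>x. \<exists>q N. dist q x \<le> 2 \<and> (\<forall>k\<ge>N. good_at (w k) (D k) (h k) q S)"
begin

lemma scales: "8 \<le> w k" "24 * w k \<le> D k" "12 * D k \<le> w (Suc k)"
  using sc unfolding good_scales_def by blast+

lemma finite_nbrs:
  assumes "x \<in> S" shows "finite (nbrs S x)"
proof -
  obtain q k where q: "dist q x \<le> 2" "good_at (w k) (D k) (h k) q S" using good[of x] by blast
  have "dist q x \<le> 4 * D k" using q(1) scales(1,2)[of k] by linarith
  then have "\<forall>y. delaunay_edge S x y \<longrightarrow> dist x y \<le> w k / 4" using q(2) assms unfolding good_at_def by blast
  then have "nbrs S x \<subseteq> S \<inter> cball x (w k / 4)" using nbrs_subset[of S x] by (auto simp: mem_nbrs)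
  then show ?thesis using locfin_cball_subset[OF S] by blast
qed

lemma tight_zones: "tight S (\<Union>j<m. zone (w j) (D j) (h j) S) (if m = 0 then 0 else 3 * D (m - 1))"
proof (induction m)
  case 0
  show ?case by (simp add: tight_def)
next
  case (Suc m)
  have "4 * (if m = 0 then 0 else 3 * D (m - 1)) \<le> w m"
    using scales[of "m - 1"] scales[of m] by (cases m) auto
  moreover have "0 \<le> (if m = 0 then 0 else 3 * D (m - 1))" using scales[of "m - 1"] by auto
  ultimately have "tight S ((\<Union>j<m. zone (w j) (D j) (h j) S) \<union> zone (w m) (D m) (h m) S) (3 * D m)"
    using Suc scales[of m] by (intro tight_zone) auto
  then show ?case by (simp add: lessThan_Suc Un_commute)
qed

text \<open>Depth \<open>12 * w\<close> near \<open>x\<close> keeps the zone, whose depth is below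
  \<open>10 * w\<close>, more than \<open>w / 2\<close> away.\<close>

lemma late_zones_far:
  obtains m where "m > 0" "\<And>j y. m \<le> j \<Longrightarrow> dist x y \<le> w j / 2 \<Longrightarrow> y \<notin> zone (w j) (D j) (h j) S"
proof -
  obtain q N where q: "dist q x \<le> 2" "\<And>k. k \<ge> N \<Longrightarrow> good_at (w k) (D k) (h k) q S" using good[of x] by blast
  show thesis
  proof (rule that[of "Suc N"])
    fix j y assume j: "Suc N \<le> j" "dist x y \<le> w j / 2"
    have "deep (D j) (h j) (12 * w j) S q" using q(2)[of j] j(1) unfolding good_at_def by simp
    moreover have "dist q y \<le> 2 + w j / 2" using q(1) j(2) dist_triangle[of q y x] by linarith
    moreover have "10 * w j \<le> 12 * w j - 2 * (2 + w j / 2)" using scales(1)[of j] by (simp add: field_simps)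
    ultimately have "deep (D j) (h j) (10 * w j) S y" by (rule deep_shift)
    then show "y \<notin> zone (w j) (D j) (h j) S" by (simp add: zone_def)
  qed simp
qed

text \<open>Late zones are farther from \<open>x\<close> than twice the bound on edges and diameters
  of the earlier components, so a path from \<open>x\<close> can never step into them.\<close>

lemma finite_region_component:
  assumes "x \<in> region w D h S"
  shows "finite {y. (x, y) \<in> paths S (region w D h S)}"
proof -
  obtain m where m: "m > 0" "\<And>j y. m \<le> j \<Longrightarrow> dist x y \<le> w j / 2 \<Longrightarrow> y \<notin> zone (w j) (D j) (h j) S"
    by (rule late_zones_far[of x]) (rule that)
  define Z where "Z = (\<Union>j<m. zone (w j) (D j) (h j) S)"
  define B where "B = 3 * D (m - 1)"
  have t: "tight S Z B" using tight_zones[of m] m(1) by (simp add: Z_def B_def)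
  have B: "0 \<le> B" "2 * B \<le> w j / 2" if "m \<le> j" for j
    using scales[of "m - 1"] m(1) good_scales_mono[OF sc that] by (auto simp: B_def)
  have stay: "y \<in> Z" if y: "dist x y \<le> 2 * B" "y \<in> region w D h S" for y
  proof -
    obtain j where "y \<in> zone (w j) (D j) (h j) S" using y(2) by (auto simp: region_def)
    moreover from this have "\<not> m \<le> j" using m(2) B(2)[of j] y(1) by (meson order_trans)
    ultimately show ?thesis by (auto simp: Z_def)
  qed
  have xZ: "x \<in> Z" using stay[of x] assms B(1)[of m] by simp
  have "(x, y) \<in> paths S Z" if "(x, y) \<in> paths S (region w D h S)" for y
    using that unfolding paths_def[of S "region w D h S"]
  proof (induction rule: rtrancl_induct)
    case (step y y')
    have y: "y \<in> Z" using pathsD[OF step.IH xZ] .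
    have "dist x y \<le> B" "dist y y' \<le> B" using t y xZ step unfolding tight_def by auto
    then have "dist x y' \<le> 2 * B" using dist_triangle[of x y' y] by linarith
    then have "y' \<in> Z" using stay step by auto
    then show ?case using paths_step[OF step.IH y] step by auto
  qed simp
  then have "{y. (x, y) \<in> paths S (region w D h S)} \<subseteq> S \<inter> cball x B"
  proof (intro subsetI)
    fix y assume "y \<in> {y. (x, y) \<in> paths S (region w D h S)}"
    then have "(x, y) \<in> paths S Z" using \<open>\<And>y. (x, y) \<in> paths S (region w D h S) \<Longrightarrow> (x, y) \<in> paths S Z\<close> by blast
    then have "y \<in> Z" "dist x y \<le> B" using t xZ pathsD unfolding tight_def by blast+
    then show "y \<in> S \<inter> cball x B" by (auto simp: Z_def zone_def)
  qed
  then show ?thesis using locfin_cball_subset[OF S] by blast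
qed

text \<open>A path in the core starts at depth \<open>8 * w\<close> of a cell. At the first vertex
  of smaller depth all core points within distance \<open>w\<close> would be in the zone, hence in
  the region, where core points keep six neighbours in the core. The last clause of
  \<open>good_at\<close> says that such a vertex is not in the core.\<close>

lemma finite_core_component:
  defines "K \<equiv> peel_core (nbrs S) (region w D h S) S"
  assumes x: "x \<in> K"
  shows "finite {y. (x, y) \<in> paths S K}"
proof -
  have KS: "K \<subseteq> S" by (auto simp: K_def peel_core_def dest: peel_subset[THEN subsetD])
  obtain q k where q: "dist q x \<le> 2" "good_at (w k) (D k) (h k) q S" using good[of x] by blast
  define w' D' h' where p: "w' = w k" "D' = D k" "h' = h k"
  have sw: "8 \<le> w'" "24 * w' \<le> D'" using scales[of k] by (simp_all add: p)
  have g: "deep D' h' (12 * w') S q" "\<And>x y. x \<in> S \<Longrightarrow> dist q x \<le> 4 * D' \<Longrightarrow> delaunay_edge S x y \<Longrightarrow> dist x y \<le> w' / 4"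
    "\<And>z K. dist q z \<le> 4 * D' \<Longrightarrow> K \<subseteq> S \<Longrightarrow> (\<And>x. x \<in> K \<Longrightarrow> dist z x \<le> w' \<Longrightarrow> many 6 (nbrs S x \<inter> K)) \<Longrightarrow> z \<notin> K"
    using q(2) unfolding good_at_def p by blast+
  have "deep D' h' (8 * w') S x" by (rule deep_shift[OF g(1) q(1)]) (use sw in linarith)
  then obtain p0 where p0: "deep_at D' h' (8 * w') S x p0" unfolding deep_iff by blast
  have p0s: "p0 \<in> sites h' S" "dist x p0 \<le> D' - 8 * w'" using p0 unfolding deep_at_def by blast+
  have inv: "\<exists>p. deep_at D' h' (8 * w') S y p \<and> dist p p0 \<le> 1" if "(x, y) \<in> paths S K" for y
    using that unfolding paths_def
  proof (induction rule: rtrancl_induct)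
    case base
    then show ?case using p0 by auto
  next
    case (step y y')
    have e: "delaunay_edge S y y'" "y \<in> K" "y' \<in> K" using step.hyps by (auto simp: mem_nbrs)
    obtain p where pd: "deep_at D' h' (8 * w') S y p" "dist p p0 \<le> 1" using step.IH by blast
    have "dist y p \<le> D' - 8 * w'" using pd unfolding deep_at_def by blast
    then have xy: "dist x y \<le> 2 * D' - 16 * w' + 1"
      using dist_triangle[of x y p0] dist_triangle[of p0 y p] p0s pd dist_commute[of p p0] dist_commute[of y p] by linarith
    have "dist q y \<le> 4 * D'" using xy q(1) dist_triangle[of q y x] sw by linarith
    then have len: "dist y y' \<le> w' / 4" using g(2) e KS by blast
    have xy': "dist x y' \<le> 2 * D'" using xy len dist_triangle[of x y' y] sw by linarith
    show ?case
    proof (cases "deep D' h' (8 * w') S y'")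
      case True
      then obtain p' where p': "deep_at D' h' (8 * w') S y' p'" unfolding deep_iff by blast
      have "dist p' p0 \<le> 1" by (rule cluster_step[OF pd(1) p' _ _ p0s(1) pd(2)]) (use len sw in linarith)+
      then show ?thesis using p' by blast
    next
      case False
      \<comment> \<open>An edge of length at most \<open>w / 4\<close> costs at most
        \<open>w / 2\<close> of depth.\<close>
      have d7: "deep D' h' (15 / 2 * w') S y'" 
        by (rule deep_shift[of _ _ "8 * w'" _ y _ "w' / 4"]) (use pd len in \<open>auto simp: deep_iff\<close>)
      have "y' \<notin> K"
      proof (rule g(3)[OF _ KS])
        show "dist q y' \<le> 4 * D'" using xy' q(1) dist_triangle[of q y' x] sw by linarith
        fix u assume u: "u \<in> K" "dist y' u \<le> w'"
        have "deep D' h' (2 * w') S u" by (rule deep_shift[OF d7 u(2)]) (use sw in linarith)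
        moreover have "\<not> deep D' h' (10 * w') S u"
        proof
          assume "deep D' h' (10 * w') S u"
          then have "deep D' h' (8 * w') S y'" by (rule deep_shift[of _ _ _ _ _ _ w']) (use u(2) dist_commute[of u y'] in simp_all)
          then show False using False by blast
        qed
        moreover have "dist u v \<le> w'" if "delaunay_edge S u v" for v
        proof -
          have "dist q u \<le> 4 * D'"
            using xy' q(1) u(2) dist_triangle[of q u x] dist_triangle[of x u y'] sw by linarith
          then show ?thesis using g(2)[of u v] that u KS sw by force
        qed
        ultimately have "u \<in> zone w' D' h' S" using u KS by (auto simp: zone_def)
        then have "u \<in> region w D h S" by (auto simp: region_def p)
        then show "many 6 (nbrs S u \<inter> K)"
          using peel_core_many[of u "nbrs S"] u KS finite_nbrs unfolding K_def by blast
      qed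
      then show ?thesis using e by blast
    qed
  qed
  have "{y. (x, y) \<in> paths S K} \<subseteq> S \<inter> cball x (2 * D')"
  proof
    fix y assume "y \<in> {y. (x, y) \<in> paths S K}"
    then have y: "(x, y) \<in> paths S K" by simp
    obtain p where pd: "deep_at D' h' (8 * w') S y p" "dist p p0 \<le> 1" using inv[OF y] by blast
    have "dist y p \<le> D' - 8 * w'" using pd unfolding deep_at_def by blast
    then have "dist x y \<le> 2 * D'"
      using dist_triangle[of x y p0] dist_triangle[of p0 y p] p0s pd sw dist_commute[of p p0] dist_commute[of y p] by linarith
    moreover have "y \<in> S" using pathsD[OF y x] KS by blast
    ultimately show "y \<in> S \<inter> cball x (2 * D')" by simp
  qed
  then show ?thesis using locfin_cball_subset[OF S] by blast
qed

end

text \<open>Edges of \<open>S\<close> inside \<open>U\<close> remain edges of \<open>U\<close>,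
  whose average degree is below six.\<close>

lemma delaunay_degenerate:
  assumes gp: "general_position S" and U: "finite U" "U \<noteq> {}" "U \<subseteq> S"
  shows "\<exists>x\<in>U. \<not> many 6 (nbrs S x \<inter> U)"
proof (rule ccontr)
  assume *: "\<not> ?thesis"
  have fin: "finite (nbrs U x)" for x by (rule finite_subset[OF nbrs_subset U(1)])
  have "6 * card U = (\<Sum>x\<in>U. 6)" by simp
  also have "\<dots> \<le> (\<Sum>x\<in>U. card (nbrs U x))"
  proof (rule sum_mono)
    fix x assume x: "x \<in> U"
    have "nbrs S x \<inter> U \<subseteq> nbrs U x" using delaunay_edge_mono[OF _ U(3) x] by (auto simp: mem_nbrs)
    moreover have "many 6 (nbrs S x \<inter> U)" using * x by simp
    ultimately have "many 6 (nbrs U x)" using many_mono[of 6 "nbrs S x \<inter> U"] by simp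
    moreover note fin[of x]
    ultimately show "6 \<le> card (nbrs U x)" by (simp add: many_card)
  qed
  also have "\<dots> = card (SIGMA x:U. nbrs U x)"
    using U(1) fin by simp
  also have "(SIGMA x:U. nbrs U x) = delaunay_edges U"
    by (auto simp: delaunay_edges_def nbrs_def delaunay_edge_def)
  finally show False
    using card_delaunay_edges[OF U(1,2) general_position_subset[OF gp U(3)]] by linarith
qed

lemma coloring_proper:
  assumes S: "locfin S" and sc: "good_scales w D"
    and good: "\<And>x. \<exists>q N. dist q x \<le> 2 \<and> (\<forall>k\<ge>N. good_at (w k) (D k) (h k) q S)"
    and gp: "general_position S" and gen: "generic_distances S"
  shows "proper_coloring 6 S (coloring w D h S)"
proof -
  have m: "many 4 S" using good[of 0] unfolding good_at_def by blast
  have A: "chooses_after w D h S = (\<lambda>x y. y \<in> nbrs S x \<and> earlier (nbrs S) (region w D h S) S (label S) x y)"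
    by (intro ext) (simp add: chooses_after_def)
  note pc = peeling_coloring[of "nbrs S" S "region w D h S" "label S", folded A]
  have 1: "nbrs S x \<subseteq> S" for x by (rule nbrs_subset)
  have 2: "y \<in> nbrs S x \<Longrightarrow> x \<in> nbrs S y" for x y by (simp add: mem_nbrs delaunay_edge_sym)
  have 3: "finite (nbrs S x)" if "x \<in> S" for x using finite_nbrs[OF S sc good that] .
  have 4: "finite U \<Longrightarrow> U \<noteq> {} \<Longrightarrow> U \<subseteq> S \<Longrightarrow> \<exists>x\<in>U. \<not> many 6 (nbrs S x \<inter> U)" for U
    by (rule delaunay_degenerate[OF gp])
  have 5: "finite {y. (x, y) \<in> {(x, y). y \<in> nbrs S x \<and> x \<in> region w D h S \<and> y \<in> region w D h S}\<^sup>*}"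
    if "x \<in> region w D h S \<inter> S" for x
    using finite_region_component[OF S sc good, of x] that unfolding paths_def by blast
  have 6: "finite {y. (x, y) \<in> {(x, y). y \<in> nbrs S x \<and> x \<in> peel_core (nbrs S) (region w D h S) S \<and>
      y \<in> peel_core (nbrs S) (region w D h S) S}\<^sup>*}"
    if "x \<in> peel_core (nbrs S) (region w D h S) S" for x
    using finite_core_component[OF S sc good that] unfolding paths_def .
  have 7: "label S x \<noteq> label S y" if "x \<in> S" "y \<in> S" "y \<in> nbrs S x" for x y
    using that by (intro label_distinct[OF S m gen]) (auto simp: mem_nbrs delaunay_edge_def)
  have a: "S = (\<Union>i<6. greedy_class (chooses_after w D h S) S i)"
    by (rule pc(1)[OF 1 2 3 4 5 6 7])
  have b: "i \<noteq> j \<Longrightarrow> greedy_class (chooses_after w D h S) S i \<inter> greedy_class (chooses_after w D h S) S j = {}" for i j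
    by (rule pc(2)[OF 1 2 3 4 5 6 7])
  have c: "x \<in> greedy_class (chooses_after w D h S) S i \<Longrightarrow> y \<in> greedy_class (chooses_after w D h S) S i \<Longrightarrow> y \<notin> nbrs S x" for x y i
    by (rule pc(3)[OF 1 2 3 4 5 6 7])
  have "coloring w D h S i = greedy_class (chooses_after w D h S) S i" if "i < 6" for i
    using that by (simp add: coloring_def)
  then show ?thesis unfolding proper_coloring_def using a b c by (simp add: mem_nbrs)
qed

section \<open>The theorem\<close>

lemma eventually_good_scale:
  "eventually (\<lambda>m. (large_enough m \<and> failure_bound (2 ^ m\<^sup>2) \<le> (1 / 2) ^ k) \<and> c \<le> ((2::real) ^ m\<^sup>2) ^ 10) at_top"
proof -
  have lim: "filterlim (\<lambda>m::nat. (2::real) ^ m\<^sup>2) at_top at_top" by real_asymp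
  have "eventually (\<lambda>m::nat. failure_bound (2 ^ m\<^sup>2) < (1 / 2) ^ k) at_top"
    by (rule order_tendstoD(2)[OF filterlim_compose[OF failure_bound_tendsto lim]]) simp
  moreover have "eventually (\<lambda>m::nat. max 1 c \<le> (2::real) ^ m\<^sup>2) at_top"
    using lim by (simp only: filterlim_at_top)
  ultimately show ?thesis using eventually_large_enough
  proof eventually_elim
    case (elim m)
    have "(2::real) ^ m\<^sup>2 \<le> (2 ^ m\<^sup>2) ^ 10" by (rule self_le_power) auto
    then show ?case using elim by simp
  qed
qed

text \<open>Each scale is chosen after the previous one, large enough for the nesting and for a
  failure probability of at most \<open>(1 / 2) ^ k\<close>, which makes the Borel-Cantelli sum
  converge.\<close>

lemma scales_exist:
  obtains n :: "nat \<Rightarrow> nat" where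
    "\<And>k. large_enough (n k)" "\<And>k. failure_bound (2 ^ (n k)\<^sup>2) \<le> (1 / 2) ^ k"
    "good_scales (\<lambda>k. (2 ^ (n k)\<^sup>2) ^ 10) (\<lambda>k. (2 ^ (n k)\<^sup>2) ^ 15)"
proof -
  define x where "x m = (2::real) ^ m\<^sup>2" for m :: nat
  have "\<exists>n. \<forall>k. (large_enough (n k) \<and> failure_bound (x (n k)) \<le> (1 / 2) ^ k) \<and> 12 * x (n k) ^ 15 \<le> x (n (Suc k)) ^ 10"
  proof (rule dependent_nat_choice)
    show "\<exists>m. large_enough m \<and> failure_bound (x m) \<le> (1 / 2) ^ 0"
      using eventually_good_scale[of 0 0] unfolding x_def eventually_at_top_linorder by blast
    fix m k
    show "\<exists>m'. (large_enough m' \<and> failure_bound (x m') \<le> (1 / 2) ^ Suc k) \<and> 12 * x m ^ 15 \<le> x m' ^ 10"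
      using eventually_good_scale[of "Suc k" "12 * x m ^ 15"] unfolding x_def eventually_at_top_linorder by blast
  qed
  then obtain n where n: "\<And>k. large_enough (n k)" "\<And>k. failure_bound (x (n k)) \<le> (1 / 2) ^ k"
    "\<And>k. 12 * x (n k) ^ 15 \<le> x (n (Suc k)) ^ 10" by blast
  have "good_scales (\<lambda>k. x (n k) ^ 10) (\<lambda>k. x (n k) ^ 15)"
    unfolding good_scales_def
  proof (intro allI conjI)
    fix k
    note L = large_enoughD[OF n(1) x_def]
    have "x (n k) ^ 1 \<le> x (n k) ^ 10" using L(8)[of k] by (intro power_increasing) auto
    then show "8 \<le> x (n k) ^ 10" using L(8)[of k] by simp
    show "24 * x (n k) ^ 10 \<le> x (n k) ^ 15" using L(6)[of k] by linarith
    show "12 * x (n k) ^ 15 \<le> x (n (Suc k)) ^ 10" by (rule n(3))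
  qed
  then show thesis using n(1,2) unfolding x_def by (intro that)
qed

text \<open>A countable supply of centres for the almost sure estimates; the scheme itself does not
  refer to them.\<close>

definition int_pt :: "int \<times> int \<Rightarrow> pt" where
  "int_pt u = vector [of_int (fst u), of_int (snd u)]"

lemma int_pt_near: "\<exists>u. dist (int_pt u) x \<le> 2"
proof
  have "dist (int_pt (\<lfloor>x$1\<rfloor>, \<lfloor>x$2\<rfloor>)) x \<le> \<bar>of_int \<lfloor>x$1\<rfloor> - x$1\<bar> + \<bar>of_int \<lfloor>x$2\<rfloor> - x$2\<bar>"
    using dist_le_components[of "int_pt (\<lfloor>x$1\<rfloor>, \<lfloor>x$2\<rfloor>)" x] by (simp add: int_pt_def)
  also have "\<dots> \<le> 2" by linarith
  finally show "dist (int_pt (\<lfloor>x$1\<rfloor>, \<lfloor>x$2\<rfloor>)) x \<le> 2" .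
qed

text \<open>The centre \<open>q\<close> does not depend on the configuration, so the Borel-Cantelli
  lemma applies to the covering events \<open>B k\<close>.\<close>

lemma (in poisson) AE_good_at:
  fixes n :: "nat \<Rightarrow> nat" and x :: "nat \<Rightarrow> real"
  assumes n: "\<And>k. large_enough (n k)" and f: "\<And>k. failure_bound (x k) \<le> (1 / 2) ^ k"
    and x: "\<And>k. x k = 2 ^ (n k)\<^sup>2"
  shows "AE S in P. general_position S \<longrightarrow> (\<exists>N. \<forall>k\<ge>N. good_at (x k ^ 10) (x k ^ 15) (1 / x k ^ 14) q S)"
proof -
  have "\<forall>k. \<exists>B. B \<in> events \<and> prob B \<le> failure_bound (x k) \<and>
    (\<forall>S\<in>space P - B. general_position S \<longrightarrow> good_at (x k ^ 10) (x k ^ 15) (1 / x k ^ 14) q S)"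
  proof
    fix k
    have "x k = real (2 ^ (n k)\<^sup>2)" by (simp add: x)
    then show "\<exists>B. B \<in> events \<and> prob B \<le> failure_bound (x k) \<and>
        (\<forall>S\<in>space P - B. general_position S \<longrightarrow> good_at (x k ^ 10) (x k ^ 15) (1 / x k ^ 14) q S)"
      using good_scale_prob[OF n[of k], of q] unfolding Bex_def by (simp only:)
  qed
  then obtain B where B: "\<And>k. B k \<in> events" "\<And>k. prob (B k) \<le> failure_bound (x k)"
    "\<And>k S. S \<in> space P - B k \<Longrightarrow> general_position S \<Longrightarrow> good_at (x k ^ 10) (x k ^ 15) (1 / x k ^ 14) q S"
    by (drule_tac choice) blast
  have "summable (\<lambda>k. prob (B k))"
    by (rule summable_comparison_test'[of "\<lambda>k. (1 / 2) ^ k" 0])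
       (use order_trans[OF B(2) f] in \<open>simp_all add: summable_geometric\<close>)
  then have "AE S in P. eventually (\<lambda>k. S \<in> space P - B k) sequentially"
    by (intro borel_cantelli_AE1) (use B(1) in \<open>simp_all add: emeasure_eq_measure\<close>)
  then show ?thesis
  proof eventually_elim
    case (elim S)
    then show ?case using B(3) unfolding eventually_sequentially by blast
  qed
qed

lemma (in poisson) AE_many: "AE S in P. many 4 S"
proof -
  define A where "A n = {S \<in> space P. card (S \<inter> grid_box 0 (real (Suc n)) 0 0) \<in> {..<4}}" for n
  define B where "B = (\<Inter>n. A n)"
  have A: "A n \<in> events" for n unfolding A_def by (rule count_event) (simp_all add: grid_box_bounded)
  then have BE: "B \<in> events" unfolding B_def by (intro sets.countable_INT) auto
  define f where "f t = exp (- t\<^sup>2) * (1 + t\<^sup>2 + t ^ 4 / 2 + t ^ 6 / 6)" for t :: real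
  have "prob (A n) = f (real (Suc n))" for n
    using prob_count_less[OF grid_box_borel grid_box_bounded, of 0 "real (Suc n)" 0 0 4]
    by (simp add: A_def f_def measure_grid_box eval_nat_numeral del: of_nat_Suc)
  then have "prob B \<le> f (real (Suc n))" for n
    using finite_measure_mono[of B "A n"] A by (auto simp: B_def)
  moreover have "(\<lambda>n. f (real (Suc n))) \<longlonglongrightarrow> 0" unfolding f_def by real_asymp
  ultimately have "prob B \<le> 0" by (intro LIMSEQ_le_const) auto
  then have "prob B = 0" using measure_nonneg[of P B] by linarith
  then have "B \<in> null_sets P" using BE by (simp add: null_sets_def emeasure_eq_measure)
  from AE_not_in[OF this] AE_space show ?thesis
  proof eventually_elim
    case (elim S)
    then obtain n where "4 \<le> card (S \<inter> grid_box 0 (real (Suc n)) 0 0)" by (auto simp: B_def A_def not_less)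
    moreover have "finite (S \<inter> grid_box 0 (real (Suc n)) 0 0)"
      using locfin_space[OF elim(2)] by (simp add: locfin_def grid_box_bounded)
    ultimately show ?case using many_card many_mono by blast
  qed
qed

theorem theorem1:
  assumes "poisson_law P"
  shows "\<exists>F. F \<in> measurable Msp (Msp_pow 6) \<and>
             (AE S in P. proper_coloring 6 S (F S)) \<and>
             (\<forall>g S. isometry g \<and> S \<in> Mspace \<longrightarrow>
                 (\<forall>i<6. g ` (F S i) = F (g ` S) i))"
proof -
  interpret poisson P using assms by unfold_locales
  obtain n :: "nat \<Rightarrow> nat" where n: "\<And>k. large_enough (n k)" "\<And>k. failure_bound (2 ^ (n k)\<^sup>2) \<le> (1 / 2) ^ k"
    "good_scales (\<lambda>k. (2 ^ (n k)\<^sup>2) ^ 10) (\<lambda>k. (2 ^ (n k)\<^sup>2) ^ 15)" by (rule scales_exist) (rule that)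
  define x where "x k = (2::real) ^ (n k)\<^sup>2" for k
  define F where "F = coloring (\<lambda>k. x k ^ 10) (\<lambda>k. x k ^ 15) (\<lambda>k. 1 / x k ^ 14)"
  \<comment> \<open>The countably many integer centres share one null set, and every point of the
    plane is within 2 of such a centre.\<close>
  have "AE S in P. \<forall>u. general_position S \<longrightarrow>
      (\<exists>N. \<forall>k\<ge>N. good_at (x k ^ 10) (x k ^ 15) (1 / x k ^ 14) (int_pt u) S)"
    unfolding AE_all_countable by (intro allI AE_good_at[where n = n]) (simp_all add: x_def n)
  then have "AE S in P. proper_coloring 6 S (F S)"
    using AE_general_position AE_many AE_space
  proof eventually_elim
    case (elim S)
    then have S: "general_position S" "generic_distances S" "locfin S" by (simp_all add: locfin_space)
    have "\<exists>q N. dist q z \<le> 2 \<and> (\<forall>k\<ge>N. good_at (x k ^ 10) (x k ^ 15) (1 / x k ^ 14) q S)" for z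
      using int_pt_near[of z] elim(1) S(1) by blast
    then show ?case
      unfolding F_def by (intro coloring_proper S n(3)[folded x_def])
  qed
  moreover have "F \<in> measurable Msp (Msp_pow 6)" unfolding F_def by (rule measurable_coloring)
  moreover have "g ` (F S i) = F (g ` S) i" if "isometry g" "i < 6" for g S i
    unfolding F_def by (rule coloring_image[OF that])
  ultimately show ?thesis by blast
qed

end
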